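(* Let $q=p^l$, $k=\mathbb{F}_q(T)$, and let $u\ge 1$ be such that $\mathbb{F}_{p^u}\subseteq\mathbb{F}_q$. Let $K/k$ be a finite abelian $p$-extension with $\mathrm{Gal}(K/k)\cong(\mathbb{Z}/p^{\alpha_1}\mathbb{Z})\times\cdots\times(\mathbb{Z}/p^{\alpha_u}\mathbb{Z})$, $1\le\alpha_1\le\cdots\le\alpha_u=v$, and let $P_1,\dots,P_r\in R_T^+$ be the finite primes of $k$ ramified in $K$. Let $K=k(\vec y_0)$ with $\vec y_0\in W_v(\bar k)$, $$\vec y_0^{\,p^u}\stackrel{\bullet}{-}\vec y_0=\vec\xi_0\in W_v(k),\qquad \vec\xi_0=\vec\delta_1\stackrel{\bullet}{+}\cdots\stackrel{\bullet}{+}\vec\delta_r\stackrel{\bullet}{+}\vec\gamma,$$ where the components satisfy: (i) $\vec\delta_i=(\delta_{i,1},\dots,\delta_{i,v})$ with $\delta_{i,j}=Q_{i,j}/P_i^{e_{i,j}}$, $e_{i,j}\ge 0$, $Q_{i,j}\in R_T$, $\deg Q_{i,j}<\deg P_i^{e_{i,j}}$ (so $\delta_{i,j}=0$ if $e_{i,j}=0$), and if $e_{i,j}>0$ then $\gcd(Q_{i,j},P_i)=1$ and $e_{i,j}=\lambda_{i,j}p^{m_{i,j}}$ with $\gcd(\lambda_{i,j},p)=1$, $0\le m_{i,j}<u$; (ii) $\vec\gamma=(\gamma_1,\dots,\gamma_v)$ with $\gamma_j=f_j(T)\in R_T$ and, when $f_j\notin\mathbb{F}_q$, $\deg f_j=\nu_jp^{m_j}$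 with $\gcd(q,\nu_j)=1$, $0\le m_j<u$. Let $\vec y_i,\vec z\in W_v(\bar k)$ satisfy $\vec y_i^{\,p^u}\stackrel{\bullet}{-}\vec y_i=\vec\delta_i$ ($1\le i\le r$) and $\vec z^{\,p^u}\stackrel{\bullet}{-}\vec z=\vec\gamma$, and put $\vec y:=\vec y_1\stackrel{\bullet}{+}\cdots\stackrel{\bullet}{+}\vec y_r$. Let $n,m\in\mathbb{N}$ and $N\in R_T$ be such that $K\subseteq {}_nk(\Lambda_N)_m$, let $M:=L_nk_m$ and $E:=KM\cap k(\Lambda_N)$. Then $$E=k(\vec y),\qquad E_{\mathfrak{ge}}=k(\vec y_1,\dots,\vec y_r),\qquad K_{\mathfrak{ge}}=k(\vec y_1,\dots,\vec y_r,\vec z).$$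
   Context: $p$ is the characteristic of $k$, $R_T=\mathbb{F}_q[T]$, $R_T^+$ is the set of monic irreducible polynomials in $R_T$, and $P_\infty$ (the infinite prime) is the pole of $T$ in $k$. $\bar k$ is an algebraic closure of $k$. $W_v(F)$ is the ring of $p$-typical Witt vectors of length $v$ over $F$, with Witt addition and subtraction denoted $\stackrel{\bullet}{+}$, $\stackrel{\bullet}{-}$; for $\vec w=(w_1,\dots,w_v)$, $\vec w^{\,p^u}=(w_1^{p^u},\dots,w_v^{p^u})$ and $k(\vec w)=k(w_1,\dots,w_v)$. For nonzero $N\in R_T$, $k(\Lambda_N)$ is the $N$-th Carlitz cyclotomic function field. $L_n$ denotes the subfield of degree $q^n$ over $k$ of $k(\Lambda_{1/T^{n+1}})$, the cyclotomic function field of modulus $(1/T)^{n+1}$ constructed with $\mathbb{F}_q[1/T]$ in place of $\mathbb{F}_q[T]$ (so $L_n$ is the fixed field of $\mathbb{F}_q^*$). $k_m:=\mathbb{F}_{q^m}(T)$, and ${}_nk(\Lambda_N)_m:=L_n\,k(\Lambda_N)\,\mathbb{F}_{q^m}$. By the Kronecker--Weber theorem every finite abelian extension of $k$ is contained in some ${}_nk(\Lambda_N)_m$. The genus field $F_{\mathfrak{ge}}$ of a finite abelian extension $F/k$ is the maximal extension of $F$ that is abelian over $k$ and contained in the Hilbert class field of $F$, the latter being (Rosen) the maximal abelian extension of $F$ that is unramified at every prime and in which every prime of $F$ above $P_\infty$ decomposes fully. *)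

theory Defs
  imports
    "HOL-Algebra.Algebra"
    "HOL-Algebra.Algebraic_Closure_Type"
    "HOL-Computational_Algebra.Computational_Algebra"
    "HOL-Library.Cardinality"
    "HOL-Library.Poly_Mapping"
begin

hide_const (open) Divisibility.irreducible Divisibility.prime Polynomials.degree
  Polynomials.lead_coeff up_ring.monom up_ring.coeff

section \<open>Witt vectors of finite length\<close>

text \<open>
  Integer polynomials in two sequences of indeterminates: \<open>Inl i\<close> stands for \<open>X\<^sub>i\<close> and
  \<open>Inr i\<close> for \<open>Y\<^sub>i\<close>.
\<close>

type_synonym int_mpoly = "((nat + nat) \<Rightarrow>\<^sub>0 nat) \<Rightarrow>\<^sub>0 int"

definition mpoly_var :: "nat + nat \<Rightarrow> int_mpoly" where
  "mpoly_var i = Poly_Mapping.single (Poly_Mapping.single i 1) 1"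

definition mpoly_eval :: "(nat + nat \<Rightarrow> 'b :: comm_ring_1) \<Rightarrow> int_mpoly \<Rightarrow> 'b" where
  "mpoly_eval \<rho> P =
     (\<Sum>m\<in>Poly_Mapping.keys P. of_int (Poly_Mapping.lookup P m) *
        (\<Prod>i\<in>Poly_Mapping.keys m. \<rho> i ^ Poly_Mapping.lookup m i))"

definition witt_ghost :: "nat \<Rightarrow> (nat \<Rightarrow> 'b :: comm_ring_1) \<Rightarrow> nat \<Rightarrow> 'b" where
  "witt_ghost p x n = (\<Sum>i\<le>n. of_nat (p ^ i) * x i ^ (p ^ (n - i)))"

text \<open>
  For \<open>opr\<close> addition or subtraction and \<open>p\<close> prime, there is exactly one sequence of integer
  polynomials with this property (Witt); its terms are the polynomials giving the components
  of the sum or difference of two Witt vectors.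
\<close>

definition witt_polys :: "nat \<Rightarrow> (int_mpoly \<Rightarrow> int_mpoly \<Rightarrow> int_mpoly) \<Rightarrow> nat \<Rightarrow> int_mpoly" where
  "witt_polys p opr =
     (THE S. \<forall>n. witt_ghost p S n =
        opr (witt_ghost p (\<lambda>i. mpoly_var (Inl i)) n) (witt_ghost p (\<lambda>i. mpoly_var (Inr i)) n))"

text \<open>
  A Witt vector of length \<open>v\<close> is a list of length \<open>v\<close>; the component numbered \<open>j\<close> in
  \<open>(w\<^sub>1, \<dots>, w\<^sub>v)\<close> is \<open>w ! (j - 1)\<close>.
\<close>

definition witt_vectors :: "nat \<Rightarrow> 'b set \<Rightarrow> 'b list set" where
  "witt_vectors v F = {w. length w = v \<and> set w \<subseteq> F}"

definition witt_op ::
  "nat \<Rightarrow> (int_mpoly \<Rightarrow> int_mpoly \<Rightarrow> int_mpoly) \<Rightarrow> 'b :: comm_ring_1 list \<Rightarrow> 'b list \<Rightarrow> 'b list" where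
  "witt_op p opr x y =
     map (\<lambda>n. mpoly_eval (case_sum (nth x) (nth y)) (witt_polys p opr n)) [0..<length x]"

definition witt_add :: "nat \<Rightarrow> 'b :: comm_ring_1 list \<Rightarrow> 'b list \<Rightarrow> 'b list" where
  "witt_add p = witt_op p (+)"

definition witt_diff :: "nat \<Rightarrow> 'b :: comm_ring_1 list \<Rightarrow> 'b list \<Rightarrow> 'b list" where
  "witt_diff p = witt_op p (-)"

definition witt_sum :: "nat \<Rightarrow> nat \<Rightarrow> 'b :: comm_ring_1 list list \<Rightarrow> 'b list" where
  "witt_sum p v ws = foldr (witt_add p) ws (replicate v 0)"

definition witt_power :: "'b :: comm_ring_1 list \<Rightarrow> nat \<Rightarrow> 'b list" where
  "witt_power w e = map (\<lambda>a. a ^ e) w"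


section \<open>Field extensions inside a fixed field\<close>

text \<open>All fields are subfields of one ambient field, given as a type.\<close>

abbreviation \<Omega> :: "'b :: field ring" where
  "\<Omega> \<equiv> ring_of_type_algebra"

definition adjoin :: "'b :: field set \<Rightarrow> 'b set \<Rightarrow> 'b set" where
  "adjoin F S = generate_field \<Omega> (F \<union> S)"

definition field_ext :: "'b :: field set \<Rightarrow> 'b set \<Rightarrow> bool" where
  "field_ext F L \<longleftrightarrow> subfield F \<Omega> \<and> subfield L \<Omega> \<and> F \<subseteq> L"

definition finite_ext :: "'b :: field set \<Rightarrow> 'b set \<Rightarrow> bool" where
  "finite_ext F L \<longleftrightarrow> field_ext F L \<and> ring.finite_dimension \<Omega> F L"

definition ext_degree :: "'b :: field set \<Rightarrow> 'b set \<Rightarrow> nat" where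
  "ext_degree F L = ring.dim \<Omega> F L"

definition Gal :: "'b :: field set \<Rightarrow> 'b set \<Rightarrow> ('b \<Rightarrow> 'b) monoid" where
  "Gal F L = (BijGroup L)
     \<lparr>carrier := {\<sigma> \<in> Bij L. \<sigma> \<in> ring_hom (\<Omega>\<lparr>carrier := L\<rparr>) (\<Omega>\<lparr>carrier := L\<rparr>) \<and> (\<forall>x\<in>F. \<sigma> x = x)}\<rparr>"

definition galois_ext :: "'b :: field set \<Rightarrow> 'b set \<Rightarrow> bool" where
  "galois_ext F L \<longleftrightarrow> field_ext F L \<and> (\<forall>x\<in>L. \<not> ring.transcendental \<Omega> F x) \<and>
     {x \<in> L. \<forall>\<sigma>\<in>carrier (Gal F L). \<sigma> x = x} = F"

text \<open>Abelian extensions may be of infinite degree.\<close>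

definition abelian_ext :: "'b :: field set \<Rightarrow> 'b set \<Rightarrow> bool" where
  "abelian_ext F L \<longleftrightarrow> galois_ext F L \<and> comm_group (Gal F L)"


section \<open>Primes\<close>

text \<open>
  A prime of a function field \<open>F\<close> over a finite field is given by its valuation ring \<open>V\<close>
  (which automatically contains the constants).
\<close>

definition prime_of :: "'b :: field set \<Rightarrow> 'b set \<Rightarrow> bool" where
  "prime_of F V \<longleftrightarrow> subring V \<Omega> \<and> V \<subset> F \<and> (\<forall>x\<in>F. x \<in> V \<or> inverse x \<in> V)"

definition max_ideal :: "'b :: field set \<Rightarrow> 'b set" where
  "max_ideal V = {x \<in> V. x = 0 \<or> inverse x \<notin> V}"

definition valuation :: "'b :: field set \<Rightarrow> 'b \<Rightarrow> int" where
  "valuation V x =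
     (THE n. \<exists>t w. max_ideal V = (*) t ` V \<and> w \<in> V - max_ideal V \<and> x = w * t powi n)"

definition primes_above :: "'b :: field set \<Rightarrow> 'b set \<Rightarrow> 'b set \<Rightarrow> 'b set set" where
  "primes_above F V L = {W. prime_of L W \<and> W \<inter> F = V}"

text \<open>The ramification index of the prime \<open>W\<close> of an extension of \<open>F\<close> over the prime \<open>W \<inter> F\<close>.\<close>

definition ramification_index :: "'b :: field set \<Rightarrow> 'b set \<Rightarrow> nat" where
  "ramification_index F W =
     (THE e. \<forall>x\<in>F - {0}. valuation W x = int e * valuation (W \<inter> F) x)"

definition unramified_at :: "'b :: field set \<Rightarrow> 'b set \<Rightarrow> 'b set \<Rightarrow> bool" where
  "unramified_at F V L \<longleftrightarrow> (\<forall>W\<in>primes_above F V L. ramification_index F W = 1)"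

definition decomposes_fully :: "'b :: field set \<Rightarrow> 'b set \<Rightarrow> 'b set \<Rightarrow> bool" where
  "decomposes_fully F V L \<longleftrightarrow> card (primes_above F V L) = ext_degree F L"


section \<open>The rational function field and its algebraic closure\<close>

text \<open>The field of constants of order \<open>q = CARD('a)\<close> is the type \<open>'a\<close>.\<close>

type_synonym 'a kbar = "'a poly fract alg_closure"

definition k_field :: "'a :: finite_field kbar set" where
  "k_field = range to_ac"

definition of_RT :: "'a :: finite_field poly \<Rightarrow> 'a kbar" where
  "of_RT f = to_ac (to_fract f)"

abbreviation T_elem :: "'a :: finite_field kbar" where
  "T_elem \<equiv> of_RT [:0, 1:]"

definition GF :: "nat \<Rightarrow> 'a :: finite_field kbar set" where
  "GF Q = {x. x ^ Q = x}"

definition monic_irred :: "'a :: finite_field poly \<Rightarrow> bool" where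
  "monic_irred P \<longleftrightarrow> irreducible P \<and> lead_coeff P = 1"

definition finite_prime :: "'a :: finite_field poly \<Rightarrow> 'a kbar set" where
  "finite_prime P = {of_RT a / of_RT b | a b. \<not> P dvd b}"

definition infinite_prime :: "'a :: finite_field kbar set" where
  "infinite_prime = {of_RT a / of_RT b | a b. b \<noteq> 0 \<and> degree a \<le> degree b}"


section \<open>Cyclotomic function fields\<close>

text \<open>
  The Carlitz action for the polynomial ring \<open>\<F>\<^sub>q[t]\<close>, where \<open>t\<close> is \<open>T\<close> or \<open>1/T\<close>: it is
  \<open>\<F>\<^sub>q\<close>-linear, and \<open>t\<close> acts by \<open>x \<mapsto> t x + x\<^sup>q\<close>. The polynomial \<open>a\<close> stands for the
  element \<open>a(t)\<close>.
\<close>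

definition carlitz :: "'a :: finite_field kbar \<Rightarrow> 'a poly \<Rightarrow> 'a kbar \<Rightarrow> 'a kbar" where
  "carlitz t a x =
     (\<Sum>i\<le>degree a. of_RT [:coeff a i:] * ((\<lambda>y. t * y + y ^ CARD('a)) ^^ i) x)"

definition carlitz_torsion :: "'a :: finite_field kbar \<Rightarrow> 'a poly \<Rightarrow> 'a kbar set" where
  "carlitz_torsion t a = {x. carlitz t a x = 0}"

definition cyclotomic :: "'a :: finite_field kbar \<Rightarrow> 'a poly \<Rightarrow> 'a kbar set" where
  "cyclotomic t a = adjoin k_field (carlitz_torsion t a)"

text \<open>
  The field \<open>L\<^sub>n\<close> is the fixed field of the automorphisms that act on the \<open>(1/T)\<^sup>n\<^sup>+\<^sup>1\<close>-torsion
  as multiplication by some element of \<open>\<F>\<^sub>q\<^sup>*\<close>.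
\<close>

definition L_field :: "nat \<Rightarrow> 'a :: finite_field kbar set" where
  "L_field n =
     (let t = 1 / T_elem; a = monom 1 (Suc n); C = cyclotomic t a
      in {x \<in> C. \<forall>\<sigma>\<in>carrier (Gal k_field C).
            (\<exists>c. c \<noteq> 0 \<and> (\<forall>x\<in>carlitz_torsion t a. \<sigma> x = of_RT [:c:] * x)) \<longrightarrow> \<sigma> x = x})"

definition k_const :: "nat \<Rightarrow> 'a :: finite_field kbar set" where
  "k_const m = adjoin k_field (GF (CARD('a) ^ m))"

definition nkm_field :: "nat \<Rightarrow> 'a :: finite_field poly \<Rightarrow> nat \<Rightarrow> 'a kbar set" where
  "nkm_field n N m =
     adjoin k_field (L_field n \<union> cyclotomic T_elem N \<union> GF (CARD('a) ^ m))"


section \<open>Hilbert class field and genus field\<close>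

text \<open>
  In both definitions the maximum is taken among all abelian extensions, including infinite
  ones; such an extension is unramified (decomposes fully) iff every finite subextension is.
\<close>

definition hilbert_class_field :: "'a :: finite_field kbar set \<Rightarrow> 'a kbar set" where
  "hilbert_class_field F =
     (GREATEST H. abelian_ext F H \<and>
        (\<forall>L. finite_ext F L \<and> L \<subseteq> H \<longrightarrow>
           (\<forall>V. prime_of F V \<longrightarrow> unramified_at F V L) \<and>
           (\<forall>V\<in>primes_above k_field infinite_prime F. decomposes_fully F V L)))"

definition genus_field :: "'a :: finite_field kbar set \<Rightarrow> 'a kbar set" where
  "genus_field F = (GREATEST G. F \<subseteq> G \<and> abelian_ext k_field G \<and> G \<subseteq> hilbert_class_field F)"

end

theory Submission
 imports Defs
begin

text \<open>The field \<open>k\<close> has no proper finite Galois extension that is unramified at all finite primes and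
fully decomposed at infinity, so the Galois group of an abelian extension is generated by the inertia
groups at the finite primes and the decomposition group at infinity. An Artin--Schreier--Witt extension
is unramified where its right-hand side is integral and splits where it vanishes. Hence inertia at
\<open>P\<^sub>i\<close> moves only \<open>y\<^sub>i\<close>, and decomposition at infinity moves only \<open>z\<close>. In an abelian extension of
\<open>k(y\<^sub>1, \<dots>, y\<^sub>r, z)\<close> inside its Hilbert class field these groups are detected on \<open>y\<^sub>i\<close> and \<open>z\<close>
alone, which makes this field its own genus field. For the first equation, decomposition at infinity acts on
the Carlitz torsion through scalars, hence with order prime to \<open>p\<close>. This puts \<open>y\<close> into \<open>k(\<Lambda>\<^sub>N)\<close>
and \<open>z\<close> into \<open>M\<close>, and \<open>k(\<Lambda>\<^sub>N)\<close> meets \<open>M\<close> in \<open>k\<close>.\<close>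

text \<open>Every field lies in one algebraic closure, and Galois groups are replaced by
  \<open>Aut F\<close>, the automorphisms of the whole closure, so that elements of different groups
  can be composed and compared without restriction maps. Primes are valuation rings; no completion
  or residue field is formed. Weak approximation followed by a trace stands in for completion, and
  congruences modulo the maximal ideal for residue fields. That \<open>k\<close> has no extension of
  the forbidden kind is usually read off from the Hurwitz genus formula. Here it comes from
  characteristic p: a Galois extension \<open>L\<close> of \<open>k\<close> is the sum of the
  \<open>T^i L^p\<close> with \<open>i < p\<close>, and if \<open>L\<close> is unramified, the
  coefficients of a function without finite poles have no finite poles either, while their pole
  orders at infinity shrink by the factor \<open>p\<close>. Functions with bounded poles thus
  descend to constants. In the first equation two exponents separate \<open>k(Lambda_N)\<close> from
  \<open>M\<close>: \<open>q - 1\<close> kills the scalars acting on torsion, \<open>q^n\<close>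
  kills every automorphism on \<open>L_n\<close>, and \<open>q^n\<close> is 1 modulo
  \<open>q - 1\<close>.\<close>

notation (input) iff (infixr "<->" 25)

abbreviation (input) "TT == T_elem"
abbreviation (input) "prm == prime_of"
abbreviation (input) "adj == adjoin"
abbreviation (input) "Tor == carlitz_torsion"
abbreviation (input) "Pfin == finite_prime"
abbreviation (input) "wadd == witt_add"
abbreviation (input) "kk == k_field"
abbreviation (input) "mx == max_ideal"
abbreviation (input) "vl == valuation"
abbreviation (input) "Pinf == infinite_prime"
abbreviation (input) "RT == of_RT"

section \<open>Subrings, subfields and extension of homomorphisms\<close>

text \<open>A set predicate on an arbitrary commutative ring type, so that it also applies to the
  polynomial sets \<open>pols R\<close>. The lemmas \<open>sr_iff\<close> and \<open>sf_iff\<close>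
  connect it with \<open>subring\<close> and \<open>subfield\<close> of the ambient field.\<close>

definition is_sr :: "'b::comm_ring_1 set => bool" where
 "is_sr R <-> 1:R & (ALL x:R. ALL y:R. x - y:R & x * y:R)"

definition is_sf :: "'b::field set => bool" where
 "is_sf F <-> is_sr F & (ALL x:F. inverse x:F)"

lemma is_srI:
 assumes "1:R" "!!x y. x:R ==> y:R ==> x - y:R" "!!x y. x:R ==> y:R ==> x * y:R"
 shows "is_sr R"
 using assms by (simp add: is_sr_def)

context
 fixes R :: "'b::comm_ring_1 set"
 assumes R: "is_sr R"
begin

lemma sr_1: "1:R" using R by (simp add: is_sr_def)
lemma sr_diff: "x:R ==> y:R ==> x - y:R" using R by (simp add: is_sr_def)
lemma sr_mult: "x:R ==> y:R ==> x * y:R" using R by (simp add: is_sr_def)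
lemma sr_0: "0:R" using sr_diff[OF sr_1 sr_1] by simp
lemma sr_um: "x:R ==> - x:R" using sr_diff[OF sr_0, of x] by simp
lemma sr_add: "x:R ==> y:R ==> x + y:R"
 using sr_diff[of x "- y"] sr_um[of y] by simp
lemma sr_pow: "x:R ==> x ^ n:R"
 by (induction n) (simp_all add: sr_1 sr_mult)
lemma sr_sum: "(!!i. i:A ==> f i:R) ==> sum f A:R"
 by (induction A rule: infinite_finite_induct) (simp_all add: sr_0 sr_add)
lemma sr_prod: "(!!i. i:A ==> f i:R) ==> prod f A:R"
 by (induction A rule: infinite_finite_induct) (simp_all add: sr_1 sr_mult)
lemma sr_nat: "of_nat n:R"
 by (induction n) (simp_all add: sr_0 sr_1 sr_add)
lemma subring_of_int: "of_int n:R"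
 by (cases n) (simp_all add: sr_nat sr_um sr_diff sr_1)

lemmas sr_cl = sr_1 sr_0 sr_diff sr_add sr_mult
 sr_um sr_pow sr_nat subring_of_int

end

lemma sf_sr: "is_sf F ==> is_sr F" by (simp add: is_sf_def)
lemma sf_inv: "is_sf F ==> x:F ==> inverse x:F" by (simp add: is_sf_def)
lemma sf_div: "is_sf F ==> x:F ==> y:F ==> x / y:F"
 by (simp add: is_sf_def divide_inverse sr_mult)

lemmas sf_cl = sr_cl[OF sf_sr] sf_inv sf_div

lemma Omega_simps [simp]: "carrier \<Omega> = UNIV" "x \<otimes>\<^bsub>\<Omega>\<^esub> y = x * y" "x \<oplus>\<^bsub>\<Omega>\<^esub> y = x + y"
 "\<one>\<^bsub>\<Omega>\<^esub> = 1" "\<zero>\<^bsub>\<Omega>\<^esub> = 0"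
 by (simp_all add: ring_of_type_algebra_def)

lemma Omega_field: "field (\<Omega> :: 'b::field ring)" by (rule field_from_type_algebra)
lemma Omega_cring: "cring (\<Omega> :: 'b::field ring)" by (rule cring_from_type_algebra)
lemma Omega_ring: "ring (\<Omega> :: 'b::field ring)" by (rule ring_from_type_algebra)

lemma Omega_uminus [simp]: "\<ominus>\<^bsub>\<Omega>\<^esub> x = - (x :: 'b::field)"
 by (rule abelian_group.minus_equality[OF ring.is_abelian_group[OF Omega_ring]]) auto

lemma Omega_inv [simp]: "x ~= 0 ==> inv\<^bsub>\<Omega>\<^esub> x = inverse (x :: 'b::field)"
 by (rule comm_monoid.comm_inv_char[OF cring.axioms(2)[OF Omega_cring]]) auto

lemma sr_iff: "subring V \<Omega> <-> is_sr (V :: 'b::field set)"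
proof
 assume "subring V \<Omega>"
 show "is_sr V"
 proof (rule is_srI)
  show "1:V" using subringE(3)[OF `subring V \<Omega>`] by simp
  fix x y assume "x:V" "y:V"
  thus "x - y:V" "x * y:V"
   using subringE(7)[OF `subring V \<Omega>`, of x "- y"] subringE(5)[OF `subring V \<Omega>`, of y] subringE(6)[OF `subring V \<Omega>`, of x y] by simp_all
 qed
next
 assume R: "is_sr V"
 show "subring V \<Omega>"
  by (rule ring.subringI[OF Omega_ring]) (simp_all add: sr_cl[OF R])
qed

lemma sf_iff: "subfield F \<Omega> <-> is_sf (F :: 'b::field set)"
proof
 assume F: "subfield F \<Omega>"
 have "inverse x:F" if "x:F" for x
 proof (cases "x = 0")
  case True thus ?thesis using that by simp
 next
  case False thus ?thesis using ring.subfield_m_inv(1)[OF Omega_ring F, of x] that by simp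
 qed
 thus "is_sf F" using subfieldE(1)[OF F] by (simp add: is_sf_def sr_iff)
next
 assume F: "is_sf F"
 show "subfield F \<Omega>"
 proof (rule field.subfieldI'[OF Omega_field])
  show "subring F \<Omega>" using F by (simp add: sr_iff is_sf_def)
  fix x assume "x:F - {\<zero>\<^bsub>\<Omega>\<^esub>}"
  thus "inv\<^bsub>\<Omega>\<^esub> x:F" using F by (simp add: sf_inv)
 qed
qed

lemma adj_sf: "is_sf (adj F S)"
 unfolding adjoin_def sf_iff[symmetric] by (rule field.generate_field_is_subfield[OF Omega_field]) simp

lemma adj_base: "F <= adj F S" and adj_gen: "S <= adj F S"
 by (auto simp: adjoin_def intro: generate_field.incl)

lemma adj_least:
 assumes "is_sf L" "F <= L" "S <= L"
 shows "adj F S <= L"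
 unfolding adjoin_def using field.generate_field_min_subfield1[OF Omega_field, of "F Un S" L] assms
 by (simp add: sf_iff)

lemma adj_mono: "F <= F' ==> S <= S' ==> adj F S <= adj F' S'"
 by (rule adj_least[OF adj_sf]) (use adj_base adj_gen in blast)+

lemma adjoin_union: "adj F (S Un S') = adj (adj F S) S'"
proof (rule antisym)
 show "adj F (S Un S') <= adj (adj F S) S'"
  by (rule adj_least[OF adj_sf])
   (use adj_base[of F S] adj_base[of "adj F S" S'] adj_gen[of S F] adj_gen[of S' "adj F S"] in blast)+
 show "adj (adj F S) S' <= adj F (S Un S')"
  by (rule adj_least[OF adj_sf adj_mono[OF order_refl]])
   (use adj_gen[of "S Un S'" F] in blast)+
qed

lemma adjoin_self:
 assumes "is_sf F" "S <= F" shows "adj F S = F"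
 by (rule antisym[OF adj_least[OF assms(1) order_refl assms(2)] adj_base])

lemma sf_UNIV [simp]: "is_sf UNIV" by (simp add: is_sf_def is_sr_def)

lemma sf_Union:
 assumes "\<C> ~= {}" "!!L. L:\<C> ==> is_sf L"
  and dir: "!!L M. L:\<C> ==> M:\<C> ==> EX N:\<C>. L Un M <= N"
 shows "is_sf (\<Union>\<C>)"
 unfolding is_sf_def
proof (intro conjI is_srI ballI)
 show "1:\<Union>\<C>" using assms(1,2) by (auto intro: sf_cl)
 fix x y assume "x:\<Union>\<C>" "y:\<Union>\<C>"
 then obtain L M where "L:\<C>" "M:\<C>" "x:L" "y:M" by auto
 moreover obtain N where "N:\<C>" "L Un M <= N" using dir calculation by metis
 ultimately show "x - y:\<Union>\<C>" "x * y:\<Union>\<C>"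
  using assms(2)[of N] sf_cl(3)[of N x y] sf_cl(5)[of N x y] by blast+
next
 fix x assume "x:\<Union>\<C>"
 thus "inverse x:\<Union>\<C>" using assms(2) sf_inv by blast
qed

lemma adjoin_finite_subset:
 assumes "x:adj F S"
 obtains S' where "finite S'" "S' <= S" "x:adj F S'"
proof -
 let ?C = "(%S'. adj F S') ` {S'. finite S' & S' <= S}"
 have "is_sf (\<Union>?C)"
 proof (rule sf_Union)
  show "?C ~= {}" by auto
  show "is_sf L" if "L:?C" for L using that adj_sf by auto
  fix L M assume "L:?C" "M:?C"
  then obtain A B where AB: "L = adj F A" "M = adj F B" "finite A" "finite B" "A <= S" "B <= S"
   by auto
  have "L Un M <= adj F (A Un B)"
   unfolding AB using adj_mono[of F F A "A Un B"] adj_mono[of F F B "A Un B"] by auto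
  thus "EX N:?C. L Un M <= N" using AB by (intro bexI[of _ "adj F (A Un B)"]) auto
 qed
 moreover have "F <= \<Union>?C" using adj_base[of F "{}"] by auto
 moreover have "S <= \<Union>?C"
 proof
  fix s assume "s:S"
  thus "s:\<Union>?C" using adj_gen[of "{s}" F] by (intro UnionI[of "adj F {s}"]) auto
 qed
 ultimately have "adj F S <= \<Union>?C" by (rule adj_least)
 thus thesis using assms that by auto
qed

definition hom_on :: "'b::comm_ring_1 set => ('b => 'c::comm_ring_1) => bool" where
 "hom_on R ph <-> ph 1 = 1 & (ALL x:R. ALL y:R. ph (x + y) = ph x + ph y & ph (x * y) = ph x * ph y)"

context
 fixes R :: "'b::comm_ring_1 set" and ph :: "'b => 'c::comm_ring_1"
 assumes R: "is_sr R" and ph: "hom_on R ph"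
begin

lemma hom_on_one: "ph 1 = 1" using ph by (simp add: hom_on_def)
lemma hom_on_add: "x:R ==> y:R ==> ph (x + y) = ph x + ph y" using ph by (simp add: hom_on_def)
lemma hom_on_mult: "x:R ==> y:R ==> ph (x * y) = ph x * ph y" using ph by (simp add: hom_on_def)
lemma hom_on_zero: "ph 0 = 0"
 using hom_on_add[OF sr_0[OF R] sr_0[OF R]] by simp
lemma hom_on_uminus: "x:R ==> ph (- x) = - ph x"
 using hom_on_add[of x "- x"] sr_um[OF R, of x] hom_on_zero
 by (simp add: add_eq_0_iff)
lemma hom_on_diff: "x:R ==> y:R ==> ph (x - y) = ph x - ph y"
 using hom_on_add[of x "- y"] sr_um[OF R, of y] hom_on_uminus[of y] by simp
lemma hom_on_power: "x:R ==> ph (x ^ n) = ph x ^ n"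
 by (induction n) (simp_all add: hom_on_one hom_on_mult sr_pow[OF R])
lemma hom_on_sum: "(!!i. i:A ==> f i:R) ==> ph (sum f A) = (SUM i:A. ph (f i))"
 by (induction A rule: infinite_finite_induct) (simp_all add: hom_on_zero hom_on_add sr_sum[OF R])
lemma hom_on_prod: "(!!i. i:A ==> f i:R) ==> ph (prod f A) = (PROD i:A. ph (f i))"
 by (induction A rule: infinite_finite_induct) (simp_all add: hom_on_one hom_on_mult sr_prod[OF R])

end

lemma hom_on_inverse:
 fixes ph :: "'b::field => 'c::field"
 assumes "is_sf F" "hom_on F ph" "x:F"
 shows "ph (inverse x) = inverse (ph x)"
proof (cases "x = 0")
 case True thus ?thesis using hom_on_zero[OF sf_sr[OF assms(1)] assms(2)] by simp
next
 case False
 have "ph x * ph (inverse x) = 1"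
  using hom_on_mult[OF sf_sr[OF assms(1)] assms(2), of x "inverse x"]
   hom_on_one[OF sf_sr[OF assms(1)] assms(2)] sf_inv[OF assms(1,3)] assms(3) False by simp
 thus ?thesis by (metis inverse_unique)
qed

lemma hom_on_inj:
 fixes ph :: "'b::field => 'c::field"
 assumes "is_sf F" "hom_on F ph" shows "inj_on ph F"
proof (rule inj_onI)
 fix x y assume xy: "x:F" "y:F" "ph x = ph y"
 let ?d = "x - y"
 have d: "?d:F" "ph ?d = 0"
  using xy hom_on_diff[OF sf_sr[OF assms(1)] assms(2), of x y] sf_cl(3)[OF assms(1)] by simp_all
 show "x = y"
 proof (rule ccontr)
  assume "x ~= y"
  hence "ph (?d * inverse ?d) = 1"
   using hom_on_one[OF sf_sr[OF assms(1)] assms(2)] by simp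
  moreover have "ph (?d * inverse ?d) = ph ?d * ph (inverse ?d)"
   by (rule hom_on_mult[OF sf_sr[OF assms(1)] assms(2) d(1) sf_inv[OF assms(1) d(1)]])
  ultimately show False using d(2) by simp
 qed
qed

subsection \<open>Polynomials with coefficients in a subring\<close>

definition pols :: "'b::comm_ring_1 set => 'b poly set" where
 "pols R = {p. ALL i. coeff p i:R}"

lemma poly_eq_sum_le:
 fixes f :: "'b::comm_ring_1 poly"
 assumes "degree f <= n" shows "poly f x = (SUM i<=n. coeff f i * x ^ i)"
 unfolding poly_altdef by (rule sum.mono_neutral_left) (use assms in \<open>auto simp: coeff_eq_0\<close>)

lemma poly_in_subring:
 assumes "is_sr R" "p:pols R" "x:R" shows "poly p x:R"
 unfolding poly_altdef using assms by (intro sr_sum sr_mult sr_pow) (auto simp: pols_def)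

lemma hom_on_poly:
 assumes "is_sr R" "hom_on R ph" "p:pols R" "x:R"
 shows "ph (poly p x) = (SUM i<=degree p. ph (coeff p i) * ph x ^ i)"
proof -
 have c: "coeff p i:R" for i using assms(3) by (simp add: pols_def)
 show ?thesis
  unfolding poly_altdef
  by (subst hom_on_sum[OF assms(1,2)])
   (simp_all add: c assms sr_mult sr_pow hom_on_mult[OF assms(1,2)] hom_on_power[OF assms(1,2)])
qed

lemma pols_pCons: "pCons a p:pols R <-> a:R & p:pols R"
 by (auto simp: pols_def coeff_pCons split: nat.splits)

lemma pols_sr: "is_sr R ==> is_sr (pols R)"
 by (rule is_srI) (auto simp: pols_def coeff_mult sr_cl coeff_1 intro!: sr_sum)

subsection \<open>Extension of places\<close>

text \<open>A homomorphism from a subring is handled through its graph, so that Zorn's lemma applies to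
 sets ordered by inclusion.\<close>

definition pgraph :: "('b::field \<times> 'c::field) set => bool" where
 "pgraph G <-> (1,1):G & (ALL a b c d. (a,b):G --> (c,d):G --> (a-c,b-d):G & (a * c, b * d):G)
  & (ALL y. (0,y):G --> y = 0)"

text \<open>With \<open>G\<close> read as a homomorphism, \<open>g\<close> is the image of
  \<open>f\<close>, coefficient by coefficient. The choice \<open>g = 0\<close> says that the
  coefficients of \<open>f\<close> lie in the kernel.\<close>

definition ppair :: "('b::field \<times> 'c::field) set => 'b poly => 'c poly => bool" where
 "ppair G f g <-> (ALL i. (coeff f i, coeff g i):G)"

context
 fixes G :: "('b::field \<times> 'c::field) set"
 assumes G: "pgraph G"
begin

lemma pg_one: "(1,1):G" and pg_diff: "(a,b):G ==> (c,d):G ==> (a-c,b-d):G"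
 and pg_mult: "(a,b):G ==> (c,d):G ==> (a * c, b * d):G" and pg_fun: "(0,y):G ==> y = 0"
 using G by (auto simp: pgraph_def)
lemma pg_zero: "(0,0):G" using pg_diff[OF pg_one pg_one] by simp
lemma pg_add: assumes "(a,b):G" "(c,d):G" shows "(a + c, b + d):G"
 using pg_diff[OF assms(1) pg_diff[OF pg_zero assms(2)]] by simp
lemma pg_unique: assumes "(a,b):G" "(a,c):G" shows "b = c"
proof -
 have "(0, b - c):G" using pg_diff[OF assms] by simp
 from pg_fun[OF this] show ?thesis by simp
qed
lemma pg_power: "(a,b):G ==> (a^n,b^n):G"
 by (induction n) (simp_all add: pg_one pg_mult)
lemma pg_sum: "(!!i. i:A ==> (f i, g i):G) ==> (sum f A, sum g A):G"
 by (induction A rule: infinite_finite_induct) (simp_all add: pg_zero pg_add)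

lemma pp_zero: "ppair G 0 0" by (simp add: ppair_def pg_zero)
lemma pp_diff: "ppair G f g ==> ppair G f' g' ==> ppair G (f - f') (g - g')"
 by (simp add: ppair_def pg_diff)
lemma pp_add: "ppair G f g ==> ppair G f' g' ==> ppair G (f + f') (g + g')"
 by (simp add: ppair_def pg_add)
lemma pp_mult: "ppair G f g ==> ppair G f' g' ==> ppair G (f * f') (g * g')"
 by (auto simp: ppair_def coeff_mult intro!: pg_sum pg_mult)
lemma pp_monom: "(a,b):G ==> ppair G (monom a n) (monom b n)"
 by (simp add: ppair_def pg_zero)
lemma pp_sum: "(!!i. i:A ==> ppair G (f i) (g i)) ==> ppair G (sum f A) (sum g A)"
 by (induction A rule: infinite_finite_induct) (simp_all add: pp_zero pp_add)
lemma pp_const: "(a,b):G ==> ppair G [:a:] [:b:]"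
 using pp_monom[of a b 0] by (simp add: monom_0)

lemma pg_extend:
 assumes fn: "!!f g. ppair G f g ==> poly f x = 0 ==> poly g et = 0"
 shows "EX G'. pgraph G' & G <= G' & (x,et):G'"
proof (intro exI conjI)
 let ?G = "{(poly f x, poly g et) | f g. ppair G f g}"
 have incl: "(poly f x, poly g et):?G" if "ppair G f g" for f g using that by blast
 show "G <= ?G"
 proof
  fix c assume "c:G"
  thus "c:?G" using incl[OF pp_const[of "fst c" "snd c"]] by simp
 qed
 show "(x,et):?G" using incl[OF pp_monom[OF pg_one, of 1]] by (simp add: poly_monom)
 show "pgraph ?G"
  unfolding pgraph_def
 proof (intro conjI allI impI)
  show "(1,1):?G" using incl[OF pp_const[OF pg_one]] by simp
  show "y = 0" if "(0,y):?G" for y using that fn by auto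
  fix a b c d assume "(a,b):?G" "(c,d):?G"
  then obtain f g f' g' where *: "ppair G f g" "ppair G f' g'" "a = poly f x" "b = poly g et"
   "c = poly f' x" "d = poly g' et" by blast
  show "(a-c,b-d):?G" using incl[OF pp_diff[OF *(1,2)]] * by simp
  show "(a * c, b * d):?G" using incl[OF pp_mult[OF *(1,2)]] * by simp
 qed
qed

context
 assumes max: "!!G'. pgraph G' ==> G <= G' ==> G' = G"
begin

lemma pg_extend_max:
 assumes "!!f g. ppair G f g ==> poly f x = 0 ==> poly g et = 0"
 shows "(x,et):G"
 using pg_extend[of x et] assms max by blast

text \<open>A relation \<open>f(1/a) = 0\<close>, multiplied by \<open>a^n\<close>, becomes an
  identity between elements of the domain of \<open>G\<close>, and its image is
  \<open>b^n g(1/b) = 0\<close>. Hence the value \<open>1/b\<close> at \<open>1/a\<close> is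
  consistent, and maximality of \<open>G\<close> does the rest.\<close>

lemma pg_inverse:
 assumes "(a,b):G" "b ~= 0" shows "(inverse a, inverse b):G"
proof (rule pg_extend_max)
 have a: "a ~= 0" using assms pg_fun by blast
 fix f g assume fg: "ppair G f g" "poly f (inverse a) = 0"
 define n where "n = max (degree f) (degree g)"
 have *: "(SUM i<=n. coeff h i * c ^ (n - i)) = c ^ n * poly h (inverse c)" if "degree h <= n" "c ~= 0"
  for h :: "'d::field poly" and c
  unfolding poly_eq_sum_le[OF that(1)] sum_distrib_left
  by (rule sum.cong) (use that(2) in \<open>auto simp: power_diff field_simps\<close>)
 have "(SUM i<=n. coeff f i * a ^ (n - i), SUM i<=n. coeff g i * b ^ (n - i)):G"
  using fg(1) assms(1) by (intro pg_sum pg_mult pg_power) (simp_all add: ppair_def)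
 moreover have "(SUM i<=n. coeff f i * a ^ (n - i)) = 0" using *[of f a] a fg(2) by (simp add: n_def)
 ultimately have "(SUM i<=n. coeff g i * b ^ (n - i)) = 0" using pg_fun by metis
 thus "poly g (inverse b) = 0" using *[of g b] assms(2) by (simp add: n_def)
qed

text \<open>The descent in Chevalley's extension theorem. The hypotheses on \<open>f\<close> and
  \<open>h\<close> say that the kernel generates the unit ideal after adjoining \<open>x\<close>,
  and also after adjoining \<open>y = 1/x\<close>; the relation of smaller degree serves to shorten
  the other one.\<close>

lemma bad_descent:
 assumes xy: "x * y = 1"
  and f: "ppair G f 0" "poly f x = 1" and h: "ppair G h 0" "poly h y = 1"
  and d: "degree h <= degree f"
 shows "EX f'. ppair G f' 0 & poly f' x = 1 & degree f' < degree f"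
proof -
 define n where "n = degree f"
 define b0 where "b0 = coeff h 0"
 have b0: "(b0, 0):G" using h(1) by (simp add: ppair_def b0_def)
 have cf: "(coeff f i, 0):G" "(coeff h i, 0):G" for i using f(1) h(1) by (auto simp: ppair_def)
 have "n ~= 0"
 proof
  assume "n = 0"
  hence "(1, 0):G" using f(2) cf(1)[of 0] poly_eq_sum_le[of f 0 x] by (simp add: n_def)
  from pg_unique[OF pg_one this] show False by simp
 qed
 have ub: "(1 - b0, 1):G" using pg_diff[OF pg_one b0] by simp
 hence b1: "b0 ~= 1" using pg_fun[of 1] by auto
 have ui: "(inverse (1 - b0), 1):G" using pg_inverse[OF ub] by simp
 \<comment> \<open>As \<open>b0\<close> maps to 0, \<open>1 - b0\<close> maps to 1 and is invertible
   in the domain. Dividing by it turns \<open>h\<close> into a relation for 1 without constant term;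
   multiplied by \<open>coeff f n * x ^ n\<close> it rewrites the leading term of \<open>f\<close>
   in lower powers of \<open>x\<close>.\<close>
 define c where "c j = coeff h j * inverse (1 - b0)" for j
 have c: "(c j, 0):G" for j using pg_mult[OF cf(2) ui, of j] by (simp add: c_def)
 have hy: "(SUM j:{1..n}. c j * y ^ j) = 1"
 proof -
  have "1 = (SUM j<=n. coeff h j * y ^ j)" using h(2) poly_eq_sum_le[of h n y] d by (simp add: n_def)
  also have "{..n} = insert 0 {1..n}" by auto
  finally have "(SUM j:{1..n}. coeff h j * y ^ j) = 1 - b0"
   by (simp add: b0_def eq_diff_eq add.commute)
  hence "(SUM j:{1..n}. coeff h j * y ^ j) * inverse (1 - b0) = 1" using b1 by simp
  thus ?thesis unfolding sum_distrib_right c_def by (simp add: mult_ac)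
 qed
 define r where "r = (SUM j:{1..n}. monom (coeff f n * c j) (n - j))"
 define f' where "f' = f - monom (coeff f n) n + r"
 have "ppair G r (SUM j:{1..n}. monom (0 * 0) (n - j))"
  unfolding r_def by (intro pp_sum pp_monom pg_mult cf c)
 hence "ppair G r 0" by simp
 hence pp': "ppair G f' 0"
  using pp_add[OF pp_diff[OF f(1) pp_monom[OF cf(1), of n n]], of r 0] by (simp add: f'_def)
 have "poly r x = (SUM j:{1..n}. coeff f n * x ^ n * (c j * y ^ j))"
  unfolding r_def poly_sum poly_monom
 proof (rule sum.cong[OF refl])
  fix j assume j: "j:{1..n}"
  have "x ^ n * y ^ j = x ^ (n - j) * (x * y) ^ j"
   using j by (simp add: power_mult_distrib mult.assoc[symmetric] power_add[symmetric])
  thus "coeff f n * c j * x ^ (n - j) = coeff f n * x ^ n * (c j * y ^ j)"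
   using xy by (simp add: mult_ac)
 qed
 also have "... = coeff f n * x ^ n" unfolding sum_distrib_left[symmetric] hy by simp
 finally have "poly f' x = 1" using f(2) by (simp add: f'_def poly_monom)
 moreover have "degree f' <= n - 1"
 proof (rule degree_le, intro allI impI)
  fix i assume "n - 1 < i"
  hence i: "i >= n" by simp
  have "coeff r i = 0" unfolding r_def coeff_sum using i `n ~= 0` by (intro sum.neutral) auto
  moreover have "coeff (f - monom (coeff f n) n) i = 0"
   using i by (cases "i = n") (auto simp: n_def coeff_eq_0)
  ultimately show "coeff f' i = 0" by (simp add: f'_def)
 qed
 ultimately show ?thesis using pp' `n ~= 0` by (intro exI[of _ f']) (auto simp: n_def)
qed

lemma not_both_bad:
 assumes xy: "x * y = 1" shows "~ ((EX f. ppair G f 0 & poly f x = 1) & (EX h. ppair G h 0 & poly h y = 1))"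
proof
 assume bad: "(EX f. ppair G f 0 & poly f x = 1) & (EX h. ppair G h 0 & poly h y = 1)"
 have "False" if "ppair G f 0" "poly f x = 1" "ppair G h 0" "poly h y = 1" for f h
  using that
 proof (induction "degree f + degree h" arbitrary: f h rule: less_induct)
  case less
  show ?case
  proof (cases "degree h <= degree f")
   case True
   then obtain f' where "ppair G f' 0" "poly f' x = 1" "degree f' < degree f"
    using bad_descent[OF xy less.prems] by blast
   thus ?thesis using less.hyps[of f' h] less.prems by auto
  next
   case False
   then obtain f' where "ppair G f' 0" "poly f' y = 1" "degree f' < degree h"
    using bad_descent[of y x h f] xy less.prems by (auto simp: mult.commute)
   thus ?thesis using less.hyps[of f f'] less.prems by auto
  qed
 qed
 thus False using bad by blast
qed

end
end

text \<open>The images of the polynomials vanishing at \<open>x\<close> form an ideal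
  \<open>J\<close>. A nonzero element of least degree generates it, because elements of nonzero
  image are invertible. It is not constant, since otherwise the kernel would generate the unit
  ideal, so it has a root, and that root is a consistent value at \<open>x\<close>.\<close>

lemma pg_not_bad_closed:
 fixes G :: "('b::field \<times> 'c::alg_closed_field) set"
 assumes G: "pgraph G" and max: "!!G'. pgraph G' ==> G <= G' ==> G' = G"
  and nb: "~ (EX f. ppair G f 0 & poly f x = 1)"
 shows "EX et. (x,et):G"
proof -
 define J where "J = {g. EX f. ppair G f g & poly f x = 0}"
 show ?thesis
 proof (cases "J <= {0}")
  case True
  have "(x,0):G"
   by (rule pg_extend_max[OF G max]) (use True in \<open>auto simp: J_def\<close>)
  thus ?thesis by blast
 next
  case False
  hence "EX g. g:J & g ~= 0" by auto
  then obtain g where g: "g:J" "g ~= 0" and gmin: "!!h. h:J ==> h ~= 0 ==> degree g <= degree h"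
   using ex_has_least_nat[of "%g. g:J & g ~= 0" _ degree] by metis
  obtain f where f: "ppair G f g" "poly f x = 0" using g by (auto simp: J_def)
  have lg: "lead_coeff g ~= 0" using g by simp
  have lf: "(coeff f (degree g), lead_coeff g):G" using f by (simp add: ppair_def)
  note li = pg_inverse[OF G max lf lg]
  have "degree g ~= 0"
  proof
   assume d: "degree g = 0"
   then obtain c where c: "g = [:c:]" by (rule degree_eq_zeroE)
   hence "c ~= 0" using g by auto
   hence g1: "[:inverse (lead_coeff g):] * g = 1" by (simp add: c one_pCons)
   have "ppair G ([:inverse (coeff f (degree g)):] * f) 1"
    using pp_mult[OF G pp_const[OF G li] f(1)] g1 by simp
   hence "ppair G (1 - [:inverse (coeff f (degree g)):] * f) 0"
    using pp_diff[OF G pp_const[OF G pg_one[OF G]], of _ 1] by (simp add: one_pCons)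
   thus False using nb f(2) by force
  qed
  then obtain et where et: "poly g et = 0" using alg_closed_imp_poly_has_root[of g] by auto
  have dvd: "g dvd h" if "h:J" for h
   using that
  proof (induction "degree h" arbitrary: h rule: less_induct)
   case less
   show ?case
   proof (cases "h = 0")
    case False
    hence d: "degree g <= degree h" using gmin less.prems by blast
    obtain f2 where f2: "ppair G f2 h" "poly f2 x = 0" using less.prems by (auto simp: J_def)
    define c where "c = coeff f2 (degree h) * inverse (coeff f (degree g))"
    define e where "e = lead_coeff h * inverse (lead_coeff g)"
    define n where "n = degree h - degree g"
    have ce: "(c,e):G" unfolding c_def e_def using f2(1) by (intro pg_mult[OF G] li) (simp add: ppair_def)
    define h' where "h' = h - monom e n * g"
    have "ppair G (f2 - monom c n * f) h'"
     unfolding h'_def by (intro pp_diff[OF G] pp_mult[OF G] pp_monom[OF G] ce f f2)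
    hence h'J: "h':J" unfolding J_def using f f2 by (auto intro!: exI[of _ "f2 - monom c n * f"])
    have e0: "e ~= 0" using lg False by (simp add: e_def)
    have dm: "degree (monom e n * g) = degree h"
     using e0 g(2) d by (simp add: degree_mult_eq degree_monom_eq n_def)
    have "coeff (monom e n * g) (degree h) = lead_coeff h"
     using d lg by (simp add: coeff_monom_mult n_def e_def)
    hence "h' = 0 \<or> degree h' < degree h"
    proof -
     have "coeff h' (degree h) = 0" using `coeff (monom e n * g) (degree h) = lead_coeff h` by (simp add: h'_def)
     moreover have "degree h' <= degree h" unfolding h'_def using dm by (intro degree_diff_le) auto
     ultimately show ?thesis by (metis leading_coeff_0_iff le_neq_implies_less)
    qed
    hence "g dvd h'" using less.hyps[of h'] h'J by auto
    moreover have "h = h' + monom e n * g" by (simp add: h'_def)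
    ultimately show ?thesis by (metis dvd_add dvd_triv_right)
   qed simp
  qed
  have "(x,et):G"
  proof (rule pg_extend_max[OF G max])
   fix f' g' assume "ppair G f' g'" "poly f' x = 0"
   hence "g dvd g'" using dvd by (auto simp: J_def)
   thus "poly g' et = 0" using et by (auto elim!: dvdE)
  qed
  thus ?thesis by blast
 qed
qed

text \<open>Chevalley's theorem. It serves twice: homomorphisms of fields extend to automorphisms of
  the closure, and reduction maps of subrings of \<open>k\<close> extend to primes of the
  closure.\<close>

theorem place_extension:
 fixes ph :: "'b::field => 'c::alg_closed_field"
 assumes R: "is_sr R" and ph: "hom_on R ph"
 obtains O' ps where "R <= O'" "is_sr O'" "hom_on O' ps" "!!x. x:R ==> ps x = ph x"
  "!!x. x:O' \<or> inverse x:O'" "!!x. x:O' ==> ps x ~= 0 ==> inverse x:O'"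
proof -
 define G0 where "G0 = {(x, ph x) | x. x:R}"
 have G0: "pgraph G0"
  unfolding pgraph_def G0_def using sr_cl[OF R] hom_on_one[OF R ph] hom_on_zero[OF R ph]
   hom_on_diff[OF R ph] hom_on_mult[OF R ph] by auto
 define A where "A = {G. pgraph G & G0 <= G}"
 have "EX M:A. ALL Z:A. M <= Z --> Z = M"
 proof (rule subset_Zorn_nonempty)
  show "A ~= {}" using G0 by (auto simp: A_def)
  fix \<C> assume C: "\<C> ~= {}" "subset.chain A \<C>"
  have dir: "EX Z:\<C>. a:Z & b:Z" if ab: "a:\<Union>\<C>" "b:\<Union>\<C>" for a b
  proof -
   obtain Z Y where ZY: "Z:\<C>" "Y:\<C>" "a:Z" "b:Y" using ab by blast
   hence "Z <= Y \<or> Y <= Z" using C(2) unfolding subset_chain_def by blast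
   thus ?thesis using ZY by blast
  qed
  have pgC: "pgraph Z" "G0 <= Z" if "Z:\<C>" for Z using C(2) that by (auto simp: subset_chain_def A_def)
  have "pgraph (\<Union>\<C>)"
   unfolding pgraph_def
  proof (intro conjI allI impI)
   show "(1,1):\<Union>\<C>" using C(1) pg_one[OF pgC(1)] by auto
   show "y = 0" if "(0,y):\<Union>\<C>" for y using that pg_fun[OF pgC(1)] by auto
   fix a b c d assume "(a,b):\<Union>\<C>" "(c,d):\<Union>\<C>"
   then obtain Z where Z: "Z:\<C>" "(a,b):Z" "(c,d):Z" using dir by blast
   hence "(a-c,b-d):Z" "(a * c, b * d):Z"
    using pg_diff[OF pgC(1)[OF Z(1)]] pg_mult[OF pgC(1)[OF Z(1)]] by auto
   thus "(a-c,b-d):\<Union>\<C>" "(a * c, b * d):\<Union>\<C>" using Z(1) by auto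
  qed
  thus "\<Union>\<C>:A" using pgC(2) C(1) by (auto simp: A_def)
 qed
 then obtain G where G: "pgraph G" "G0 <= G" and m: "!!Z. Z:A ==> G <= Z ==> Z = G"
  by (auto simp: A_def)
 have max: "G' = G" if "pgraph G'" "G <= G'" for G' using m[of G'] that G(2) by (auto simp: A_def)
 define O' where "O' = Domain G"
 define ps where "ps x = (THE y. (x,y):G)" for x
 have ps: "ps x = y" if "(x,y):G" for x y
  unfolding ps_def using that pg_unique[OF G(1)] by (intro the_equality) auto
 have psG: "(x, ps x):G" if "x:O'" for x using that ps by (auto simp: O'_def)
 show thesis
 proof (rule that[of O' ps])
  show "R <= O'" using G(2) by (auto simp: O'_def G0_def)
  show "ps x = ph x" if "x:R" for x using that G(2) by (intro ps) (auto simp: G0_def)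
  show "is_sr O'"
  proof (rule is_srI)
   show "1:O'" using pg_one[OF G(1)] by (auto simp: O'_def)
   show "x - y:O'" "x * y:O'" if "x:O'" "y:O'" for x y
    using pg_diff[OF G(1)] pg_mult[OF G(1)] that unfolding O'_def by blast+
  qed
  show "hom_on O' ps" unfolding hom_on_def
  proof (intro conjI ballI)
   show "ps 1 = 1" using ps pg_one[OF G(1)] by auto
   show "ps (x + y) = ps x + ps y" "ps (x * y) = ps x * ps y" if "x:O'" "y:O'" for x y
    using pg_add[OF G(1) psG psG] pg_mult[OF G(1) psG psG] that ps by auto
  qed
  show "inverse x:O'" if "x:O'" "ps x ~= 0" for x
   using pg_inverse[OF G(1) max psG[OF that(1)] that(2)] by (auto simp: O'_def)
  show "x:O' \<or> inverse x:O'" for x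
  proof (cases "x = 0")
   case True thus ?thesis using pg_zero[OF G(1)] by (auto simp: O'_def)
  next
   case False
   hence "x * inverse x = 1" by simp
   from not_both_bad[OF G(1) max this]
   show ?thesis using pg_not_bad_closed[OF G(1) max] unfolding O'_def Domain_iff by blast
  qed
 qed
qed

text \<open>Dividing the equation by \<open>x ^ (n - 1)\<close> expresses \<open>x\<close> through
  powers of \<open>1/x\<close>, which lies in \<open>R\<close> if \<open>x\<close> does not.\<close>

lemma int_closed:
 fixes x :: "'b::field"
 assumes R: "is_sr R" and vr: "x:R \<or> inverse x:R"
  and p: "p:pols R" "lead_coeff p = 1" "poly p x = 0"
 shows "x:R"
proof (rule ccontr)
 assume x: "x~:R"
 define y where "y = inverse x"
 have y: "y:R" "x ~= 0" using x vr sr_0[OF R] by (auto simp: y_def)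
 define n where "n = degree p"
 have "n ~= 0"
 proof
  assume "n = 0"
  hence "p = [:1:]" using p(2) by (metis degree_0_id n_def)
  thus False using p(3) by simp
 qed
 have "0 = (SUM i<=n. coeff p i * x ^ i)" using p(3) by (simp add: poly_altdef n_def)
 also have "{..n} = insert n {..<n}" by auto
 also have "(SUM i:insert n {..<n}. coeff p i * x ^ i) = x ^ n + (SUM i<n. coeff p i * x ^ i)"
  using p(2) by (simp add: n_def)
 finally have "x ^ n = - (SUM i<n. coeff p i * x ^ i)" by (simp add: eq_neg_iff_add_eq_0)
 hence "x ^ n * y ^ (n - 1) = - (SUM i<n. coeff p i * x ^ i * y ^ (n - 1))"
  by (simp add: sum_distrib_right)
 also have "(SUM i<n. coeff p i * x ^ i * y ^ (n - 1)) = (SUM i<n. coeff p i * y ^ (n - 1 - i))"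
 proof (rule sum.cong[OF refl])
  fix i assume "i:{..<n}"
  hence "y ^ (n - 1) = y ^ i * y ^ (n - 1 - i)" by (simp add: power_add[symmetric])
  thus "coeff p i * x ^ i * y ^ (n - 1) = coeff p i * y ^ (n - 1 - i)"
   using y(2) by (simp add: y_def field_simps)
 qed
 also have "x ^ n * y ^ (n - 1) = x"
  using y(2) `n ~= 0` by (cases n) (simp_all add: y_def field_simps)
 finally have "x = - (SUM i<n. coeff p i * y ^ (n - 1 - i))" .
 moreover have "(SUM i<n. coeff p i * y ^ (n - 1 - i)):R"
  using p(1) y by (intro sr_sum[OF R] sr_mult[OF R] sr_pow[OF R]) (auto simp: pols_def)
 ultimately show False using x sr_um[OF R] by metis
qed

section \<open>Automorphisms of the ambient algebraic closure\<close>

definition alg_over :: "'b::field set => 'b => bool" where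
 "alg_over F x <-> (EX p:pols F. lead_coeff p = 1 & poly p x = 0)"

lemma algebraic_overI:
 assumes "is_sf F" "p:pols F" "p ~= 0" "poly p x = 0"
 shows "alg_over F x"
 unfolding alg_over_def
proof (intro bexI conjI)
 let ?p = "smult (inverse (lead_coeff p)) p"
 show "?p:pols F" using assms by (auto simp: pols_def sf_cl)
 show "lead_coeff ?p = 1" "poly ?p x = 0" using assms by auto
qed

text \<open>Automorphisms of the whole type, not of an extension \<open>L\<close>: one element acts
  on all fields at once, and the group of a subextension is obtained by looking at fewer
  points.\<close>

definition Aut :: "'b::field set => ('b => 'b) set" where
 "Aut F = {si. bij si & hom_on UNIV si & (ALL x:F. si x = x)}"

lemma hom_poly_fixed:
 fixes si :: "'b::field => 'b"
 assumes si: "hom_on UNIV si" "!!x. x:F ==> si x = x" and p: "p:pols F"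
 shows "si (poly p x) = poly p (si x)"
proof -
 have "si (poly p x) = (SUM i<=degree p. si (coeff p i) * si x ^ i)"
  by (rule hom_on_poly[OF sf_sr[OF sf_UNIV] si(1)]) (auto simp: pols_def)
 thus ?thesis using p si(2) by (simp add: poly_altdef pols_def)
qed

text \<open>The extended place has a valuation ring as domain. That ring contains \<open>F0\<close>,
  over which everything is algebraic, so it is the whole field. Surjectivity follows because the map
  permutes the finitely many roots of each polynomial over \<open>F0\<close>.\<close>

theorem hom_extends_to_Aut:
 fixes F F0 :: "'b::alg_closed_field set"
 assumes F0: "is_sf F0" "F0 <= F" and F: "is_sf F" and alg: "!!x. alg_over F0 x"
  and ph: "hom_on F ph" "!!x. x:F0 ==> ph x = x"
 obtains si where "si:Aut F0" "!!x. x:F ==> si x = ph x"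
proof -
 obtain O' ps where O': "F <= O'" "is_sr O'" "hom_on O' ps" "!!x. x:F ==> ps x = ph x"
  "!!x. x:O' \<or> inverse x:O'"
  using place_extension[OF sf_sr[OF F] ph(1)] by metis
 have "x:O'" for x
 proof -
  obtain p where "p:pols F0" "lead_coeff p = 1" "poly p x = 0"
   using alg[of x] by (auto simp: alg_over_def)
  moreover have "pols F0 <= pols O'" using F0(2) O'(1) by (auto simp: pols_def)
  ultimately show ?thesis using int_closed[OF O'(2,5)] by blast
 qed
 hence OU: "O' = UNIV" by auto
 hence h: "hom_on UNIV ps" using O'(3) by simp
 have fix0: "ps x = x" if "x:F0" for x using O'(4)[of x] ph(2)[of x] F0(2) that by auto
 have inj: "inj ps" by (rule hom_on_inj[OF sf_UNIV h])
 have "y:range ps" for y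
 proof -
  obtain p where p: "p:pols F0" "lead_coeff p = 1" "poly p y = 0"
   using alg[of y] by (auto simp: alg_over_def)
  let ?Z = "{x. poly p x = 0}"
  have "finite ?Z" using p(2) by (intro poly_roots_finite) auto
  moreover have "ps ` ?Z <= ?Z"
   using hom_poly_fixed[OF h fix0 p(1), symmetric] hom_on_zero[OF sf_sr[OF sf_UNIV] h] by auto
  ultimately have "ps ` ?Z = ?Z" using inj by (meson endo_inj_surj inj_on_subset subset_UNIV)
  thus ?thesis using p(3) by auto
 qed
 hence "bij ps" using inj by (auto simp: bij_def)
 thus thesis using that[of ps] h fix0 O'(4) by (auto simp: Aut_def)
qed

section \<open>Galois theory inside an algebraically closed field\<close>

text \<open>A base of the closure: the ambient algebraically closed field is an algebraic closure of
  \<open>F\<close>.\<close>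

definition clb :: "'b::alg_closed_field set => bool" where
 "clb F <-> is_sf F & (ALL x. alg_over F x)"

lemma clb_sf: "clb F ==> is_sf F" by (simp add: clb_def)
lemma clb_alg: "clb F ==> alg_over F x" by (simp add: clb_def)

lemma pols_mono: "F <= F' ==> pols F <= pols F'"
 by (auto simp: pols_def)

lemma clb_mono:
 assumes "clb F" "F <= F'" "is_sf F'" shows "clb F'"
 using assms pols_mono[OF assms(2)] unfolding clb_def alg_over_def by blast

lemma closure_base_adjoin: "clb F ==> clb (adj F S)"
 by (rule clb_mono[OF _ adj_base adj_sf])

lemma UNIV_subring: "is_sr (UNIV :: 'b::field set)" by (rule sf_sr) simp

lemma AutD: "si:Aut F ==> hom_on UNIV si" "si:Aut F ==> bij si" "si:Aut F ==> x:F ==> si x = x"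
 by (auto simp: Aut_def)

context
 fixes F :: "'b::field set" and si :: "'b => 'b"
 assumes si: "si:Aut F"
begin

lemma aut_zero: "si 0 = 0" by (rule hom_on_zero[OF UNIV_subring AutD(1)[OF si]])
lemma aut_one: "si 1 = 1" by (rule hom_on_one[OF UNIV_subring AutD(1)[OF si]])
lemma aut_add: "si (x + y) = si x + si y" by (rule hom_on_add[OF UNIV_subring AutD(1)[OF si]]) auto
lemma aut_diff: "si (x - y) = si x - si y" by (rule hom_on_diff[OF UNIV_subring AutD(1)[OF si]]) auto
lemma aut_uminus: "si (- x) = - si x" by (rule hom_on_uminus[OF UNIV_subring AutD(1)[OF si]]) auto
lemma aut_mult: "si (x * y) = si x * si y" by (rule hom_on_mult[OF UNIV_subring AutD(1)[OF si]]) auto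
lemma aut_power: "si (x ^ n) = si x ^ n" by (rule hom_on_power[OF UNIV_subring AutD(1)[OF si]]) auto
lemma aut_sum: "si (sum f A) = (SUM i:A. si (f i))" by (rule hom_on_sum[OF UNIV_subring AutD(1)[OF si]]) auto
lemma aut_prod: "si (prod f A) = (PROD i:A. si (f i))" by (rule hom_on_prod[OF UNIV_subring AutD(1)[OF si]]) auto
lemma aut_inv1: "si (inverse x) = inverse (si x)" by (rule hom_on_inverse[OF sf_UNIV AutD(1)[OF si]]) auto
lemma aut_eq_iff: "si x = si y <-> x = y" using AutD(2)[OF si] by (auto simp: bij_def inj_def)
lemma aut_eq_0: "si x = 0 <-> x = 0" using aut_eq_iff[of x 0] aut_zero by simp
lemma aut_poly: "p:pols F ==> si (poly p x) = poly p (si x)"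
 by (rule hom_poly_fixed[OF AutD(1)[OF si] AutD(3)[OF si]])

lemma aut_inv: "inv_into UNIV si:Aut F" and aut_inv_app: "si (inv_into UNIV si x) = x" "inv_into UNIV si (si x) = x"
proof -
 note b = AutD(2)[OF si]
 show 1: "si (inv_into UNIV si x) = x" "inv_into UNIV si (si x) = x" for x
  using b by (simp_all add: bij_is_surj surj_f_inv_f bij_is_inj)
 have e: "inv_into UNIV si x = y" if "si y = x" for x y using 1 that by auto
 have "inv_into UNIV si 1 = 1" by (rule e) (rule aut_one)
 moreover have "inv_into UNIV si (x + y) = inv_into UNIV si x + inv_into UNIV si y" for x y
  by (rule e) (simp add: aut_add 1)
 moreover have "inv_into UNIV si (x * y) = inv_into UNIV si x * inv_into UNIV si y" for x y
  by (rule e) (simp add: aut_mult 1)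
 moreover have "inv_into UNIV si x = x" if "x:F" for x by (rule e) (rule AutD(3)[OF si that])
 ultimately show "inv_into UNIV si:Aut F" using b by (simp add: Aut_def bij_imp_bij_inv hom_on_def)
qed

lemma aut_image_subfield: "is_sf L ==> is_sf (si -` L)"
 by (auto simp: is_sf_def is_sr_def aut_one aut_diff aut_mult aut_inv1)

lemma aut_adjoin_into:
 assumes "is_sf L" "F <= L" "si ` S <= L" shows "si ` adj F S <= L"
proof -
 have "adj F S <= si -` L"
  using assms by (intro adj_least aut_image_subfield) (auto simp: AutD(3)[OF si])
 thus ?thesis by auto
qed

end

lemma aut_id: "id:Aut F" "(%x. x):Aut F"
 using bij_id by (auto simp: Aut_def hom_on_def id_def)

lemma aut_comp: assumes "si:Aut F" "ta:Aut F" shows "si \<circ> ta:Aut F"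
 using assms bij_comp[of ta si] by (auto simp: Aut_def hom_on_def)

lemma aut_pow: assumes "si:Aut F" shows "si ^^ n:Aut F"
proof (induction n)
 case (Suc n) thus ?case using aut_comp[OF assms, of "si ^^ n"] by (simp only: funpow.simps)
qed (simp only: funpow.simps aut_id)

lemma Aut_mono: "F <= F' ==> Aut F' <= Aut F" by (auto simp: Aut_def)

lemma eq_sf:
 assumes "si:Aut F" "ta:Aut F" shows "is_sf {x. si x = ta x}"
 using assms by (auto simp: is_sf_def is_sr_def aut_one aut_diff aut_mult aut_inv1)

lemma agree_adj:
 assumes "si:Aut F" "ta:Aut F" "!!s. s:S ==> si s = ta s" "x:adj F S"
 shows "si x = ta x"
proof -
 have "adj F S <= {x. si x = ta x}"
  using assms by (intro adj_least eq_sf) (auto simp: AutD(3))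
 thus ?thesis using assms(4) by auto
qed

subsection \<open>Minimal polynomials\<close>

lemma polys_over_division:
 assumes R: "is_sr R" and g: "g:pols R" "lead_coeff g = 1" and f: "f:pols R"
 shows "EX q:pols R. EX r:pols R. f = q * g + r & (r = 0 \<or> degree r < degree g)"
 using f
proof (induction "degree f" arbitrary: f rule: less_induct)
 case less
 note PR = pols_sr[OF R]
 show ?case
 proof (cases "f = 0 \<or> degree f < degree g")
  case True
  thus ?thesis using less.prems sr_0[OF PR] by (intro bexI[of _ 0] bexI[of _ f]) auto
 next
  case False
  define m where "m = monom (lead_coeff f) (degree f - degree g)"
  have m: "m:pols R" using less.prems sr_0[OF R] by (auto simp: m_def pols_def)
  define f' where "f' = f - m * g"
  have f': "f':pols R" unfolding f'_def
   by (intro sr_diff[OF PR] sr_mult[OF PR] less.prems m g)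
  have "coeff (m * g) (degree f) = lead_coeff f"
   using False g(2) by (simp add: m_def coeff_monom_mult)
  moreover have "degree (m * g) <= degree f"
   using degree_mult_le[of m g] degree_monom_le[of "lead_coeff f" "degree f - degree g"] False
   unfolding m_def by linarith
  ultimately have "f' = 0 \<or> degree f' < degree f"
   by (metis (no_types) f'_def coeff_diff degree_diff_le diff_self eq_zero_or_degree_less order_refl)
  hence "EX q:pols R. EX r:pols R. f' = q * g + r & (r = 0 \<or> degree r < degree g)"
  proof
   assume "f' = 0" thus ?thesis using sr_0[OF PR] by (intro bexI[of _ 0]) auto
  qed (use less.hyps f' in blast)
  then obtain q r where "q:pols R" "r:pols R" "f' = q * g + r" "r = 0 \<or> degree r < degree g"
   by blast
  thus ?thesis using m
   by (intro bexI[of _ "q + m"] bexI[of _ r]) (auto simp: f'_def algebra_simps intro: sr_add[OF PR])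
 qed
qed

definition is_minpoly :: "'b::field set => 'b => 'b poly => bool" where
 "is_minpoly F s g <-> g:pols F & lead_coeff g = 1 & poly g s = 0 &
  (ALL f:pols F. poly f s = 0 --> f ~= 0 --> degree g <= degree f)"

lemma minpoly_exists:
 assumes "clb F" shows "EX g. is_minpoly F s g"
proof -
 let ?P = "%p. p:pols F & lead_coeff p = 1 & poly p s = 0"
 obtain p where "?P p" using clb_alg[OF assms, of s] by (auto simp: alg_over_def)
 then obtain g where g: "?P g" and min: "!!f. ?P f ==> degree g <= degree f"
  using ex_has_least_nat[of ?P p degree] by blast
 have "degree g <= degree f" if "f:pols F" "poly f s = 0" "f ~= 0" for f
 proof -
  have "?P (smult (inverse (lead_coeff f)) f)"
   using that clb_sf[OF assms] by (auto simp: pols_def sf_cl)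
  from min[OF this] that show ?thesis by simp
 qed
 thus ?thesis using g unfolding is_minpoly_def by blast
qed

lemma minpoly_dvd:
 assumes F: "is_sf F" and g: "is_minpoly F s g" and f: "f:pols F" "poly f s = 0"
 shows "EX q:pols F. f = q * g"
proof -
 have g': "g:pols F" "lead_coeff g = 1" "poly g s = 0" using g by (auto simp: is_minpoly_def)
 obtain q r where qr: "q:pols F" "r:pols F" "f = q * g + r" "r = 0 \<or> degree r < degree g"
  using polys_over_division[OF sf_sr[OF F] g'(1,2) f(1)] by blast
 have "poly r s = 0" using qr(3) f(2) g'(3) by simp
 hence "r = 0" using g qr(2,4) unfolding is_minpoly_def by (meson leD)
 thus ?thesis using qr by auto
qed

text \<open>An annihilating polynomial of least degree has a nonzero constant term, and solving for
  the inverse exhibits it as a polynomial expression in \<open>x\<close>.\<close>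

lemma alg_sr_inv:
 assumes F: "is_sf F" and R: "is_sr R" "F <= R" and x: "x:R" "alg_over F x"
 shows "inverse x:R"
proof (cases "x = 0")
 case True thus ?thesis using x by simp
next
 case False
 have "EX p:pols F. p ~= 0 & poly p x = 0"
  using x(2) unfolding alg_over_def by (metis coeff_0 zero_neq_one)
 then obtain p0 where "p0:pols F & p0 ~= 0 & poly p0 x = 0" by blast
 then obtain p where p: "p:pols F & p ~= 0 & poly p x = 0"
  and min: "!!f. f:pols F & f ~= 0 & poly f x = 0 ==> degree p <= degree f"
  using ex_has_least_nat[of "%p. p:pols F & p ~= 0 & poly p x = 0" p0 degree] by blast
 obtain a q where pq: "p = pCons a q" by (cases p)
 have aq: "a:F" "q:pols F" using p by (auto simp: pq pols_pCons)
 have e: "a + x * poly q x = 0" using p by (simp add: pq)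
 have "a ~= 0"
 proof
  assume "a = 0"
  hence "poly q x = 0" "q ~= 0" using e False p pq by auto
  hence "degree p <= degree q" using min aq by blast
  thus False using `q ~= 0` by (simp add: pq)
 qed
 hence "inverse x = - poly q x * inverse a"
  using e False by (simp add: field_simps eq_neg_iff_add_eq_0)
 moreover have "poly q x:R"
  using aq pols_mono[OF R(2)] by (intro poly_in_subring[OF R(1)] x(1)) auto
 moreover have "inverse a:R" using sf_inv[OF F aq(1)] R(2) by auto
 ultimately show ?thesis using sr_mult[OF R(1)] sr_um[OF R(1)] by metis
qed

lemma adjoin_singleton:
 assumes "clb F"
 shows "adj F {s} = {poly h s | h. h:pols F}" (is "_ = ?R")
proof
 note F = clb_sf[OF assms]
 note PR = pols_sr[OF sf_sr[OF F]]
 have in_R: "poly h s:?R" if "h:pols F" for h using that by blast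
 have R: "is_sr ?R"
 proof (rule is_srI)
  show "1:?R" using in_R[OF sr_1[OF PR]] by simp
  fix x y assume "x:?R" "y:?R"
  then obtain f h where "f:pols F" "h:pols F" "x = poly f s" "y = poly h s" by blast
  thus "x - y:?R" "x * y:?R"
   using in_R[OF sr_diff[OF PR, of f h]] in_R[OF sr_mult[OF PR, of f h]] by simp_all
 qed
 have FR: "F <= ?R"
 proof
  fix c assume "c:F"
  thus "c:?R" using in_R[of "[:c:]"] sr_0[OF sf_sr[OF F]] sr_0[OF PR]
   by (simp add: pols_pCons)
 qed
 have "s:?R" using in_R[of "[:0,1:]"] sr_0[OF sf_sr[OF F]] sr_0[OF PR]
  sr_1[OF sf_sr[OF F]] by (simp add: pols_pCons)
 moreover have "is_sf ?R" unfolding is_sf_def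
  using R alg_sr_inv[OF F R FR _ clb_alg[OF assms]] by blast
 ultimately show "adj F {s} <= ?R" using FR by (intro adj_least) auto
 show "?R <= adj F {s}"
  using poly_in_subring[OF sf_sr[OF adj_sf], of _ F "{s}" s]
   pols_mono[OF adj_base[of F "{s}"]] adj_gen[of "{s}" F] by blast
qed

lemma adj_minpoly:
 assumes "clb F" "is_minpoly F s g" "x:adj F {s}"
 obtains h where "h:pols F" "h = 0 \<or> degree h < degree g" "x = poly h s"
proof -
 note F = clb_sf[OF assms(1)]
 obtain f where f: "f:pols F" "x = poly f s" using assms(3) adjoin_singleton[OF assms(1)] by auto
 have g: "g:pols F" "lead_coeff g = 1" "poly g s = 0" using assms(2) by (auto simp: is_minpoly_def)
 obtain q r where "q:pols F" "r:pols F" "f = q * g + r" "r = 0 \<or> degree r < degree g"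
  using polys_over_division[OF sf_sr[OF F] g(1,2) f(1)] by blast
 thus thesis using that[of r] f(2) g(3) by simp
qed

lemma conjugate_exists:
 assumes cb: "clb F" and g: "is_minpoly F s g" and s': "poly g s' = 0"
 obtains si where "si:Aut F" "si s = s'"
proof -
 note F = clb_sf[OF cb]
 note PR = pols_sr[OF sf_sr[OF F]]
 have wd: "poly f s' = poly h s'" if fh: "f:pols F" "h:pols F" "poly f s = poly h s" for f h
 proof -
  obtain q where "f - h = q * g"
   using minpoly_dvd[OF F g sr_diff[OF PR fh(1,2)]] fh(3) by auto
  hence "poly (f - h) s' = 0" using s' by simp
  thus ?thesis by simp
 qed
 define ph where "ph x = poly (SOME h. h:pols F & x = poly h s) s'" for x
 have ph: "ph (poly f s) = poly f s'" if "f:pols F" for f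
 proof -
  let ?h = "SOME h. h:pols F & poly f s = poly h s"
  have "?h:pols F & poly f s = poly ?h s" by (rule someI[of _ f]) (use that in auto)
  thus ?thesis using wd[of ?h f] that by (simp add: ph_def)
 qed
 have as: "adj F {s} = {poly h s | h. h:pols F}" by (rule adjoin_singleton[OF cb])
 have "hom_on (adj F {s}) ph" unfolding hom_on_def
 proof (intro conjI ballI)
  show "ph 1 = 1" using ph[OF sr_1[OF PR]] by simp
  fix x y assume "x:adj F {s}" "y:adj F {s}"
  then obtain f h where fh: "f:pols F" "h:pols F" "x = poly f s" "y = poly h s"
   unfolding as by blast
  show "ph (x + y) = ph x + ph y"
   using ph[OF sr_add[OF PR fh(1,2)]] ph[OF fh(1)] ph[OF fh(2)] fh by simp
  show "ph (x * y) = ph x * ph y"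
   using ph[OF sr_mult[OF PR fh(1,2)]] ph[OF fh(1)] ph[OF fh(2)] fh by simp
 qed
 moreover have "ph c = c" if "c:F" for c
  using ph[of "[:c:]"] that sr_0[OF PR] by (simp add: pols_pCons)
 ultimately obtain si where si: "si:Aut F" "!!x. x:adj F {s} ==> si x = ph x"
  using hom_extends_to_Aut[OF F adj_base adj_sf clb_alg[OF cb]] by metis
 have "si s = ph s" using si(2) adj_gen[of "{s}" F] by auto
 also have "ph s = s'" using ph[of "[:0,1:]"] sr_1[OF sf_sr[OF F]]
  sr_0[OF sf_sr[OF F]] sr_0[OF PR] by (simp add: pols_pCons)
 finally show thesis using that si(1) by blast
qed

lemma fin_conj:
 assumes "clb F" shows "finite ((%si. si x) ` Aut F)"
proof -
 obtain p where p: "p:pols F" "lead_coeff p = 1" "poly p x = 0"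
  using clb_alg[OF assms, of x] by (auto simp: alg_over_def)
 have "(%si. si x) ` Aut F <= {y. poly p y = 0}"
 proof safe
  fix si assume s: "si:Aut F"
  show "poly p (si x) = 0" using aut_poly[OF s p(1), of x] p(3) aut_zero[OF s] by simp
 qed
 moreover have "finite {y. poly p y = 0}" using p(2) by (intro poly_roots_finite) auto
 ultimately show ?thesis by (rule finite_subset)
qed

subsection \<open>Separable elements\<close>

definition sep :: "'b::field set => 'b => bool" where
 "sep F x <-> (EX f:pols F. poly f x = 0 & poly (pderiv f) x ~= 0)"

lemma sep_mono: "sep F x ==> F <= F' ==> sep F' x"
 using pols_mono[of F F'] unfolding sep_def by blast

text \<open>Stability of \<open>L\<close> under \<open>Aut F\<close> is left out on purpose: the
  condition can then be passed up a tower of separable steps, none of which needs to be normal over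
  \<open>F\<close>. Stability is added in \<open>gal\<close>.\<close>

definition gfix :: "'b::field set => 'b set => bool" where
 "gfix F L <-> (ALL x:L. (ALL si:Aut F. si x = x) --> x:F)"

lemma card_roots_separable:
 fixes g :: "'b::alg_closed_field poly"
 assumes g: "g ~= 0" and s: "!!x. poly g x = 0 ==> poly (pderiv g) x ~= 0"
 shows "card {x. poly g x = 0} = degree g"
proof -
 obtain A where A: "size A = degree g" "g = smult (lead_coeff g) (\<Prod>x\<in>#A. [:-x, 1:])"
  using alg_closed_imp_factorization[OF g] by blast
 have roots: "{x. poly g x = 0} = set_mset A"
  by (subst A(2)) (use g in \<open>auto simp: poly_prod_mset prod_mset_zero_iff\<close>)
 have "count A x = 1" if x: "x :# A" for x
 proof (rule ccontr)
  assume "count A x ~= 1"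
  hence "x :# A - {#x#}" using x by (metis count_eq_zero_iff count_single diff_zero in_diff_count le_neq_implies_less less_one linorder_not_le not_less_eq_eq One_nat_def)
  then obtain B where "A = add_mset x (add_mset x B)" using x by (metis insert_DiffM)
  hence "g = [:-x,1:] * ([:-x,1:] * smult (lead_coeff g) (\<Prod>x\<in>#B. [:-x, 1:]))"
   using A(2) by (simp add: mult_ac)
  then obtain h where h: "g = [:-x,1:] * ([:-x,1:] * h)" by blast
  have "poly (pderiv g) x = 0" unfolding h pderiv_mult by simp
  moreover have "poly g x = 0" using x roots by auto
  ultimately show False using s by blast
 qed
 hence "size A = card (set_mset A)" by (simp add: size_multiset_overloaded_eq)
 thus ?thesis using A(1) roots by simp
qed

text \<open>Write \<open>x = h(s)\<close> with \<open>h\<close> of smaller degree than the minimal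
  polynomial. As \<open>x\<close> is fixed, \<open>h - x\<close> vanishes at all conjugates of
  \<open>s\<close>. Separability makes these as many as the degree of the minimal polynomial, so
  \<open>h\<close> is constant.\<close>

lemma gal_fixed_singleton:
 assumes cb: "clb F" and s: "sep F s"
 shows "gfix F (adj F {s})"
 unfolding gfix_def
proof (intro ballI impI)
 fix x assume x: "x:adj F {s}" and fx: "ALL si:Aut F. si x = x"
 note F = clb_sf[OF cb]
 obtain g where g: "is_minpoly F s g" using minpoly_exists[OF cb] by blast
 have g': "g:pols F" "lead_coeff g = 1" "poly g s = 0" using g by (auto simp: is_minpoly_def)
 obtain f where f: "f:pols F" "poly f s = 0" "poly (pderiv f) s ~= 0" using s by (auto simp: sep_def)
 obtain q where "f = q * g" using minpoly_dvd[OF F g f(1,2)] by blast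
 hence gs: "poly (pderiv g) s ~= 0" using f(3) g'(3) by (auto simp: pderiv_mult)
 have dg: "pderiv g:pols F" using g'(1) sf_sr[OF F]
  by (auto simp: pols_def coeff_pderiv simp del: of_nat_Suc intro!: sr_mult sr_nat)
 have sg: "poly (pderiv g) s' ~= 0" if s': "poly g s' = 0" for s'
 proof -
  obtain si where si: "si:Aut F" "si s = s'" using conjugate_exists[OF cb g s'] by blast
  show ?thesis using aut_poly[OF si(1) dg, of s] aut_eq_0[OF si(1), of "poly (pderiv g) s"] gs si(2) by simp
 qed
 have g0: "g ~= 0" using g'(2) by auto
 have card: "card {s'. poly g s' = 0} = degree g" by (rule card_roots_separable[OF g0 sg])
 obtain h where h: "h:pols F" "h = 0 \<or> degree h < degree g" "x = poly h s"
  using adj_minpoly[OF cb g x] by blast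
 have hs: "poly h s' = x" if s': "poly g s' = 0" for s'
 proof -
  obtain si where si: "si:Aut F" "si s = s'" using conjugate_exists[OF cb g s'] by blast
  have "si x = x" using fx si(1) by blast
  thus ?thesis using aut_poly[OF si(1) h(1), of s] h(3) si(2) by simp
 qed
 have dpos: "degree g > 0"
 proof (rule ccontr)
  assume "~ degree g > 0"
  then obtain c where "g = [:c:]" using degree_eq_zeroE by auto
  thus False using g' by auto
 qed
 have "h - [:x:] = 0"
 proof (rule ccontr)
  assume n: "h - [:x:] ~= 0"
  have "degree g <= card {s'. poly (h - [:x:]) s' = 0}"
   unfolding card[symmetric] using hs by (intro card_mono poly_roots_finite n) auto
  also have "... <= degree (h - [:x:])" by (rule card_poly_roots_bound[OF n])
  also have "... < degree g" using h(2) dpos by (intro degree_diff_less) auto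
  finally show False by simp
 qed
 hence "x = coeff h 0" by (metis coeff_pCons_0 eq_iff_diff_eq_0)
 thus "x:F" using h(1) by (simp add: pols_def)
qed

lemma gal_fixed_trans:
 assumes "gfix F L" "gfix L L'" "F <= L"
 shows "gfix F L'"
 using assms Aut_mono[OF assms(3)] unfolding gfix_def by blast

lemma gal_fixed_mono: "gfix F L ==> L' <= L ==> gfix F L'"
 by (auto simp: gfix_def)

lemma gal_fixed_insert:
 assumes "clb F" "gfix F (adj F S)" "sep (adj F S) s"
 shows "gfix F (adj F (insert s S))"
proof -
 have "adj F (insert s S) = adj (adj F S) {s}" using adjoin_union[of F S "{s}"] by simp
 thus ?thesis
  using gal_fixed_trans[OF assms(2) gal_fixed_singleton[OF closure_base_adjoin[OF assms(1)] assms(3)] adj_base] by simp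
qed

lemma gfix_adj:
 assumes cb: "clb F" and S: "!!s. s:S ==> sep F s"
 shows "gfix F (adj F S)"
proof -
 have fin: "gfix F (adj F S')" if "finite S'" "S' <= S" for S'
  using that
 proof (induction S' rule: finite_induct)
  case empty
  have "adj F {} = F" using adjoin_self[OF clb_sf[OF cb], of "{}"] by simp
  thus ?case by (simp add: gfix_def)
 next
  case (insert s S')
  thus ?case using S sep_mono[OF _ adj_base] by (intro gal_fixed_insert cb) auto
 qed
 show ?thesis unfolding gfix_def
 proof (intro ballI impI)
  fix x assume x: "x:adj F S" "ALL si:Aut F. si x = x"
  obtain S' where "finite S'" "S' <= S" "x:adj F S'" using adjoin_finite_subset[OF x(1)] .
  thus "x:F" using fin[of S'] x(2) by (auto simp: gfix_def)
 qed
qed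

subsection \<open>Galois and abelian extensions\<close>

definition gal :: "'b::field set => 'b set => bool" where
 "gal F L <-> is_sf F & is_sf L & F <= L & (ALL si:Aut F. si ` L <= L) & gfix F L"

lemma galD: assumes "gal F L"
 shows "is_sf F" "is_sf L" "F <= L" "si:Aut F ==> x:L ==> si x:L" "gfix F L"
  "x:L ==> (!!si. si:Aut F ==> si x = x) ==> x:F"
 using assms by (auto simp: gal_def gfix_def)

lemma gal_image: assumes "gal F L" "si:Aut F" shows "si ` L = L"
proof
 show "si ` L <= L" using galD(4)[OF assms] by auto
 show "L <= si ` L"
 proof
  fix x assume "x:L"
  hence "inv_into UNIV si x:L" using galD(4)[OF assms(1) aut_inv[OF assms(2)]] by simp
  thus "x:si ` L" using aut_inv_app(1)[OF assms(2), of x] by force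
 qed
qed

lemma map_poly_hom_mult:
 assumes si: "si:Aut F" shows "map_poly si (p * q) = map_poly si p * map_poly si q"
 by (rule poly_eqI) (simp add: coeff_map_poly aut_zero[OF si] coeff_mult aut_sum[OF si] aut_mult[OF si])

lemma orbit_poly_fixed:
 assumes si: "si:Aut F" and C: "finite C" "si ` C = C"
 shows "si (coeff (PROD c:C. [:-c, 1:]) i) = coeff (PROD c:C. [:-c, 1:]) i"
proof -
 have m: "map_poly si (PROD c:A. [:-c, 1:]) = (PROD c:A. [:- si c, 1:])" if "finite A" for A
  using that
 proof (induction A rule: finite_induct)
  case empty show ?case by (simp add: aut_one[OF si] aut_zero[OF si] map_poly_1')
 next
  case (insert a A)
  thus ?case
   by (simp add: map_poly_hom_mult[OF si] map_poly_pCons aut_one[OF si] aut_zero[OF si] aut_uminus[OF si] del: mult_pCons_left)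
 qed
 have "inj_on si C" using aut_eq_iff[OF si] by (auto simp: inj_on_def)
 hence "(PROD c:C. [:- si c, 1:]) = (PROD c:C. [:-c, 1:])"
  using C(2) prod.reindex[of si C "%c. [:-c, 1:]"] by (simp add: o_def)
 hence "map_poly si (PROD c:C. [:-c, 1:]) = (PROD c:C. [:-c, 1:])" using m[OF C(1)] by simp
 thus ?thesis by (metis coeff_map_poly aut_zero[OF si])
qed

lemma orbit_stable:
 assumes "si:Aut F" shows "si ` ((%ta. ta x) ` Aut F) = (%ta. ta x) ` Aut F" (is "si ` ?C = ?C")
proof -
 have "si ` ?C <= ?C" if s: "si:Aut F" for si
 proof safe
  fix ta assume "ta:Aut F"
  thus "si (ta x):?C" by (intro image_eqI[of _ _ "si \<circ> ta"] aut_comp s) simp_all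
 qed
 note sub = this
 have "?C <= si ` ?C"
 proof
  fix y assume "y:?C"
  hence "inv_into UNIV si y:?C" using sub[OF aut_inv[OF assms]] by blast
  thus "y:si ` ?C" by (rule rev_image_eqI) (simp add: aut_inv_app(1)[OF assms])
 qed
 thus ?thesis using sub[OF assms] by blast
qed

lemma gal_conj_poly:
 assumes cb: "clb F" and g: "gal F L" and x: "x:L"
 defines "C \<equiv> (%si. si x) ` Aut F"
 shows "finite C" "C <= L" "x:C" "(PROD c:C. [:-c, 1:]):pols F"
proof -
 show C: "finite C" unfolding C_def by (rule fin_conj[OF cb])
 show CL: "C <= L" unfolding C_def using galD(4)[OF g _ x] by auto
 show "x:C" unfolding C_def by (rule image_eqI[OF _ aut_id(2)]) simp
 have "(PROD c:C. [:-c, 1:]):pols L"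
 proof (rule sr_prod[OF pols_sr[OF sf_sr[OF galD(2)[OF g]]]])
  fix c assume "c:C"
  thus "[:- c, 1:]:pols L"
   using CL sr_cl[OF sf_sr[OF galD(2)[OF g]]]
    sr_0[OF pols_sr[OF sf_sr[OF galD(2)[OF g]]]] by (auto simp: pols_pCons)
 qed
 hence L: "coeff (PROD c:C. [:-c, 1:]) i:L" for i by (simp add: pols_def)
 have "coeff (PROD c:C. [:-c, 1:]) i:F" for i
 proof (rule galD(6)[OF g L])
  fix si assume s: "si:Aut F"
  show "si (coeff (PROD c:C. [:-c, 1:]) i) = coeff (PROD c:C. [:-c, 1:]) i"
   by (rule orbit_poly_fixed[OF s C orbit_stable[OF s, of x, folded C_def]])
 qed
 thus "(PROD c:C. [:-c, 1:]):pols F" by (simp add: pols_def)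
qed

lemma gal_imp_sep:
 assumes cb: "clb F" and g: "gal F L" and x: "x:L" shows "sep F x"
proof -
 define C where "C = (%si. si x) ` Aut F"
 note * = gal_conj_poly[OF assms, folded C_def]
 let ?r = "PROD c:C - {x}. [:-c, 1:]"
 have e: "(PROD c:C. [:-c, 1:]) = [:-x, 1:] * ?r" by (rule prod.remove[OF *(1,3)])
 have "poly ?r x ~= 0" using *(1) by (simp add: poly_prod)
 moreover have "poly (pderiv ([:-x, 1:] * ?r)) x = poly ?r x"
  unfolding pderiv_mult by (simp add: pderiv_pCons)
 moreover have "poly ([:-x, 1:] * ?r) x = 0" by simp
 ultimately show ?thesis unfolding sep_def using *(4) e by metis
qed

lemma gal_adjoinI:
 assumes cb: "clb F" and fx: "gfix F (adj F S)"
  and st: "!!si s. si:Aut F ==> s:S ==> si s:adj F S"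
 shows "gal F (adj F S)"
 unfolding gal_def using clb_sf[OF cb] adj_sf adj_base fx
  aut_adjoin_into[OF _ adj_sf adj_base, of _ F S S] st by blast

lemma gal_composite:
 assumes cb: "clb F" and L: "!!L. L:\<C> ==> gal F L"
 shows "gal F (adj F (\<Union>\<C>))"
proof (rule gal_adjoinI[OF cb])
 show "gfix F (adj F (\<Union>\<C>))"
  using gal_imp_sep[OF cb L] by (intro gfix_adj[OF cb]) auto
 show "si s:adj F (\<Union>\<C>)" if "si:Aut F" "s:\<Union>\<C>" for si s
  using that galD(4)[OF L] adj_gen[of "\<Union>\<C>" F] by blast
qed

lemma gal_intermediate:
 assumes cb: "clb F" and g: "gal F L" and E: "is_sf E" "F <= E" "E <= L"
 shows "gal E L"
proof -
 note cbE = clb_mono[OF cb E(2,1)]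
 have "adj E L = L" by (rule antisym[OF adj_least[OF galD(2)[OF g] E(3) order_refl] adj_gen])
 moreover have "sep E x" if "x:L" for x using sep_mono[OF gal_imp_sep[OF cb g that] E(2)] .
 ultimately have "gfix E L" using gfix_adj[OF cbE, of L] by simp
 thus ?thesis using E galD(2,4)[OF g] Aut_mono[OF E(2)] unfolding gal_def by blast
qed

definition abel :: "'b::field set => 'b set => bool" where
 "abel F L <-> gal F L & (ALL si:Aut F. ALL ta:Aut F. ALL x:L. si (ta x) = ta (si x))"

lemma abel_gal: "abel F L ==> gal F L" by (simp add: abel_def)
lemma abel_commute: "abel F L ==> si:Aut F ==> ta:Aut F ==> x:L ==> si (ta x) = ta (si x)"
 by (simp add: abel_def)

lemma abel_adjoinI:
 assumes "gal F (adj F S)"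
  and c: "!!si ta s. si:Aut F ==> ta:Aut F ==> s:S ==> si (ta s) = ta (si s)"
 shows "abel F (adj F S)"
 unfolding abel_def
proof (intro conjI ballI assms(1))
 fix si ta x assume "si:Aut F" "ta:Aut F" "x:adj F S"
 thus "si (ta x) = ta (si x)"
  using agree_adj[OF aut_comp[of si F ta] aut_comp[of ta F si], of S x] c by simp
qed

lemma abel_composite:
 assumes "clb F" "!!L. L:\<C> ==> abel F L"
 shows "abel F (adj F (\<Union>\<C>))"
 using assms by (intro abel_adjoinI gal_composite) (auto intro: abel_gal abel_commute)

lemma abel_comp2:
 assumes "clb F" "abel F L" "abel F L'"
 shows "abel F (adj F (L Un L'))"
 using abel_composite[OF assms(1), of "{L, L'}"] assms by auto

lemma abel_mid:
 assumes cb: "clb F" and a: "abel F L" and E: "is_sf E" "F <= E" "E <= L"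
 shows "abel E L" "abel F E"
proof -
 note g = abel_gal[OF a]
 note gE = gal_intermediate[OF cb g E]
 show "abel E L" unfolding abel_def using gE abel_commute[OF a] Aut_mono[OF E(2)] by blast
 have st: "si x:E" if s: "si:Aut F" and x: "x:E" for si x
 proof (rule galD(6)[OF gE])
  show "si x:L" using galD(4)[OF g s] x E(3) by auto
  fix ta assume t: "ta:Aut E"
  hence "ta (si x) = si (ta x)" using abel_commute[OF a _ s, of ta x] Aut_mono[OF E(2)] x E(3) by auto
  thus "ta (si x) = si x" using AutD(3)[OF t x] by simp
 qed
 have "gal F E" unfolding gal_def
  using E galD(1)[OF g] st gal_fixed_mono[OF galD(5)[OF g] E(3)] by auto
 thus "abel F E" unfolding abel_def using abel_commute[OF a] E(3) by blast
qed

section \<open>Galois groups and degrees\<close>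

text \<open>Unlike \<open>Aut F\<close> this is finite for finitely generated \<open>L\<close>, so
  that norms, traces and counts can be taken over it; \<open>restrict\<close> makes equality depend
  on the values on \<open>L\<close> alone.\<close>

definition Grp :: "'b::field set => 'b set => ('b => 'b) set" where
 "Grp F L = (%si. restrict si L) ` Aut F"

definition fing :: "'b::field set => 'b set => bool" where
 "fing F L <-> (EX S. finite S & L = adj F S)"

lemma fin_gen_composite:
 assumes "fing F L" "fing F L'" shows "fing F (adj F (L Un L'))"
proof -
 obtain S S' where S: "finite S" "L = adj F S" "finite S'" "L' = adj F S'"
  using assms by (auto simp: fing_def)
 have "adj F (L Un L') = adj F (S Un S')"
 proof (rule antisym; rule adj_least[OF adj_sf adj_base])
  show "L Un L' <= adj F (S Un S')" unfolding S using adj_mono[of F F] by simp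
  show "S Un S' <= adj F (L Un L')"
   unfolding S using adj_gen[of S F] adj_gen[of S' F] adj_gen[of "adj F S Un adj F S'" F] by blast
 qed
 thus ?thesis using S unfolding fing_def by blast
qed

lemma fin_gen_base:
 assumes "is_sf F" shows "fing F F"
 using adjoin_self[OF assms, of "{}"] unfolding fing_def by blast

lemma Grp_app: "g:Grp F L ==> EX si:Aut F. ALL x:L. g x = si x" by (auto simp: Grp_def)

lemma finite_Grp:
 assumes cb: "clb F" and L: "fing F L"
 shows "finite (Grp F L)"
proof -
 obtain S where S: "finite S" "L = adj F S" using L by (auto simp: fing_def)
 have SL: "S <= L" unfolding S by (rule adj_gen)
 have "inj_on (%g. restrict g S) (Grp F L)"
 proof (rule inj_onI)
  fix g h assume g: "g:Grp F L" and h: "h:Grp F L" and e: "restrict g S = restrict h S"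
  obtain si ta where st: "si:Aut F" "ta:Aut F" "g = restrict si L" "h = restrict ta L"
   using g h by (auto simp: Grp_def)
  have "si s = ta s" if "s:S" for s using fun_cong[OF e, of s] that SL st by auto
  hence "si x = ta x" if "x:L" for x using agree_adj[OF st(1,2)] that S(2) by metis
  thus "g = h" unfolding st by (intro restrict_ext) auto
 qed
 moreover have "(%g. restrict g S) ` Grp F L <= PiE S (%s. (%si. si s) ` Aut F)"
  using SL by (auto simp: Grp_def)
 moreover have "finite (PiE S (%s. (%si. si s) ` Aut F))"
  by (intro finite_PiE S fin_conj[OF cb])
 ultimately show ?thesis by (meson finite_imageD finite_subset)
qed

lemma Grp_translate:
 assumes cb: "clb F" and L: "fing F L" and g: "gal F L" and si: "si:Aut F"
 shows "bij_betw (%g. restrict (si \<circ> g) L) (Grp F L) (Grp F L)"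
  "bij_betw (%g. restrict (g \<circ> si) L) (Grp F L) (Grp F L)"
proof -
 note fin = finite_Grp[OF cb L]
 have 1: "(%g. restrict (si \<circ> g) L) ` Grp F L <= Grp F L"
 proof (clarsimp simp: Grp_def)
  fix ta assume "ta:Aut F"
  thus "restrict (si \<circ> restrict ta L) L:(%si. restrict si L) ` Aut F"
   by (intro image_eqI[of _ _ "si \<circ> ta"] aut_comp si) (auto simp: fun_eq_iff)
 qed
 have 2: "(%g. restrict (g \<circ> si) L) ` Grp F L <= Grp F L"
 proof (clarsimp simp: Grp_def)
  fix ta assume "ta:Aut F"
  thus "restrict (restrict ta L \<circ> si) L:(%si. restrict si L) ` Aut F"
   by (intro image_eqI[of _ _ "ta \<circ> si"] aut_comp si) (auto simp: fun_eq_iff galD(4)[OF g si])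
 qed
 have "inj_on (%g. restrict (si \<circ> g) L) (Grp F L)"
 proof (rule inj_onI)
  fix g h assume gh: "g:Grp F L" "h:Grp F L" and e: "restrict (si \<circ> g) L = restrict (si \<circ> h) L"
  have "g x = h x" if "x:L" for x using fun_cong[OF e, of x] that aut_eq_iff[OF si] by simp
  moreover obtain ta ta' where "g = restrict ta L" "h = restrict ta' L" using gh by (auto simp: Grp_def)
  ultimately show "g = h" by (auto simp: fun_eq_iff restrict_def)
 qed
 thus "bij_betw (%g. restrict (si \<circ> g) L) (Grp F L) (Grp F L)"
  using 1 fin by (simp add: bij_betw_def endo_inj_surj)
 have "inj_on (%g. restrict (g \<circ> si) L) (Grp F L)"
 proof (rule inj_onI)
  fix g h assume gh: "g:Grp F L" "h:Grp F L" and e: "restrict (g \<circ> si) L = restrict (h \<circ> si) L"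
  have "g x = h x" if x: "x:L" for x
  proof -
   obtain y where "y:L" "x = si y" using gal_image[OF assms(3) si] x by auto
   thus ?thesis using fun_cong[OF e, of y] by simp
  qed
  moreover obtain ta ta' where "g = restrict ta L" "h = restrict ta' L" using gh by (auto simp: Grp_def)
  ultimately show "g = h" by (auto simp: fun_eq_iff restrict_def)
 qed
 thus "bij_betw (%g. restrict (g \<circ> si) L) (Grp F L) (Grp F L)"
  using 2 fin by (simp add: bij_betw_def endo_inj_surj)
qed

lemma Grp_sum_in_base:
 assumes cb: "clb F" and L: "fing F L" and g: "gal F L" and x: "x:L"
 shows "(SUM g:Grp F L. g x):F"
proof (rule galD(6)[OF g])
 show "(SUM g:Grp F L. g x):L"
  using galD(4)[OF g _ x] x by (intro sr_sum[OF sf_sr[OF galD(2)[OF g]]]) (auto simp: Grp_def)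
 fix si assume s: "si:Aut F"
 have "si (SUM g:Grp F L. g x) = (SUM g:Grp F L. (restrict (si \<circ> g) L) x)" using x by (simp add: aut_sum[OF s])
 also have "... = (SUM g:Grp F L. g x)" by (rule sum.reindex_bij_betw[OF Grp_translate(1)[OF cb L g s]])
 finally show "si (SUM g:Grp F L. g x) = (SUM g:Grp F L. g x)" .
qed

lemma Grp_prod_in_base:
 assumes cb: "clb F" and L: "fing F L" and g: "gal F L" and x: "x:L"
 shows "(PROD g:Grp F L. g x):F"
proof (rule galD(6)[OF g])
 show "(PROD g:Grp F L. g x):L"
  using galD(4)[OF g _ x] x by (intro sr_prod[OF sf_sr[OF galD(2)[OF g]]]) (auto simp: Grp_def)
 fix si assume s: "si:Aut F"
 have "si (PROD g:Grp F L. g x) = (PROD g:Grp F L. (restrict (si \<circ> g) L) x)" using x by (simp add: aut_prod[OF s])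
 also have "... = (PROD g:Grp F L. g x)" by (rule prod.reindex_bij_betw[OF Grp_translate(1)[OF cb L g s]])
 finally show "si (PROD g:Grp F L. g x) = (PROD g:Grp F L. g x)" .
qed

subsection \<open>Primitive elements\<close>

text \<open>Take \<open>x\<close> outside the earlier subspaces. If it falls into the new one,
  \<open>V\<close>, choose \<open>y\<close> outside \<open>V\<close>: then \<open>y + c * x\<close>
  avoids \<open>V\<close> for every \<open>c\<close>, and each earlier subspace excludes at most one
  \<open>c\<close> of the infinite field.\<close>

lemma avoid_proper_subspaces:
 fixes F L :: "'b::field set"
 assumes fin: "finite \<V>" and F: "is_sf F" "infinite F" and L: "is_sf L" "F <= L"
  and V: "ALL V:\<V>. (EX x:L. x~:V) & (ALL x:V. ALL y:V. x - y:V) & (ALL x:V. ALL c:F. c * x:V)"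
 shows "EX x:L. ALL V:\<V>. x~:V"
 using fin V
proof (induction \<V> rule: finite_induct)
 case empty
 thus ?case using sf_cl(1)[OF L(1)] by auto
next
 case (insert V \<V>)
 have "EX x:L. ALL V:\<V>. x~:V" by (rule insert.IH) (use insert.prems in simp)
 then obtain x where x: "x:L" "!!U. U:\<V> ==> x~:U" by blast
 have VV: "!!U x y. U:insert V \<V> ==> x:U ==> y:U ==> x - y:U"
  "!!U x c. U:insert V \<V> ==> x:U ==> c:F ==> c * x:U" using insert.prems by blast+
 show ?case
 proof (cases "x:V")
  case False thus ?thesis using x by auto
 next
  case True
  obtain y where y: "y:L" "y~:V" using insert.prems by auto
  have *: "y + c * x~:V" if c: "c:F" for c
  proof
   assume "y + c * x:V"
   hence "y + c * x - c * x:V" by (intro VV(1)[of V] VV(2)[of V] insertI1 True c)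
   thus False using y by simp
  qed
  have fin: "finite {c:F. y + c * x:U}" if U: "U:\<V>" for U
  proof -
   have "c = d" if cd: "c:F" "d:F" "y + c * x:U" "y + d * x:U" for c d
   proof (rule ccontr)
    assume n: "c ~= d"
    have "(y + c * x) - (y + d * x):U" by (intro VV(1)[of U] insertI2 U cd)
    hence "(c - d) * x:U" by (simp add: algebra_simps)
    hence "inverse (c - d) * ((c - d) * x):U"
     by (rule VV(2)[OF insertI2[OF U] _ sf_inv[OF F(1) sf_cl(3)[OF F(1) cd(1,2)]]])
    thus False using x(2)[OF U] n by (simp add: mult.assoc[symmetric])
   qed
   hence "EX c. {c:F. y + c * x:U} <= {c}" by blast
   thus ?thesis using finite_subset by blast
  qed
  have "finite (UN U:\<V>. {c:F. y + c * x:U})" using insert.hyps(1) fin by (intro finite_UN_I)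
  then obtain c where c: "c:F" "c~:(UN U:\<V>. {c:F. y + c * x:U})"
   using F(2) finite_subset[of F] by blast
  have "y + c * x:L" using c L(2) by (intro sf_cl(4,5)[OF L(1)] x y) auto
  thus ?thesis using * c by (intro bexI[of _ "y + c * x"]) auto
 qed
qed

text \<open>The subspaces to avoid are those on which two different elements of
  \<open>Grp F L\<close> agree; finiteness of the group makes them finitely many.\<close>

lemma primitive_element:
 assumes cb: "clb F" and F: "infinite F" and L: "fing F L" and g: "gal F L"
 obtains s where "s:L" "inj_on (%g. g s) (Grp F L)" "!!si ta x. si:Aut F ==> ta:Aut F ==> si s = ta s ==> x:L ==> si x = ta x"
proof -
 note Fs = galD(1)[OF g] and Ls = galD(2)[OF g]
 define \<V> where "\<V> = (%(g,h). {x:L. g x = h x}) ` {(g,h). g:Grp F L & h:Grp F L & g ~= h}"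
 have "EX x:L. ALL V:\<V>. x~:V"
 proof (rule avoid_proper_subspaces[OF _ Fs F Ls galD(3)[OF g]])
  have "finite {(g,h). g:Grp F L & h:Grp F L & g ~= h}"
   by (rule finite_subset[OF _ finite_cartesian_product[OF finite_Grp[OF cb L] finite_Grp[OF cb L]]]) auto
  thus "finite \<V>" unfolding \<V>_def by (rule finite_imageI)
  show "ALL V:\<V>. (EX x:L. x~:V) & (ALL x:V. ALL y:V. x - y:V) & (ALL x:V. ALL c:F. c * x:V)"
  proof (intro ballI conjI)
   fix V assume V: "V:\<V>"
   obtain si ta where st: "si:Aut F" "ta:Aut F" "V = {x:L. restrict si L x = restrict ta L x}"
    and ne: "restrict si L ~= restrict ta L"
    using V unfolding \<V>_def Grp_def by auto
   have V': "V = {x:L. si x = ta x}" unfolding st(3) by auto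
   show "EX x:L. x~:V" using ne unfolding V' by (auto intro: restrict_ext)
   show "x - y:V" if "x:V" "y:V" for x y
    using that unfolding V' by (simp add: aut_diff[OF st(1)] aut_diff[OF st(2)] sf_cl(3)[OF Ls])
   show "c * x:V" if "x:V" "c:F" for x c
    using that galD(3)[OF g] unfolding V'
    by (auto simp: aut_mult[OF st(1)] aut_mult[OF st(2)] AutD(3)[OF st(1)] AutD(3)[OF st(2)] intro: sf_cl(5)[OF Ls])
  qed
 qed
 then obtain s where s: "s:L" "!!V. V:\<V> ==> s~:V" by blast
 have inj: "g = h" if gh: "g:Grp F L" "h:Grp F L" "g s = h s" for g h
 proof (rule ccontr)
  assume "g ~= h"
  hence "{x:L. g x = h x}:\<V>" unfolding \<V>_def using gh by (intro image_eqI[of _ _ "(g,h)"]) auto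
  thus False using s gh(3) by blast
 qed
 show thesis
 proof (rule that[OF s(1)])
  show "inj_on (%g. g s) (Grp F L)" using inj by (auto simp: inj_on_def)
  show "si x = ta x" if "si:Aut F" "ta:Aut F" "si s = ta s" "x:L" for si ta x
   using fun_cong[OF inj[of "restrict si L" "restrict ta L"], of x] that s(1) by (auto simp: Grp_def)
 qed
qed

text \<open>Artin's theorem for a monoid of automorphisms. For a primitive \<open>s\<close> the
  polynomial with roots the \<open>A\<close>-orbit of \<open>s\<close> has coefficients in
  \<open>F\<close>, so \<open>si s\<close> is again in the orbit, and an automorphism is determined
  on \<open>L\<close> by its value at \<open>s\<close>.\<close>

lemma artin:
 assumes cb: "clb F" and F: "infinite F" and L: "fing F L" and g: "gal F L"
  and A: "A <= Aut F" "(%x. x):A" "!!a b. a:A ==> b:A ==> a \<circ> b:A"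
  and fx: "!!x. x:L ==> (!!a. a:A ==> a x = x) ==> x:F"
  and si: "si:Aut F"
 obtains a where "a:A" "!!x. x:L ==> si x = a x"
proof -
 note Ls = galD(2)[OF g]
 obtain s where s: "s:L" and un: "!!si ta x. si:Aut F ==> ta:Aut F ==> si s = ta s ==> x:L ==> si x = ta x"
  using primitive_element[OF cb F L g] by metis
 define C where "C = (%a. a s) ` A"
 have finC: "finite C" unfolding C_def
  by (rule finite_subset[OF image_mono[OF A(1)] fin_conj[OF cb]])
 have CL: "C <= L" unfolding C_def using galD(4)[OF g _ s] A(1) by auto
 have st: "a ` C = C" if a: "a:A" for a
 proof (rule endo_inj_surj[OF finC])
  show "a ` C <= C"
  proof (clarsimp simp: C_def)
   fix b assume "b:A"
   thus "a (b s):(%a. a s) ` A" using A(3)[OF a] by (intro image_eqI[of _ _ "a \<circ> b"]) auto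
  qed
  have "a:Aut F" using A(1) a by auto
  thus "inj_on a C" by (simp add: inj_on_def aut_eq_iff)
 qed
 let ?p = "PROD c:C. [:-c, 1:]"
 note LS = sf_sr[OF Ls]
 have "?p:pols L"
  using CL by (intro sr_prod[OF pols_sr[OF LS]])
   (auto simp: pols_pCons sr_cl[OF LS] sr_0[OF pols_sr[OF LS]])
 hence "coeff ?p i:F" for i
  using orbit_poly_fixed[OF _ finC st] A(1) by (intro fx) (auto simp: pols_def)
 hence p: "?p:pols F" by (simp add: pols_def)
 have "s:C" unfolding C_def by (rule image_eqI[OF _ A(2)]) simp
 hence "poly ?p s = 0" using finC by (auto simp: poly_prod)
 hence "poly ?p (si s) = 0" using aut_poly[OF si p, of s] aut_zero[OF si] by simp
 hence "si s:C" using finC by (auto simp: poly_prod)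
 then obtain a where "a:A" "si s = a s" by (auto simp: C_def)
 thus thesis using that un[OF si, of a] A(1) by blast
qed

text \<open>Among the finite subsets of \<open>E\<close> take one whose automorphisms have the
  fewest restrictions to \<open>L\<close>. Adjoining a further element of \<open>E\<close> cannot
  reduce their number, so every such automorphism fixes that element, which therefore was already
  generated.\<close>

lemma fin_gen_mid:
 assumes cb: "clb F" and L: "fing F L" and g: "gal F L" and E: "is_sf E" "F <= E" "E <= L"
 shows "fing F E"
proof -
 let ?n = "%S. card ((%si. restrict si L) ` Aut (adj F S))"
 obtain S where S: "finite S" "S <= E" and min: "!!S'. finite S' ==> S' <= E ==> ?n S <= ?n S'"
  using ex_has_least_nat[of "%S. finite S & S <= E" "{}" ?n] by auto
 have "E <= adj F S"
 proof
  fix x assume x: "x:E"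
  let ?A = "%S. (%si. restrict si L) ` Aut (adj F S)"
  have sub: "?A (insert x S) <= ?A S" by (intro image_mono Aut_mono adj_mono) auto
  have fin: "finite (?A S)"
   by (rule finite_subset[OF _ finite_Grp[OF cb L]]) (unfold Grp_def, intro image_mono Aut_mono adj_base)
  have eq: "?A (insert x S) = ?A S"
   by (rule card_seteq[OF fin sub]) (use min[of "insert x S"] S x in auto)
  have SL: "adj F S <= L" by (rule adj_least[OF galD(2,3)[OF g]]) (use S E in auto)
  note g' = gal_intermediate[OF cb g adj_sf adj_base SL]
  show "x:adj F S"
  proof (rule galD(6)[OF g'])
   show xL: "x:L" using x E by auto
   fix si assume "si:Aut (adj F S)"
   hence "restrict si L:?A (insert x S)" using eq by blast
   then obtain ta where t: "ta:Aut (adj F (insert x S))" "restrict si L = restrict ta L" by auto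
   have "ta x = x" by (rule AutD(3)[OF t(1)]) (use adj_gen[of "insert x S" F] in auto)
   thus "si x = x" using fun_cong[OF t(2), of x] xL by simp
  qed
 qed
 moreover have "adj F S <= E" by (rule adj_least[OF E(1,2) S(2)])
 ultimately show ?thesis using S(1) unfolding fing_def by blast
qed

lemma fin_gen_mono: assumes "fing F L" "F <= E" "E <= L" shows "fing E L"
proof -
 obtain S where S: "finite S" "L = adj F S" using assms by (auto simp: fing_def)
 have "adj E S = L"
 proof (rule antisym)
  show "adj E S <= L" using assms(3) unfolding S(2)
   by (intro adj_least[OF adj_sf] adj_gen)
  show "L <= adj E S" unfolding S(2) by (rule adj_mono[OF assms(2) order_refl])
 qed
 thus ?thesis using S(1) unfolding fing_def by blast
qed

subsection \<open>Comparison with the definitions through vector space dimension and Galois groups\<close>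

lemma line_ext:
 "x:ring.line_extension \<Omega> F v E <-> (EX k:F. EX w:E. x = k * v + (w :: 'b::field))"
 using ring.line_extension_mem_iff[OF Omega_ring] by simp

lemma dim_adj:
 assumes cb: "clb F" and g: "is_minpoly F s g"
 shows "ring.dimension \<Omega> (degree g) F (adj F {s})"
proof -
 note F = clb_sf[OF cb]
 \<comment> \<open>\<open>E i\<close> is spanned by the first \<open>i\<close> powers of
   \<open>s\<close>. Up to the degree of the minimal polynomial each new power is independent of the
   earlier ones.\<close>
 define E where "E i = {poly h s | h. h:pols F & (ALL j>=i. coeff h j = 0)}" for i
 have g': "g:pols F" "lead_coeff g = 1" "poly g s = 0"
  "!!f. f:pols F ==> poly f s = 0 ==> f ~= 0 ==> degree g <= degree f" using g by (auto simp: is_minpoly_def)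
 have "ring.dimension \<Omega> i F (E i)" if "i <= degree g" for i
  using that
 proof (induction i)
  case 0
  have "E 0 = {0}" using sr_0[OF sf_sr[OF F]]
   by (auto simp: E_def poly_eq_iff pols_def intro!: exI[of _ 0] simp flip: poly_eq_iff) (metis coeff_0 poly_0 poly_eqI)
  thus ?case using ring.zero_dim[OF Omega_ring] by simp
 next
  case (Suc i)
  have "s ^ i~:E i"
  proof
   assume "s ^ i:E i"
   then obtain h where h: "h:pols F" "ALL j>=i. coeff h j = 0" "s ^ i = poly h s" by (auto simp: E_def)
   let ?f = "monom 1 i - h"
   have "?f:pols F" using h(1) by (auto simp: pols_def intro!: sf_cl[OF F])
   moreover have "poly ?f s = 0" using h(3) by (simp add: poly_monom)
   moreover have "coeff ?f i = 1" using h(2) by simp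
   moreover have "degree ?f <= i" using h(2) by (intro degree_le) auto
   ultimately show False using g'(4)[of ?f] Suc.prems by force
  qed
  moreover have "ring.line_extension \<Omega> F (s ^ i) (E i) = E (Suc i)"
  proof (intro Set.set_eqI iffI)
   fix x assume "x:ring.line_extension \<Omega> F (s ^ i) (E i)"
   then obtain k h where kh: "k:F" "h:pols F" "ALL j>=i. coeff h j = 0" "x = k * s ^ i + poly h s"
    by (auto simp: line_ext E_def)
   thus "x:E (Suc i)" unfolding E_def
    by (intro CollectI exI[of _ "monom k i + h"]) (auto simp: poly_monom pols_def intro!: sf_cl[OF F])
  next
   fix x assume "x:E (Suc i)"
   then obtain h where h: "h:pols F" "ALL j>=Suc i. coeff h j = 0" "x = poly h s" by (auto simp: E_def)
   let ?h = "h - monom (coeff h i) i"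
   have "poly ?h s:E i" unfolding E_def
   proof (intro CollectI exI conjI allI impI)
    show "?h:pols F" using h(1) by (auto simp: pols_def intro!: sf_cl[OF F])
    fix j assume "i <= j" thus "coeff ?h j = 0" using h(2) by (cases "j = i") auto
   qed simp
   moreover have "x = coeff h i * s ^ i + poly ?h s" using h(3) by (simp add: poly_monom)
   moreover have "coeff h i:F" using h(1) by (simp add: pols_def)
   ultimately show "x:ring.line_extension \<Omega> F (s ^ i) (E i)" unfolding line_ext by blast
  qed
  ultimately show ?case using ring.Suc_dim[OF Omega_ring, of "s ^ i" "E i" i F] Suc by simp
 qed
 moreover have "E (degree g) = adj F {s}"
 proof
  show "E (degree g) <= adj F {s}" unfolding E_def adjoin_singleton[OF cb] by blast
  show "adj F {s} <= E (degree g)"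
  proof
   fix x assume "x:adj F {s}"
   then obtain h where h: "h:pols F" "h = 0 \<or> degree h < degree g" "x = poly h s"
    using adj_minpoly[OF cb g] by metis
   have "ALL j>=degree g. coeff h j = 0" using h(2) by (cases "h = 0") (auto intro: coeff_eq_0)
   thus "x:E (degree g)" unfolding E_def using h by blast
  qed
 qed
 ultimately show ?thesis by (metis order_refl)
qed

lemma clb_not_trans:
 assumes cb: "clb F" shows "~ ring.transcendental \<Omega> F x"
proof -
 obtain g where "is_minpoly F x g" using minpoly_exists[OF cb] by blast
 hence "ring.finite_dimension \<Omega> F (adj F {x})"
  using dim_adj[OF cb] ring.finite_dimensionI[OF Omega_ring] by blast
 thus ?thesis
  using ring.finite_dimension_imp_algebraic[OF Omega_ring, of F "adj F {x}" x] adj_gen[of "{x}" F]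
   clb_sf[OF cb] adj_sf[of F "{x}"] subfieldE(1)[of "adj F {x}" \<Omega>]
  by (auto simp: sf_iff over_def)
qed

lemma dimension_imp_generated:
 assumes "ring.dimension \<Omega> n F E" and F: "is_sf F"
 shows "EX S. finite S & S <= E & E <= adj F S & 0:E"
 using assms
proof (induction n F E rule: ring.dimension.induct[OF Omega_ring, consumes 1])
 case (1 K)
 show ?case using sf_cl(2)[OF adj_sf] by (intro exI[of _ "{}"]) auto
next
 case (2 v E n K)
 then obtain S where S: "finite S" "S <= E" "E <= adj K S" "0:E" by blast
 let ?E = "ring.line_extension \<Omega> K v E"
 have memI: "k * v + w:?E" if "k:K" "w:E" for k w using that unfolding line_ext by blast
 have EE: "E <= ?E" using memI[of 0] sf_cl(2)[OF 2(5)] by force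
 have "v:?E" using memI[of 1 0] sf_cl(1)[OF 2(5)] S(4) by simp
 moreover have "?E <= adj K (insert v S)"
 proof
  fix x assume "x:?E"
  then obtain k w where "k:K" "w:E" "x = k * v + w" by (auto simp: line_ext)
  moreover have "v:adj K (insert v S)" using adj_gen[of "insert v S" K] by auto
  moreover have "E <= adj K (insert v S)" using S(3) adj_mono[of K K S "insert v S"] by auto
  ultimately show "x:adj K (insert v S)"
   using adj_base[of K "insert v S"] by (auto intro!: sf_cl(4,5)[OF adj_sf])
 qed
 ultimately show ?case using S EE by (intro exI[of _ "insert v S"]) auto
qed

lemma finite_ext_fing:
 assumes "finite_ext F L" shows "is_sf F" "is_sf L" "F <= L" "fing F L"
proof -
 show F: "is_sf F" and L: "is_sf L" "F <= L"
  using assms by (auto simp: finite_ext_def field_ext_def sf_iff)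
 obtain n where "ring.dimension \<Omega> n F L"
  using assms unfolding finite_ext_def ring.finite_dimension_def[OF Omega_ring] by blast
 from dimension_imp_generated[OF this F] obtain S where S: "finite S" "S <= L" "L <= adj F S" by blast
 hence "L = adj F S" using adj_least[OF L S(2)] by simp
 thus "fing F L" unfolding fing_def using S(1) by blast
qed

lemma ext_degree_gal:
 assumes cb: "clb F" and F: "infinite F" and L: "fing F L" and g: "gal F L"
 shows "finite_ext F L" "ext_degree F L = card (Grp F L)"
proof -
 note Fs = galD(1)[OF g]
 obtain s where s: "s:L" "inj_on (%g. g s) (Grp F L)"
  and un: "!!si ta x. si:Aut F ==> ta:Aut F ==> si s = ta s ==> x:L ==> si x = ta x"
  using primitive_element[OF cb F L g] by metis
 have sub: "adj F {s} <= L" using s by (intro adj_least galD(2,3)[OF g]) auto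
 note gs = gal_intermediate[OF cb g adj_sf adj_base sub]
 have "L <= adj F {s}"
 proof
  fix x assume x: "x:L"
  show "x:adj F {s}"
  proof (rule galD(6)[OF gs x])
   fix si assume a: "si:Aut (adj F {s})"
   have "si s = s" using AutD(3)[OF a] adj_gen[of "{s}" F] by auto
   thus "si x = x" using un[of si "%x. x" x] a Aut_mono[OF adj_base[of F "{s}"]] aut_id(2) x by auto
  qed
 qed
 hence Ls: "L = adj F {s}" using sub by auto
 define C where "C = (%si. si s) ` Aut F"
 note C = gal_conj_poly[OF cb g s(1), folded C_def]
 obtain p where p: "is_minpoly F s p" using minpoly_exists[OF cb] by blast
 have p': "p:pols F" "p ~= 0" "poly p s = 0" using p by (auto simp: is_minpoly_def)
 have "degree p <= degree (PROD c:C. [:-c, 1:])"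
  using p C(4) C(1,3) by (auto simp: is_minpoly_def poly_prod)
 also have "... = card C" using C(1) by (subst degree_prod_eq_sum_degree) auto
 finally have "degree p <= card C" .
 moreover have "card C <= card {x. poly p x = 0}"
 proof (rule card_mono[OF poly_roots_finite[OF p'(2)]])
  show "C <= {x. poly p x = 0}"
  proof (clarsimp simp: C_def)
   fix si assume "si:Aut F"
   thus "poly p (si s) = 0" using aut_poly[OF _ p'(1), of si s] p'(3) aut_zero by metis
  qed
 qed
 moreover have "card {x. poly p x = 0} <= degree p" by (rule card_poly_roots_bound[OF p'(2)])
 moreover have "card C = card (Grp F L)"
 proof -
  have "C = (%g. g s) ` Grp F L" using s(1) by (auto simp: C_def Grp_def image_image)
  thus ?thesis using card_image[OF s(2)] by simp
 qed
 ultimately have dp: "degree p = card (Grp F L)" by linarith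
 have d: "ring.dimension \<Omega> (card (Grp F L)) F L"
  using dim_adj[OF cb p] unfolding dp Ls[symmetric] .
 show "finite_ext F L" unfolding finite_ext_def field_ext_def sf_iff
  using galD(1-3)[OF g] ring.finite_dimensionI[OF Omega_ring d] by blast
 show "ext_degree F L = card (Grp F L)"
  using ring.dimI[OF Omega_ring, of F "card (Grp F L)" L] d Fs by (simp add: ext_degree_def sf_iff over_def)
qed

lemma carrier_Gal:
 "ta:carrier (Gal F L) <-> ta:Bij L & hom_on L ta & (ALL x:F. ta x = x)"
 by (auto simp: Gal_def ring_hom_def hom_on_def Bij_def bij_betw_def)

lemma Aut_restrict_Gal:
 assumes "si:Aut F" "si ` L = L" "F <= L" "1:L" "!!x y. x:L ==> y:L ==> x + y:L & x * y:L"
 shows "restrict si L:carrier (Gal F L)"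
 unfolding carrier_Gal Bij_def bij_betw_def
 using assms by (auto simp: inj_on_def aut_eq_iff hom_on_def aut_one aut_add aut_mult AutD(3))

lemma carrier_Gal_extend:
 assumes cb: "clb F" and L: "is_sf L" "F <= L" and t: "ta:carrier (Gal F L)"
 obtains si where "si:Aut F" "!!x. x:L ==> si x = ta x" "si ` L = L"
proof -
 have t': "hom_on L ta" "!!x. x:F ==> ta x = x" "ta ` L = L"
  using t by (auto simp: carrier_Gal Bij_def bij_betw_def)
 obtain si where si: "si:Aut F" "!!x. x:L ==> si x = ta x"
  using hom_extends_to_Aut[OF clb_sf[OF cb] L(2,1) clb_alg[OF cb] t'(1,2)] by metis
 moreover have "si ` L = L" using si(2) t'(3) by (metis image_cong)
 ultimately show thesis using that by blast
qed

text \<open>The implication towards \<open>gal\<close> needs stability of \<open>L\<close> under all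
  of \<open>Aut F\<close>. The automorphisms preserving \<open>L\<close> have fixed field
  \<open>F\<close> by hypothesis, so the polynomial of the orbit of \<open>x\<close> under them has
  coefficients in \<open>F\<close>; any other automorphism sends \<open>x\<close> to one of its
  roots, hence into \<open>L\<close>.\<close>

theorem galois_ext_iff:
 assumes cb: "clb F" shows "galois_ext F L <-> gal F L"
proof
 assume g: "gal F L"
 note L = galD(2)[OF g]
 have r: "restrict si L:carrier (Gal F L)" if "si:Aut F" for si
  by (rule Aut_restrict_Gal[OF that gal_image[OF g that] galD(3)[OF g]]) (auto intro: sf_cl[OF L])
 have "x:F" if x: "x:L" "ALL si:carrier (Gal F L). si x = x" for x
  by (rule galD(6)[OF g x(1)]) (use r x in force)
 hence "{x:L. ALL si:carrier (Gal F L). si x = x} = F"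
  using galD(3)[OF g] by (auto simp: carrier_Gal)
 thus "galois_ext F L"
  using galD(1-3)[OF g] clb_not_trans[OF cb]
  by (simp add: galois_ext_def field_ext_def sf_iff)
next
 assume "galois_ext F L"
 hence F: "is_sf F" and L: "is_sf L" "F <= L" and fx: "{x:L. ALL si:carrier (Gal F L). si x = x} = F"
  by (auto simp: galois_ext_def field_ext_def sf_iff)
 let ?A = "{si:Aut F. si ` L = L}"
 have fx': "x:F" if x: "x:L" "!!si. si:?A ==> si x = x" for x
 proof -
  have "ta x = x" if t: "ta:carrier (Gal F L)" for ta
  proof -
   obtain si where s: "si:Aut F" "!!x. x:L ==> si x = ta x" "si ` L = L" using carrier_Gal_extend[OF cb L t] by metis
   show ?thesis using x(2)[of si] s(1,3) s(2)[OF x(1)] by simp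
  qed
  thus ?thesis using fx x(1) by auto
 qed
 have "si x:L" if s: "si:Aut F" and x: "x:L" for si x
 proof -
  define C where "C = (%si. si x) ` ?A"
  have finC: "finite C" unfolding C_def by (rule finite_subset[OF image_mono fin_conj[OF cb]]) auto
  have CL: "C <= L" unfolding C_def using x by auto
  have st: "a ` C = C" if a: "a:?A" for a
  proof (rule endo_inj_surj[OF finC])
   show "a ` C <= C"
   proof (clarsimp simp: C_def)
    fix b assume b: "b:Aut F" "b ` L = L"
    have "(a \<circ> b) ` L = a ` (b ` L)" by (rule image_comp[symmetric])
    hence "a \<circ> b:?A" using a b aut_comp[of a F b] by simp
    thus "a (b x):(%si. si x) ` ?A" by (intro image_eqI[of _ _ "a \<circ> b"]) auto
   qed
   show "inj_on a C" using a by (auto simp: inj_on_def aut_eq_iff)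
  qed
  let ?p = "PROD c:C. [:-c, 1:]"
  note LS = sf_sr[OF L(1)]
  have "?p:pols L"
   using CL by (intro sr_prod[OF pols_sr[OF LS]])
    (auto simp: pols_pCons sr_cl[OF LS] sr_0[OF pols_sr[OF LS]])
  hence "coeff ?p i:F" for i
   using orbit_poly_fixed[OF _ finC st] by (intro fx') (auto simp: pols_def)
  hence p: "?p:pols F" by (simp add: pols_def)
  have "x:C" unfolding C_def by (rule image_eqI[of _ _ "%x. x"]) (auto simp: aut_id)
  hence "poly ?p x = 0" using finC by (auto simp: poly_prod)
  hence "poly ?p (si x) = 0" using aut_poly[OF s p, of x] aut_zero[OF s] by simp
  thus ?thesis using finC CL by (auto simp: poly_prod)
 qed
 thus "gal F L" unfolding gal_def gfix_def using F L fx' by blast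
qed

theorem abelian_ext_iff:
 assumes cb: "clb F" shows "abelian_ext F L <-> abel F L"
proof -
 have "comm_group (Gal F L) <-> (ALL si:Aut F. ALL ta:Aut F. ALL x:L. si (ta x) = ta (si x))" if g: "gal F L"
 proof
  note L = galD(2)[OF g]
  have r: "restrict si L:carrier (Gal F L)" if "si:Aut F" for si
   by (rule Aut_restrict_Gal[OF that gal_image[OF g that] galD(3)[OF g]]) (auto intro: sf_cl[OF L])
  have B: "carrier (Gal F L) <= Bij L" by (auto simp: carrier_Gal)
  have m: "si \<otimes>\<^bsub>Gal F L\<^esub> ta = compose L si ta" if "si:carrier (Gal F L)" "ta:carrier (Gal F L)" for si ta
   using that B by (auto simp: Gal_def BijGroup_def)
  {
   assume c: "comm_group (Gal F L)"
   show "ALL si:Aut F. ALL ta:Aut F. ALL x:L. si (ta x) = ta (si x)"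
   proof (intro ballI)
    fix si ta x assume s: "si:Aut F" and t: "ta:Aut F" and x: "x:L"
    have "compose L (restrict si L) (restrict ta L) = compose L (restrict ta L) (restrict si L)"
     using comm_monoid.m_comm[OF comm_group.axioms(1)[OF c] r[OF s] r[OF t]] m[OF r[OF s] r[OF t]] m[OF r[OF t] r[OF s]] by simp
    from fun_cong[OF this, of x] show "si (ta x) = ta (si x)"
     using x galD(4)[OF g s x] galD(4)[OF g t x] by (simp add: compose_def)
   qed
  }
  assume c: "ALL si:Aut F. ALL ta:Aut F. ALL x:L. si (ta x) = ta (si x)"
  have one: "\<one>\<^bsub>Gal F L\<^esub> = restrict (%x. x) L" by (simp add: Gal_def BijGroup_def)
  have ext: "EX si:Aut F. ta = restrict si L" if t: "ta:carrier (Gal F L)" for ta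
  proof -
   obtain si where s: "si:Aut F" "!!x. x:L ==> si x = ta x" using carrier_Gal_extend[OF cb L galD(3)[OF g] t] by metis
   have "ta:extensional L" using t B by (auto simp: Bij_def)
   hence "ta = restrict si L" using s(2) by (intro extensionalityI[of _ L]) auto
   thus ?thesis using s(1) by blast
  qed
  have mr: "restrict si L \<otimes>\<^bsub>Gal F L\<^esub> restrict ta L = restrict (si \<circ> ta) L" if "si:Aut F" "ta:Aut F" for si ta
   using m[OF r r] that galD(4)[OF g] by (auto simp: compose_def fun_eq_iff)
  show "comm_group (Gal F L)"
  proof (rule comm_groupI)
   show "\<one>\<^bsub>Gal F L\<^esub>:carrier (Gal F L)" unfolding one by (rule r[OF aut_id(2)])
   fix x assume "x:carrier (Gal F L)"
   then obtain si where s: "si:Aut F" "x = restrict si L" using ext by blast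
   show "\<one>\<^bsub>Gal F L\<^esub> \<otimes>\<^bsub>Gal F L\<^esub> x = x" unfolding one s(2) mr[OF aut_id(2) s(1)] by (simp add: o_def)
   have "inv_into UNIV si \<circ> si = (%x. x)" using aut_inv_app(2)[OF s(1)] by (simp add: fun_eq_iff)
   hence "restrict (inv_into UNIV si) L \<otimes>\<^bsub>Gal F L\<^esub> x = \<one>\<^bsub>Gal F L\<^esub>"
    unfolding one s(2) mr[OF aut_inv[OF s(1)] s(1)] by simp
   thus "EX y:carrier (Gal F L). y \<otimes>\<^bsub>Gal F L\<^esub> x = \<one>\<^bsub>Gal F L\<^esub>" using r[OF aut_inv[OF s(1)]] by blast
   fix y assume "y:carrier (Gal F L)"
   then obtain ta where t: "ta:Aut F" "y = restrict ta L" using ext by blast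
   show "x \<otimes>\<^bsub>Gal F L\<^esub> y:carrier (Gal F L)" unfolding s(2) t(2) mr[OF s(1) t(1)] by (rule r[OF aut_comp[OF s(1) t(1)]])
   show "x \<otimes>\<^bsub>Gal F L\<^esub> y = y \<otimes>\<^bsub>Gal F L\<^esub> x" unfolding s(2) t(2) mr[OF s(1) t(1)] mr[OF t(1) s(1)]
    using c s(1) t(1) by (intro restrict_ext) auto
   fix z assume "z:carrier (Gal F L)"
   then obtain rh where u: "rh:Aut F" "z = restrict rh L" using ext by blast
   show "x \<otimes>\<^bsub>Gal F L\<^esub> y \<otimes>\<^bsub>Gal F L\<^esub> z = x \<otimes>\<^bsub>Gal F L\<^esub> (y \<otimes>\<^bsub>Gal F L\<^esub> z)"
    unfolding s(2) t(2) u(2) mr[OF s(1) t(1)] mr[OF t(1) u(1)] mr[OF aut_comp[OF s(1) t(1)] u(1)] mr[OF s(1) aut_comp[OF t(1) u(1)]]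
    by (simp only: o_assoc)
  qed
 qed
 thus ?thesis unfolding abelian_ext_def abel_def galois_ext_iff[OF cb] by blast
qed

section \<open>Discrete valuation rings in fields\<close>

definition vunit :: "'b::field set => 'b set" where
 "vunit V = {x:V. x ~= 0 & inverse x:V}"

lemma primeD:
 assumes "prm F V"
 shows "is_sr V" "V <= F" "V ~= F" "x:F ==> x:V \<or> inverse x:V"
 using assms by (auto simp: prime_of_def sr_iff)

lemma mx_iff: "x:mx V <-> x:V & x~:vunit V"
 by (auto simp: max_ideal_def vunit_def)

lemma mx_sub: "x:mx V ==> x:V" by (simp add: max_ideal_def)
lemma vunit_sub: "x:vunit V ==> x:V" by (simp add: vunit_def)
lemma vunit_nz: "x:vunit V ==> x ~= 0" by (simp add: vunit_def)

context
 fixes V :: "'b::field set"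
 assumes V: "is_sr V"
begin

lemma vunit_one: "1:vunit V" by (simp add: vunit_def sr_1[OF V])
lemma vunit_mult: "x:vunit V ==> y:vunit V ==> x * y:vunit V"
 by (auto simp: vunit_def intro: sr_mult[OF V])
lemma vunit_inv: "x:vunit V ==> inverse x:vunit V" by (auto simp: vunit_def)
lemma vunit_uminus: "x:vunit V ==> - x:vunit V" by (auto simp: vunit_def intro: sr_um[OF V])
lemma vunit_power: "x:vunit V ==> x ^ n:vunit V"
 by (induction n) (auto intro: vunit_one vunit_mult)
lemma vunit_powi: "x:vunit V ==> x powi n:vunit V"
 by (auto simp: power_int_def intro: vunit_inv vunit_power)
lemma vunit_cancel: "x:vunit V ==> x * y:V <-> y:V"
 using sr_mult[OF V, of "inverse x" "x * y"] sr_mult[OF V, of x y]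
 by (auto simp: vunit_def mult.assoc[symmetric])
lemma vunit_divides_one: "x:V ==> y:V ==> x * y:vunit V ==> x:vunit V"
 using sr_mult[OF V, of y "inverse (x * y)"] by (auto simp: vunit_def field_simps)
lemma mx_0: "0:mx V" by (simp add: max_ideal_def sr_0[OF V])
lemma mx_1: "1~:mx V" by (simp add: max_ideal_def sr_1[OF V])
lemma mx_mult: "x:mx V ==> y:V ==> x * y:mx V"
 using vunit_divides_one[of x y] sr_mult[OF V, of x y] by (auto simp: mx_iff)
lemma mx_um: "x:mx V ==> - x:mx V"
 using mx_mult[of x "-1"] sr_um[OF V sr_1[OF V]] by simp
lemma vunit_power_iff: assumes "x:V" "n > 0" shows "x ^ n:vunit V <-> x:vunit V"
proof
 assume "x ^ n:vunit V"
 thus "x:vunit V" using vunit_divides_one[OF assms(1) sr_pow[OF V assms(1), of "n - 1"]] assms(2)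
  by (simp add: power_Suc[symmetric] del: power_Suc)
qed (rule vunit_power)
lemma mx_prime: "x:V ==> y:V ==> x * y:mx V ==> x:mx V \<or> y:mx V"
 using vunit_mult by (auto simp: mx_iff)

end

lemma vunit_powi_iff:
 assumes P: "prm F V" and x: "x:F" and n: "n > 0"
 shows "x ^ n:vunit V <-> x:vunit V"
proof
 note V = primeD(1)[OF P]
 assume u: "x ^ n:vunit V"
 show "x:vunit V"
 proof (cases "x:V")
  case True thus ?thesis using vunit_power_iff[OF V True n] u by simp
 next
  case False
  hence "inverse x:V" using primeD(4)[OF P x] by simp
  moreover have "inverse x ^ n:vunit V" using vunit_inv[OF V u] by (simp add: power_inverse)
  ultimately show ?thesis using vunit_power_iff[OF V _ n] vunit_inv[OF V, of "inverse x"] by auto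
 qed
qed (rule vunit_power[OF primeD(1)[OF P]])

lemma mx_add:
 assumes F: "is_sf F" and P: "prm F V" and xy: "x:mx V" "y:mx V"
 shows "x + y:mx V"
proof (cases "x = 0 \<or> y = 0")
 case True thus ?thesis using xy by auto
next
 case False
 note V = primeD(1)[OF P]
 have F': "x:F" "y:F" using xy mx_sub primeD(2)[OF P] by blast+
 consider "x / y:V" | "y / x:V"
  using primeD(4)[OF P sf_div[OF F F']] by (auto simp: inverse_divide)
 thus ?thesis
 proof cases
  case 1
  have "y * (x / y + 1):mx V" by (intro mx_mult[OF V] xy sr_add[OF V] 1 sr_1[OF V])
  thus ?thesis using False by (simp add: field_simps)
 next
  case 2
  have "x * (y / x + 1):mx V" by (intro mx_mult[OF V] xy sr_add[OF V] 2 sr_1[OF V])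
  thus ?thesis using False by (simp add: field_simps)
 qed
qed

lemma mx_diff:
 assumes "is_sf F" "prm F V" "x:mx V" "y:mx V"
 shows "x - y:mx V"
 using mx_add[OF assms(1-3) mx_um[OF primeD(1)[OF assms(2)] assms(4)]] by simp

lemma mx_sum:
 assumes "is_sf F" "prm F V" "!!i. i:A ==> f i:mx V"
 shows "sum f A:mx V"
 using assms(3) by (induction A rule: infinite_finite_induct)
  (auto intro: mx_0[OF primeD(1)[OF assms(2)]] mx_add[OF assms(1,2)])

lemma vunit_add:
 assumes "is_sf F" "prm F V" "x:vunit V" "y:mx V" shows "x + y:vunit V"
proof (rule ccontr)
 assume "x + y~:vunit V"
 hence "x + y:mx V"
  using sr_add[OF primeD(1)[OF assms(2)] vunit_sub[OF assms(3)] mx_sub[OF assms(4)]] by (simp add: mx_iff)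
 hence "x + y - y:mx V" using mx_diff[OF assms(1,2) _ assms(4)] by blast
 thus False using assms(3) by (simp add: mx_iff)
qed

lemma not_in_prime:
 assumes "prm F V" "x:F" "x~:V" shows "inverse x:mx V"
 using primeD(4)[OF assms(1,2)] assms(3) by (auto simp: max_ideal_def)

text \<open>Says at once that \<open>V\<close> is a discrete valuation ring of \<open>F\<close> and
  that \<open>t\<close> is a uniformizer.\<close>

definition unif :: "'b::field set => 'b set => 'b => bool" where
 "unif F V t <-> is_sf F & prm F V & t:mx V & t ~= 0 &
  (ALL x:F. x ~= 0 --> (EX w:vunit V. EX n. x = w * t powi n))"

context
 fixes F V :: "'b::field set" and t :: 'b
 assumes U: "unif F V t"
begin

lemma unif_field: "is_sf F" and unif_prime: "prm F V" and unif_mem: "t:mx V" and unif_nz: "t ~= 0"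
 using U by (auto simp: unif_def)

lemma unif_sr: "is_sr V" by (rule primeD(1)[OF unif_prime])

lemma unif_expand: assumes "x:F" "x ~= 0" obtains w n where "w:vunit V" "x = w * t powi n"
 using U assms unfolding unif_def by blast

lemma unif_in_F: "t:F" using mx_sub[OF unif_mem] primeD(2)[OF unif_prime] by auto

lemma unif_pow_mem: "n >= 0 ==> t powi n:V" and unif_pow_ideal: "n > 0 ==> t powi n:mx V"
proof -
 show V: "t powi n:V" if "n >= 0" for n
  using that sr_pow[OF unif_sr mx_sub[OF unif_mem], of "nat n"] by (simp add: power_int_def)
 show "t powi n:mx V" if "n > 0"
  using mx_mult[OF unif_sr unif_mem V[of "n - 1"]] that unif_nz
  by (simp add: power_int_minus_mult power_int_diff)
qed

lemma unif_pow_vunit: "t powi n:vunit V <-> n = 0"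
proof
 assume u: "t powi n:vunit V"
 have "t powi (-n):vunit V" using vunit_inv[OF unif_sr u] by (simp add: power_int_minus)
 thus "n = 0" using u unif_pow_ideal[of n] unif_pow_ideal[of "-n"] by (cases n "0::int" rule: linorder_cases) (auto simp: mx_iff)
qed (simp add: vunit_one[OF unif_sr])

lemma unif_unique: assumes "w:vunit V" "w':vunit V" "w * t powi n = w' * t powi n'" shows "n = n'"
proof -
 have "t powi (n - n') = w' * inverse w"
  using assms(3) vunit_nz[OF assms(1)] unif_nz by (simp add: power_int_diff field_simps)
 hence "t powi (n - n'):vunit V" using vunit_mult[OF unif_sr assms(2) vunit_inv[OF unif_sr assms(1)]] by simp
 thus ?thesis using unif_pow_vunit by simp
qed

lemma unif_mem_iff: assumes "w:vunit V" shows "w * t powi n:V <-> n >= 0"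
proof -
 have "t powi n~:V" if "n < 0"
 proof
  assume "t powi n:V"
  hence "t powi n * t powi (-n):mx V"
   using mx_mult[OF unif_sr unif_pow_ideal[of "-n"], of "t powi n"] that by (simp add: mult.commute)
  thus False using unif_nz mx_1[OF unif_sr] by (simp add: power_int_minus)
 qed
 thus ?thesis using vunit_cancel[OF unif_sr assms] unif_pow_mem by force
qed

lemma max_ideal_unif: "mx V = (*) t ` V"
proof
 show "(*) t ` V <= mx V" using mx_mult[OF unif_sr unif_mem] by auto
 show "mx V <= (*) t ` V"
 proof
  fix x assume x: "x:mx V"
  show "x:(*) t ` V"
  proof (cases "x = 0")
   case True thus ?thesis using sr_0[OF unif_sr] by (intro image_eqI[of _ _ 0]) auto
  next
   case False
   have "x:F" using mx_sub[OF x] primeD(2)[OF unif_prime] by auto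
   then obtain w n where w: "w:vunit V" "x = w * t powi n" using unif_expand False by blast
   have "n >= 0" using unif_mem_iff[OF w(1)] mx_sub[OF x] w(2) by simp
   moreover have "n ~= 0" using x w by (auto simp: mx_iff)
   ultimately have "w * t powi (n - 1):V" using unif_mem_iff[OF w(1)] by simp
   thus ?thesis using w(2) unif_nz by (intro image_eqI[of _ _ "w * t powi (n - 1)"]) (simp_all add: power_int_diff)
  qed
 qed
qed

text \<open>\<open>valuation\<close> allows any generator of the maximal ideal. A second generator
  differs from \<open>t\<close> by a unit, so the exponent is the same.\<close>

lemma val_eqI:
 assumes w: "w:vunit V" shows "vl V (w * t powi n) = n"
 unfolding valuation_def
proof (rule the_equality)
 show "EX t' w'. mx V = (*) t' ` V & w':V - mx V & w * t powi n = w' * t' powi n"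
  using max_ideal_unif w vunit_sub[OF w] by - (rule exI[of _ t], rule exI[of _ w], auto simp: mx_iff)
 fix n' assume "EX t' w'. mx V = (*) t' ` V & w':V - mx V & w * t powi n = w' * t' powi n'"
 then obtain t' w' where t': "mx V = (*) t' ` V" "w':vunit V" "w * t powi n = w' * t' powi n'"
  by (auto simp: mx_iff)
 have "t':mx V" using t'(1) sr_1[OF unif_sr] by (auto intro: image_eqI[of _ _ 1])
 then obtain a where a: "a:V" "t' = t * a" using max_ideal_unif by auto
 obtain b where b: "b:V" "t = t' * b" using unif_mem t'(1) by auto
 have "t * (a * b) = t * 1" using a(2) b(2) by (metis mult.assoc mult.right_neutral)
 hence "a * b = 1" using unif_nz by simp
 hence "a:vunit V" using a b vunit_divides_one[OF unif_sr a(1) b(1)] vunit_one[OF unif_sr] by simp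
 hence "w' * a powi n':vunit V" by (intro vunit_mult[OF unif_sr t'(2)] vunit_powi[OF unif_sr])
 thus "n' = n" using unif_unique[OF w, of "w' * a powi n'" n n'] t'(3) a(2)
  by (simp add: power_int_mult_distrib mult_ac)
qed

lemma val_expand: assumes "x:F" "x ~= 0" obtains w where "w:vunit V" "x = w * t powi vl V x"
 using unif_expand[OF assms] val_eqI by metis

lemma val_unif: "vl V t = 1" using val_eqI[OF vunit_one[OF unif_sr], of 1] by simp

lemma val_mult: assumes "x:F" "x ~= 0" "y:F" "y ~= 0" shows "vl V (x * y) = vl V x + vl V y"
proof -
 obtain w where w: "w:vunit V" "x = w * t powi vl V x" using val_expand[OF assms(1,2)] .
 obtain w' where w': "w':vunit V" "y = w' * t powi vl V y" using val_expand[OF assms(3,4)] .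
 have "x * y = (w * w') * t powi (vl V x + vl V y)"
  by (subst w(2), subst w'(2)) (simp add: power_int_add unif_nz mult_ac)
 thus ?thesis using val_eqI[OF vunit_mult[OF unif_sr w(1) w'(1)]] by simp
qed

lemma val_mem_iff: assumes "x:F" "x ~= 0" shows "x:V <-> vl V x >= 0"
 using val_expand[OF assms] unif_mem_iff by metis

lemma val_vunit_iff: assumes "x:F" "x ~= 0" shows "x:vunit V <-> vl V x = 0"
proof
 assume "x:vunit V" thus "vl V x = 0" using val_eqI[of x 0] by simp
next
 assume "vl V x = 0" thus "x:vunit V" using val_expand[OF assms] by auto
qed

lemma val_ideal_iff: assumes "x:F" "x ~= 0" shows "x:mx V <-> vl V x > 0"
 using val_mem_iff[OF assms] val_vunit_iff[OF assms] by (auto simp: mx_iff)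

lemma val_power: assumes "x:F" "x ~= 0" shows "vl V (x ^ n) = int n * vl V x"
proof (induction n)
 case 0 thus ?case using val_vunit_iff[of 1] vunit_one[OF unif_sr] sf_cl(1)[OF unif_field] by simp
next
 case (Suc n)
 thus ?case using val_mult[OF assms sr_pow[OF sf_sr[OF unif_field] assms(1)], of n] assms by (simp add: algebra_simps)
qed

lemma val_inverse: assumes "x:F" "x ~= 0" shows "vl V (inverse x) = - vl V x"
 using val_mult[OF assms sf_inv[OF unif_field assms(1)]] assms val_power[of 1 0] sf_cl(1)[OF unif_field] by simp

lemma val_divide: assumes "x:F" "x ~= 0" "y:F" "y ~= 0" shows "vl V (x / y) = vl V x - vl V y"
 using val_mult[OF assms(1,2) sf_inv[OF unif_field assms(3)]] assms val_inverse by (simp add: divide_inverse)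

text \<open>Zero counts as having infinite value; \<open>valuation\<close> itself says nothing about
  it.\<close>

definition vge :: "int => 'b => bool" where "vge n x <-> x:F & (x = 0 \<or> vl V x >= n)"

lemma unif_pow_F: "t powi m:F"
 using unif_in_F by (auto simp: power_int_def intro: sf_cl[OF unif_field])

lemma vge_iff: "vge n x <-> x * t powi (- n):V"
proof (cases "x:F & x ~= 0")
 case True
 have "vl V (t powi m) = m" for m using val_eqI[OF vunit_one[OF unif_sr], of m] by simp
 hence "vl V (x * t powi (- n)) = vl V x - n" using True unif_pow_F unif_nz by (subst val_mult) auto
 thus ?thesis using val_mem_iff[of "x * t powi (- n)"] True unif_pow_F unif_nz unif_field
  by (auto simp: vge_def sf_cl(5))
next
 case False
 have "x:F" if "x * t powi (- n):V"
 proof -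
  have "(x * t powi (- n)) * t powi n:F"
   by (rule sf_cl(5)[OF unif_field _ unif_pow_F]) (use that primeD(2)[OF unif_prime] in auto)
  thus ?thesis using unif_nz by (simp add: power_int_minus mult.assoc)
 qed
 thus ?thesis using False sr_0[OF unif_sr] sf_cl(2)[OF unif_field] by (auto simp: vge_def)
qed

lemma vge_diff: "vge n x ==> vge n y ==> vge n (x - y)"
 unfolding vge_iff using sr_diff[OF unif_sr] by (simp add: algebra_simps)
lemma vge_add: "vge n x ==> vge n y ==> vge n (x + y)"
 unfolding vge_iff using sr_add[OF unif_sr] by (simp add: algebra_simps)
lemma vge_zero: "vge n 0" unfolding vge_def using sf_cl(2)[OF unif_field] by simp
lemma vge_sum: "(!!i. i:A ==> vge n (f i)) ==> vge n (sum f A)"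
 by (induction A rule: infinite_finite_induct) (simp_all add: vge_zero vge_add)
lemma vge_mult: "vge n x ==> vge m y ==> vge (n + m) (x * y)"
 unfolding vge_def using val_mult[of x y] by (auto intro: sf_cl(5)[OF unif_field])
lemma vge_mono: "vge n x ==> m <= n ==> vge m x" by (auto simp: vge_def)
lemma vge_0: "vge 0 x <-> x:V" by (simp add: vge_iff)
lemma vge_1: "vge 1 x <-> x:mx V"
proof (cases "x = 0")
 case False
 have "x:F" if "x:mx V" using mx_sub[OF that] primeD(2)[OF unif_prime] by auto
 thus ?thesis using val_ideal_iff[of x] False by (auto simp: vge_def)
qed (use mx_0[OF unif_sr] vge_zero in auto)
lemma vge_uminus: "vge n x ==> vge n (- x)" using vge_diff[OF vge_zero] by force
lemma vge_all: "(!!n. vge n x) ==> x = 0"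
proof (rule ccontr)
 assume "x ~= 0" "!!n. vge n x"
 hence "vge (vl V x + 1) x" by blast
 thus False using `x ~= 0` by (simp add: vge_def)
qed

lemma val_add_eq: assumes "x:F" "x ~= 0" "vge (vl V x + 1) y"
 shows "x + y ~= 0" "vl V (x + y) = vl V x"
proof -
 have xg: "~ vge (vl V x + 1) x" "vge (vl V x) x" using assms by (auto simp: vge_def)
 have n: "~ vge (vl V x + 1) (x + y)" using vge_diff[OF _ assms(3), of "x + y"] xg(1) by auto
 moreover have "vge (vl V x) (x + y)" using vge_add[OF xg(2) vge_mono[OF assms(3)]] by simp
 ultimately show "x + y ~= 0" "vl V (x + y) = vl V x" by (auto simp: vge_def)
qed

end

lemma uniformizerI:
 assumes "unif F V t" "s:F" "s ~= 0" "vl V s = 1" shows "unif F V s"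
proof -
 note U = assms(1)
 obtain a where a: "a:vunit V" "s = a * t powi 1" using val_expand[OF U assms(2,3)] assms(4) by metis
 have "EX w:vunit V. EX n. x = w * s powi n" if x: "x:F" "x ~= 0" for x
 proof -
  obtain w n where w: "w:vunit V" "x = w * t powi n" using unif_expand[OF U x] .
  have "x = (w * a powi (- n)) * s powi n" using w(2) vunit_nz[OF a(1)] unfolding a(2)
   by (simp add: power_int_mult_distrib power_int_minus)
  moreover have "w * a powi (- n):vunit V" by (intro vunit_mult[OF unif_sr[OF U]] vunit_powi[OF unif_sr[OF U]] w a)
  ultimately show ?thesis by blast
 qed
 moreover have "s:mx V" using val_ideal_iff[OF U assms(2,3)] assms(4) by simp
 ultimately show ?thesis using U assms(3) by (auto simp: unif_def)
qed

lemma unif_image: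
 assumes s: "si:Aut k" "si ` F = F" and U: "unif F V t"
 shows "unif F (si ` V) (si t)"
proof -
 have vu: "si ` vunit V = vunit (si ` V)" "si ` mx V = mx (si ` V)"
  by (auto simp: vunit_def max_ideal_def aut_inv1[OF s(1), symmetric] aut_eq_0[OF s(1)] image_iff aut_eq_iff[OF s(1)])
 have P: "prm F V" by (rule unif_prime[OF U])
 have "prm F (si ` V)" unfolding prime_of_def sr_iff
 proof (intro conjI ballI)
  note V = primeD(1)[OF P]
  show "is_sr (si ` V)"
  proof (rule is_srI)
   show "1:si ` V" using sr_1[OF V] aut_one[OF s(1)] by (metis imageI)
   fix x y assume "x:si ` V" "y:si ` V"
   thus "x - y:si ` V" "x * y:si ` V"
    using sr_diff[OF V] sr_mult[OF V] by (auto simp: aut_diff[OF s(1), symmetric] aut_mult[OF s(1), symmetric])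
  qed
  have "si ` V = si ` F <-> V = F" using AutD(2)[OF s(1)] by (simp add: bij_is_inj inj_image_eq_iff)
  thus "si ` V < F" using primeD(2,3)[OF P] s(2) by auto
  fix x assume "x:F"
  then obtain y where "y:F" "x = si y" using s(2) by auto
  thus "x:si ` V \<or> inverse x:si ` V"
   using primeD(4)[OF P, of y] by (auto simp: aut_inv1[OF s(1), symmetric])
 qed
 moreover have "EX w:vunit (si ` V). EX n. x = w * si t powi n" if x: "x:F" "x ~= 0" for x
 proof -
  obtain y where y: "y:F" "x = si y" using s(2) x by auto
  hence "y ~= 0" using x aut_zero[OF s(1)] by auto
  then obtain w n where "w:vunit V" "y = w * t powi n" using unif_expand[OF U y(1)] by blast
  moreover have "si (t powi n) = si t powi n" by (simp add: power_int_def aut_power[OF s(1)] aut_inv1[OF s(1)])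
  ultimately show ?thesis using y(2) by (intro bexI[of _ "si w"] exI[of _ n]) (auto simp: aut_mult[OF s(1)] vu(1)[symmetric])
 qed
 ultimately show ?thesis using unif_field[OF U] unif_mem[OF U] unif_nz[OF U] vu
  by (auto simp: unif_def aut_eq_0[OF s(1)])
qed

text \<open>Properness is the point: were \<open>F\<close> inside \<open>W\<close>, every element of
  \<open>L\<close>, being integral over \<open>F\<close>, would be in \<open>W\<close>.\<close>

lemma pr_rest:
 assumes cb: "clb F" and L: "is_sf L" "F <= L" and W: "prm L W"
 shows "prm F (W Int F)"
 unfolding prime_of_def sr_iff
proof (intro conjI ballI)
 note F = clb_sf[OF cb]
 show "is_sr (W Int F)"
  using primeD(1)[OF W] sf_sr[OF F] by (auto simp: is_sr_def)
 show "W Int F < F"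
 proof (rule ccontr)
  assume "~ W Int F < F"
  hence FW: "F <= W" by auto
  have "x:W" if "x:L" for x
  proof -
   obtain p where "p:pols F" "lead_coeff p = 1" "poly p x = 0"
    using clb_alg[OF cb, of x] by (auto simp: alg_over_def)
   thus ?thesis
    using int_closed[OF primeD(1)[OF W] primeD(4)[OF W that]] pols_mono[OF FW] by blast
  qed
  thus False using primeD(2,3)[OF W] by auto
 qed
 fix x assume "x:F"
 thus "x:W Int F \<or> inverse x:W Int F" using primeD(4)[OF W, of x] L sf_inv[OF F] by auto
qed

lemma mx_Int: "is_sf F ==> mx (W Int F) = mx W Int F"
 "is_sf F ==> vunit (W Int F) = vunit W Int F"
 by (auto simp: max_ideal_def vunit_def sf_inv)

lemma dominant_term:
 assumes F: "is_sf F" and P: "prm F V" and "finite I" "!!i. i:I ==> f i:F" "EX i:I. f i ~= 0"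
 obtains i where "i:I" "f i ~= 0" "!!j. j:I ==> f j / f i:V"
proof -
 note V = primeD(1)[OF P]
 have "EX i:J. f i ~= 0 & (ALL j:J. f j / f i:V)" if "finite J" "J <= I" "EX i:J. f i ~= 0" for J
  using that
 proof (induction J rule: finite_induct)
  case (insert a J)
  show ?case
  proof (cases "EX i:J. f i ~= 0")
   case False
   thus ?thesis using insert.prems sr_1[OF V] sr_0[OF V] by auto
  next
   case True
   then obtain i where i: "i:J" "f i ~= 0" "ALL j:J. f j / f i:V" using insert by auto
   have aF: "f a:F" "f i:F" using insert.prems assms(4) i by auto
   show ?thesis
   proof (cases "f a / f i:V")
    case True thus ?thesis using i by auto
   next
    case False
    hence ia: "f i / f a:V" "f a ~= 0"
     using primeD(4)[OF P sf_div[OF F aF]] sr_0[OF V] by (auto simp: inverse_divide)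
    have "f j / f a:V" if "j:J" for j
     using sr_mult[OF V ia(1), of "f j / f i"] i that by simp
    thus ?thesis using ia sr_1[OF V] by auto
   qed
  qed
 qed auto
 from this[OF assms(3) order_refl assms(5)] show thesis using that by blast
qed

text \<open>Divide by a dominant term. If all other quotients were in the maximal ideal, so would be
  their sum \<open>-1\<close>.\<close>

lemma equal_terms:
 assumes F: "is_sf F" and P: "prm F V" and I: "finite I" "(SUM i:I. f i) = 0" "!!i. i:I ==> f i:F"
  and nz: "EX i:I. f i ~= 0"
 obtains i j where "i:I" "j:I" "i ~= j" "f i ~= 0" "f j ~= 0" "f i / f j:vunit V"
proof -
 note V = primeD(1)[OF P]
 obtain i where i: "i:I" "f i ~= 0" "!!j. j:I ==> f j / f i:V"
  using dominant_term[OF F P I(1,3) nz] by metis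
 have "EX j:I - {i}. f j / f i~:mx V"
 proof (rule ccontr)
  assume "~ ?thesis"
  hence "(SUM j:I - {i}. f j / f i):mx V" by (intro mx_sum[OF F P]) auto
  moreover have "(SUM j:I - {i}. f j / f i) = -1"
   using I(1,2) i(1,2) by (simp add: sum_divide_distrib[symmetric] sum_diff1)
  ultimately show False using mx_um[OF V] mx_1[OF V] by force
 qed
 then obtain j where j: "j:I" "j ~= i" "f j / f i~:mx V" by auto
 hence "f j / f i:vunit V" using i(3) by (auto simp: mx_iff)
 moreover from this have "f j ~= 0" using vunit_nz by force
 ultimately show thesis using that[of j i] i j by auto
qed

text \<open>In the equation of \<open>x\<close> over \<open>F\<close> two terms have equal value, so
  a bounded power of \<open>x\<close> is a unit times a power of \<open>t\<close>. A common exponent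
  turns this into a homomorphism from \<open>L - {0}\<close> to the integers whose kernel is the
  unit group; an element of least positive image is a uniformizer.\<close>

theorem unif_ext:
 assumes cb: "clb F" and L: "fing F L" and g: "gal F L"
  and W: "prm L W" and U: "unif F (W Int F) t"
 shows "EX po. unif L W po"
proof -
 note Ls = galD(2)[OF g] and FL = galD(3)[OF g] and F = galD(1)[OF g]
 note WR = primeD(1)[OF W]
 define D where "D = card (Grp F L)"
 \<comment> \<open>Two terms of degrees \<open>i\<close> and \<open>j\<close> of equal value give
   information about \<open>x ^ (j - i)\<close>. The factorial is divisible by every difference that
   can occur.\<close>
 define N :: nat where "N = fact D"
 have N: "N > 0" by (simp add: N_def)
 have tW: "t:mx W" "t ~= 0" "t:F" "t:L"
  using unif_mem[OF U] unif_nz[OF U] unif_in_F[OF U] FL by (auto simp: mx_Int[OF F])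
 have key: "EX n. x ^ N * t powi n:vunit W" if x: "x:L" "x ~= 0" for x
 proof -
  let ?C = "(%si. si x) ` Aut F"
  note C = gal_conj_poly[OF cb g x(1)]
  let ?p = "PROD c:?C. [:-c, 1:]"
  have "degree ?p = card ?C" using C(1) by (subst degree_prod_eq_sum_degree) auto
  also have "card ?C <= D"
  proof -
   have "?C = (%g. g x) ` Grp F L" using x by (auto simp: Grp_def image_image)
   thus ?thesis using card_image_le[OF finite_Grp[OF cb L], of "%g. g x"] by (simp add: D_def)
  qed
  finally have deg: "degree ?p <= D" .
  have p0: "?p ~= 0" using C(1) by auto
  have "(SUM i:{..degree ?p}. coeff ?p i * x ^ i) = 0"
   using C(1,3) by (simp add: poly_altdef[symmetric] poly_prod)
  moreover have "coeff ?p i:F" for i using C(4) by (simp add: pols_def)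
  hence "coeff ?p i * x ^ i:L" for i using FL x by (auto intro!: sf_cl[OF Ls])
  moreover have "EX i:{..degree ?p}. coeff ?p i * x ^ i ~= 0"
   using p0 x(2) by (intro bexI[of _ "degree ?p"]) auto
  ultimately obtain i j where ij: "i <= degree ?p" "j <= degree ?p" "i ~= j" "coeff ?p i * x ^ i ~= 0"
   "coeff ?p j * x ^ j ~= 0" "(coeff ?p i * x ^ i) / (coeff ?p j * x ^ j):vunit W"
   using equal_terms[OF Ls W, of "{..degree ?p}" "%i. coeff ?p i * x ^ i"] by auto
  have *: "EX n. x ^ N * t powi n:vunit W"
   if h: "i < j" "j <= D" "a:F" "b:F" "a ~= 0" "b ~= 0" "(a * x ^ i) / (b * x ^ j):vunit W" for i j a b
  proof -
   have "a / b:F" "a / b ~= 0" using h by (auto intro: sf_div[OF F])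
   then obtain w n where w: "w:vunit (W Int F)" "a / b = w * t powi n" using unif_expand[OF U] by blast
   have wW: "w:vunit W" "w ~= 0" using w(1) vunit_nz by (auto simp: mx_Int[OF F])
   have "(a * x ^ i) / (b * x ^ j) = (a / b) / x ^ (j - i)"
    using h x(2) by (simp add: power_diff field_simps)
   hence "w * t powi n / x ^ (j - i):vunit W" using h(7) w(2) by simp
   from vunit_mult[OF WR vunit_inv[OF WR this] wW(1)]
   have "x ^ (j - i) * t powi (- n):vunit W"
    using wW(2) by (simp add: power_int_minus field_simps)
   moreover have "j - i dvd N" unfolding N_def using h(1,2) by (intro dvd_fact) auto
   then obtain c where c: "N = (j - i) * c" by auto
   ultimately have "(x ^ (j - i) * t powi (- n)) ^ c:vunit W" using vunit_power[OF WR] by blast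
   moreover have "(x ^ (j - i) * t powi (- n)) ^ c = x ^ N * t powi (- n * int c)"
    using power_int_mult[of t "- n" "int c"] by (simp add: power_mult_distrib c power_mult)
   ultimately show ?thesis by metis
  qed
  have cF: "coeff ?p i:F" "coeff ?p j:F" using C(4) by (simp_all add: pols_def)
  show ?thesis
  proof (cases "i < j")
   case True thus ?thesis using *[OF True _ cF] ij deg by auto
  next
   case False
   have "(coeff ?p j * x ^ j) / (coeff ?p i * x ^ i):vunit W" using vunit_inv[OF WR ij(6)] by (simp add: inverse_divide)
   thus ?thesis using *[of j i, OF _ _ cF(2,1)] False ij deg by auto
  qed
 qed
 \<comment> \<open>\<open>f\<close> is \<open>N\<close> times the valuation normalised to be 1 at
   \<open>t\<close>.\<close>
 define f where "f x = (SOME n. x ^ N * t powi (- n):vunit W)" for x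
 have f: "x ^ N * t powi (- f x):vunit W" if x: "x:L" "x ~= 0" for x
 proof -
  obtain n where "x ^ N * t powi (- (- n)):vunit W" using key[OF x] by auto
  thus ?thesis unfolding f_def by (rule someI)
 qed
 have tu: "n = 0" if "t powi n:vunit W" for n
 proof -
  have "t powi n:F" using tW(3) by (auto simp: power_int_def intro: sf_cl[OF F])
  hence "t powi n:vunit (W Int F)" using that by (simp add: mx_Int[OF F])
  thus ?thesis using unif_pow_vunit[OF U] by simp
 qed
 have f_eq: "f x = n" if x: "x:L" "x ~= 0" "x ^ N * t powi (- n):vunit W" for x n
 proof -
  have "(x ^ N * t powi (- f x)) * inverse (x ^ N * t powi (- n)):vunit W"
   by (intro vunit_mult[OF WR] vunit_inv[OF WR] f x)
  moreover have "(x ^ N * t powi (- f x)) * inverse (x ^ N * t powi (- n)) = t powi (n - f x)"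
   using x(2) tW(2) by (simp add: power_int_minus power_int_diff field_simps)
  ultimately show ?thesis using tu by force
 qed
 have f_mult: "f (x * y) = f x + f y" if "x:L" "x ~= 0" "y:L" "y ~= 0" for x y
 proof (rule f_eq)
  have "(x ^ N * t powi (- f x)) * (y ^ N * t powi (- f y)):vunit W" by (intro vunit_mult[OF WR] f that)
  thus "(x * y) ^ N * t powi - (f x + f y):vunit W"
   using tW(2) by (simp add: power_mult_distrib power_int_add power_int_diff mult_ac power_int_minus divide_inverse)
 qed (use that in \<open>auto intro: sf_cl[OF Ls]\<close>)
 have f_t: "f t = int N" by (rule f_eq) (use tW vunit_one[OF WR] in \<open>auto simp: power_int_minus\<close>)
 have f_inv: "f (inverse x) = - f x" if "x:L" "x ~= 0" for x
  using vunit_inv[OF WR f[OF that]] that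
  by (intro f_eq) (auto simp: power_int_minus power_inverse intro: sf_cl[OF Ls])
 have f_pow: "f (x powi n) = n * f x" "x powi n:L" if x: "x:L" "x ~= 0" for x n
 proof -
  have L': "x ^ m:L" for m using x by (intro sf_cl[OF Ls])
  have p: "f (x ^ m) = int m * f x" for m
  proof (induction m)
   case 0 show ?case by (rule f_eq) (auto simp: vunit_one[OF WR] sf_cl(1)[OF Ls])
  next
   case (Suc m) thus ?case using f_mult[OF x L', of m] x by (simp add: algebra_simps)
  qed
  show "x powi n:L" using L' x by (auto simp: power_int_def intro: sf_cl[OF Ls])
  show "f (x powi n) = n * f x"
   using p[of "nat n"] p[of "nat (-n)"] f_inv[OF L', of "nat (-n)"] x(2)
   by (auto simp: power_int_def power_inverse)
 qed
 have unit_iff: "x:vunit W <-> f x = 0" if x: "x:L" "x ~= 0" for x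
 proof -
  have "f x = 0 <-> x ^ N:vunit W" using f_eq[OF x, of 0] f[OF x] by auto
  thus ?thesis using vunit_powi_iff[OF W x(1) N] by simp
 qed
 have "EX n. n > 0 & (EX x:L. x ~= 0 & f x = int n)" using tW f_t N by blast
 then obtain e where e: "e > 0 & (EX x:L. x ~= 0 & f x = int e)"
  and emin: "!!m. m > 0 & (EX x:L. x ~= 0 & f x = int m) ==> e <= m"
  using ex_has_least_nat[of "%n. n > 0 & (EX x:L. x ~= 0 & f x = int n)" _ "%n. n"] by blast
 obtain po where po: "po:L" "po ~= 0" "f po = int e" using e by blast
 have exp: "EX w:vunit W. EX n. x = w * po powi n" if x: "x:L" "x ~= 0" for x
 proof -
  define n where "n = f x div int e"
  define w where "w = x * po powi (- n)"
  have w: "w:L" "w ~= 0" unfolding w_def using x po f_pow(2) by (auto intro: sf_cl[OF Ls])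
  have "f w = f x - n * int e" unfolding w_def using x po f_pow(2)[OF po(1,2)] by (subst f_mult) (auto simp: f_pow(1)[OF po(1,2)])
  hence fw: "f w = f x mod int e" by (simp add: n_def minus_div_mult_eq_mod[symmetric])
  have "f w = 0"
  proof (rule ccontr)
   assume "f w ~= 0"
   hence pos: "f w > 0" "f w < int e" using fw e pos_mod_sign[of "int e" "f x"] pos_mod_bound[of "int e" "f x"] by auto
   hence "e <= nat (f w)" using w by (intro emin) auto
   thus False using pos by simp
  qed
  hence "w:vunit W" using unit_iff[OF w] by simp
  moreover have "x = w * po powi n" using po(2) by (simp add: w_def power_int_minus)
  ultimately show ?thesis by blast
 qed
 have "po:mx W"
 proof (rule ccontr)
  assume n: "po~:mx W"
  have nu: "po~:vunit W" using unit_iff[OF po(1,2)] po(3) e by simp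
  hence "po~:W" using n by (auto simp: mx_iff)
  hence i: "inverse po:W" using primeD(4)[OF W po(1)] by auto
  have "inverse (po ^ N * t powi (- int e)):vunit W" using vunit_inv[OF WR f[OF po(1,2)]] po(3) by simp
  moreover have "inverse (po ^ N * t powi (- int e)) = t * (inverse po ^ N * t ^ (e - 1))"
  proof -
   have "t powi (- int e) = inverse (t ^ e)" "t ^ e = t * t ^ (e - 1)"
    using e by (simp_all add: power_int_minus power_Suc[symmetric] del: power_Suc)
   thus ?thesis by (simp add: power_inverse mult_ac)
  qed
  moreover have "t * (inverse po ^ N * t ^ (e - 1)):mx W"
   using i mx_sub[OF tW(1)] by (intro mx_mult[OF WR tW(1)] sr_mult[OF WR] sr_pow[OF WR])
  ultimately show False by (simp add: mx_iff)
 qed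
 thus ?thesis using exp po Ls W by (auto simp: unif_def)
qed

section \<open>Weak approximation and conjugate primes\<close>

definition dvr :: "'b::field set => 'b set => bool" where
 "dvr L W <-> (EX po. unif L W po)"

lemma dvr_prime: "dvr L W ==> prm L W" "dvr L W ==> is_sf L"
 by (auto simp: dvr_def unif_def)

text \<open>An element of \<open>W'\<close> outside \<open>W\<close> has a pole at \<open>W\<close>,
  so its powers have poles of any order, and every element of \<open>L\<close> is an element of
  \<open>W\<close> times such a power.\<close>

lemma dvr_maximal:
 assumes W: "dvr L W" and W': "prm L W'" and sub: "W <= W'" shows "W = W'"
proof (rule ccontr)
 assume "W ~= W'"
 then obtain x where x: "x:W'" "x~:W" using sub by auto
 obtain t where U: "unif L W t" using W by (auto simp: dvr_def)
 note R = primeD(1)[OF W']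
 have xL: "x:L" "x ~= 0" using x primeD(2)[OF W'] sr_0[OF unif_sr[OF U]] by auto
 have "L <= W'"
 proof
  fix y assume y: "y:L"
  show "y:W'"
  proof (cases "y = 0")
   case False
   define n where "n = nat \<bar>vl W y\<bar>"
   have "vl W x < 0" using val_mem_iff[OF U xL] x(2) by simp
   hence "int n * vl W x <= int n * (-1)" by (intro mult_left_mono) auto
   hence "int n * vl W x <= vl W y" by (simp add: n_def)
   moreover have xn: "x ^ n:L" "x ^ n ~= 0" using xL dvr_prime(2)[OF W] by (auto intro: sf_cl)
   ultimately have "vl W (y / x ^ n) >= 0" using val_divide[OF U y False xn] val_power[OF U xL] by simp
   moreover have "y / x ^ n:L" "y / x ^ n ~= 0" using y False xn dvr_prime(2)[OF W] by (auto intro: sf_div)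
   ultimately have "y / x ^ n:W'" using val_mem_iff[OF U] sub by blast
   hence "y / x ^ n * x ^ n:W'" using x(1) by (intro sr_mult[OF R] sr_pow[OF R])
   thus ?thesis using xL by simp
  qed (simp add: sr_0[OF R])
 qed
 thus False using primeD(2,3)[OF W'] by auto
qed

lemma separate_two:
 assumes "dvr L W" "dvr L W'" "W ~= W'"
 obtains z where "z:L" "z ~= 0" "vl W z < 0" "vl W' z > 0"
proof -
 note L = dvr_prime(2)[OF assms(1)]
 obtain t t' where U: "unif L W t" "unif L W' t'" using assms by (auto simp: dvr_def)
 obtain a where a: "a:W'" "a~:W" using dvr_maximal[OF assms(2) dvr_prime(1)[OF assms(1)]] assms(3) by auto
 obtain b where b: "b:W" "b~:W'" using dvr_maximal[OF assms(1) dvr_prime(1)[OF assms(2)]] assms(3) by auto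
 have aL: "a:L" "a ~= 0" using a primeD(2)[OF unif_prime[OF U(2)]] sr_0[OF unif_sr[OF U(1)]] by auto
 have bL: "b:L" "b ~= 0" using b primeD(2)[OF unif_prime[OF U(1)]] sr_0[OF unif_sr[OF U(2)]] by auto
 have "vl W (a / b) < 0" "vl W' (a / b) > 0"
  using val_divide[OF U(1) aL bL] val_divide[OF U(2) aL bL] a b
   val_mem_iff[OF U(1) aL] val_mem_iff[OF U(1) bL] val_mem_iff[OF U(2) aL] val_mem_iff[OF U(2) bL] by auto
 thus thesis using that[of "a / b"] aL bL sf_div[OF L aL(1) bL(1)] by simp
qed

lemma val_one_plus:
 assumes U: "unif L W t" and y: "y:L" "y ~= 0" "vl W y ~= 0"
 shows "1 + y ~= 0" "vl W (1 + y) = min 0 (vl W y)"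
proof -
 have one: "1:L" "vl W 1 = 0" using sf_cl(1)[OF unif_field[OF U]] val_power[OF U, of 1 0] by auto
 have "1 + y ~= 0 & vl W (1 + y) = min 0 (vl W y)"
 proof (cases "vl W y > 0")
  case True
  thus ?thesis using val_add_eq[OF U one(1), of y] one y by (simp add: vge_def[OF U])
 next
  case False
  thus ?thesis using val_add_eq[OF U y(1,2), of 1] one y by (simp add: vge_def[OF U] add.commute)
 qed
 thus "1 + y ~= 0" "vl W (1 + y) = min 0 (vl W y)" by auto
qed

text \<open>If the element \<open>z\<close> found for the earlier primes is not yet small at
  \<open>W1\<close>, it is combined with \<open>z'\<close>, which has a pole at \<open>W0\<close>
  and a zero at \<open>W1\<close>. If \<open>z\<close> is a unit at \<open>W1\<close>, a power of it
  times \<open>z'\<close> works. If \<open>z\<close> has a pole there,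
  \<open>z ^ r / (1 + z ^ r)\<close> is used instead: it is a unit at both poles of \<open>z\<close>
  and small where \<open>z\<close> is small.\<close>

lemma separate_set:
 assumes W0: "dvr L W0" and "finite \<W>" "!!W. W:\<W> ==> dvr L W & W ~= W0" "\<W> ~= {}"
 shows "EX z:L. z ~= 0 & vl W0 z < 0 & (ALL W:\<W>. vl W z > 0)"
 using assms(2,4,3)
proof (induction \<W> rule: finite_ne_induct)
 case (singleton W)
 thus ?case using separate_two[OF W0, of W] by (metis singletonD singletonI)
next
 case (insert W1 \<W>)
 note L = dvr_prime(2)[OF W0]
 obtain z where z: "z:L" "z ~= 0" "vl W0 z < 0" "!!W. W:\<W> ==> vl W z > 0" using insert by auto
 have d1: "dvr L W1" "W0 ~= W1" using insert.prems by auto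
 obtain z' where z': "z':L" "z' ~= 0" "vl W0 z' < 0" "vl W1 z' > 0" using separate_two[OF W0 d1] by metis
 obtain t0 t1 where U0: "unif L W0 t0" and U1: "unif L W1 t1" using W0 d1 by (auto simp: dvr_def)
 \<comment> \<open>Large enough to outweigh possible poles of \<open>z'\<close> at the earlier
   primes.\<close>
 define r where "r = 1 + nat (SUM W:\<W>. \<bar>vl W z'\<bar>)"
 have zr: "z ^ r:L" "z ^ r ~= 0" using z by (auto intro: sf_cl[OF L])
 have big: "vl W (z ^ r) + vl W z' > 0" "vl W (z ^ r) > 0" if W: "W:\<W>" for W
 proof -
  obtain t where U: "unif L W t" using insert.prems W by (auto simp: dvr_def)
  have "\<bar>vl W z'\<bar> <= (SUM W:\<W>. \<bar>vl W z'\<bar>)" using insert.hyps(1) W by (intro member_le_sum) auto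
  moreover have "int r * 1 <= int r * vl W z" using z(4)[OF W] by (intro mult_left_mono) auto
  ultimately show "vl W (z ^ r) + vl W z' > 0" "vl W (z ^ r) > 0" using val_power[OF U z(1,2), of r] by (auto simp: r_def)
 qed
 have r0: "r > 0" by (simp add: r_def)
 consider "vl W1 z > 0" | "vl W1 z = 0" | "vl W1 z < 0" by linarith
 thus ?case
 proof cases
  case 1 thus ?thesis using z by auto
 next
  case 2
  have "vl W0 (z ^ r * z') < 0" using val_mult[OF U0 zr z'(1,2)] val_power[OF U0 z(1,2)] z(3) z'(3) r0
   by (simp add: add_neg_neg mult_pos_neg)
  moreover have "vl W1 (z ^ r * z') > 0" using val_mult[OF U1 zr z'(1,2)] val_power[OF U1 z(1,2)] 2 z'(4) by simp
  moreover have "vl W (z ^ r * z') > 0" if W: "W:\<W>" for W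
  proof -
   obtain t where U: "unif L W t" using insert.prems W by (auto simp: dvr_def)
   show ?thesis using big(1)[OF W] val_mult[OF U zr z'(1,2)] by simp
  qed
  ultimately show ?thesis using zr z' sf_cl(5)[OF L] by (intro bexI[of _ "z ^ r * z'"]) auto
 next
  case 3
  have v0: "vl W0 (z ^ r) < 0" "vl W1 (z ^ r) < 0"
   using val_power[OF U0 z(1,2)] val_power[OF U1 z(1,2)] z(3) 3 r0 by (simp_all add: mult_pos_neg)
  have o: "1 + z ^ r ~= 0" using val_one_plus(1)[OF U0 zr] v0 by simp
  have oL: "1 + z ^ r:L" by (intro sf_cl[OF L] z(1))
  define y where "y = z ^ r / (1 + z ^ r)"
  have y: "y:L" "y ~= 0" unfolding y_def using zr o oL by (auto intro: sf_div[OF L])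
  have vy: "vl W y = vl W (z ^ r) - min 0 (vl W (z ^ r))"
   if U: "unif L W t" "vl W (z ^ r) ~= 0" for W t
   unfolding y_def val_divide[OF U(1) zr oL o] val_one_plus(2)[OF U(1) zr U(2)] ..
  have "vl W0 (y * z') < 0" "vl W1 (y * z') > 0"
   using val_mult[OF U0 y z'(1,2)] val_mult[OF U1 y z'(1,2)] vy[OF U0] vy[OF U1] v0 z' by auto
  moreover have "vl W (y * z') > 0" if W: "W:\<W>" for W
  proof -
   obtain t where U: "unif L W t" using insert.prems W by (auto simp: dvr_def)
   show ?thesis using big[OF W] val_mult[OF U y z'(1,2)] vy[OF U] by simp
  qed
  ultimately show ?thesis using y z' sf_cl(5)[OF L] by (intro bexI[of _ "y * z'"]) auto
 qed
qed

text \<open>The factor \<open>z ^ n / (1 + z ^ n)\<close> is close to 1 where \<open>z\<close> has a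
  pole and close to 0 where \<open>z\<close> has a zero; \<open>n\<close> also absorbs the values of
  \<open>x\<close> itself.\<close>

theorem weak_approx:
 assumes W0: "dvr L W0" and fin: "finite \<W>" and \<W>: "!!W. W:\<W> ==> dvr L W & W ~= W0" and x: "x:L"
 obtains b where "b:L" "vge L W0 N (b - x)" "!!W. W:\<W> ==> vge L W N b"
proof (cases "x = 0 \<or> \<W> = {}")
 case True
 obtain t0 where U0: "unif L W0 t0" using W0 by (auto simp: dvr_def)
 have "vge L W N 0" if "W:\<W>" for W using \<W>[OF that] vge_zero unfolding dvr_def by blast
 thus thesis using True that[of x] x vge_zero[OF U0] by auto
next
 case False
 note L = dvr_prime(2)[OF W0]
 obtain z where z: "z:L" "z ~= 0" "vl W0 z < 0" "!!W. W:\<W> ==> vl W z > 0"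
  using separate_set[OF W0 fin \<W>] False by blast
 obtain t0 where U0: "unif L W0 t0" using W0 by (auto simp: dvr_def)
 define n where "n = 1 + nat (\<bar>N\<bar> + \<bar>vl W0 x\<bar> + (SUM W:\<W>. \<bar>vl W x\<bar>))"
 have n0: "n > 0" by (simp add: n_def)
 have S0: "(SUM W:\<W>. \<bar>vl W x\<bar>) >= 0" by (intro sum_nonneg) auto
 have zn: "z ^ n:L" "z ^ n ~= 0" using z by (auto intro: sf_cl[OF L])
 have v0: "vl W0 (z ^ n) <= - int n"
 proof -
  have "int n * vl W0 z <= int n * (-1)" using z(3) by (intro mult_left_mono) auto
  thus ?thesis using val_power[OF U0 z(1,2), of n] by simp
 qed
 have o: "1 + z ^ n ~= 0" "vl W0 (1 + z ^ n) = vl W0 (z ^ n)" using val_one_plus[OF U0 zn] v0 n0 by auto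
 have oL: "1 + z ^ n:L" by (intro sf_cl[OF L] z(1))
 define b where "b = z ^ n / (1 + z ^ n) * x"
 have "b - x = - (x / (1 + z ^ n))" using o(1) by (simp add: b_def field_simps)
 moreover have "vge L W0 N (x / (1 + z ^ n))"
 proof -
  have "vl W0 (x / (1 + z ^ n)) = vl W0 x - vl W0 (z ^ n)"
   using val_divide[OF U0 x _ oL o(1)] False o(2) by simp
  moreover have "int n >= \<bar>N\<bar> + \<bar>vl W0 x\<bar>" using S0 unfolding n_def by simp
  ultimately have "vl W0 (x / (1 + z ^ n)) >= N" using v0 by linarith
  thus ?thesis using sf_div[OF L x oL] by (simp add: vge_def[OF U0])
 qed
 ultimately have "vge L W0 N (b - x)" using vge_uminus[OF U0] by simp
 moreover have bL: "b:L" unfolding b_def by (rule sf_cl(5)[OF L sf_div[OF L zn(1) oL] x])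
 moreover have "vge L W N b" if W: "W:\<W>" for W
 proof -
  obtain t where U: "unif L W t" using \<W>[OF W] by (auto simp: dvr_def)
  have "\<bar>vl W x\<bar> <= (SUM W:\<W>. \<bar>vl W x\<bar>)" using fin W by (intro member_le_sum) auto
  moreover have "int n * 1 <= int n * vl W z" using z(4)[OF W] by (intro mult_left_mono) auto
  moreover have "int n > \<bar>N\<bar> + \<bar>vl W0 x\<bar> + (SUM W:\<W>. \<bar>vl W x\<bar>)" using S0 unfolding n_def by simp
  ultimately have vz: "vl W (z ^ n) >= N + \<bar>vl W x\<bar>" "vl W (z ^ n) > 0"
   unfolding val_power[OF U z(1,2), of n] by linarith+
  have "vl W (1 + z ^ n) = 0" using val_one_plus(2)[OF U zn] vz by simp
  hence "vl W (z ^ n / (1 + z ^ n)) = vl W (z ^ n)" using val_divide[OF U zn oL o(1)] by simp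
  moreover have "z ^ n / (1 + z ^ n) ~= 0" using zn o(1) by simp
  ultimately have "vl W b = vl W (z ^ n) + vl W x" unfolding b_def
   using val_mult[OF U sf_div[OF L zn(1) oL] _ x] False by metis
  thus ?thesis using vz bL by (auto simp: vge_def[OF U])
 qed
 ultimately show thesis using that by blast
qed

lemma vge_image:
 assumes s: "si:Aut k" "si ` L = L" and U: "unif L W t"
 shows "vge L (si ` W) n (si x) <-> vge L W n x"
proof -
 have "si (t powi m) = si t powi m" for m by (simp add: power_int_def aut_power[OF s(1)] aut_inv1[OF s(1)])
 hence "si x * si t powi - n = si (x * t powi - n)" by (simp add: aut_mult[OF s(1)])
 thus ?thesis
  unfolding vge_iff[OF U] vge_iff[OF unif_image[OF s U]] using aut_eq_iff[OF s(1)] by (auto simp: image_iff)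
qed

lemma dvr_image: "si:Aut k ==> si ` L = L ==> dvr L W ==> dvr L (si ` W)"
 using unif_image unfolding dvr_def by blast

lemma image_max_ideal: "si:Aut k ==> mx (si ` W) = si ` mx W"
 by (auto simp: max_ideal_def aut_inv1[symmetric] aut_eq_0 aut_eq_iff image_iff)

lemma fin_conj_primes:
 assumes "clb F" "fing F L" "W <= L" shows "finite ((%si. si ` W) ` Aut F)"
proof -
 have r: "restrict si L ` W = si ` W" for si using assms(3) by (intro image_cong) auto
 have "(%si. si ` W) ` Aut F = (%g. g ` W) ` Grp F L" unfolding Grp_def image_image r ..
 thus ?thesis using finite_Grp[OF assms(1,2)] by simp
qed

lemma vunit_prod: "is_sr V ==> (!!i. i:A ==> f i:vunit V) ==> prod f A:vunit V"
 by (induction A rule: infinite_finite_induct) (simp_all add: vunit_one vunit_mult)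

text \<open>If the two orbits of primes were disjoint, weak approximation would give an element
  congruent to 1 at the conjugates of \<open>W\<close> and to 0 at those of \<open>W'\<close>. Its
  norm lies in \<open>F\<close>, is a unit at \<open>W\<close> and a nonunit at \<open>W'\<close>,
  although both primes have the same restriction to \<open>F\<close>.\<close>

theorem prime_trans:
 assumes cb: "clb F" and L: "fing F L" and g: "gal F L" and W: "dvr L W" "dvr L W'" and eq: "W Int F = W' Int F"
 obtains si where "si:Aut F" "si ` W = W'"
proof (rule ccontr)
 assume "~ thesis"
 hence no: "si ` W ~= W'" if "si:Aut F" for si using that \<open>!!si. si:Aut F ==> si ` W = W' ==> thesis\<close> by blast
 note LS = galD(2)[OF g] and FS = galD(1)[OF g]
 note P = dvr_prime(1)[OF W(1)] and P' = dvr_prime(1)[OF W(2)]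
 define C where "C = (%si. si ` W) ` Aut F"
 define C' where "C' = (%si. si ` W') ` Aut F"
 have fin: "finite C" "finite C'" unfolding C_def C'_def
  using fin_conj_primes[OF cb L] primeD(2)[OF P] primeD(2)[OF P'] by auto
 have dv: "dvr L U" if "U:C Un C'" for U using that W dvr_image[OF _ gal_image[OF g]] unfolding C_def C'_def by blast
 have disj: "C Int C' = {}"
 proof (rule ccontr)
  assume "C Int C' ~= {}"
  then obtain si ta where st: "si:Aut F" "ta:Aut F" "si ` W = ta ` W'" unfolding C_def C'_def by blast
  have "(inv_into UNIV ta \<circ> si) ` W = inv_into UNIV ta ` ta ` W'" using st(3) by (metis image_comp)
  also have "... = W'" using aut_inv_app(2)[OF st(2)] by (simp add: image_image)
  finally show False using no[OF aut_comp[OF aut_inv[OF st(2)] st(1)]] by blast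
 qed
 have "EX b. b:L & vge L U 1 (b - 1) & (ALL U':C Un C' - {U}. vge L U' 1 b)" if U: "U:C" for U
  using weak_approx[of L U "C Un C' - {U}" 1 1] dv U fin sf_cl(1)[OF LS] by (metis DiffD1 DiffD2 UnI1 finite_Diff finite_UnI singletonI)
 then obtain b where b: "!!U. U:C ==> b U:L" "!!U. U:C ==> vge L U 1 (b U - 1)"
  "!!U U'. U:C ==> U':C Un C' ==> U' ~= U ==> vge L U' 1 (b U)" by (metis Diff_iff singletonD)
 define a where "a = (SUM U:C. b U)"
 have aL: "a:L" unfolding a_def by (intro sr_sum[OF sf_sr[OF LS]] b)
 have a0: "vge L U 1 a" if U: "U:C'" for U
 proof -
  obtain t where "unif L U t" using dv U by (auto simp: dvr_def)
  thus ?thesis unfolding a_def using disj U by (intro vge_sum b) auto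
 qed
 have a1: "vge L U 1 (a - 1)" if U: "U:C" for U
 proof -
  obtain t where t: "unif L U t" using dv U by (auto simp: dvr_def)
  have "a - 1 = (b U - 1) + (SUM U':C - {U}. b U')" unfolding a_def using sum.remove[OF fin(1) U, of b] by simp
  thus ?thesis using U by (simp only:) (intro vge_add[OF t] vge_sum[OF t] b, auto)
 qed
 let ?N = "PROD g:Grp F L. g a"
 have NF: "?N:F" by (rule Grp_prod_in_base[OF cb L g aL])
 obtain t t' where U: "unif L W t" and U': "unif L W' t'" using W by (auto simp: dvr_def)
 have conj: "vge L W 1 (si a - 1) & vge L W' 1 (si a)" if s: "si:Aut F" for si
 proof -
  let ?r = "inv_into UNIV si"
  note r = aut_inv[OF s]
  have i: "si ` ?r ` A = A" for A using aut_inv_app(1)[OF s] by (simp add: image_image)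
  have "?r ` W:C" "?r ` W':C'" unfolding C_def C'_def using r by auto
  hence "vge L (?r ` W) 1 (a - 1)" "vge L (?r ` W') 1 a" using a0 a1 by auto
  moreover have "unif L (?r ` W) (?r t)" "unif L (?r ` W') (?r t')"
   using unif_image[OF r gal_image[OF g r]] U U' by auto
  ultimately show ?thesis using vge_image[OF s gal_image[OF g s]] by (metis i aut_diff[OF s] aut_one[OF s])
 qed
 have "g a:vunit W & g a:mx W'" if h: "g:Grp F L" for g
 proof -
  obtain si where s: "si:Aut F" "g a = si a" using Grp_app[OF h] aL by auto
  have "1 + (si a - 1):vunit W"
   using conj[OF s(1)] by (intro vunit_add[OF LS P] vunit_one[OF primeD(1)[OF P]]) (simp add: vge_1[OF U])
  thus ?thesis using conj[OF s(1)] s(2) vge_1[OF U'] by simp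
 qed
 hence gu: "g a:vunit W" "g a:mx W'" if "g:Grp F L" for g using that by auto
 have "?N:vunit W" by (intro vunit_prod[OF primeD(1)[OF P]] gu(1))
 moreover have "?N:mx W'"
 proof -
  let ?i = "restrict (%x. x) L"
  have i: "?i:Grp F L" unfolding Grp_def by (rule imageI[OF aut_id(2)])
  have "(PROD g:Grp F L - {?i}. g a):W'"
   by (rule sr_prod[OF primeD(1)[OF P'] mx_sub[OF gu(2)]]) simp
  from mx_mult[OF primeD(1)[OF P'] gu(2)[OF i] this]
  show ?thesis unfolding prod.remove[OF finite_Grp[OF cb L] i, of "%g. g a"] .
 qed
 ultimately show False using eq NF unfolding mx_iff
  by (metis Int_iff mx_Int(2)[OF FS] vunit_sub)
qed

section \<open>Decomposition and inertia\<close>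

definition decomp :: "'b::field set => 'b set => ('b => 'b) set" where
 "decomp F W = {si:Aut F. si ` W = W}"

definition inertia :: "'b::field set => 'b set => ('b => 'b) set" where
 "inertia F W = {si:decomp F W. ALL x:W. si x - x:mx W}"

definition triv_on :: "('b => 'b) set => 'b set => bool" where
 "triv_on A L <-> (ALL si:A. ALL x:L. si x = x)"

lemma decompD: "si:decomp F W ==> si:Aut F" "si:decomp F W ==> si ` W = W"
 by (auto simp: decomp_def)
lemma inertD: "si:inertia F W ==> si:decomp F W" "si:inertia F W ==> x:W ==> si x - x:mx W"
 by (auto simp: inertia_def)

lemma inv_image_eq: assumes "si:Aut F" shows "inv_into UNIV si ` si ` A = A" "si ` inv_into UNIV si ` A = A"
 using aut_inv_app[OF assms] by (simp_all add: image_image)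

lemma decomp_inv: "si:decomp F W ==> inv_into UNIV si:decomp F W"
 using aut_inv[of si F] inv_image_eq(1)[of si F W] unfolding decomp_def by auto

lemma decomp_comp: "si:decomp F W ==> ta:decomp F W ==> si \<circ> ta:decomp F W"
 using aut_comp[of si F ta] unfolding decomp_def by (simp del: o_apply add: image_comp[symmetric])

lemma decomp_max_ideal: "si:decomp F W ==> x:mx W ==> si x:mx W"
 using image_max_ideal[of si F W] unfolding decomp_def by auto

lemma restrict_image: "W <= L ==> restrict si L ` W = si ` W" by (intro image_cong) auto

lemma Grp_stabilizer:
 assumes "W <= L" shows "h:Grp F L & h ` W = W <-> (EX si:decomp F W. h = restrict si L)"
proof
 assume "h:Grp F L & h ` W = W"
 then obtain si where s: "si:Aut F" "h = restrict si L" "h ` W = W" unfolding Grp_def by blast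
 hence "si ` W = W" unfolding s(2) restrict_image[OF assms] by simp
 thus "EX si:decomp F W. h = restrict si L" using s by (intro bexI[of _ si]) (simp_all add: decomp_def)
next
 assume "EX si:decomp F W. h = restrict si L"
 then obtain si where s: "si:decomp F W" "h = restrict si L" by blast
 thus "h:Grp F L & h ` W = W" unfolding Grp_def s(2) restrict_image[OF assms] decomp_def by simp
qed

text \<open>The substitute for completing at \<open>W\<close>. Choose \<open>b\<close> close to
  \<open>x\<close> at \<open>W\<close> and close to 0 at the other conjugates of \<open>W\<close>:
  the automorphisms moving \<open>W\<close> contribute almost nothing to the full trace of
  \<open>b\<close>, which lies in \<open>F\<close>.\<close>

lemma trace_approximation:
 assumes cb: "clb F" and L: "fing F L" and g: "gal F L" and W: "dvr L W" and x: "x:L"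
 obtains c where "c:F" "vge L W N (c - (SUM g:{g:Grp F L. g ` W = W}. g x))"
proof -
 note P = dvr_prime(1)[OF W]
 obtain t where U: "unif L W t" using W by (auto simp: dvr_def)
 define C where "C = (%si. si ` W) ` Aut F"
 have fin: "finite C" unfolding C_def by (rule fin_conj_primes[OF cb L primeD(2)[OF P]])
 have dv: "dvr L U" if "U:C" for U using that W dvr_image[OF _ gal_image[OF g]] unfolding C_def by blast
 obtain b where b: "b:L" "vge L W N (b - x)" "!!U. U:C - {W} ==> vge L U N b"
  using weak_approx[OF W, of "C - {W}" x N] fin dv x by blast
 define D where "D = {g:Grp F L. g ` W = W}"
 have D: "D <= Grp F L" "finite (Grp F L)" using finite_Grp[OF cb L] by (auto simp: D_def)
 define c where "c = (SUM g:Grp F L. g b)"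
 have "c - (SUM g:D. g x) = (SUM g:D. g b - g x) + (SUM g:Grp F L - D. g b)"
  unfolding c_def using sum.subset_diff[OF D, of "%g. g b"] by (simp add: sum_subtractf)
 moreover have "vge L W N (g b - g x)" if g': "g:D" for g
 proof -
  obtain si where s: "si:Aut F" "si ` W = W" "g = restrict si L"
   using g' Grp_stabilizer[OF primeD(2)[OF P], of g F] unfolding D_def decomp_def by blast
  hence "vge L W N (si (b - x))" using vge_image[OF s(1) gal_image[OF g s(1)] U, of N "b - x"] b(2) s(2) by simp
  thus ?thesis using b(1) x s(3) by (simp add: aut_diff[OF s(1)])
 qed
 moreover have "vge L W N (g b)" if g': "g:Grp F L - D" for g
 proof -
  obtain si where s: "si:Aut F" "g = restrict si L" using g' unfolding Grp_def by blast
  let ?r = "inv_into UNIV si"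
  note r = aut_inv[OF s(1)]
  have sW: "si ` W ~= W"
   using g' s Grp_stabilizer[OF primeD(2)[OF P], of g F] unfolding D_def decomp_def by blast
  have "?r ` W ~= W" using sW inv_image_eq(2)[OF s(1), of W] by metis
  hence "vge L (?r ` W) N b" using r by (intro b(3)) (auto simp: C_def)
  hence "vge L (si ` ?r ` W) N (si b)"
   using vge_image[OF s(1) gal_image[OF g s(1)] unif_image[OF r gal_image[OF g r] U]] by simp
  thus ?thesis using b(1) s(2) by (simp add: inv_image_eq(2)[OF s(1)])
 qed
 ultimately have "vge L W N (c - (SUM g:D. g x))" by (simp only:) (intro vge_add[OF U] vge_sum[OF U], auto)
 thus thesis using that[of c] Grp_sum_in_base[OF cb L g b(1)] by (simp add: c_def D_def)
qed

text \<open>Dedekind's independence of characters, read modulo the maximal ideal. Comparing the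
  relation at \<open>x * y\<close> with \<open>ps y\<close> times the relation at \<open>x\<close>
  removes the character \<open>ps\<close>; once the other coefficients are in the ideal, evaluation
  at 1 settles the last one.\<close>

lemma dedekind_mod:
 assumes F: "is_sf F" and P: "prm F W" and "finite S"
  and hom: "!!ka x y. ka:S ==> x:W ==> y:W ==> ka x:W & ka (x * y) = ka x * ka y & ka 1 = 1"
  and dist: "!!ka ps. ka:S ==> ps:S ==> ka ~= ps ==> EX x:W. ka x - ps x~:mx W"
  and c: "!!ka. ka:S ==> c ka:W" and z: "!!x. x:W ==> (SUM ka:S. c ka * ka x):mx W"
 shows "ALL ka:S. c ka:mx W"
 using `finite S` hom dist c z
proof (induction S arbitrary: c rule: finite_induct)
 case (insert ps S)
 note R = primeD(1)[OF P]
 note hom = insert.prems(1) and dist = insert.prems(2) and c = insert.prems(3) and z = insert.prems(4)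
 have IH: "ALL ka:S. c ka * (ka y - ps y):mx W" if y: "y:W" for y
 proof (rule insert.IH)
  fix x assume x: "x:W"
  have "(SUM ka:insert ps S. c ka * ka (x * y)) - (SUM ka:insert ps S. c ka * ka x) * ps y:mx W"
   by (intro mx_diff[OF F P] z sr_mult[OF R] x y mx_mult[OF R]) (use hom x y in blast)
  moreover have "(SUM ka:insert ps S. c ka * ka (x * y)) = (SUM ka:insert ps S. c ka * ka x * ka y)"
   using hom x y by (intro sum.cong) (auto simp: mult.assoc)
  ultimately show "(SUM ka:S. c ka * (ka y - ps y) * ka x):mx W"
   using insert.hyps by (simp add: sum_distrib_left sum_subtractf algebra_simps)
 next
  fix ka x y assume "ka:S" "x:W" "y:W"
  thus "ka x:W & ka (x * y) = ka x * ka y & ka 1 = 1" using hom[of ka x y] by simp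
 next
  fix ka ps' assume "ka:S" "ps':S" "ka ~= ps'"
  thus "EX x:W. ka x - ps' x~:mx W" using dist[of ka ps'] by simp
 next
  fix ka assume h: "ka:S"
  have "ka y:W" "ps y:W" using hom[of ka y y] hom[of ps y y] h y by simp_all
  thus "c ka * (ka y - ps y):W" using c[of ka] h by (intro sr_mult[OF R] sr_diff[OF R]) simp_all
 qed
 have S: "c ka:mx W" if h: "ka:S" for ka
 proof -
  have "ka ~= ps" using h insert.hyps by auto
  then obtain y where y: "y:W" "ka y - ps y~:mx W" using dist[of ka ps] h by auto
  have "c ka:W" "ka y - ps y:W" using c hom[of _ y 1] h y sr_1[OF R] sr_diff[OF R] by auto
  thus ?thesis using mx_prime[OF R, of "c ka" "ka y - ps y"] IH[OF y(1)] h y(2) by auto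
 qed
 have "(SUM ka:S. c ka * ka 1):mx W"
  using hom[of _ 1 1] sr_1[OF R] by (intro mx_sum[OF F P] mx_mult[OF R] S) simp_all
 hence "c ps * ps 1:mx W"
  using mx_diff[OF F P z[OF sr_1[OF R]]] insert.hyps by fastforce
 thus ?case using S hom[of ps 1 1] sr_1[OF R] by auto
qed simp

text \<open>Trivial inertia makes the decomposition group act by pairwise incongruent maps.
  Independence then provides \<open>a\<close> for which the partial trace of \<open>a * po\<close>
  is \<open>po\<close> times a unit, and an element of \<open>F\<close> agreeing with this trace
  modulo the square of the maximal ideal is a uniformizer.\<close>

theorem unif_inert:
 fixes F :: "'b::alg_closed_field set"
 assumes cb: "clb F" and L: "fing F L" and g: "gal F L" and W: "dvr L W" and I: "triv_on (inertia F W) L"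
 obtains t where "t:F" "unif L W t"
proof -
 note LS = galD(2)[OF g]
 note P = dvr_prime(1)[OF W]
 note R = primeD(1)[OF P]
 have WL: "W <= L" by (rule primeD(2)[OF P])
 obtain po where U: "unif L W po" using W by (auto simp: dvr_def)
 have pL: "po:L" "po ~= 0" "po:mx W" using unif_in_F[OF U] unif_nz[OF U] unif_mem[OF U] .
 define D where "D = {g:Grp F L. g ` W = W}"
 have Dd: "EX si:decomp F W. h = restrict si L" if "h:D" for h
  using that Grp_stabilizer[OF WL, of h F] unfolding D_def by blast
 have fD: "finite D" using finite_Grp[OF cb L] by (simp add: D_def)
 define c where "c h = h po / po" for h :: "'b => 'b"
 have cu: "c h:vunit W" if h: "h:D" for h
 proof -
  obtain si where s: "si:Aut F" "si ` W = W" "h = restrict si L" using Dd[OF h] by (auto simp: decomp_def)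
  have "unif L W (si po)" using unif_image[OF s(1) gal_image[OF g s(1)] U] s(2) by simp
  hence "vl W (si po) = 1" "si po:L" "si po ~= 0" using val_unif unif_in_F unif_nz by blast+
  thus ?thesis using val_divide[OF U _ _ pL(1,2), of "si po"] val_unif[OF U] pL s(3) sf_div[OF LS, of "si po" po]
   by (subst val_vunit_iff[OF U]) (auto simp: c_def)
 qed
 have "(%x. x):decomp F W" using aut_id(2)[of F] by (simp add: decomp_def)
 hence id: "restrict (%x. x) L:D" unfolding D_def using Grp_stabilizer[OF WL] by blast
 have "EX a:W. (SUM h:D. c h * h a)~:mx W"
 proof (rule ccontr)
  assume n: "~ ?thesis"
  have "ALL h:D. c h:mx W"
  proof (rule dedekind_mod[OF LS P fD])
   fix h x y assume h: "h:D" "x:W" "y:W"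
   obtain si where s: "si:Aut F" "si ` W = W" "h = restrict si L" using Dd[OF h(1)] by (auto simp: decomp_def)
   show "h x:W & h (x * y) = h x * h y & h 1 = 1"
    using h(2,3) WL s(2) sf_cl(1)[OF LS] sf_cl(5)[OF LS, of x y]
    by (auto simp: s(3) aut_mult[OF s(1)] aut_one[OF s(1)])
  next
   fix h h' assume hh: "h:D" "h':D" "h ~= h'"
   obtain si ta where s: "si:decomp F W" "h = restrict si L" and t: "ta:decomp F W" "h' = restrict ta L"
    using Dd[OF hh(1)] Dd[OF hh(2)] by auto
   let ?r = "inv_into UNIV ta \<circ> si"
   note ti = decomp_inv[OF t(1)] note tA = decompD(1)[OF t(1)]
   show "EX x:W. h x - h' x~:mx W"
   proof (rule ccontr)
    assume "~ ?thesis"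
    hence m: "si x - ta x:mx W" if "x:W" for x
     using that subsetD[OF WL that] s(2) t(2) by auto
    have "?r x - x:mx W" if "x:W" for x
     using decomp_max_ideal[OF ti m[OF that]] aut_inv_app(2)[OF tA] by (simp add: aut_diff[OF decompD(1)[OF ti]])
    hence "?r:inertia F W" using decomp_comp[OF ti s(1)] by (simp add: inertia_def)
    hence "?r x = x" if "x:L" for x using I that unfolding triv_on_def by blast
    hence "si x = ta x" if "x:L" for x using that aut_inv_app(1)[OF tA] by (metis comp_apply)
    thus False using hh(3) s(2) t(2) by (auto intro: restrict_ext)
   qed
  next
   show "c h:W" if "h:D" for h using vunit_sub[OF cu[OF that]] .
   show "(SUM h:D. c h * h x):mx W" if "x:W" for x using n that by blast
  qed
  thus False using cu[OF id] id by (auto simp: mx_iff)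
 qed
 then obtain a where a: "a:W" "(SUM h:D. c h * h a)~:mx W" by blast
 have ha: "h (a * po) = po * (c h * h a)" "h a:W" if h: "h:D" for h
 proof -
  obtain si where s: "si:Aut F" "si ` W = W" "h = restrict si L" using Dd[OF h] by (auto simp: decomp_def)
  show "h (a * po) = po * (c h * h a)" "h a:W"
   using a(1) WL pL s(2) sf_cl(5)[OF LS, of a po] by (auto simp: s(3) aut_mult[OF s(1)] c_def)
 qed
 define s where "s = (SUM h:D. h (a * po))"
 let ?u = "SUM h:D. c h * h a"
 have s: "s = po * ?u" unfolding s_def sum_distrib_left using ha by (intro sum.cong) auto
 have "?u:W" using cu vunit_sub ha by (intro sr_sum[OF R] sr_mult[OF R]) auto
 hence u: "?u:vunit W" using a(2) by (simp add: mx_iff)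
 hence uL: "?u:L" "?u ~= 0" using vunit_sub WL vunit_nz by blast+
 have sL: "s:L" "s ~= 0" "vl W s = 1"
  unfolding s using pL uL val_mult[OF U pL(1,2) uL] val_vunit_iff[OF U uL] u val_unif[OF U] sf_cl(5)[OF LS] by auto
 have "a * po:L" using a(1) WL pL(1) by (auto intro: sf_cl(5)[OF LS])
 then obtain t where t: "t:F" "vge L W 2 (t - s)"
  using trace_approximation[OF cb L g W, of "a * po" 2] unfolding s_def D_def by blast
 have "vge L W (vl W s + 1) (t - s)" using t(2) sL(3) by simp
 from val_add_eq[OF U sL(1,2) this] have "s + (t - s) ~= 0" "vl W (s + (t - s)) = 1" unfolding sL(3) .
 moreover have "s + (t - s) = t" by simp
 ultimately have "t ~= 0" "vl W t = 1" by simp_all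
 hence "unif L W t" using uniformizerI[OF U, of t] t(1) galD(3)[OF g] by auto
 thus thesis using that t(1) by blast
qed

text \<open>With a trivial decomposition group the partial trace of \<open>x\<close> is
  \<open>x\<close> itself.\<close>

theorem residue_of_decomp_trivial:
 assumes cb: "clb F" and L: "fing F L" and g: "gal F L" and W: "dvr L W" and D: "triv_on (decomp F W) L" and x: "x:L"
 obtains c where "c:F" "c - x:mx W"
proof -
 note P = dvr_prime(1)[OF W]
 have WL: "W <= L" by (rule primeD(2)[OF P])
 obtain t where U: "unif L W t" using W by (auto simp: dvr_def)
 have "h:Grp F L & h ` W = W <-> h = restrict (%x. x) L" for h
 proof
  assume "h:Grp F L & h ` W = W"
  then obtain si where "si:decomp F W" "h = restrict si L" unfolding Grp_stabilizer[OF WL] by blast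
  thus "h = restrict (%x. x) L" using D unfolding triv_on_def by (auto intro: restrict_ext)
 next
  assume h: "h = restrict (%x. x) L"
  have "(%x. x):decomp F W" using aut_id(2)[of F] by (simp add: decomp_def)
  thus "h:Grp F L & h ` W = W" unfolding Grp_stabilizer[OF WL] h by blast
 qed
 hence "{h:Grp F L. h ` W = W} = {restrict (%x. x) L}" by auto
 hence "(SUM h:{h:Grp F L. h ` W = W}. h x) = x" using x by simp
 then obtain c where "c:F" "vge L W 1 (c - x)" using trace_approximation[OF cb L g W x, of 1] by metis
 thus thesis using that vge_1[OF U] by blast
qed

text \<open>From \<open>x ^ Q = x + t * x1\<close> with \<open>t\<close> fixed one gets
  \<open>si x - x = (si x - x) ^ Q - t * (si x1 - x1)\<close>. If all differences are divisible by
  \<open>t ^ n\<close> with \<open>n > 0\<close>, both terms are divisible by one more power of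
  \<open>t\<close>; hence the differences vanish.\<close>

theorem inertia_trivial:
 assumes U: "unif L W t" and t: "t:F"
  and ch: "prime CHAR('b::field)" and res: "!!x. x:W ==> EX j>0. x ^ (CHAR('b) ^ j) - x:mx W"
 shows "triv_on (inertia F (W::'b set)) L"
 unfolding triv_on_def
proof (intro ballI)
 fix si x assume s: "si:inertia F W" and x: "x:L"
 note sA = decompD(1)[OF inertD(1)[OF s]]
 have main: "vge L W (int n) (si x - x)" if "x:W" for n x
  using that
 proof (induction n arbitrary: x)
  case 0
  thus ?case using inertD(2)[OF s 0] mx_sub by (auto simp: vge_0[OF U])
 next
  case (Suc n)
  show ?case
  proof (cases "n = 0")
   case True thus ?thesis using inertD(2)[OF s Suc.prems] by (simp add: vge_1[OF U])
  next
   case False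
   obtain j where j: "j > 0" "x ^ (CHAR('b) ^ j) - x:mx W" using res[OF Suc.prems] by blast
   define Q where "Q = CHAR('b) ^ j"
   have Q: "Q >= 2" using prime_ge_2_nat[OF ch] j(1) self_le_power[of "CHAR('b)" j] unfolding Q_def by linarith
   obtain x1 where x1: "x1:W" "x ^ Q - x = t * x1" using j(2) max_ideal_unif[OF U] by (auto simp: Q_def)
   have d: "vge L W (int n) (si x - x)" by (rule Suc.IH[OF Suc.prems])
   have "si x ^ Q = (si x - x) ^ Q + x ^ Q"
    using freshmans_dream'[OF ch Q_def, of "si x - x" x] by simp
   moreover have "si x = si x ^ Q - t * si x1"
   proof -
    have "x = x ^ Q - t * x1" using x1(2) by (simp add: algebra_simps)
    hence "si x = si (x ^ Q - t * x1)" by simp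
    thus ?thesis using AutD(3)[OF sA t] by (simp add: aut_diff[OF sA] aut_mult[OF sA] aut_power[OF sA])
   qed
   ultimately have e: "si x - x = (si x - x) ^ Q - t * (si x1 - x1)" using x1(2) by (simp add: algebra_simps)
   have "vge L W (int Q * int n) ((si x - x) ^ Q)"
   proof (induction Q)
    case 0 thus ?case using sr_1[OF unif_sr[OF U]] by (simp add: vge_0[OF U])
   next
    case (Suc Q) thus ?case using vge_mult[OF U d Suc] by (simp add: algebra_simps)
   qed
   moreover have "int Q * int n >= 2 * int n" using Q by (intro mult_right_mono) linarith+
   hence "int (Suc n) <= int Q * int n" using False by linarith
   ultimately have "vge L W (int (Suc n)) ((si x - x) ^ Q)" using vge_mono[OF U] by blast
   moreover have "vge L W (1 + int n) (t * (si x1 - x1))"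
    using unif_mem[OF U] Suc.IH[OF x1(1)] by (intro vge_mult[OF U]) (auto simp: vge_1[OF U])
   ultimately show ?thesis using vge_diff[OF U] by (subst e) auto
  qed
 qed
 have WW: "si x = x" if "x:W" for x
 proof -
  have "vge L W n (si x - x)" for n using main[OF that, of "nat n"] vge_mono[OF U] by (cases "n >= 0") force+
  thus ?thesis using vge_all[OF U, of "si x - x"] by simp
 qed
 have "x:W \<or> inverse x:W" using primeD(4)[OF unif_prime[OF U] x] .
 thus "si x = x" using WW[of x] WW[of "inverse x"] aut_inv1[OF sA, of x] by auto
qed

subsection \<open>Residue fields\<close>

lemma cong_power_max_ideal:
 assumes "is_sr W" "u:W" "v:W" "u - v:mx W" shows "u ^ n - v ^ n:mx W"
proof -
 have "(SUM i<n. v ^ (n - Suc i) * u ^ i):W" using assms by (intro sr_sum[OF assms(1)] sr_mult[OF assms(1)] sr_pow[OF assms(1)])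
 hence "(u - v) * (SUM i<n. v ^ (n - Suc i) * u ^ i):mx W" by (rule mx_mult[OF assms(1,4)])
 thus ?thesis by (simp add: power_diff_sumr2)
qed

lemma cong_trans_max_ideal:
 assumes "is_sf L" "prm L W" "u - v:mx W" "v - w:mx W" shows "u - w:mx W"
 using mx_add[OF assms] by simp

lemma residue_power:
 assumes L: "is_sf L" and P: "prm L W" and x: "x:W" and j: "x ^ q - x:mx W"
 shows "x ^ (q ^ k) - x:mx W"
proof (induction k)
 case 0 thus ?case by (simp add: mx_0[OF primeD(1)[OF P]])
next
 case (Suc k)
 note R = primeD(1)[OF P]
 have "(x ^ (q ^ k)) ^ q - x ^ q:mx W" using x Suc by (intro cong_power_max_ideal[OF R] sr_pow[OF R])
 from cong_trans_max_ideal[OF L P this j] show ?case by (simp add: power_mult[symmetric] mult.commute)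
qed

lemma nat_unit_char:
 assumes ch: "prime CHAR('b::field)" and B: "~ CHAR('b) dvd B"
 obtains b where "of_nat B * of_nat b = (1::'b)"
proof -
 have "coprime B CHAR('b)" using prime_imp_coprime[OF ch B] by (simp add: coprime_commute)
 moreover have "B ~= 0" using B by (cases B) auto
 ultimately obtain b y where "B * b = CHAR('b) * y + 1" using bezout_nat[of B "CHAR('b)"] by (metis coprime_iff_gcd_eq_1)
 hence "(of_nat (B * b) :: 'b) = of_nat (CHAR('b) * y + 1)" by simp
 thus thesis using that[of b] by simp
qed

text \<open>If all of \<open>Aut E\<close> acts trivially modulo the maximal ideal, then the residue extension is purely
 inseparable, hence trivial. The inseparable power is read off from the conjugate polynomial of \<open>x\<close>,
 which is a power of a linear polynomial modulo the maximal ideal.\<close>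

theorem residue_of_inertia:
 fixes E :: "'b::alg_closed_field set"
 assumes cb: "clb E" and g: "gal E L" and P: "prm L W"
  and I: "!!si. si:Aut E ==> si:inertia E W"
  and ch: "prime CHAR('b)" and x: "x:W" and res: "j > 0" "x ^ (CHAR('b) ^ j) - x:mx W"
 obtains c where "c:E" "c:W" "c - x:mx W"
proof -
 note R = primeD(1)[OF P] and LS = galD(2)[OF g] and ES = galD(1)[OF g]
 define p where "p = CHAR('b)"
 have xL: "- x:L" using x primeD(2)[OF P] sf_cl(6)[OF LS] by auto
 have xW: "- x:W" using x by (rule sr_um[OF R])
 \<comment> \<open>The conjugates of \<open>- x\<close> rather than \<open>x\<close>, so that modulo
   the maximal ideal the product of the linear factors is a power of
   \<open>[:x, 1:]\<close>.\<close>
 define C where "C = (%si. si (- x)) ` Aut E"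
 note C = gal_conj_poly[OF cb g xL, folded C_def]
 have Cm: "c:W & c - (- x):mx W" if "c:C" for c
  using that inertD(2)[OF I xW] decompD(2)[OF inertD(1)[OF I]] xW unfolding C_def by blast
 define n where "n = card C"
 have n: "n > 0" unfolding n_def using C(1,3) by (auto simp: card_gt_0_iff)
 define a where "a = multiplicity p n"
 define m' where "m' = n div p ^ a"
 have m': "n = p ^ a * m'" by (simp add: m'_def a_def multiplicity_dvd)
 have pp: "prime p" using ch by (simp add: p_def)
 have m'0: "m' > 0" "~ p dvd m'"
 proof -
  show "m' > 0" using n m' by (cases m') auto
  have "~ is_unit p" using pp not_prime_unit by blast
  thus "~ p dvd m'" unfolding m'_def a_def using n by (intro multiplicity_decompose) auto
 qed
 \<comment> \<open>With \<open>p ^ a\<close> the exact power of \<open>p\<close> dividing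
   \<open>n\<close>, this binomial coefficient is prime to \<open>p\<close>. It is the coefficient
   in front of \<open>x ^ (p ^ a)\<close> in the expansion of \<open>[:x, 1:] ^ n\<close>, so
   \<open>x ^ (p ^ a)\<close> is congruent to an element of \<open>E\<close>.\<close>
 define B where "B = n choose (p ^ a)"
 have an: "p ^ a <= n" using m' m'0 by simp
 have "multiplicity p B = 0" unfolding B_def m' using const_p_fac[OF m'0(1) pp, of a] m'0(2) by (simp add: not_dvd_imp_multiplicity_0)
 hence "~ p dvd B" using an pp by (metis B_def multiplicity_eq_zero_iff binomial_eq_0_iff not_le not_prime_unit)
 then obtain b where b: "of_nat B * of_nat b = (1::'b)" using nat_unit_char[OF ch, of B] unfolding p_def by blast
 have cong: "ALL i. coeff (PROD c:A. [:-c, 1:]) i:W & coeff ([:x, 1:] ^ card A) i:W &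
   coeff ((PROD c:A. [:-c, 1:]) - [:x, 1:] ^ card A) i:mx W" if "finite A" "A <= C" for A
  using that
 proof (induction A rule: finite_induct)
  case empty
  thus ?case using mx_0[OF R] sr_0[OF R] sr_1[OF R] by (auto simp: coeff_1)
 next
  case (insert c A)
  let ?f = "PROD c:A. [:-c, 1:]" and ?h = "[:x, 1:] ^ card A"
  have IH: "coeff ?f i:W" "coeff ?h i:W" "coeff ?f i - coeff ?h i:mx W" for i using insert by auto
  have c: "c:W" "c + x:mx W" using Cm[of c] insert.prems by auto
  have 1: "coeff (PROD c:insert c A. [:-c, 1:]) i = (if i = 0 then 0 else coeff ?f (i - 1)) - c * coeff ?f i" for i
   using insert.hyps by (cases i) (simp_all add: coeff_pCons)
  have 2: "coeff ([:x, 1:] ^ card (insert c A)) i = (if i = 0 then 0 else coeff ?h (i - 1)) + x * coeff ?h i" for i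
   using insert.hyps by (cases i) (simp_all add: coeff_pCons)
  have 3: "((if i = 0 then 0 else coeff ?f (i - 1)) - c * coeff ?f i) - ((if i = 0 then 0 else coeff ?h (i - 1)) + x * coeff ?h i)
   = (if i = 0 then 0 else coeff ?f (i - 1) - coeff ?h (i - 1)) - (coeff ?f i - coeff ?h i) * c - (c + x) * coeff ?h i" for i
   by (simp add: algebra_simps)
  have m: "(if i = 0 then 0 else coeff ?f (i - 1) - coeff ?h (i - 1)):mx W" for i using IH(3) mx_0[OF R] by auto
  show ?case
  proof (intro allI conjI)
   fix i
   show "coeff (PROD c:insert c A. [:-c, 1:]) i:W" unfolding 1 using IH c sr_0[OF R]
    by (intro sr_diff[OF R] sr_mult[OF R]) auto
   show "coeff ([:x, 1:] ^ card (insert c A)) i:W" unfolding 2 using IH x sr_0[OF R]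
    by (intro sr_add[OF R] sr_mult[OF R]) auto
   show "coeff ((PROD c:insert c A. [:-c, 1:]) - [:x, 1:] ^ card (insert c A)) i:mx W"
    unfolding coeff_diff 1 2 3 by (intro mx_diff[OF LS P] mx_mult[OF R] m IH c)
  qed
 qed
 let ?i = "n - p ^ a"
 define c0 where "c0 = coeff (PROD c:C. [:-c, 1:]) ?i"
 have "coeff ([:x, 1:] ^ n) ?i = of_nat B * x ^ (p ^ a)"
  using an by (subst coeff_linear_poly_power) (auto simp: B_def binomial_symmetric[of "p ^ a" n])
 hence c0: "c0:W" "c0 - of_nat B * x ^ (p ^ a):mx W" "c0:E"
  using cong[OF C(1) order_refl, rule_format, of ?i] C(4) unfolding c0_def n_def[symmetric] pols_def coeff_diff by auto
 define y where "y = c0 * of_nat b"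
 have y: "y:E" "y:W" unfolding y_def using c0 by (auto intro: sf_cl[OF ES] sr_cl[OF R])
 have "(c0 - of_nat B * x ^ (p ^ a)) * of_nat b:mx W" by (intro mx_mult[OF R c0(2)] sr_nat[OF R])
 moreover have "(c0 - of_nat B * x ^ (p ^ a)) * of_nat b = y - x ^ (p ^ a) * (of_nat B * of_nat b)" by (simp add: y_def algebra_simps)
 ultimately have yx: "y - x ^ (p ^ a):mx W" unfolding b by simp
 \<comment> \<open>The missing power of \<open>p\<close>: it raises the exponent
   \<open>p ^ a\<close> to \<open>p ^ (j * a)\<close>, and this power map fixes \<open>x\<close>
   modulo the maximal ideal.\<close>
 define e where "e = p ^ (j * a - a)"
 have ja: "a + (j * a - a) = j * a" using res(1) by (cases j) auto
 have "y ^ e - (x ^ (p ^ a)) ^ e:mx W" by (intro cong_power_max_ideal[OF R] y yx sr_pow[OF R] x)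
 moreover have "(x ^ (p ^ a)) ^ e = x ^ ((p ^ j) ^ a)" unfolding e_def power_mult[symmetric] power_add[symmetric] ja ..
 moreover have "x ^ ((p ^ j) ^ a) - x:mx W" using residue_power[OF LS P x] res(2) by (simp add: p_def)
 ultimately have "y ^ e - x:mx W" using cong_trans_max_ideal[OF LS P] by metis
 thus thesis using that[of "y ^ e"] y by (auto intro: sf_cl[OF ES] sr_cl[OF R])
qed

subsection \<open>Ramification index and full decomposition\<close>

text \<open>From here on ramification is tested by whether a uniformizer can be found in the base
  field. This condition passes to intermediate fields by \<open>unif_sub\<close>.\<close>

lemma ramification_index_eq_1:
 assumes F: "is_sf F" and U: "unif F (W Int F) s" and W: "unif L W po" and FL: "F <= L"
 shows "ramification_index F W = 1 <-> (EX t:F. unif L W t)"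
proof -
 have sF: "s:F" "s ~= 0" "s:L" "s:mx W" using unif_in_F[OF U] unif_nz[OF U] unif_mem[OF U] FL by (auto simp: mx_Int[OF F])
 define e where "e = nat (vl W s)"
 have e: "vl W s = int e" "e > 0" using val_ideal_iff[OF W sF(3,2)] sF(4) by (auto simp: e_def)
 have v: "vl W x = int e * vl (W Int F) x" if x: "x:F" "x ~= 0" for x
 proof -
  obtain w where w: "w:vunit (W Int F)" "x = w * s powi vl (W Int F) x" using val_expand[OF U x] .
  have wW: "w:vunit W" "w:L" "w ~= 0" using w(1) FL vunit_nz by (auto simp: mx_Int[OF F])
  have vp: "vl W (s powi m) = m * int e" "s powi m:L" for m
   using val_power[OF W sF(3,2)] val_inverse[OF W sF(3,2)] val_power[OF W sf_inv[OF unif_field[OF W] sF(3)]] e(1) sF(2,3)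
   by (auto simp: power_int_def intro: sf_cl[OF unif_field[OF W]])
  have "vl W x = vl W w + vl W (s powi vl (W Int F) x)"
   by (subst w(2), rule val_mult[OF W wW(2,3) vp(2)]) (use sF in simp)
  thus ?thesis using vp(1) val_vunit_iff[OF W wW(2,3)] wW(1) by simp
 qed
 have "ramification_index F W = e" unfolding ramification_index_def
 proof (rule the_equality)
  show "ALL x:F - {0}. vl W x = int e * vl (W Int F) x" using v by auto
  fix e' assume "ALL x:F - {0}. vl W x = int e' * vl (W Int F) x"
  thus "e' = e" using sF val_unif[OF U] e(1) by auto
 qed
 moreover have "e = 1 <-> (EX t:F. unif L W t)"
 proof
  assume "e = 1" thus "EX t:F. unif L W t" using uniformizerI[OF W sF(3,2)] e(1) sF(1) by auto
 next
  assume "EX t:F. unif L W t"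
  then obtain t where t: "t:F" "unif L W t" by blast
  have "1 = int e * vl (W Int F) t" using v[OF t(1) unif_nz[OF t(2)]] val_unif[OF t(2)] by simp
  thus "e = 1" by (metis dvdI int_dvd_int_iff of_nat_1 nat_dvd_1_iff_1)
 qed
 ultimately show ?thesis by simp
qed

theorem unramified_iff:
 assumes cb: "clb F" and L: "fing F L" and g: "gal F L" and d: "dvr F V"
 shows "unramified_at F V L <-> (ALL W. prm L W --> W Int F = V --> (EX t:F. unif L W t))"
proof -
 obtain s where U: "unif F V s" using d by (auto simp: dvr_def)
 have "ramification_index F W = 1 <-> (EX t:F. unif L W t)" if W: "prm L W" "W Int F = V" for W
 proof -
  have U': "unif F (W Int F) s" using U W(2) by simp
  obtain po where "unif L W po" using unif_ext[OF cb L g W(1) U'] by blast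
  thus ?thesis using ramification_index_eq_1[OF galD(1)[OF g] U' _ galD(3)[OF g]] by blast
 qed
 thus ?thesis unfolding unramified_at_def primes_above_def by auto
qed

text \<open>The primes above \<open>V\<close> form one orbit of \<open>Grp F L\<close>, whose order
  is the degree. The orbit has as many elements as the group exactly when stabilizers are trivial,
  and this can be tested at any one of the primes.\<close>

theorem decomposes_fully_iff:
 assumes cb: "clb F" and inf: "infinite F" and L: "fing F L" and g: "gal F L" and d: "dvr F V"
  and ex: "prm L W0" "W0 Int F = V"
 shows "decomposes_fully F V L <-> (ALL W. prm L W --> W Int F = V --> triv_on (decomp F W) L)"
proof -
 note fin = finite_Grp[OF cb L]
 obtain s where U: "unif F V s" using d by (auto simp: dvr_def)
 have dv: "dvr L W" if "prm L W" "W Int F = V" for W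
  using unif_ext[OF cb L g that(1)] U that(2) unfolding dvr_def by blast
 have deg: "ext_degree F L = card (Grp F L)" by (rule ext_degree_gal(2)[OF cb inf L g])
 have iff: "decomposes_fully F V L <-> triv_on (decomp F W) L" if W: "prm L W" "W Int F = V" for W
 proof -
  have WL: "W <= L" by (rule primeD(2)[OF W(1)])
  have img: "primes_above F V L = (%h. h ` W) ` Grp F L"
  proof (intro Set.set_eqI iffI)
   fix W' assume "W':primes_above F V L"
   hence W': "prm L W'" "W' Int F = V" by (auto simp: primes_above_def)
   obtain si where "si:Aut F" "si ` W = W'" using prime_trans[OF cb L g dv[OF W] dv[OF W']] W(2) W'(2) by metis
   thus "W':(%h. h ` W) ` Grp F L" unfolding Grp_def image_image restrict_image[OF WL] by blast
  next
   fix W' assume "W':(%h. h ` W) ` Grp F L"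
   then obtain si where s: "si:Aut F" "W' = si ` W" unfolding Grp_def image_image restrict_image[OF WL] by blast
   have "si ` W Int F = W Int F"
   proof -
    have "x:si ` W <-> x:W" if "x:F" for x
     using AutD(3)[OF s(1) that] aut_eq_iff[OF s(1)] by (metis image_iff)
    thus ?thesis by auto
   qed
   thus "W':primes_above F V L"
    using dvr_prime(1)[OF dvr_image[OF s(1) gal_image[OF g s(1)] dv[OF W]]] s(2) W(2) by (simp add: primes_above_def)
  qed
  have "decomposes_fully F V L <-> inj_on (%h. h ` W) (Grp F L)"
   unfolding decomposes_fully_def deg img using fin by (simp add: inj_on_iff_eq_card)
  also have "... <-> triv_on (decomp F W) L"
  proof
   assume i: "inj_on (%h. h ` W) (Grp F L)"
   show "triv_on (decomp F W) L" unfolding triv_on_def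
   proof (intro ballI)
    fix si x assume s: "si:decomp F W" and x: "x:L"
    have "restrict si L ` W = restrict (%x. x) L ` W" unfolding restrict_image[OF WL] using decompD(2)[OF s] by simp
    moreover have "restrict si L:Grp F L" "restrict (%x. x) L:Grp F L"
     unfolding Grp_def using decompD(1)[OF s] aut_id(2) by blast+
    ultimately have "restrict si L = restrict (%x. x) L" using inj_onD[OF i] by blast
    from fun_cong[OF this, of x] show "si x = x" using x by simp
   qed
  next
   assume tr: "triv_on (decomp F W) L"
   show "inj_on (%h. h ` W) (Grp F L)"
   proof (rule inj_onI)
    fix h h' assume "h:Grp F L" "h':Grp F L" and e: "h ` W = h' ` W"
    then obtain si ta where st: "si:Aut F" "ta:Aut F" "h = restrict si L" "h' = restrict ta L" by (auto simp: Grp_def)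
    have "si ` W = ta ` W" using e unfolding st(3,4) restrict_image[OF WL] .
    hence "(inv_into UNIV ta \<circ> si) ` W = W" using inv_image_eq(1)[OF st(2), of W] by (metis image_comp)
    hence "inv_into UNIV ta \<circ> si:decomp F W" using aut_comp[OF aut_inv[OF st(2)] st(1)] by (simp add: decomp_def)
    hence "inv_into UNIV ta (si x) = x" if "x:L" for x using tr that unfolding triv_on_def by (metis comp_apply)
    hence "si x = ta x" if "x:L" for x using that aut_inv_app(1)[OF st(2)] by metis
    thus "h = h'" unfolding st by (auto intro: restrict_ext)
   qed
  qed
  finally show ?thesis .
 qed
 show ?thesis using iff ex by blast
qed

section \<open>The rational function field\<close>

definition cst :: "'a::finite_field => 'a kbar" where "cst c = RT [:c:]"

lemma of_RT_0 [simp]: "RT 0 = 0" and of_RT_1 [simp]: "RT 1 = 1"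
 and of_RT_add: "RT (a + b) = RT a + RT b" and of_RT_diff: "RT (a - b) = RT a - RT b"
 and RT_mult: "RT (a * b) = RT a * RT b" and of_RT_uminus: "RT (- a) = - RT a"
 and of_RT_eq_0 [simp]: "RT a = 0 <-> a = 0" and of_RT_inj: "RT a = RT b <-> a = b"
 by (simp_all add: of_RT_def)

lemma of_RT_power: "RT (a ^ n) = RT a ^ n"
 by (induction n) (simp_all add: RT_mult)

lemma of_RT_sum: "RT (sum f A) = (SUM i:A. RT (f i))"
 by (induction A rule: infinite_finite_induct) (simp_all add: of_RT_add)

lemma cst_hom: "cst 0 = 0" "cst 1 = 1" "cst (a + b) = cst a + cst b" "cst (a * b) = cst a * cst b"
 "cst (a - b) = cst a - cst b" "cst a = 0 <-> a = 0" "cst (- a) = - cst a"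
 by (simp_all add: cst_def of_RT_add[symmetric] RT_mult[symmetric] of_RT_diff[symmetric] of_RT_uminus[symmetric] one_pCons[symmetric] mult.commute)

lemma cst_power: "cst (a ^ n) = cst a ^ n" by (induction n) (simp_all add: cst_hom)

lemma cst_inverse: "cst (inverse a) = inverse (cst a)"
proof (cases "a = 0")
 case False
 hence "cst a * cst (inverse a) = 1" by (simp add: cst_hom(4)[symmetric] cst_hom(2))
 thus ?thesis by (metis inverse_unique)
qed (simp add: cst_hom)

lemma cst_of_nat: "cst (of_nat n) = of_nat n" by (induction n) (simp_all add: cst_hom)

lemma CHAR_kbar: "CHAR('a::finite_field kbar) = CHAR('a)"
proof (rule CHAR_eqI)
 show "of_nat CHAR('a) = (0 :: 'a kbar)" by (simp add: cst_of_nat[symmetric] cst_hom)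
 fix n assume "of_nat n = (0 :: 'a kbar)"
 hence "(of_nat n :: 'a) = 0" by (simp add: cst_of_nat[symmetric] cst_hom)
 thus "CHAR('a) dvd n" by (simp add: of_nat_eq_0_iff_char_dvd)
qed

lemma CHAR_fract [simp]: "CHAR('a::finite_field poly fract) = CHAR('a)" using CHAR_kbar[where 'a='a] by simp

lemma CHAR_pr: "prime CHAR('a::finite_field kbar)" by simp

lemma cst_frob: "cst c ^ CARD('a) = cst (c :: 'a::finite_field)"
 by (simp add: cst_power[symmetric] finite_field_power_card_eq_same)

lemma of_RT_eval: "RT a = (SUM i<=degree a. cst (coeff a i) * TT ^ i)"
proof -
 have "RT (monom (coeff a i) i) = cst (coeff a i) * TT ^ i" for i
  by (simp add: monom_altdef cst_def RT_mult[symmetric] of_RT_power[symmetric])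
 hence "RT (SUM i<=degree a. monom (coeff a i) i) = (SUM i<=degree a. cst (coeff a i) * TT ^ i)"
  by (simp add: of_RT_sum)
 thus ?thesis by (simp only: poly_as_sum_of_monoms)
qed

lemma T_nonzero [simp]: "TT ~= 0" by simp

lemma k_field_iff: "x:kk <-> (EX a b. b ~= 0 & x = RT a / RT b)"
proof
 assume "x:kk"
 then obtain y where "x = to_ac y" by (auto simp: k_field_def)
 moreover obtain a b where "y = Fract a b" "b ~= 0" by (cases y)
 ultimately show "EX a b. b ~= 0 & x = RT a / RT b" by (auto simp: of_RT_def Fract_conv_to_fract)
next
 assume "EX a b. b ~= 0 & x = RT a / RT b"
 thus "x:kk" by (auto simp: k_field_def of_RT_def simp flip: to_ac_divide)
qed

lemma k_sf: "is_sf (kk :: 'a::finite_field kbar set)"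
 unfolding is_sf_def k_field_def
proof (intro conjI is_srI ballI)
 show "1:range to_ac" by (rule range_eqI[of _ _ 1]) simp
 fix x y :: "'a kbar" assume "x:range to_ac" "y:range to_ac"
 thus "x - y:range to_ac" "x * y:range to_ac" "inverse x:range to_ac"
  by (auto simp: to_ac_diff[symmetric] to_ac_mult[symmetric] to_ac_inverse[symmetric] simp del: to_ac_diff to_ac_mult to_ac_inverse)
qed

lemma RT_k: "RT a:kk" by (simp add: k_field_def of_RT_def)
lemma cst_k: "cst c:kk" by (simp add: cst_def RT_k)

lemma clb_k: "clb (kk :: 'a::finite_field kbar set)"
 unfolding clb_def
proof (intro conjI allI k_sf)
 fix x :: "'a kbar"
 obtain p where p: "p ~= 0" "poly (map_poly to_ac p) x = 0" using alg_closure_algebraic[of x] by blast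
 show "alg_over kk x"
  using p by (intro algebraic_overI[OF k_sf, of "map_poly to_ac p"])
   (auto simp: pols_def coeff_map_poly k_field_def map_poly_eq_0_iff)
qed

lemma infinite_k: "infinite (kk :: 'a::finite_field kbar set)"
proof
 assume "finite (kk :: 'a kbar set)"
 moreover have "range (%n::nat. TT ^ n :: 'a kbar) <= kk"
  using sr_pow[OF sf_sr[OF k_sf] RT_k] by blast
 moreover have "inj (%n::nat. TT ^ n :: 'a kbar)"
 proof (rule injI)
  fix m n :: nat assume "(TT ^ m :: 'a kbar) = TT ^ n"
  hence "([:0, 1:] :: 'a poly) ^ m = [:0, 1:] ^ n" by (simp add: of_RT_power[symmetric] of_RT_inj)
  hence "monom (1::'a) m = monom 1 n" by (simp add: monom_altdef)
  thus "m = n" by (metis degree_monom_eq zero_neq_one)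
 qed
 ultimately show False using finite_subset finite_imageD infinite_UNIV_nat by metis
qed

subsection \<open>Primes of the rational function field\<close>

lemma dvrI:
 assumes F: "is_sf F" and V: "is_sr V" "V <= F" and t: "t:V" "t ~= 0" "inverse t~:V"
  and e: "!!x. x:F ==> x ~= 0 ==> EX w:vunit V. EX n. x = w * t powi n"
 shows "unif F V t"
proof -
 have pos: "w * t powi n:V" if "w:vunit V" "n >= 0" for w n
  using that t(1) by (auto simp: power_int_def vunit_def intro!: sr_mult[OF V(1)] sr_pow[OF V(1)])
 have "x:V \<or> inverse x:V" if x: "x:F" for x
 proof (cases "x = 0")
  case False
  then obtain w n where w: "w:vunit V" "x = w * t powi n" using e[OF x] by blast
  hence "inverse x = inverse w * t powi (- n)" by (simp add: power_int_minus)
  thus ?thesis using pos[OF w(1), of n] pos[OF vunit_inv[OF V(1) w(1)], of "- n"] w(2) by (cases "n >= 0") auto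
 qed (simp add: sr_0[OF V(1)])
 hence "prm F V" unfolding prime_of_def sr_iff
  using V t sf_inv[OF F, of t] by auto
 thus ?thesis using F t e by (auto simp: unif_def max_ideal_def)
qed

lemma poly_factor_out:
 fixes a :: "'a::field poly"
 assumes P: "degree P > 0" and "a ~= 0"
 shows "EX n b. a = P ^ n * b & ~ P dvd b"
 using assms(2)
proof (induction "degree a" arbitrary: a rule: less_induct)
 case less
 show ?case
 proof (cases "P dvd a")
  case True
  then obtain c where c: "a = P * c" by auto
  hence "degree c < degree a" using less.prems P by (auto simp: degree_mult_eq)
  then obtain n b where "c = P ^ n * b" "~ P dvd b" using less.hyps[of c] less.prems c by auto
  thus ?thesis using c by (intro exI[of _ "Suc n"] exI[of _ b]) (simp add: mult.assoc)
 next
  case False thus ?thesis by (intro exI[of _ 0] exI[of _ a]) simp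
 qed
qed

lemma irr_deg: "irreducible (P :: 'a::field poly) ==> degree P > 0"
 by (metis Factorial_Ring.irreducible_def gr_zeroI is_unit_iff_degree)

lemma unif_fin:
 assumes P: "irreducible P"
 shows "unif kk (Pfin P) (RT P)"
proof (rule dvrI[OF k_sf])
 have pr: "prime_elem P" using P by (rule field_poly_irreducible_imp_prime)
 have P0: "P ~= 0" using P by auto
 have memI: "RT a / RT b:Pfin P" if "~ P dvd b" for a b using that by (auto simp: finite_prime_def)
 show "is_sr (Pfin P)"
 proof (rule is_srI)
  show "1:Pfin P" using memI[of 1 1] P by (simp add: irreducible_not_unit)
  fix x y assume "x:Pfin P" "y:Pfin P"
  then obtain a b c d where *: "~ P dvd b" "~ P dvd d" "x = RT a / RT b" "y = RT c / RT d"
   unfolding finite_prime_def by auto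
  have nd: "~ P dvd b * d" using * pr by (simp add: prime_elem_dvd_mult_iff)
  have nz: "b ~= 0" "d ~= 0" using * by auto
  have "x - y = RT (a * d - c * b) / RT (b * d)" "x * y = RT (a * c) / RT (b * d)"
   using nz by (simp_all add: * RT_mult of_RT_diff field_simps)
  thus "x - y:Pfin P" "x * y:Pfin P" using memI[OF nd] by simp_all
 qed
 show "Pfin P <= kk"
 proof
  fix x :: "'a kbar" assume "x:Pfin P"
  then obtain a b where ab: "~ P dvd b" "x = RT a / RT b" unfolding finite_prime_def by auto
  hence "b ~= 0" by auto
  thus "x:kk" using ab(2) k_field_iff by blast
 qed
 show "RT P:Pfin P" using memI[of 1 P] P by (simp add: irreducible_not_unit)
 show "RT P ~= 0" using P0 by simp
 show "inverse (RT P)~:Pfin P"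
 proof
  assume "inverse (RT P):Pfin P"
  then obtain a b where ab: "~ P dvd b" "inverse (RT P) = RT a / RT b" unfolding finite_prime_def by auto
  have "b ~= 0" using ab(1) by auto
  hence "RT b = RT (P * a)" using ab(2) P0 by (simp add: RT_mult field_simps)
  thus False using ab(1) of_RT_inj by (metis dvd_triv_left)
 qed
 fix x :: "'a kbar" assume "x:kk" "x ~= 0"
 then obtain a b where ab: "x = RT a / RT b" "b ~= 0" "a ~= 0" by (auto simp: k_field_iff)
 obtain i a' where a': "a = P ^ i * a'" "~ P dvd a'" using poly_factor_out[OF irr_deg[OF P] ab(3)] by blast
 obtain j b' where b': "b = P ^ j * b'" "~ P dvd b'" using poly_factor_out[OF irr_deg[OF P] ab(2)] by blast
 have nz: "a' ~= 0" "b' ~= 0" using a' b' by auto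
 have "RT a' / RT b':vunit (Pfin P)"
  unfolding vunit_def using memI[OF b'(2), of a'] memI[OF a'(2), of b'] nz by (simp add: inverse_divide)
 moreover have "x = RT a' / RT b' * RT P powi (int i - int j)"
  unfolding ab(1) by (subst a'(1), subst b'(1)) (use P0 nz in \<open>simp add: RT_mult of_RT_power power_int_diff field_simps\<close>)
 ultimately show "EX w:vunit (Pfin P). EX n. x = w * RT P powi n" by blast
qed

lemma Pinf_iff: "b ~= 0 ==> RT a / RT b:Pinf <-> degree a <= degree b \<or> a = 0"
proof
 assume b: "b ~= 0"
 { assume "RT a / RT b:Pinf"
  then obtain c d where cd: "d ~= 0" "degree c <= degree d" "RT a / RT b = RT c / RT d"
   unfolding infinite_prime_def by auto
  hence "RT (a * d) = RT (c * b)" using b by (simp add: RT_mult field_simps)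
  hence e: "a * d = c * b" by (simp add: of_RT_inj)
  show "degree a <= degree b \<or> a = 0"
  proof (cases "a = 0")
   case False
   hence "c ~= 0" using e cd(1) by auto
   thus ?thesis using arg_cong[OF e, of degree] False b cd by (simp add: degree_mult_eq)
  qed simp }
 assume "degree a <= degree b \<or> a = 0"
 thus "RT a / RT b:Pinf"
 proof
  assume "a = 0"
  hence "RT a / RT b = RT 0 / RT 1" by simp
  thus ?thesis unfolding infinite_prime_def by (metis (mono_tags, lifting) CollectI degree_0 le0 zero_neq_one)
 qed (use b in \<open>auto simp: infinite_prime_def\<close>)
qed

lemma unif_inf: "unif kk Pinf (1 / TT :: 'a::finite_field kbar)"
proof (rule dvrI[OF k_sf])
 let ?I = "Pinf :: 'a kbar set"
 have memI: "RT a / RT b:?I" if "b ~= 0" "degree a <= degree b" for a b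
  using that unfolding infinite_prime_def by auto
 show "is_sr ?I"
 proof (rule is_srI)
  show "1:?I" using memI[of 1 1] by simp
  fix x y assume "x:?I" "y:?I"
  then obtain a b c d where *: "b ~= 0" "degree a <= degree b" "d ~= 0" "degree c <= degree d"
   "x = RT a / RT b" "y = RT c / RT d" unfolding infinite_prime_def by auto
  have nz: "b * d ~= 0" using * by simp
  have "degree (a * d - c * b) <= degree (b * d)" "degree (a * c) <= degree (b * d)"
   using * degree_mult_le[of a d] degree_mult_le[of c b] degree_mult_le[of a c]
   by (auto simp: degree_mult_eq intro!: degree_diff_le)
  moreover have "x - y = RT (a * d - c * b) / RT (b * d)" "x * y = RT (a * c) / RT (b * d)"
   using *(1,3) by (simp_all add: *(5,6) RT_mult of_RT_diff diff_frac_eq)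
  ultimately show "x - y:?I" "x * y:?I" using memI[OF nz] by simp_all
 qed
 show "?I <= kk"
 proof
  fix x :: "'a kbar" assume "x:?I"
  thus "x:kk" unfolding infinite_prime_def using k_field_iff by blast
 qed
 show "1 / TT:?I" using memI[of "[:0,1:]" 1] by simp
 show "(1 / TT :: 'a kbar) ~= 0" by simp
 show "inverse (1 / TT)~:?I" using Pinf_iff[of 1 "[:0,1::'a:]"] by (simp add: inverse_divide)
 fix x :: "'a kbar" assume "x:kk" "x ~= 0"
 then obtain a b where ab: "x = RT a / RT b" "b ~= 0" "a ~= 0" by (auto simp: k_field_iff)
 \<comment> \<open>Powers of \<open>T\<close> equalise the two degrees, which makes the quotient a
   unit at infinity.\<close>
 let ?a = "a * [:0,1:] ^ degree b" and ?b = "b * [:0,1:] ^ degree a"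
 have nz: "?a ~= 0" "?b ~= 0" using ab by auto
 have "degree ?a = degree ?b" using ab by (simp add: degree_mult_eq degree_power_eq)
 hence "RT ?a / RT ?b:vunit ?I"
  unfolding vunit_def using memI[OF nz(2), of ?a] memI[OF nz(1), of ?b] nz by (simp add: inverse_divide)
 moreover have "x = RT ?a / RT ?b * (1 / TT) powi (int (degree b) - int (degree a))"
  using ab by (simp add: RT_mult of_RT_power power_int_diff power_one_over field_simps)
 ultimately show "EX w:vunit ?I. EX n. x = w * (1 / TT) powi n" by blast
qed

text \<open>If \<open>c\<close> were outside \<open>W\<close>, its inverse would be inside, but
  \<open>c\<close> is the power of its inverse with exponent \<open>q - 2\<close>.\<close>

lemma const_prime:
 assumes "prm L W" "c:L" "c ^ q = c" "q > 1" shows "c:W"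
proof (rule ccontr)
 note R = primeD(1)[OF assms(1)]
 assume n: "c~:W"
 hence i: "inverse c:W" "c ~= 0" using primeD(4)[OF assms(1,2)] sr_0[OF R] by auto
 obtain m where m: "q = Suc (Suc m)" using less_imp_Suc_add[OF assms(4)] by auto
 hence "c ^ m * c = 1" using assms(3) i(2) by (simp add: mult.commute)
 hence "c * c ^ m = 1" by (simp only: mult.commute)
 hence "c ^ m = inverse c" by (rule inverse_unique[symmetric])
 hence "inverse c ^ m = c" by (simp add: power_inverse)
 hence "inverse c ^ (q - 2) = c" using m by simp
 thus False using sr_pow[OF R i(1), of "q - 2"] n by simp
qed

lemma card_gt: "CARD('a::finite_field) > 1"
 using card_mono[of UNIV "{0, 1 :: 'a}"] by simp

context
 fixes V :: "'a::finite_field kbar set"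
 assumes V: "prm kk V"
begin

lemma cst_prime: "cst c:V"
 by (rule const_prime[OF V cst_k cst_frob card_gt])

lemma RT_prime: "TT:V ==> RT a:V"
 unfolding of_RT_eval[of a] by (intro sr_sum sr_mult sr_pow primeD(1)[OF V] cst_prime)

text \<open>Since \<open>1/T\<close> is in the maximal ideal, a polynomial divided by the power of
  \<open>T\<close> of its degree is congruent to its leading coefficient, hence a unit. So
  \<open>V\<close> contains the valuation ring at infinity, which is maximal.\<close>

lemma prime_infinite: assumes "TT~:V" shows "V = Pinf"
proof -
 have t: "1 / TT:mx V" using not_in_prime[OF V RT_k assms] by (simp add: divide_inverse)
 note R = primeD(1)[OF V]
 have low: "RT a / TT ^ n:V" if "degree a <= n" for a n
 proof -
  have "RT a / TT ^ n = (SUM i<=degree a. cst (coeff a i) * (1 / TT) ^ (n - i))"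
   unfolding of_RT_eval[of a] sum_divide_distrib
  proof (rule sum.cong[OF refl])
   fix i assume "i:{..degree a}"
   hence "(TT :: 'a kbar) ^ n = TT ^ i * TT ^ (n - i)" using that by (simp add: power_add[symmetric])
   thus "cst (coeff a i) * TT ^ i / TT ^ n = cst (coeff a i) * (1 / TT) ^ (n - i)" by (simp add: power_one_over)
  qed
  thus ?thesis using mx_sub[OF t] by (simp only:) (intro sr_sum[OF R] sr_mult[OF R] sr_pow[OF R] cst_prime)
 qed
 have "Pinf <= V"
 proof
  fix x :: "'a kbar" assume "x:Pinf"
  then obtain a b where ab: "b ~= 0" "degree a <= degree b" "x = RT a / RT b" unfolding infinite_prime_def by auto
  define n where "n = degree b"
  define b' where "b' = b - monom (lead_coeff b) n"
  have "RT b / TT ^ n = cst (lead_coeff b) + RT b' / TT ^ n"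
   by (simp add: b'_def of_RT_diff monom_altdef RT_mult[symmetric] cst_def of_RT_power[symmetric] field_simps)
  moreover have "RT b' / TT ^ n:mx V"
  proof (cases "b' = 0")
   case False
   have "coeff b' n = 0" "degree b' <= n" by (auto simp: b'_def n_def intro!: degree_diff_le degree_monom_le)
   hence "degree b' < n" using False by (metis leading_coeff_0_iff le_neq_implies_less)
   then obtain k where k: "n = Suc k" "degree b' <= k" by (cases n) auto
   show ?thesis using mx_mult[OF R t low[OF k(2)]] k(1) by simp
  qed (simp add: mx_0[OF R])
  moreover have "cst (lead_coeff b):vunit V"
   using ab(1) cst_prime[of "lead_coeff b"] cst_prime[of "inverse (lead_coeff b)"] by (simp add: vunit_def cst_inverse cst_hom)
  ultimately have "RT b / TT ^ n:vunit V" using vunit_add[OF k_sf V] by simp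
  hence "inverse (RT b / TT ^ n):V" by (simp add: vunit_def)
  from sr_mult[OF R low[of a n] this] show "x:V" using ab by (simp add: n_def)
 qed
 thus ?thesis using dvr_maximal[OF _ V] unif_inf unfolding dvr_def by blast
qed

lemma const_not_ideal: assumes "c ~= 0" "degree c = 0" shows "RT c~:mx V"
proof -
 obtain d where "c = [:d:]" using assms(2) by (rule degree_eq_zeroE)
 hence "RT c = cst d" "d ~= 0" using assms(1) by (auto simp: cst_def)
 thus ?thesis using cst_prime[of "inverse d"] by (simp add: max_ideal_def cst_inverse cst_hom)
qed

lemma fin_ex: assumes "TT:V" obtains P where "irreducible P" "RT P:mx V"
  "!!b. RT b:mx V ==> P dvd b"
proof -
 note R = primeD(1)[OF V]
 have "EX b. b ~= 0 & RT b:mx V"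
 proof (rule ccontr)
  assume n: "~ ?thesis"
  have "kk <= V"
  proof
   fix x :: "'a kbar" assume "x:kk"
   then obtain a b where ab: "b ~= 0" "x = RT a / RT b" by (auto simp: k_field_iff)
   hence "RT b:vunit V" using n RT_prime[OF assms, of b] by (auto simp: mx_iff)
   thus "x:V" using sr_mult[OF R RT_prime[OF assms, of a]] ab(2) by (simp add: vunit_def divide_inverse)
  qed
  thus False using primeD(2,3)[OF V] by auto
 qed
 then obtain P where P: "P ~= 0 & RT P:mx V" and min: "!!b. b ~= 0 & RT b:mx V ==> degree P <= degree b"
  using ex_has_least_nat[of "%b. b ~= 0 & RT b:mx V" _ degree] by blast
 have "P dvd b" if "RT b:mx V" for b
 proof -
  have "RT (b mod P) = RT b - RT P * RT (b div P)"
   by (simp add: RT_mult[symmetric] of_RT_diff[symmetric] minus_mult_div_eq_mod)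
  hence "RT (b mod P):mx V"
   using mx_diff[OF k_sf V that mx_mult[OF R _ RT_prime[OF assms]]] P by simp
  hence "b mod P = 0" using min degree_mod_less[of P b] P by (metis leD)
  thus ?thesis by (simp add: dvd_eq_mod_eq_0)
 qed
 moreover have "irreducible P"
 proof (rule Factorial_Ring.irreducibleI)
  show "P ~= 0" using P by simp
  show "~ P dvd 1" using P const_not_ideal is_unit_iff_degree by blast
  fix a b assume ab: "P = a * b"
  hence nz: "a ~= 0" "b ~= 0" using P by auto
  have "RT a:mx V \<or> RT b:mx V"
   using mx_prime[OF R RT_prime[OF assms] RT_prime[OF assms], of a b] P ab by (simp add: RT_mult)
  hence "degree P <= degree a \<or> degree P <= degree b" using min nz by blast
  thus "a dvd 1 \<or> b dvd 1" using ab nz by (auto simp: degree_mult_eq is_unit_iff_degree)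
 qed
 ultimately show thesis using that P by blast
qed

lemma prime_finite: assumes "irreducible P" "TT:V" "RT P:mx V" shows "V = Pfin P"
proof -
 note R = primeD(1)[OF V]
 obtain g where g: "irreducible g" "!!b. RT b:mx V ==> g dvd b" using fin_ex[OF assms(2)] by metis
 obtain h where h: "P = g * h" using g(2)[OF assms(3)] by auto
 hence "h dvd 1" using Factorial_Ring.irreducibleD[OF assms(1) h] irreducible_not_unit[OF g(1)] by blast
 hence Pg: "P dvd g" unfolding h by (metis dvd_refl mult.right_neutral mult_dvd_mono)
 have "Pfin P <= V"
 proof
  fix x :: "'a kbar" assume "x:Pfin P"
  then obtain a b where ab: "~ P dvd b" "x = RT a / RT b" unfolding finite_prime_def by auto
  hence "RT b~:mx V" using g(2) Pg dvd_trans by blast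
  hence "RT b:vunit V" using RT_prime[OF assms(2)] by (simp add: mx_iff)
  thus "x:V" using sr_mult[OF R RT_prime[OF assms(2), of a]] ab(2) by (simp add: vunit_def divide_inverse)
 qed
 thus ?thesis using dvr_maximal[OF _ V] unif_fin[OF assms(1)] unfolding dvr_def by blast
qed

lemma prime_dvr: "dvr kk V"
 using prime_infinite prime_finite fin_ex unif_inf unif_fin
 unfolding dvr_def by metis

end

lemma dvr_k:
 assumes L: "fing kk L" and g: "gal kk L" and W: "prm L W" shows "dvr L W"
proof -
 have "prm kk (W Int kk)" by (rule pr_rest[OF clb_k galD(2,3)[OF g] W])
 then obtain t where "unif kk (W Int kk) t" using prime_dvr unfolding dvr_def by blast
 thus ?thesis using unif_ext[OF clb_k L g W] unfolding dvr_def by blast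
qed

subsection \<open>Residue fields are algebraic over the prime field\<close>

text \<open>The bound for the number of roots over the residue field, without forming that field:
  synthetic division by the first root lowers the degree, and primality of the maximal ideal makes
  the other roots, incongruent to the first, roots of the quotient.\<close>

lemma roots_mod_max_ideal:
 fixes W :: "'b::field set" and r :: "nat => 'b"
 assumes R: "is_sr W" and f: "f:pols W" "EX i. coeff f i~:mx W"
  and r: "!!i. r i:W" "!!i j. i < j ==> r j - r i~:mx W"
  and add: "!!x y. x:mx W ==> y:mx W ==> x + y:mx W"
  and z: "!!i. poly f (r i):mx W"
 shows False
 using f r z
proof (induction "degree f" arbitrary: f r)
 case 0
 then obtain c where c: "f = [:c:]" using degree_eq_zeroE by metis
 have "coeff [:c:] i:mx W" for i using 0(6)[of 0] mx_0[OF R] by (cases i) (simp_all add: c)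
 thus False using 0(3) c by blast
next
 case (Suc n)
 define h where "h = synthetic_div f (r 0)"
 have fh: "f = [:- r 0, 1:] * h + [:poly f (r 0):]"
  using synthetic_div_correct'[of "r 0" f] by (simp add: h_def)
 have co: "coeff f i = (if i = 0 then poly f (r 0) else coeff h (i - 1)) - r 0 * coeff h i" for i
  by (subst fh) (cases i; simp add: coeff_pCons)
 have hW: "coeff h i:W" for i
 proof (induction "degree f + 1 - i" arbitrary: i rule: less_induct)
  case less
  show ?case
  proof (cases "i > degree f")
   case True
   hence "coeff h i = 0" unfolding h_def by (intro coeff_eq_0) (simp add: degree_synthetic_div)
   thus ?thesis by (simp add: sr_0[OF R])
  next
   case False
   have "coeff h i = coeff f (Suc i) + r 0 * coeff h (Suc i)" using co[of "Suc i"] by simp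
   moreover have "coeff h (Suc i):W" by (rule less) (use False in auto)
   ultimately show ?thesis using Suc.prems(1,3) by (auto simp: pols_def intro!: sr_add[OF R] sr_mult[OF R])
  qed
 qed
 have "EX i. coeff h i~:mx W"
 proof (rule ccontr)
  assume "~ ?thesis"
  hence m: "coeff h i:mx W" for i by blast
  have "coeff f i:mx W" for i
  proof -
   have "coeff f i = (if i = 0 then poly f (r 0) else coeff h (i - 1)) + coeff h i * (- r 0)" using co[of i] by (simp add: mult.commute)
   thus ?thesis using m Suc.prems(3,5) by (simp only:) (intro add mx_mult[OF R] sr_um[OF R], auto)
  qed
  thus False using Suc.prems(2) by blast
 qed
 moreover have "poly h (r (Suc i)):mx W" for i
 proof -
  have "(r (Suc i) - r 0) * poly h (r (Suc i)) = poly f (r (Suc i)) + - poly f (r 0)" by (subst (1) fh) (simp add: algebra_simps)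
  moreover have "poly f (r (Suc i)) + - poly f (r 0):mx W" by (intro add mx_um[OF R] Suc.prems)
  moreover have "poly h (r (Suc i)):W" using hW Suc.prems(3) by (intro poly_in_subring[OF R]) (simp_all add: pols_def)
  ultimately show ?thesis
   using mx_prime[OF R, of "r (Suc i) - r 0" "poly h (r (Suc i))"] Suc.prems(3,4) sr_diff[OF R] by auto
 qed
 moreover have "n = degree h" using Suc.hyps(2) by (simp add: h_def degree_synthetic_div)
 moreover have "h:pols W" using hW by (simp add: pols_def)
 ultimately show False using Suc.hyps(1)[of h "%i. r (Suc i)"] Suc.prems(3,4) by (simp del: One_nat_def)
qed

text \<open>Algebraicity of the residue of \<open>x\<close> over the prime field, stated as
  invariance under a power of Frobenius.\<close>

definition res_alg :: "'a::finite_field kbar set => 'a kbar => bool" where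
 "res_alg W x <-> x:W & (EX j>0. x ^ (CHAR('a) ^ j) - x:mx W)"

context
 fixes L W :: "'a::finite_field kbar set"
 assumes L: "is_sf L" and W: "prm L W"
begin

lemma res_alg_common:
 assumes "finite S" "!!x. x:S ==> res_alg W x"
 shows "EX j>0. ALL x:S. x ^ (CHAR('a) ^ j) - x:mx W"
 using assms
proof (induction S rule: finite_induct)
 case (insert a S)
 then obtain j where j: "j > 0" "ALL x:S. x ^ (CHAR('a) ^ j) - x:mx W" by auto
 obtain i where i: "i > 0" "a:W" "a ^ (CHAR('a) ^ i) - a:mx W" using insert.prems[of a] by (auto simp: res_alg_def)
 have "x ^ (CHAR('a) ^ (i * j)) - x:mx W" if "x:insert a S" for x
 proof (cases "x = a")
  case True thus ?thesis using residue_power[OF L W i(2,3), of j] by (simp add: power_mult)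
 next
  case False
  hence "x:W" "x ^ (CHAR('a) ^ j) - x:mx W" using that j insert.prems[of x] by (auto simp: res_alg_def)
  thus ?thesis using residue_power[OF L W, of x _ i] by (simp add: power_mult mult.commute[of i j])
 qed
 thus ?case using i(1) j(1) by (intro exI[of _ "i * j"]) auto
qed auto

text \<open>Frobenius permutes the roots of a polynomial over a finite residue field, so that a root has only
 finitely many Frobenius iterates.\<close>

lemma res_alg_root:
 assumes x: "x:W" and f: "!!i. res_alg W (coeff f i)" "EX i. coeff f i~:mx W" and z: "poly f x:mx W"
 shows "res_alg W x"
proof -
 note R = primeD(1)[OF W]
 note ch = CHAR_pr[where 'a='a]
 obtain j where j: "j > 0" "!!i. i <= degree f ==> coeff f i ^ (CHAR('a) ^ j) - coeff f i:mx W"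
  using res_alg_common[of "coeff f ` {..degree f}"] f(1) by auto
 define Q where "Q = CHAR('a) ^ j"
 have Q: "Q = CHAR('a kbar) ^ j" by (simp add: Q_def CHAR_kbar)
 have fW: "f:pols W" using f(1) by (auto simp: pols_def res_alg_def)
 have step: "poly f (y ^ Q):mx W" if y: "y:W" "poly f y:mx W" for y
 proof -
  have "poly f y ^ Q:mx W"
   using y mx_mult[OF R y(2), of "poly f y ^ (Q - 1)"] sr_pow[OF R mx_sub[OF y(2)], of "Q - 1"]
    prime_gt_0_nat[OF CHAR_prime[where 'a='a]] by (cases Q) (auto simp: Q_def)
  moreover have "poly f y ^ Q = (SUM i<=degree f. coeff f i ^ Q * y ^ (Q * i))"
   unfolding poly_altdef freshmans_dream_sum'[OF ch Q] by (simp add: power_mult_distrib power_mult[symmetric] mult.commute)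
  moreover have "poly f (y ^ Q) = (SUM i<=degree f. coeff f i * y ^ (Q * i))" by (simp add: poly_altdef power_mult)
  ultimately have "poly f (y ^ Q) = poly f y ^ Q - (SUM i<=degree f. (coeff f i ^ Q - coeff f i) * y ^ (Q * i))"
   by (simp add: sum_subtractf algebra_simps)
  moreover have "(SUM i<=degree f. (coeff f i ^ Q - coeff f i) * y ^ (Q * i)):mx W"
   using j(2) y(1) by (intro mx_sum[OF L W] mx_mult[OF R] sr_pow[OF R]) (auto simp: Q_def)
  ultimately show ?thesis using mx_diff[OF L W] `poly f y ^ Q:mx W` by simp
 qed
 define r where "r i = x ^ (Q ^ i)" for i
 have rW: "r i:W" for i unfolding r_def by (rule sr_pow[OF R x])
 have rS: "r (Suc i) = r i ^ Q" for i by (simp add: r_def power_mult[symmetric] mult.commute)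
 have rz: "poly f (r i):mx W" for i
  by (induction i) (use z step rW in \<open>auto simp: rS simp: r_def[of 0]\<close>)
 have "EX i k. i < k & r k - r i:mx W"
  using roots_mod_max_ideal[OF R fW f(2) rW _ mx_add[OF L W] rz] by blast
 then obtain i k where ik: "i < k" "r k - r i:mx W" by blast
 define d where "d = k - i"
 have pw: "Q ^ i = CHAR('a kbar) ^ (j * i)" by (simp add: Q power_mult)
 have "r k = (x ^ (Q ^ d)) ^ (Q ^ i)" using ik(1) by (simp add: r_def d_def power_mult[symmetric] power_add[symmetric])
 moreover have "(x ^ (Q ^ d) - x) ^ (Q ^ i) + x ^ (Q ^ i) = (x ^ (Q ^ d)) ^ (Q ^ i)"
  using freshmans_dream'[OF ch pw, of "x ^ (Q ^ d) - x" x] by simp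
 ultimately have "(x ^ (Q ^ d) - x) ^ (Q ^ i) = r k - r i" by (simp add: r_def eq_diff_eq)
 hence "(x ^ (Q ^ d) - x) ^ (Q ^ i):mx W" using ik(2) by simp
 moreover have "x ^ (Q ^ d) - x:W" by (intro sr_diff[OF R] sr_pow[OF R] x)
 moreover have "Q ^ i > 0" using prime_gt_0_nat[OF CHAR_prime[where 'a='a]] by (simp add: Q_def)
 ultimately have "x ^ (Q ^ d) - x:mx W" using vunit_power_iff[OF R] by (auto simp: mx_iff)
 thus ?thesis using x ik(1) j(1) unfolding res_alg_def
  by (intro conjI exI[of _ "j * d"]) (auto simp: Q_def d_def power_mult)
qed

lemma res_alg_ideal: assumes "x:mx W" shows "res_alg W x"
proof -
 have "x * x ^ (CHAR('a) - 1) - x:mx W"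
  using mx_sub[OF assms] by (intro mx_diff[OF L W] mx_mult[OF primeD(1)[OF W] assms] sr_pow[OF primeD(1)[OF W]] assms)
 thus ?thesis using mx_sub[OF assms] prime_gt_0_nat[OF CHAR_prime[where 'a='a]]
  unfolding res_alg_def by (intro conjI exI[of _ 1]) (auto simp: power_Suc[symmetric] simp del: power_Suc)
qed

lemma res_alg_add_mult: assumes "res_alg W x" "res_alg W y" shows "res_alg W (x + y)" "res_alg W (x * y)"
proof -
 note R = primeD(1)[OF W]
 obtain j where j: "j > 0" "x ^ (CHAR('a) ^ j) - x:mx W" "y ^ (CHAR('a) ^ j) - y:mx W"
  using res_alg_common[of "{x, y}"] assms by auto
 have xy: "x:W" "y:W" using assms by (auto simp: res_alg_def)
 define Q where "Q = CHAR('a) ^ j"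
 have "(x + y) ^ Q = x ^ Q + y ^ Q" by (rule freshmans_dream'[OF CHAR_pr]) (simp add: Q_def)
 hence "(x + y) ^ Q - (x + y) = (x ^ Q - x) + (y ^ Q - y)" "(x * y) ^ Q - x * y = (x ^ Q - x) * y ^ Q + (y ^ Q - y) * x"
  by (simp_all add: power_mult_distrib algebra_simps)
 moreover have "(x ^ Q - x) + (y ^ Q - y):mx W" "(x ^ Q - x) * y ^ Q + (y ^ Q - y) * x:mx W"
  using j xy by (auto simp: Q_def intro!: mx_add[OF L W] mx_mult[OF R] sr_pow[OF R])
 ultimately have "(x + y) ^ Q - (x + y):mx W" "(x * y) ^ Q - x * y:mx W" by (simp_all only:)
 thus "res_alg W (x + y)" "res_alg W (x * y)"
  using j(1) sr_add[OF R xy] sr_mult[OF R xy] unfolding res_alg_def Q_def by blast+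
qed

lemma res_alg_fixed: assumes "x:W" "x ^ (CHAR('a) ^ j) = x" "j > 0" shows "res_alg W x"
 using assms mx_0[OF primeD(1)[OF W]] unfolding res_alg_def by auto

lemma res_alg_sum: "(!!i. i:A ==> res_alg W (f i)) ==> res_alg W (sum f A)"
 by (induction A rule: infinite_finite_induct)
  (auto intro: res_alg_add_mult res_alg_ideal mx_0[OF primeD(1)[OF W]])

lemma res_alg_power: "res_alg W x ==> res_alg W (x ^ n)"
 by (induction n) (auto intro: res_alg_add_mult res_alg_fixed[of 1 1] sr_1[OF primeD(1)[OF W]])

lemma res_alg_cst: assumes "kk <= L" shows "res_alg W (cst c)"
proof -
 note R = primeD(1)[OF W]
 have c: "cst c:W" using const_prime[OF W _ cst_frob card_gt] assms cst_k by blast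
 have one: "res_alg W 1" "res_alg W 0" "res_alg W (- 1)"
  using sr_cl[OF R] minus_power_prime_CHAR[OF CHAR_kbar[symmetric] CHAR_prime, of 1]
  by (auto intro!: res_alg_fixed[of _ 1])
 let ?f = "monom 1 CARD('a) - monom 1 1 :: 'a kbar poly"
 have "res_alg W (coeff ?f i)" for i using one card_gt[where 'a='a] by simp
 moreover have "coeff ?f CARD('a)~:mx W" using mx_1[OF R] card_gt[where 'a='a] by simp
 moreover have "poly ?f (cst c):mx W" using mx_0[OF R] by (simp add: poly_monom cst_frob)
 ultimately show ?thesis using res_alg_root[OF c] by blast
qed

end

lemma Pinf_residue:
 assumes "x:Pinf" obtains c where "x - cst c:mx Pinf"
proof -
 obtain a b where ab: "b ~= 0" "degree a <= degree b" "x = RT a / RT b" using assms unfolding infinite_prime_def by auto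
 define c where "c = coeff a (degree b) / lead_coeff b"
 define d where "d = a - smult c b"
 have x: "x - cst c = RT d / RT b"
  using ab(1) by (simp add: ab(3) d_def of_RT_diff cst_def field_simps RT_mult[symmetric])
 have "RT d / RT b:mx Pinf"
 proof (cases "d = 0")
  case True thus ?thesis using mx_0[OF unif_sr[OF unif_inf]] by simp
 next
  case False
  have "coeff d (degree b) = 0" "degree d <= degree b" using ab by (auto simp: d_def c_def intro!: degree_diff_le order.trans[OF degree_smult_le])
  hence "degree d < degree b" using False by (metis leading_coeff_0_iff le_neq_implies_less)
  thus ?thesis using False ab(1) by (simp add: max_ideal_def Pinf_iff inverse_divide)
 qed
 thus thesis using that[of c] x by simp
qed

text \<open>On \<open>k\<close> the residues come from constants (at infinity) or from
  \<open>T\<close>, a root of \<open>P\<close> modulo the prime, and from quotients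
  \<open>a / b\<close>, roots of \<open>b X - a\<close>. The general case takes a polynomial over
  \<open>k\<close> vanishing at \<open>x\<close>.\<close>

theorem residue_alg:
 fixes L :: "'a::finite_field kbar set"
 assumes L: "is_sf L" "kk <= L" and W: "prm L W" and x: "x:W"
 shows "res_alg W x"
proof -
 note R = primeD(1)[OF W]
 define V where "V = W Int kk"
 have V: "prm kk V" unfolding V_def by (rule pr_rest[OF clb_k L W])
 have mV: "mx V <= mx W" unfolding V_def mx_Int[OF k_sf] by auto
 have base: "res_alg W y" if y: "y:V" for y
 proof (cases "TT:V")
  case False
  hence "V = Pinf" by (rule prime_infinite[OF V])
  then obtain c where "y - cst c:mx W" using Pinf_residue[of y] y mV by blast
  from res_alg_add_mult(1)[OF L(1) W res_alg_ideal[OF L(1) W this] res_alg_cst[OF L(1) W L(2), of c]] show ?thesis by simp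
 next
  case True
  obtain P where P: "irreducible P" "RT P:mx V" using fin_ex[OF V True] by metis
  have TW: "TT:W" using True by (simp add: V_def)
  have "res_alg W TT"
  proof (rule res_alg_root[OF L(1) W TW, of "map_poly cst P"])
   show "res_alg W (coeff (map_poly cst P) i)" for i by (simp add: coeff_map_poly cst_hom res_alg_cst[OF L(1) W L(2)])
   have "coeff (map_poly cst P) (degree P):vunit W"
    using irr_deg[OF P(1)] res_alg_cst[OF L(1) W L(2), of "lead_coeff P"] res_alg_cst[OF L(1) W L(2), of "inverse (lead_coeff P)"]
    by (auto simp: coeff_map_poly cst_hom vunit_def res_alg_def cst_inverse)
   thus "EX i. coeff (map_poly cst P) i~:mx W" by (auto simp: mx_iff)
   have "poly (map_poly cst P) TT = RT P"
    by (simp add: poly_altdef of_RT_eval[of P] coeff_map_poly cst_hom degree_map_poly)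
   thus "poly (map_poly cst P) TT:mx W" using P(2) mV by auto
  qed
  hence pol: "res_alg W (RT a)" for a
   unfolding of_RT_eval[of a]
   by (intro res_alg_sum[OF L(1) W] res_alg_add_mult(2)[OF L(1) W] res_alg_cst[OF L(1) W L(2)] res_alg_power[OF L(1) W])
  have "V = Pfin P" by (rule prime_finite[OF V P(1) True P(2)])
  then obtain a b where ab: "~ P dvd b" "y = RT a / RT b" using y unfolding finite_prime_def by auto
  have b0: "b ~= 0" using ab(1) by auto
  have bu: "RT b:vunit W"
  proof -
   have "1 / RT b:Pfin P" using ab(1) unfolding finite_prime_def by (metis (mono_tags, lifting) CollectI of_RT_1)
   hence "inverse (RT b):W" using `V = Pfin P` by (auto simp: V_def divide_inverse)
   thus ?thesis using pol[of b] b0 by (simp add: vunit_def res_alg_def)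
  qed
  show ?thesis
  proof (rule res_alg_root[OF L(1) W, of y "[:- RT a, RT b:]"])
   show "y:W" using y by (simp add: V_def)
   show "res_alg W (coeff [:- RT a, RT b:] i)" for i
    using pol[of "- a"] pol[of b] pol[of 0] by (auto simp: coeff_pCons of_RT_uminus split: nat.splits)
   show "EX i. coeff [:- RT a, RT b:] i~:mx W" using bu by (intro exI[of _ 1]) (auto simp: mx_iff)
   show "poly [:- RT a, RT b:] y:mx W" using ab(2) b0 mx_0[OF R] by simp
  qed
 qed
 obtain p where p: "p:pols kk" "lead_coeff p = 1" "poly p x = 0"
  using clb_alg[OF clb_k, of x] by (auto simp: alg_over_def)
 have pk: "coeff p i:kk" for i using p(1) by (simp add: pols_def)
 \<comment> \<open>Division by a dominant coefficient makes the polynomial integral while keeping it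
   nonzero modulo the maximal ideal.\<close>
 obtain i0 where i0: "coeff p i0 ~= 0" "!!j. j <= degree p ==> coeff p j / coeff p i0:V"
  using dominant_term[OF k_sf V, of "{..degree p}" "coeff p"] pk p(2) by (metis atMost_iff finite_atMost order_refl zero_neq_one)
 show ?thesis
 proof (rule res_alg_root[OF L(1) W x, of "smult (inverse (coeff p i0)) p"])
  show "res_alg W (coeff (smult (inverse (coeff p i0)) p) i)" for i
  proof (cases "i <= degree p")
   case True thus ?thesis using base[OF i0(2)[OF True]] by (simp add: divide_inverse mult.commute)
  next
   case False
   thus ?thesis using base[OF sr_0[OF primeD(1)[OF V]]] by (simp add: coeff_eq_0)
  qed
  show "EX i. coeff (smult (inverse (coeff p i0)) p) i~:mx W" using i0(1) mx_1[OF R] by (intro exI[of _ i0]) simp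
  show "poly (smult (inverse (coeff p i0)) p) x:mx W" using p(3) mx_0[OF R] by simp
 qed
qed

subsection \<open>Existence of primes above a given prime\<close>

text \<open>The reduction map at infinity, or the evaluation of polynomials at a root of
  \<open>P\<close>, is extended to a place of the closure. A nonzero element of the kernel shows
  that the valuation ring obtained is proper.\<close>

lemma place_over_k:
 assumes V: "prm kk (V :: 'a::finite_field kbar set)"
 obtains O' where "prm UNIV O'" "O' Int kk = V"
proof -
 note outer = that
 have fin: thesis if O': "is_sr O'" "hom_on O' ps" "!!x. x:O' \<or> inverse x:O'" and t: "t:O'" "t ~= 0" "ps t = 0"
  and sub: "prm UNIV O' ==> O' Int kk = V" for O' and ps :: "'a kbar => 'a kbar" and t
 proof -
  have "inverse t~:O'"
  proof
   assume "inverse t:O'"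
   hence "ps (t * inverse t) = 0" using hom_on_mult[OF O'(1,2) t(1)] t(3) by simp
   thus False using t(2) hom_on_one[OF O'(1,2)] by simp
  qed
  hence "prm UNIV O'" unfolding prime_of_def sr_iff using O' by auto
  thus thesis using outer sub by blast
 qed
 show thesis
 proof (cases "TT:V")
  case False
  hence VI: "V = Pinf" by (rule prime_infinite[OF V])
  let ?I = "Pinf :: 'a kbar set"
  note PI = unif_prime[OF unif_inf[where 'a='a]] note R = primeD(1)[OF PI]
  define ph where "ph x = cst (SOME c. x - cst c:mx ?I)" for x
  have ph: "ph x = cst c" if "x - cst c:mx ?I" for x c
  proof -
   have "x - cst (SOME c. x - cst c:mx ?I):mx ?I" by (rule someI[of _ c]) (rule that)
   from mx_diff[OF k_sf PI this that]
   have "cst (c - (SOME c. x - cst c:mx ?I)):mx ?I" by (simp add: cst_hom)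
   hence "c - (SOME c. x - cst c:mx ?I) = 0"
    using const_not_ideal[OF PI, of "[:c - (SOME c. x - cst c:mx ?I):]"] by (auto simp: cst_def)
   thus ?thesis by (simp add: ph_def)
  qed
  have "hom_on ?I ph" unfolding hom_on_def
  proof (intro conjI ballI)
   show "ph 1 = 1" using ph[of 1 1] mx_0[OF R] by (simp add: cst_hom)
   fix x y assume xy: "x:?I" "y:?I"
   obtain c where c: "x - cst c:mx ?I" using Pinf_residue[OF xy(1)] .
   obtain d where d: "y - cst d:mx ?I" using Pinf_residue[OF xy(2)] .
   have "x + y - cst (c + d) = (x - cst c) + (y - cst d)" "x * y - cst (c * d) = (x - cst c) * y + (y - cst d) * cst c"
    by (simp_all add: cst_hom algebra_simps)
   moreover have "(x - cst c) + (y - cst d):mx ?I" "(x - cst c) * y + (y - cst d) * cst c:mx ?I"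
    by (intro mx_add[OF k_sf PI] mx_mult[OF R] c d xy cst_prime[OF PI])+
   ultimately have "x + y - cst (c + d):mx ?I" "x * y - cst (c * d):mx ?I" by (simp_all only:)
   note this[THEN ph]
   thus "ph (x + y) = ph x + ph y" "ph (x * y) = ph x * ph y" using ph[OF c] ph[OF d] by (simp_all add: cst_hom)
  qed
  then obtain O' ps where O': "?I <= O'" "is_sr O'" "hom_on O' ps" "!!x. x:?I ==> ps x = ph x" "!!x. x:O' \<or> inverse x:O'"
   using place_extension[OF R] by metis
  have tI: "1 / TT:mx ?I" "1 / TT:?I" using unif_mem[OF unif_inf] mx_sub by blast+
  have "ps (1 / TT) = 0" using O'(4)[OF tI(2)] ph[of "1 / TT" 0] tI(1) by (simp add: cst_hom)
  moreover have "O' Int kk = V" if "prm UNIV O'"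
   using dvr_maximal[of kk ?I "O' Int kk"] pr_rest[OF clb_k sf_UNIV subset_UNIV that]
    unif_inf O'(1) primeD(2)[OF PI] unfolding VI dvr_def by blast
  ultimately show thesis using fin[OF O'(2,3,5), of "1 / TT"] O'(1) tI(2) by auto
 next
  case True
  obtain P where P: "irreducible P" "RT P:mx V" using fin_ex[OF V True] by metis
  have VP: "V = Pfin P" by (rule prime_finite[OF V P(1) True P(2)])
  have cstp: "map_poly cst (a + b) = map_poly cst a + map_poly cst b" "map_poly cst (a * b) = map_poly cst a * map_poly cst b" for a b :: "'a poly"
  proof -
   have s: "cst (sum f A) = (SUM i:A. cst (f i))" for f :: "nat => 'a" and A
    by (induction A rule: infinite_finite_induct) (simp_all add: cst_hom)
   show "map_poly cst (a + b) = map_poly cst a + map_poly cst b" "map_poly cst (a * b) = map_poly cst a * map_poly cst b"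
    by (intro poly_eqI; simp add: coeff_map_poly coeff_mult cst_hom s)+
  qed
  have "degree (map_poly cst P) > 0" using irr_deg[OF P(1)] by (subst degree_map_poly) (auto simp: cst_hom)
  then obtain et where et: "poly (map_poly cst P) et = 0" using alg_closed_imp_poly_has_root by blast
  define ph where "ph x = poly (map_poly cst (the_inv RT x)) et" for x
  have ph: "ph (RT a) = poly (map_poly cst a) et" for a
   by (simp add: ph_def the_inv_f_f inj_def of_RT_inj)
  have R: "is_sr (range (RT :: 'a poly => _))"
  proof (rule is_srI)
   show "1:range (RT :: 'a poly => _)" by (metis of_RT_1 rangeI)
  qed (auto simp: of_RT_diff[symmetric] RT_mult[symmetric])
  have "hom_on (range RT) ph" unfolding hom_on_def
  proof (intro conjI ballI)
   show "ph 1 = 1" using ph[of 1] by (simp add: map_poly_1' cst_hom)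
  qed (auto simp: of_RT_add[symmetric] RT_mult[symmetric] ph cstp)
  then obtain O' ps where O': "range RT <= O'" "is_sr O'" "hom_on O' ps" "!!x. x:range RT ==> ps x = ph x" "!!x. x:O' \<or> inverse x:O'"
   using place_extension[OF R, of ph] by metis
  have z: "ps (RT P) = 0" using O'(4) ph et by simp
  have inO: "RT a:O'" for a using O'(1) by auto
  have "O' Int kk = V" if pr: "prm UNIV O'"
  proof -
   have "inverse (RT P)~:O'"
   proof
    assume "inverse (RT P):O'"
    hence "ps (RT P * inverse (RT P)) = 0" using hom_on_mult[OF O'(2,3) inO] z by simp
    moreover have "RT P ~= 0" using irr_deg[OF P(1)] by auto
    ultimately show False using hom_on_one[OF O'(2,3)] by simp
   qed
   hence "RT P:mx (O' Int kk)" using inO RT_k by (auto simp: max_ideal_def)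
   thus ?thesis unfolding VP
    by (intro prime_finite[OF pr_rest[OF clb_k sf_UNIV subset_UNIV pr] P(1)]) (use inO RT_k in auto)
  qed
  moreover have "RT P ~= 0" using irr_deg[OF P(1)] by auto
  ultimately show thesis using fin[OF O'(2,3,5) inO _ z] by blast
 qed
qed

lemma prime_image:
 assumes "si:Aut k" "si ` L = L" "prm L W" shows "prm L (si ` W)"
 unfolding prime_of_def sr_iff
proof (intro conjI ballI)
 note V = primeD(1)[OF assms(3)] note s = assms(1,2)
 show "is_sr (si ` W)"
 proof (rule is_srI)
  show "1:si ` W" using sr_1[OF V] aut_one[OF s(1)] by (metis imageI)
  fix x y assume "x:si ` W" "y:si ` W"
  thus "x - y:si ` W" "x * y:si ` W"
   using sr_diff[OF V] sr_mult[OF V] by (auto simp: aut_diff[OF s(1), symmetric] aut_mult[OF s(1), symmetric])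
 qed
 have "si ` W = si ` L <-> W = L" using AutD(2)[OF s(1)] by (simp add: bij_is_inj inj_image_eq_iff)
 thus "si ` W < L" using primeD(2,3)[OF assms(3)] s(2) by auto
 fix x assume "x:L"
 then obtain y where "y:L" "x = si y" using s(2) by auto
 thus "x:si ` W \<or> inverse x:si ` W"
  using primeD(4)[OF assms(3), of y] by (auto simp: aut_inv1[OF s(1), symmetric])
qed

text \<open>A prime of the closure above \<open>V Int kk\<close> need not lie above
  \<open>V\<close>, but its restriction to \<open>F\<close> is conjugate to \<open>V\<close>; moving
  it by an automorphism of the closure corrects this.\<close>

theorem above_ex:
 fixes F L :: "'a::finite_field kbar set"
 assumes F: "gal kk F" "fing kk F" and L: "is_sf L" "F <= L" and V: "prm F V"
 obtains W where "prm L W" "W Int F = V"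
proof -
 have "prm kk (V Int kk)" by (rule pr_rest[OF clb_k galD(2,3)[OF F(1)] V])
 then obtain O' where O': "prm UNIV O'" "O' Int kk = V Int kk" using place_over_k by blast
 have P: "prm F (O' Int F)"
  by (rule pr_rest[OF clb_mono[OF clb_k galD(3)[OF F(1)] galD(2)[OF F(1)]] sf_UNIV subset_UNIV O'(1)])
 have "(O' Int F) Int kk = V Int kk" using O'(2) galD(3)[OF F(1)] by auto
 then obtain si where s: "si:Aut kk" "si ` (O' Int F) = V"
  using prime_trans[OF clb_k F(2,1) dvr_k[OF F(2,1) P] dvr_k[OF F(2,1) V]] by metis
 have pu: "prm UNIV (si ` O')" by (rule prime_image[OF s(1) _ O'(1)]) (use AutD(2)[OF s(1)] in \<open>auto simp: bij_def\<close>)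
 have cb: "clb L" by (rule clb_mono[OF clb_k _ L(1)]) (use galD(3)[OF F(1)] L(2) in auto)
 have "prm L (si ` O' Int L)" by (rule pr_rest[OF cb sf_UNIV subset_UNIV pu])
 moreover have "si ` O' Int L Int F = si ` (O' Int F)"
  using gal_image[OF F(1) s(1)] L(2) image_Int[of si O' F] AutD(2)[OF s(1)] by (auto simp: bij_def)
 ultimately show thesis using that s(2) by simp
qed

section \<open>The rational function field has no unramified extensions split at infinity\<close>

lemma unif_sub:
 assumes U: "unif E W t" and Z: "is_sf Z" "Z <= E" and t: "t:Z"
 shows "unif Z (W Int Z) t"
proof (rule dvrI[OF Z(1)])
 note R = unif_sr[OF U]
 have nz: "t ~= 0" and m: "t:mx W" using unif_nz[OF U] unif_mem[OF U] by auto
 show "is_sr (W Int Z)" using R sf_sr[OF Z(1)] by (auto simp: is_sr_def)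
 show "t:W Int Z" "inverse t~:W Int Z" "t ~= 0" using m t nz by (auto simp: max_ideal_def)
 fix x assume x: "x:Z" "x ~= 0"
 then obtain w n where w: "w:vunit W" "x = w * t powi n" using unif_expand[OF U, of x] Z(2) by blast
 have "t powi (- n):Z" using t by (auto simp: power_int_def intro: sf_cl[OF Z(1)])
 moreover have "w = x * t powi (- n)" using w(2) nz by (simp add: power_int_minus)
 ultimately have "w:Z" using x(1) sf_cl(5)[OF Z(1)] by simp
 thus "EX w:vunit (W Int Z). EX n. x = w * t powi n" using w mx_Int(2)[OF Z(1), of W] by blast
qed simp

text \<open>The sums on the right form a ring \<open>B\<close> between \<open>L^p\<close> and
  \<open>L\<close>. Its elements are algebraic over \<open>L^p\<close>, so it is a field, and it
  contains \<open>k\<close> because constants are \<open>p\<close>-th powers. Thus \<open>L\<close>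
  is Galois over \<open>B\<close>, yet automorphisms fixing \<open>x ^ p\<close> fix
  \<open>x\<close>; hence \<open>B = L\<close>.\<close>

lemma p_basis:
 fixes L :: "'a::finite_field kbar set"
 assumes g: "gal kk L" and x: "x:L"
 shows "EX f. (ALL i. f i:L) & x = (SUM i<CHAR('a). TT ^ i * f i ^ CHAR('a))"
proof -
 define p where "p = CHAR('a)"
 have pp: "p > 0" using prime_gt_0_nat[OF CHAR_prime[where 'a='a]] by (simp add: p_def)
 note LS = galD(2)[OF g] and kL = galD(3)[OF g]
 have fr: "(u + v) ^ p = u ^ p + v ^ p" for u v :: "'a kbar"
  by (rule freshmans_dream[OF CHAR_pr]) (simp add: p_def)
 have frd: "(u - v) ^ p = u ^ p - v ^ p" for u v :: "'a kbar" using fr[of "u - v" v] by simp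
 have frs: "sum h A ^ p = (SUM i:A. h i ^ p)" for h :: "nat => 'a kbar" and A
  by (rule freshmans_dream_sum[OF CHAR_pr]) (simp add: p_def)
 define B where "B = {SUM i<p. TT ^ i * f i ^ p | f. ALL i. f i:L}"
 have BI: "(SUM i<p. TT ^ i * f i ^ p):B" if "!!i. f i:L" for f using that unfolding B_def by blast
 have TL: "TT ^ n:L" for n using kL RT_k by (auto intro: sf_cl[OF LS])
 have mon: "TT ^ n * a ^ p:B" if a: "a:L" for n a
 proof -
  define f where "f i = (if i = n mod p then TT ^ (n div p) * a else 0)" for i
  have "(SUM i<p. TT ^ i * f i ^ p) = (SUM i:{n mod p}. TT ^ i * f i ^ p)"
   by (rule sum.mono_neutral_right) (use pp in \<open>auto simp: f_def\<close>)
  also have "... = TT ^ (n mod p) * (TT ^ (n div p)) ^ p * a ^ p" by (simp add: f_def power_mult_distrib)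
  also have "(TT :: 'a kbar) ^ (n mod p) * (TT ^ (n div p)) ^ p = TT ^ n"
   unfolding power_mult[symmetric] power_add[symmetric] by simp
  finally show ?thesis using BI[of f] a TL sf_cl(5)[OF LS] sf_cl(2)[OF LS] by (auto simp: f_def)
 qed
 have Badd: "u - v:B" if "u:B" "v:B" for u v
 proof -
  obtain f where "ALL i. f i:L" "u = (SUM i<p. TT ^ i * f i ^ p)" using `u:B` unfolding B_def by blast
  moreover obtain h where "ALL i. h i:L" "v = (SUM i<p. TT ^ i * h i ^ p)" using `v:B` unfolding B_def by blast
  ultimately show ?thesis using BI[of "%i. f i - h i"] sf_cl(3)[OF LS] by (simp add: frd sum_subtractf algebra_simps)
 qed
 have B0: "0:B" using mon[OF sf_cl(2)[OF LS], of 0] pp by (simp add: power_0_left)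
 have Bsum: "sum h A:B" if "!!i. i:A ==> h i:B" for h :: "nat \<times> nat => 'a kbar" and A
  using that
 proof (induction A rule: infinite_finite_induct)
  case (insert a A)
  thus ?case using Badd[of "h a" "0 - sum h A"] Badd[OF B0, of "sum h A"] by simp
 qed (simp_all add: B0)
 have R: "is_sr B"
 proof (rule is_srI)
  show "1:B" using mon[OF sf_cl(1)[OF LS], of 0] by simp
  fix u v assume uv: "u:B" "v:B"
  show "u - v:B" by (rule Badd[OF uv])
  obtain f where f: "ALL i. f i:L" "u = (SUM i<p. TT ^ i * f i ^ p)" using uv(1) unfolding B_def by blast
  obtain h where h: "ALL i. h i:L" "v = (SUM i<p. TT ^ i * h i ^ p)" using uv(2) unfolding B_def by blast
  note fh = f(1) h(1) f(2) h(2)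
  have "u * v = (SUM (i,j):{..<p} \<times> {..<p}. TT ^ (i + j) * (f i * h j) ^ p)"
   unfolding fh sum_product sum.cartesian_product by (intro sum.cong) (auto simp: power_add power_mult_distrib mult_ac)
  also have "... : B" using fh(1,2) sf_cl(5)[OF LS] by (intro Bsum) (auto intro!: mon)
  finally show "u * v:B" .
 qed
 define Lp where "Lp = (%a. a ^ p) ` L"
 have Lp: "is_sf Lp" unfolding is_sf_def Lp_def
 proof (intro conjI is_srI ballI)
  show "1:(%a. a ^ p) ` L" using sf_cl(1)[OF LS] by force
  fix u v assume "u:(%a. a ^ p) ` L" "v:(%a. a ^ p) ` L"
  thus "u - v:(%a. a ^ p) ` L" "u * v:(%a. a ^ p) ` L" "inverse u:(%a. a ^ p) ` L"
   by (auto simp: frd[symmetric] power_mult_distrib[symmetric] power_inverse[symmetric] intro!: imageI sf_cl[OF LS])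
 qed
 have LpB: "Lp <= B" unfolding Lp_def using mon[of _ 0] by auto
 have BL: "B <= L" unfolding B_def using TL[of 1] by (auto intro!: sr_sum sr_mult sr_pow sf_sr[OF LS])
 have "is_sf B" unfolding is_sf_def
 proof (intro conjI R ballI)
  fix b assume b: "b:B"
  have "b ^ p:Lp" using b BL by (auto simp: Lp_def)
  hence "monom 1 p - [:b ^ p:]:pols Lp"
   by (auto simp: pols_def coeff_pCons intro!: sf_cl[OF Lp] split: nat.splits)
  moreover have "coeff (monom 1 p - [:b ^ p:]) p = 1" using pp by (cases p) auto
  hence "monom 1 p - [:b ^ p:] ~= 0" by (metis coeff_0 zero_neq_one)
  moreover have "poly (monom 1 p - [:b ^ p:]) b = 0" by (simp add: poly_monom)
  ultimately have "alg_over Lp b" by (intro algebraic_overI[OF Lp])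
  thus "inverse b:B" by (rule alg_sr_inv[OF Lp R LpB b])
 qed
 moreover have kB: "kk <= B"
 proof
  fix y :: "'a kbar" assume "y:kk"
  then obtain a b where ab: "y = RT a / RT b" using k_field_iff by blast
  have c: "cst c:B" for c
  proof -
   have "inj (%d::'a. d ^ p)"
   proof (rule injI)
    fix d e :: 'a assume "d ^ p = e ^ p"
    hence "(d - e) ^ p = 0" using freshmans_dream[OF CHAR_prime p_def, of "d - e" e] by simp
    thus "d = e" by simp
   qed
   hence "surj (%d::'a. d ^ p)" by (simp add: finite_UNIV_inj_surj)
   then obtain d where "c = d ^ p" by (metis surjE)
   thus ?thesis using mon[of "cst d" 0] kL cst_k by (auto simp: cst_power)
  qed
  have "RT a:B" for a :: "'a poly"
   unfolding of_RT_eval[of a] using mon[OF sf_cl(1)[OF LS]] by (intro sr_sum[OF R] sr_mult[OF R] c) simp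
  thus "y:B" unfolding ab using sf_div[OF `is_sf B`] by blast
 qed
 ultimately have gB: "gal B L" using gal_intermediate[OF clb_k g _ _ BL] by blast
 have "x:B"
 proof (rule galD(6)[OF gB x])
  fix si assume s: "si:Aut B"
  have "si x ^ p = x ^ p" using AutD(3)[OF s, of "x ^ p"] LpB x by (auto simp: Lp_def aut_power[OF s])
  hence "(si x - x) ^ p = 0" by (simp add: frd)
  thus "si x = x" by simp
 qed
 thus ?thesis unfolding B_def p_def by auto
qed

text \<open>The values of the nonzero terms are pairwise incongruent modulo \<open>p\<close>, as
  \<open>a\<close> has value 1 or -1. No cancellation can occur, so each term is at least as small
  as the sum.\<close>

lemma val_distinct_terms:
 assumes U: "unif L W t" and p: "p > 0" and a: "a:L" "a ~= 0" "\<bar>vl W a\<bar> = 1" and f: "!!i. f i:L"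
  and s: "vge L W n (SUM i<p. a ^ i * f i ^ p)" and i: "i < p"
 shows "vge L W n (a ^ i * f i ^ p)"
proof (cases "EX i<p. f i ~= 0")
 case False thus ?thesis using i p vge_zero[OF U] by (auto simp: power_0_left)
next
 case True
 note P = unif_prime[OF U] and LS = unif_field[OF U]
 let ?g = "%i. a ^ i * f i ^ p"
 have gL: "?g i:L" for i using a f by (intro sf_cl[OF LS])
 obtain j where j: "j < p" "?g j ~= 0" "!!i. i < p ==> ?g i / ?g j:W"
  using dominant_term[OF LS P, of "{..<p}" ?g] gL True a(2) by auto
 have vg: "vl W (?g i) = int i * vl W a + int p * vl W (f i)" if "?g i ~= 0" for i
 proof -
  have "f i ~= 0" using that p by auto
  thus ?thesis using a f sf_cl(7)[OF LS]
   by (subst val_mult[OF U]) (auto simp: val_power[OF U])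
 qed
 have m: "?g i / ?g j:mx W" if i: "i < p" "i ~= j" for i
 proof (cases "?g i = 0")
  case True
  show ?thesis unfolding True div_0 by (rule mx_0[OF unif_sr[OF U]])
 next
  case False
  have "vl W (?g i) ~= vl W (?g j)"
  proof
   assume "vl W (?g i) = vl W (?g j)"
   hence "(int i - int j) * vl W a = int p * (vl W (f j) - vl W (f i))"
    unfolding vg[OF False] vg[OF j(2)] by (simp add: algebra_simps)
   hence "int p dvd \<bar>(int i - int j) * vl W a\<bar>" by simp
   hence "int p dvd \<bar>int i - int j\<bar>" by (simp add: abs_mult a(3))
   moreover have "\<bar>int i - int j\<bar> < int p" "\<bar>int i - int j\<bar> > 0" using i j(1) by auto
   ultimately show False using zdvd_imp_le by (meson not_less)
  qed
  hence "?g i / ?g j~:vunit W" using val_divide[OF U gL False gL j(2)] val_vunit_iff[OF U sf_div[OF LS gL gL], of i j] False j(2) by simp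
  thus ?thesis using j(3)[OF i(1)] by (simp add: mx_iff)
 qed
 let ?S = "SUM i<p. ?g i"
 have "?S / ?g j = 1 + (SUM i:{..<p} - {j}. ?g i / ?g j)"
  unfolding sum_divide_distrib using j(1,2) by (subst sum.remove[of _ j]) auto
 moreover have "... : vunit W"
  using m by (intro vunit_add[OF LS P vunit_one[OF unif_sr[OF U]]] mx_sum[OF LS P]) auto
 ultimately have u: "?S / ?g j:vunit W" by simp
 hence S0: "?S ~= 0" using vunit_nz by fastforce
 have SL: "?S:L" by (intro sr_sum[OF sf_sr[OF LS]] gL)
 have "vl W ?S = vl W (?g j)"
  using u val_vunit_iff[OF U sf_div[OF LS SL gL]] val_divide[OF U SL S0 gL j(2)] S0 j(2) by simp
 hence "vge L W n (?g j)" using s S0 gL[of j] by (simp add: vge_def[OF U])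
 hence "vge L W (0 + n) (?g i / ?g j * ?g j)" using j(3)[OF i] by (intro vge_mult[OF U]) (simp_all add: vge_0[OF U])
 moreover have "?g i / ?g j * ?g j = ?g i" by (rule nonzero_eq_divide_eq[THEN iffD1, OF j(2) refl, symmetric, THEN sym])
 ultimately show ?thesis by (simp only: add_0_left)
qed

lemma poly_of_all_finite_primes:
 assumes "y:kk" and fin: "!!P. irreducible P ==> y:Pfin P"
 shows "EX a. y = RT (a :: 'a::finite_field poly)"
proof -
 define R where "R b <-> b ~= 0 & (EX a. y = RT a / RT b)" for b :: "'a poly"
 obtain b0 where "R b0" using assms(1) k_field_iff unfolding R_def by blast
 then obtain b where Rb: "R b" and min: "!!c. R c ==> degree b <= degree c" using ex_has_least_nat[of R b0 degree] by blast
 have b: "b ~= 0 & (EX a. y = RT a / RT b)" using Rb by (simp add: R_def)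
 obtain a where a: "y = RT a / RT b" using b by blast
 have "degree b = 0"
 proof (rule ccontr)
  assume d: "degree b ~= 0"
  hence "EX P. P dvd b & degree P > 0" by (intro exI[of _ b]) simp
  then obtain P where P: "P dvd b & degree P > 0" and Pm: "!!c. c dvd b & degree c > 0 ==> degree P <= degree c"
   using ex_has_least_nat[of "%P. P dvd b & degree P > 0" _ degree] by blast
  have irr: "irreducible P"
  proof (rule Factorial_Ring.irreducibleI)
   show "P ~= 0" "~ P dvd 1" using P b by (auto simp: is_unit_iff_degree)
   fix c e assume ce: "P = c * e"
   have nz: "c ~= 0" "e ~= 0" using ce P by auto
   have "c dvd b" "e dvd b" using ce P by (auto intro: dvd_mult_left dvd_mult_right)
   hence "degree c = 0 \<or> degree e = 0" using Pm[of c] Pm[of e] ce nz by (auto simp: degree_mult_eq)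
   thus "c dvd 1 \<or> e dvd 1" using nz by (simp add: is_unit_iff_degree)
  qed
  obtain c e where ce: "~ P dvd e" "y = RT c / RT e" using fin[OF irr] unfolding finite_prime_def by auto
  have "e ~= 0" using ce(1) by auto
  hence "RT (a * e) = RT (c * b)" using a ce(2) b by (simp add: RT_mult field_simps)
  hence "P dvd a * e" using P by (simp add: of_RT_inj)
  hence "P dvd a" using ce(1) field_poly_irreducible_imp_prime[OF irr] by (simp add: prime_elem_dvd_mult_iff)
  then obtain a' b' where ab': "a = P * a'" "b = P * b'" using P by (auto elim!: dvdE)
  hence nz: "P ~= 0" "b' ~= 0" using b by auto
  hence "y = RT a' / RT b'" using a ab' by (simp add: RT_mult)
  hence "degree b <= degree b'" using min nz(2) unfolding R_def by blast
  thus False using ab' nz P by (simp add: degree_mult_eq)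
 qed
 then obtain c where c: "b = [:c:]" by (rule degree_eq_zeroE)
 hence "RT b * RT [:inverse c:] = 1" using b by (simp add: RT_mult[symmetric] one_pCons[symmetric])
 hence "RT [:inverse c:] = inverse (RT b)" by (rule inverse_unique[symmetric])
 hence "y = RT (a * [:inverse c:])" using a by (simp only: RT_mult divide_inverse)
 thus ?thesis by blast
qed

section \<open>Functions with bounded poles in an unramified extension\<close>

context
 fixes L :: "'a::finite_field kbar set"
 assumes g: "gal kk L" and fg: "fing kk L"
  and unr: "!!W. prm L W ==> EX t:kk. unif L W t"
  and split: "!!W x. prm L W ==> W Int kk = Pinf ==> x:W ==> EX c:kk. c - x:mx W"
begin

text \<open>The Riemann-Roch space of \<open>d\<close> times the infinite places: no poles at finite
  primes, pole order at most \<open>d\<close> at the primes above infinity. Negative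
  \<open>d\<close> forces zeros there.\<close>

definition bdd :: "int => 'a kbar set" where
 "bdd d = {x:L. ALL W. prm L W --> (if TT:W then x:W else vge L W (- d) x)}"

lemma bddD: "x:bdd d ==> x:L" "x:bdd d ==> prm L W ==> TT:W ==> x:W"
 "x:bdd d ==> prm L W ==> TT~:W ==> vge L W (- d) x"
 by (auto simp: bdd_def)

lemma TL: "TT:L" using galD(3)[OF g] RT_k by auto

lemma prime_k: assumes "prm L W" shows "prm kk (W Int kk)"
 by (rule pr_rest[OF clb_k galD(2,3)[OF g] assms])

text \<open>\<open>T - T^Q\<close> has derivative 1, so the polynomial \<open>P\<close> below
  \<open>W\<close> divides it exactly once, and unramifiedness keeps the value 1 in
  \<open>L\<close>. The shape matters: \<open>T\<close> is moved by a \<open>p\<close>-th power to a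
  uniformizer, so the \<open>p\<close>-basis can be recentred at \<open>W\<close>.\<close>

lemma unif_finite:
 assumes W: "prm L W" and t: "TT:W" shows "EX j>0. unif L W (TT - TT ^ (CHAR('a) ^ j))"
proof -
 obtain j where j: "j > 0" "TT ^ (CHAR('a) ^ j) - TT:mx W"
  using residue_alg[OF galD(2,3)[OF g] W t] by (auto simp: res_alg_def)
 define Q where "Q = CHAR('a) ^ j"
 define h :: "'a poly" where "h = [:0,1:] - [:0,1:] ^ Q"
 have hT: "RT h = TT - TT ^ Q" by (simp add: h_def of_RT_diff of_RT_power)
 have "- (TT ^ Q - TT):mx W" using mx_um[OF primeD(1)[OF W] j(2)] by (simp add: Q_def)
 hence hm: "RT h:mx W" by (simp add: hT)
 define V where "V = W Int kk"
 have V: "prm kk V" unfolding V_def by (rule prime_k[OF W])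
 have TV: "TT:V" "RT h:mx V" using t hm RT_k by (auto simp: V_def mx_Int[OF k_sf])
 obtain P where P: "irreducible P" "RT P:mx V" "!!b. RT b:mx V ==> P dvd b" using fin_ex[OF V TV(1)] by metis
 have VP: "V = Pfin P" by (rule prime_finite[OF V P(1) TV(1) P(2)])
 obtain r where r: "h = P * r" using P(3)[OF TV(2)] by auto
 have "(of_nat Q :: 'a) = 0" using j(1) by (simp add: Q_def)
 hence "pderiv h = 1"
  by (simp add: h_def pderiv_diff pderiv_pCons one_pCons power_def[symmetric] pderiv_power)
 hence "P * pderiv r + r * pderiv P = 1" using r by (simp add: pderiv_mult)
 moreover have "~ P dvd 1" using P(1) irreducible_not_unit by blast
 ultimately have "~ P dvd r" by (metis dvd_add dvd_mult2 dvd_triv_left)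
 hence "RT r~:mx V" using P(3) by blast
 hence ru: "RT r:vunit W" using RT_prime[OF V TV(1), of r] mx_Int(2)[OF k_sf, of W] unfolding V_def by (auto simp: mx_iff)
 obtain t where t: "t:kk" "unif L W t" using unr[OF W] by blast
 have tV: "unif kk V t" unfolding V_def by (rule unif_sub[OF t(2) k_sf galD(3)[OF g] t(1)])
 have vP: "vl V (RT P) = 1" using val_unif[OF unif_fin[OF P(1)]] VP by simp
 have "vl W (RT P) = 1"
 proof -
  obtain w where w: "w:vunit V" "RT P = w * t powi 1"
   using val_expand[OF tV RT_k, of P] vP irr_deg[OF P(1)] by (metis of_RT_eq_0 degree_0 less_irrefl)
  thus ?thesis using val_eqI[OF t(2), of w 1] mx_Int(2)[OF k_sf, of W] unfolding V_def by auto
 qed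
 moreover have PL: "RT P:L" "RT r:L" "RT P ~= 0" "RT r ~= 0"
  using galD(3)[OF g] RT_k irr_deg[OF P(1)] vunit_nz[OF ru] by auto
 ultimately have "vl W (RT h) = 1"
  using val_mult[OF t(2) PL(1,3,2,4)] val_vunit_iff[OF t(2) PL(2,4)] ru by (simp add: r RT_mult)
 hence "unif L W (RT h)"
  using uniformizerI[OF t(2), of "RT h"] PL r sf_cl(5)[OF galD(2)[OF g] PL(1,2)] by (simp add: RT_mult)
 thus ?thesis using j(1) by (auto simp: hT Q_def)
qed

lemma unif_infinite:
 assumes W: "prm L W" and T: "TT~:W" shows "unif L W (1 / TT)" "W Int kk = Pinf"
proof -
 show I: "W Int kk = Pinf" by (rule prime_infinite[OF prime_k[OF W]]) (use T in auto)
 obtain t where t: "t:kk" "unif L W t" using unr[OF W] by blast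
 have tV: "unif kk Pinf t" using unif_sub[OF t(2) k_sf galD(3)[OF g] t(1)] I by simp
 have iT: "1 / TT:(kk :: 'a kbar set)" using unif_in_F[OF unif_inf] .
 have "vl Pinf (1 / TT :: 'a kbar) = 1" by (rule val_unif[OF unif_inf])
 then obtain w where w: "w:vunit Pinf" "1 / TT = w * t powi 1"
  using val_expand[OF tV iT] by (metis divide_eq_0_iff T_nonzero zero_neq_one)
 hence "vl W (1 / TT) = 1" using val_eqI[OF t(2), of w 1] I mx_Int(2)[OF k_sf, of W] by auto
 thus "unif L W (1 / TT)" using uniformizerI[OF t(2), of "1 / TT"] iT galD(3)[OF g] by auto
qed

text \<open>At a finite prime the powers of \<open>T\<close> need not have distinct values modulo
  \<open>p\<close>. Substituting \<open>T = ta + S ^ p\<close> rewrites the sum in powers of the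
  uniformizer \<open>ta\<close>, where \<open>val_distinct_terms\<close> applies.\<close>

lemma p_basis_finite:
 assumes W: "prm L W" and T: "TT:W" and f: "!!i. f i:L" and x: "(SUM i<CHAR('a). TT ^ i * f i ^ CHAR('a)):W"
  and i: "i < CHAR('a)"
 shows "f i:W"
proof -
 define p where "p = CHAR('a)"
 have pp: "p > 0" using prime_gt_0_nat[OF CHAR_prime[where 'a='a]] by (simp add: p_def)
 note LS = galD(2)[OF g] and R = primeD(1)[OF W]
 obtain j where j: "j > 0" "unif L W (TT - TT ^ (CHAR('a) ^ j))" using unif_finite[OF W T] by blast
 define S where "S = (TT :: 'a kbar) ^ (p ^ (j - 1))"
 define ta where "ta = TT - S ^ p"
 have Sp: "S ^ p = TT ^ (CHAR('a) ^ j)" using j(1) by (cases j) (simp_all add: S_def p_def power_mult[symmetric] mult.commute)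
 have U: "unif L W ta" using j(2) by (simp add: ta_def Sp)
 have SW: "S:W" using T unfolding S_def by (rule sr_pow[OF R])
 have frs: "sum h A ^ p = (SUM i:A. h i ^ p)" for h :: "nat => 'a kbar" and A
  by (rule freshmans_dream_sum[OF CHAR_pr]) (simp add: p_def)
 \<comment> \<open>Lets the binomial coefficients be absorbed into \<open>p\<close>-th
   powers.\<close>
 have fermat: "(of_nat n :: 'a kbar) ^ p = of_nat n" for n
 proof (induction n)
  case (Suc n)
  have "(of_nat n + 1 :: 'a kbar) ^ p = of_nat n ^ p + 1 ^ p"
   by (rule freshmans_dream[OF CHAR_pr]) (simp add: p_def)
  thus ?case using Suc by (simp add: add.commute)
 qed (use pp in simp)
 \<comment> \<open>The coefficient of \<open>ta ^ m\<close> after the substitution, as the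
   \<open>p\<close>-th root of the sum of the contributions from \<open>i \<ge> m\<close>.\<close>
 define y where "y m = (SUM i:{m..<p}. of_nat (i choose m) * S ^ (i - m) * f i)" for m
 have yL: "y m:L" for m unfolding y_def using f SW primeD(2)[OF W]
  by (auto intro!: sr_sum[OF sf_sr[OF LS]] sr_cl[OF sf_sr[OF LS]])
 have "(SUM i<p. TT ^ i * f i ^ p) = (SUM i<p. SUM m<=i. ta ^ m * (of_nat (i choose m) * S ^ (i - m) * f i) ^ p)"
 proof (rule sum.cong[OF refl])
  fix i
  have "TT ^ i = (ta + S ^ p) ^ i" by (simp add: ta_def)
  also have "... = (SUM m<=i. of_nat (i choose m) * ta ^ m * (S ^ p) ^ (i - m))" by (rule binomial_ring)
  finally show "TT ^ i * f i ^ p = (SUM m<=i. ta ^ m * (of_nat (i choose m) * S ^ (i - m) * f i) ^ p)"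
   by (simp add: sum_distrib_left power_mult_distrib fermat power_mult[symmetric] mult_ac)
 qed
 also have "... = (SUM m<p. SUM i:{m..<p}. ta ^ m * (of_nat (i choose m) * S ^ (i - m) * f i) ^ p)"
  by (subst sum.Sigma; simp; subst sum.Sigma; simp) (rule sum.reindex_bij_witness[of _ "%(a,b). (b,a)" "%(a,b). (b,a)"]; auto)
 also have "... = (SUM m<p. ta ^ m * y m ^ p)" unfolding y_def by (simp add: frs sum_distrib_left)
 finally have e: "(SUM i<p. TT ^ i * f i ^ p) = (SUM m<p. ta ^ m * y m ^ p)" .
 have yW: "y m:W" if m: "m < p" for m
 proof (cases "y m = 0")
  case True thus ?thesis by (simp add: sr_0[OF R])
 next
  case False
  have t: "ta:L" "ta ~= 0" using unif_in_F[OF U] unif_nz[OF U] .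
  have "vge L W 0 (ta ^ m * y m ^ p)"
   using x e val_unif[OF U] by (intro val_distinct_terms[OF U pp t _ yL _ m]) (simp_all add: vge_0[OF U] p_def)
  hence "int m + int p * vl W (y m) >= 0"
   using False t yL[of m] sf_cl(7)[OF LS] val_mult[OF U, of "ta ^ m" "y m ^ p"]
   by (simp add: vge_def[OF U] val_power[OF U] val_unif[OF U])
  hence "int p * vl W (y m) > int p * (-1)" using m by linarith
  hence "vl W (y m) > -1" using pp by (simp only: mult_less_cancel_left_pos of_nat_0_less_iff)
  thus ?thesis using val_mem_iff[OF U yL False] by simp
 qed
 \<comment> \<open>The system expressing \<open>y\<close> through \<open>f\<close> is triangular
   with diagonal 1 and integral entries, so it is solved from the top index downwards.\<close>
 have "f m:W" if m: "m < p" for m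
  using m
 proof (induction "p - m" arbitrary: m rule: less_induct)
  case less
  have "y m = f m + (SUM i:{Suc m..<p}. of_nat (i choose m) * S ^ (i - m) * f i)"
   unfolding y_def using less.prems by (subst sum.atLeast_Suc_lessThan) auto
  hence fm: "f m = y m - (SUM i:{Suc m..<p}. of_nat (i choose m) * S ^ (i - m) * f i)" by simp
  have "(SUM i:{Suc m..<p}. of_nat (i choose m) * S ^ (i - m) * f i):W"
   using less SW by (intro sr_sum[OF R] sr_mult[OF R] sr_nat[OF R] sr_pow[OF R]) auto
  from sr_diff[OF R yW[OF less.prems] this] show ?case unfolding fm .
 qed
 thus ?thesis using i by (simp add: p_def)
qed

text \<open>At infinity \<open>T\<close> itself has value -1, so the terms have distinct values
  modulo \<open>p\<close>; the bound \<open>- i + p * v(f i) \<ge> - d\<close> yields the quotient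
  by rounding down.\<close>

lemma bdd_expand:
 assumes x: "x:bdd d"
 shows "EX f. (ALL i<CHAR('a). f i:bdd ((d - int i) div int CHAR('a))) & x = (SUM i<CHAR('a). TT ^ i * f i ^ CHAR('a))"
proof -
 define p where "p = CHAR('a)"
 have pp: "p > 0" using prime_gt_0_nat[OF CHAR_prime[where 'a='a]] by (simp add: p_def)
 note LS = galD(2)[OF g]
 obtain f where f: "!!i. f i:L" "x = (SUM i<p. TT ^ i * f i ^ p)" using p_basis[OF g bddD(1)[OF x]] by (auto simp: p_def)
 have "f i:bdd ((d - int i) div int p)" if i: "i < p" for i
  unfolding bdd_def
 proof (intro CollectI conjI allI impI f(1))
  fix W assume W: "prm L W"
  show "if TT:W then f i:W else vge L W (- ((d - int i) div int p)) (f i)"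
  proof (cases "TT:W")
   case True
   thus ?thesis using p_basis_finite[OF W True f(1)] bddD(2)[OF x W True] i f(2) by (simp add: p_def)
  next
   case False
   note U = unif_infinite(1)[OF W False]
   have vT: "vl W TT = -1" using val_inverse[OF U TL T_nonzero] val_unif[OF U] by (simp add: divide_inverse)
   have v: "vge L W (- d) (TT ^ i * f i ^ p)"
    using bddD(3)[OF x W False] f(2) vT by (intro val_distinct_terms[OF U pp TL T_nonzero _ f(1) _ i]) simp_all
   have "vge L W (- ((d - int i) div int p)) (f i)"
   proof (cases "f i = 0")
    case True thus ?thesis using vge_zero[OF U] by simp
   next
    case nz: False
    have "- d <= - int i + int p * vl W (f i)"
     using v nz TL f(1)[of i] sf_cl(7)[OF LS] val_mult[OF U, of "TT ^ i" "f i ^ p"]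
     by (simp add: vge_def[OF U] val_power[OF U] vT)
    hence "- vl W (f i) * int p <= d - int i" by (simp add: mult.commute)
    hence "(- vl W (f i) * int p) div int p <= (d - int i) div int p" using pp by (intro zdiv_mono1) auto
    moreover have "(- vl W (f i) * int p) div int p = - vl W (f i)"
     by (rule nonzero_mult_div_cancel_right) (use pp in simp)
    ultimately show ?thesis using f(1)[of i] by (simp add: vge_def[OF U])
   qed
   thus ?thesis using False by simp
  qed
 qed
 thus ?thesis using f(2) unfolding p_def by blast
qed

lemma infinite_prime_above: obtains W where "prm L W" "W Int kk = Pinf"
proof -
 have gk: "gal kk (kk :: 'a kbar set)" unfolding gal_def gfix_def using k_sf by (auto dest: AutD(3))
 show thesis using above_ex[OF gk fin_gen_base[OF k_sf] galD(2,3)[OF g] unif_prime[OF unif_inf]] that by blast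
qed

text \<open>The norm of \<open>y\<close> has no poles, so it is a polynomial. It also vanishes at
  infinity, so it is zero, and then some conjugate of \<open>y\<close> is zero.\<close>

lemma bdd_0_zero:
 assumes y: "y:bdd 0" and W: "prm L W" "W Int kk = Pinf" "y:mx W"
 shows "y = 0"
proof -
 note LS = galD(2)[OF g]
 have mem: "y:U" if U: "prm L U" for U
 proof (cases "TT:U")
  case True thus ?thesis by (rule bddD(2)[OF y U])
 next
  case False thus ?thesis using bddD(3)[OF y U False] by (simp add: vge_0[OF unif_infinite(1)[OF U False]])
 qed
 have conj: "h y:U" if U: "prm L U" and h: "h:Grp kk L" for U h
 proof -
  obtain si where s: "si:Aut kk" "h y = si y" using Grp_app[OF h] bddD(1)[OF y] by auto
  have "y:inv_into UNIV si ` U" by (rule mem[OF prime_image[OF aut_inv[OF s(1)] gal_image[OF g aut_inv[OF s(1)]] U]])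
  hence "si y:si ` inv_into UNIV si ` U" by blast
  thus ?thesis using s by (simp add: inv_image_eq(2)[OF s(1)])
 qed
 define N where "N = (PROD h:Grp kk L. h y)"
 have Nk: "N:kk" unfolding N_def by (rule Grp_prod_in_base[OF clb_k fg g bddD(1)[OF y]])
 have NU: "N:U" if "prm L U" for U unfolding N_def by (rule sr_prod[OF primeD(1)[OF that] conj[OF that]])
 have gk: "gal kk (kk :: 'a kbar set)" unfolding gal_def gfix_def using k_sf by (auto dest: AutD(3))
 have "N:Pfin P" if "irreducible P" for P
  using above_ex[OF gk fin_gen_base[OF k_sf] LS galD(3)[OF g] unif_prime[OF unif_fin[OF that]]] NU Nk by blast
 then obtain a where a: "N = RT a" using poly_of_all_finite_primes[OF Nk] by blast
 have i: "restrict (%x. x) L:Grp kk L" unfolding Grp_def by (rule imageI[OF aut_id(2)])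
 have "N = y * (PROD h:Grp kk L - {restrict (%x. x) L}. h y)"
  unfolding N_def prod.remove[OF finite_Grp[OF clb_k fg] i, of "%h. h y"] using bddD(1)[OF y] by simp
 hence "N:mx W" using mx_mult[OF primeD(1)[OF W(1)] W(3)] conj[OF W(1)]
  by (metis (no_types, lifting) DiffD1 sr_prod[OF primeD(1)[OF W(1)]])
 hence "N:mx Pinf" using Nk W(2) mx_Int(1)[OF k_sf, of W] by auto
 hence "RT a = 0" using Pinf_iff[of 1 a] Pinf_iff[of a 1] unfolding a
  by (cases "a = 0") (auto simp: max_ideal_def divide_inverse)
 hence "N = 0" using a by simp
 then obtain h where h: "h:Grp kk L" "h y = 0" unfolding N_def using finite_Grp[OF clb_k fg] by auto
 then obtain si where "si:Aut kk" "si y = 0" using Grp_app[OF h(1)] bddD(1)[OF y] by auto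
 thus ?thesis using aut_eq_0 by blast
qed

lemma bdd_diff_const: assumes "x:bdd 0" shows "x - cst c:bdd 0"
 unfolding bdd_def
proof (intro CollectI conjI allI impI)
 have cL: "cst c:L" using galD(3)[OF g] cst_k by auto
 show "x - cst c:L" using bddD(1)[OF assms] cL by (rule sf_cl(3)[OF galD(2)[OF g]])
 fix W assume W: "prm L W"
 note c = const_prime[OF W cL cst_frob card_gt] and R = primeD(1)[OF W]
 show "if TT:W then x - cst c:W else vge L W (- 0) (x - cst c)"
  using bddD(2)[OF assms W] bddD(3)[OF assms W] sr_diff[OF R _ c] vge_0[OF unif_infinite(1)[OF W]] by auto
qed

text \<open>The coefficients in the \<open>p\<close>-basis have smaller pole bounds, negative bounds
  forcing them to vanish, so induction applies. For bound 0, full splitting supplies a constant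
  congruent to \<open>x\<close> at one infinite prime, and the difference is zero by the norm
  argument.\<close>

lemma bdd_in_k: "x:bdd (int n) ==> x:kk"
proof (induction n arbitrary: x rule: less_induct)
 case (less n)
 obtain W where W: "prm L W" "W Int kk = Pinf" using infinite_prime_above .
 have TW: "TT~:W"
 proof
  assume "TT:W"
  hence "TT:W Int kk" using RT_k by blast
  thus False using W(2) Pinf_iff[of 1 "[:0,1::'a:]"] by simp
 qed
 note U = unif_infinite(1)[OF W(1) TW]
 have neg: "x = 0" if x: "x:bdd d" "d < 0" for x d
 proof (rule bdd_0_zero[OF _ W])
  show "x:bdd 0" unfolding bdd_def
   using bddD[OF x(1)] vge_mono[OF unif_infinite(1), of _ "- d" x 0] x(2) by auto
  show "x:mx W" using bddD(3)[OF x(1) W(1) TW] vge_mono[OF U, of "- d" x 1] x(2) by (simp add: vge_1[OF U])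
 qed
 show ?case
 proof (cases "n = 0")
  case True
  hence x: "x:bdd 0" using less.prems by simp
  have "x:W" using bddD(3)[OF x W(1) TW] by (simp add: vge_0[OF U])
  then obtain c where c: "c:kk" "c - x:mx W" using split[OF W] by blast
  have "c - x + x:W" by (rule sr_add[OF primeD(1)[OF W(1)] mx_sub[OF c(2)] `x:W`])
  hence "c:Pinf" using c(1) W(2) by auto
  then obtain e where e: "c - cst e:mx Pinf" using Pinf_residue by blast
  hence "c - cst e:mx W" using W(2) mx_Int(1)[OF k_sf, of W] by auto
  hence "(c - cst e) - (c - x):mx W" by (rule mx_diff[OF galD(2)[OF g] W(1) _ c(2)])
  hence "x - cst e = 0" by (intro bdd_0_zero[OF bdd_diff_const[OF x] W]) simp
  thus ?thesis using cst_k by (metis eq_iff_diff_eq_0)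
 next
  case False
  obtain f where f: "!!i. i < CHAR('a) ==> f i:bdd ((int n - int i) div int CHAR('a))" "x = (SUM i<CHAR('a). TT ^ i * f i ^ CHAR('a))"
   using bdd_expand[OF less.prems] by blast
  have p2: "CHAR('a) >= 2" by (rule prime_ge_2_nat[OF CHAR_prime])
  have "f i:kk" if i: "i < CHAR('a)" for i
  proof (cases "(int n - int i) div int CHAR('a) < 0")
   case True thus ?thesis using neg[OF f(1)[OF i]] sf_cl(2)[OF k_sf] by simp
  next
   case nn: False
   define m where "m = nat ((int n - int i) div int CHAR('a))"
   have "int m <= int n div int CHAR('a)" using nn p2 by (auto simp: m_def intro: zdiv_mono1)
   also have "... < int n" using False p2 by (intro int_div_less_self) auto
   finally have "m < n" by simp
   moreover have "f i:bdd (int m)" using f(1)[OF i] nn by (simp add: m_def)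
   ultimately show ?thesis by (rule less.IH)
  qed
  thus ?thesis unfolding f(2)
   by (intro sr_sum sr_mult sr_pow sf_sr[OF k_sf] RT_k) auto
 qed
qed

text \<open>It remains to clear denominators: a polynomial multiple of a given element is integral
  over the polynomial ring and hence has poles only at infinity.\<close>

theorem no_unramified_extension: "L = kk"
proof
 show "kk <= L" by (rule galD(3)[OF g])
 show "L <= kk"
 proof
  fix x assume x: "x:L"
  note LS = galD(2)[OF g] and kR = sf_sr[OF k_sf]
  obtain p where p: "p:pols kk" "lead_coeff p = 1" "poly p x = 0"
   using clb_alg[OF clb_k, of x] by (auto simp: alg_over_def)
  define n where "n = degree p"
  have "EX d. d ~= 0 & (EX b. coeff p i = RT b / RT d)" for i
   using p(1) k_field_iff[of "coeff p i"] unfolding pols_def by blast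
  then obtain d where d: "!!i. d i ~= 0" "!!i. EX b. coeff p i = RT b / RT (d i)" by metis
  define b where "b = (PROD i<=n. d i)"
  have b0: "b ~= 0" using d(1) by (simp add: b_def)
  have bc: "EX a. RT b * coeff p i = RT a" for i
  proof (cases "i <= n")
   case True
   obtain a where a: "coeff p i = RT a / RT (d i)" using d(2) by blast
   have "b = d i * (PROD i:{..n} - {i}. d i)" unfolding b_def using True by (subst prod.remove[of _ i]) auto
   hence "RT b * coeff p i = RT ((PROD i:{..n} - {i}. d i) * a)" using a d(1)[of i] by (simp add: RT_mult)
   thus ?thesis by blast
  next
   case False thus ?thesis by (intro exI[of _ 0]) (simp add: n_def coeff_eq_0)
  qed
  define y where "y = RT b * x"
  have yL: "y:L" unfolding y_def using galD(3)[OF g] RT_k x by (auto intro: sf_cl(5)[OF LS])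
  \<comment> \<open>The polynomial of \<open>RT b * x\<close>, obtained from that of
    \<open>x\<close> by scaling the variable; it is monic with coefficients in the polynomial
    ring.\<close>
  define q where "q = (SUM i<=n. monom (RT b ^ (n - i) * coeff p i) i)"
  have cq: "coeff q i = (if i <= n then RT b ^ (n - i) * coeff p i else 0)" for i
   unfolding q_def coeff_sum by (simp add: sum.delta')
  have "poly q y = (SUM i<=n. RT b ^ (n - i) * coeff p i * y ^ i)" by (simp add: q_def poly_sum poly_monom)
  also have "... = (SUM i<=n. RT b ^ n * (coeff p i * x ^ i))"
  proof (rule sum.cong[OF refl])
   fix i assume "i:{..n}"
   hence "(RT b :: 'a kbar) ^ n = RT b ^ (n - i) * RT b ^ i" by (simp add: power_add[symmetric])
   thus "RT b ^ (n - i) * coeff p i * y ^ i = RT b ^ n * (coeff p i * x ^ i)" by (simp add: y_def power_mult_distrib)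
  qed
  also have "... = RT b ^ n * poly p x" by (simp add: poly_altdef n_def sum_distrib_left)
  finally have "poly q y = RT b ^ n * poly p x" .
  hence qy: "poly q y = 0" using p(3) by simp
  have "degree q = n" by (rule antisym[OF degree_le le_degree]) (use p(2) in \<open>auto simp: cq n_def\<close>)
  hence ql: "lead_coeff q = 1" using p(2) by (simp add: cq n_def)
  have qc: "EX a. coeff q i = RT a" for i
  proof -
   consider "i > n" | "i = n" | "i < n" by linarith
   thus ?thesis
   proof cases
    case 1 thus ?thesis by (intro exI[of _ 0]) (simp add: cq)
   next
    case 2 thus ?thesis using p(2) by (intro exI[of _ 1]) (simp add: cq n_def)
   next
    case 3
    then obtain m where m: "n - i = Suc m" by (metis Suc_diff_Suc)
    obtain a where "RT b * coeff p i = RT a" using bc by blast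
    hence "coeff q i = RT (b ^ m * a)" using 3 by (simp add: cq m RT_mult of_RT_power mult.assoc mult.left_commute)
    thus ?thesis by blast
   qed
  qed
  have fin: "y:W" if W: "prm L W" "TT:W" for W
  proof (rule int_closed[OF primeD(1)[OF W(1)] primeD(4)[OF W(1) yL] _ ql qy])
   have TW: "TT:W Int kk" using W(2) RT_k by blast
   have "coeff q i:W" for i
   proof -
    obtain a where "coeff q i = RT a" using qc by blast
    thus ?thesis using RT_prime[OF prime_k[OF W(1)] TW, of a] by simp
   qed
   thus "q:pols W" by (simp add: pols_def)
  qed
  obtain W0 where W0: "prm L W0" "W0 Int kk = Pinf" using infinite_prime_above .
  define C where "C = (%si. si ` W0) ` Aut kk"
  have finC: "finite C" unfolding C_def by (rule fin_conj_primes[OF clb_k fg primeD(2)[OF W0(1)]])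
  \<comment> \<open>The primes above infinity are conjugate, hence finitely many, so the pole orders
    of \<open>y\<close> have a common bound.\<close>
  define D where "D = nat (SUM W:C. \<bar>vl W y\<bar>)"
  have "y:bdd (int D)" unfolding bdd_def
  proof (intro CollectI conjI allI impI yL)
   fix W assume W: "prm L W"
   show "if TT:W then y:W else vge L W (- int D) y"
   proof (cases "TT:W")
    case True thus ?thesis using fin[OF W] by simp
   next
    case False
    note U = unif_infinite[OF W False]
    obtain si where "si:Aut kk" "si ` W0 = W"
     using prime_trans[OF clb_k fg g dvr_k[OF fg g W0(1)] dvr_k[OF fg g W]] W0(2) U(2) by metis
    hence "W:C" by (auto simp: C_def)
    hence "\<bar>vl W y\<bar> <= (SUM W:C. \<bar>vl W y\<bar>)" by (intro member_le_sum finC) auto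
    hence "vge L W (- int D) y" using yL by (auto simp: vge_def[OF U(1)] D_def)
    thus ?thesis using False by simp
   qed
  qed
  hence "y:kk" by (rule bdd_in_k)
  hence "y / RT b:kk" by (rule sf_div[OF k_sf _ RT_k])
  thus "x:kk" using b0 by (simp add: y_def)
 qed
qed

end

subsection \<open>Generation by inertia groups\<close>

definition fixf :: "'b::field set => ('b => 'b) set => 'b set" where
 "fixf B A = {x:B. ALL a:A. a x = x}"

lemma fixf_subfield:
 assumes B: "is_sf B" and A: "A <= Aut k" shows "is_sf (fixf B A)"
proof -
 have a: "a 1 = 1" "a (x - y) = a x - a y" "a (x * y) = a x * a y" "a (inverse x) = inverse (a x)"
  if "a:A" for a x y
  using A that aut_one[of a k] aut_diff[of a k] aut_mult[of a k] aut_inv1[of a k] by auto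
 show ?thesis using sf_cl[OF B]
  by (auto simp: is_sf_def is_sr_def fixf_def a)
qed

text \<open>\<open>si\<close> may move \<open>W\<close> to another prime above the same prime of
  \<open>E\<close>. By transitivity over \<open>E\<close> an automorphism fixing \<open>E\<close>
  moves it back without changing the action on \<open>E\<close>.\<close>

lemma lift_decomp:
 fixes B :: "'b::alg_closed_field set"
 assumes cb: "clb k" and a: "abel k B" and f: "fing k B" and dv: "!!W. prm B W ==> dvr B W" and W: "prm B W"
  and E: "is_sf E" "k <= E" "E <= B" and s: "si:decomp k (W Int E)"
 obtains ta where "ta:decomp k W" "!!x. x:E ==> ta x = si x"
proof -
 note g = abel_gal[OF a]
 note aE = abel_mid[OF cb a E]
 note cbE = clb_mono[OF cb E(2,1)]
 note sA = decompD(1)[OF s]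
 have W': "prm B (si ` W)" by (rule prime_image[OF sA gal_image[OF g sA] W])
 have "si ` W Int E = si ` (W Int E)" using gal_image[OF abel_gal[OF aE(2)] sA] image_Int[of si W E] AutD(2)[OF sA] by (auto simp: bij_def)
 hence "si ` W Int E = W Int E" using decompD(2)[OF s] by simp
 then obtain rh where r: "rh:Aut E" "rh ` si ` W = W"
  using prime_trans[OF cbE fin_gen_mono[OF f E(2,3)] abel_gal[OF aE(1)] dv[OF W'] dv[OF W]] by metis
 have "rh \<circ> si:decomp k W"
  using aut_comp[OF _ sA, of rh] r Aut_mono[OF E(2)] by (auto simp: decomp_def image_comp)
 moreover have "(rh \<circ> si) x = si x" if "x:E" for x
  using AutD(3)[OF r(1) galD(4)[OF abel_gal[OF aE(2)] sA that]] by simp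
 ultimately show thesis using that by blast
qed

lemma decomp_fixf_trivial:
 fixes B :: "'a::finite_field kbar set"
 assumes a: "abel kk B" and f: "fing kk B" and W: "prm B W"
  and E: "E = fixf B (decomp kk W)"
 shows "triv_on (decomp kk (W Int E)) E"
 unfolding triv_on_def
proof (intro ballI)
 fix si x assume s: "si:decomp kk (W Int E)" and x: "x:E"
 have "is_sf E" "kk <= E" "E <= B" unfolding E
  using fixf_subfield[OF galD(2)[OF abel_gal[OF a]], of "decomp kk W" kk] galD(3)[OF abel_gal[OF a]]
  by (auto simp: fixf_def decomp_def AutD(3))
 then obtain ta where "ta:decomp kk W" "ta x = si x" using lift_decomp[OF clb_k a f dvr_k[OF f abel_gal[OF a]] W _ _ _ s] x by metis
 thus "si x = x" using x unfolding E fixf_def by auto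
qed

text \<open>By \<open>artin\<close>, \<open>Aut E\<close> acts on \<open>B\<close> through the
  inertia group of \<open>W\<close>, so residues at \<open>W\<close> are represented in
  \<open>E\<close>. A lift of an inertia element of \<open>W Int E\<close> to the decomposition
  group of \<open>W\<close> therefore acts trivially on all residues, belongs to the inertia group
  of \<open>W\<close>, and fixes \<open>E\<close>.\<close>

lemma inertia_fixf:
 fixes B :: "'a::finite_field kbar set"
 assumes a: "abel kk B" and f: "fing kk B" and W: "prm B W"
  and E: "E = fixf B (inertia kk W)"
 shows "triv_on (inertia kk (W Int E)) E"
 unfolding triv_on_def
proof (intro ballI)
 fix si x assume s: "si:inertia kk (W Int E)" and x: "x:E"
 note g = abel_gal[OF a] note BS = galD(2)[OF g] note R = primeD(1)[OF W]
 have IA: "inertia kk W <= Aut kk" by (auto simp: inertia_def decomp_def)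
 have E': "is_sf E" "kk <= E" "E <= B" unfolding E
  using fixf_subfield[OF BS IA] galD(3)[OF g] IA by (auto simp: fixf_def AutD(3))
 have cbE: "clb E" by (rule clb_mono[OF clb_k E'(2,1)])
 have gE: "gal E B" by (rule abel_gal[OF abel_mid(1)[OF clb_k a E']])
 have comp: "si \<circ> ta:inertia kk W" if st: "si:inertia kk W" "ta:inertia kk W" for si ta
  unfolding inertia_def
 proof (intro CollectI conjI ballI decomp_comp inertD(1) st)
  fix x assume x: "x:W"
  hence "ta x:W" using decompD(2)[OF inertD(1)[OF st(2)]] by blast
  from mx_add[OF BS W inertD(2)[OF st(1) this] inertD(2)[OF st(2) x]]
  show "(si \<circ> ta) x - x:mx W" by simp
 qed
 have id: "(%x. x):inertia kk W" using aut_id(2) mx_0[OF R] by (auto simp: inertia_def decomp_def)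
 have IE: "rh:inertia E W" if r: "rh:Aut E" for rh
 proof -
  have AE: "inertia kk W <= Aut E" using IA unfolding E fixf_def Aut_def by auto
  have kE: "infinite E" using infinite_k E'(2) finite_subset by blast
  have fx: "y:E" if "y:B" "!!a. a:inertia kk W ==> a y = y" for y using that unfolding E fixf_def by auto
  obtain a where a: "a:inertia kk W" "!!x. x:B ==> rh x = a x"
   using artin[OF cbE kE fin_gen_mono[OF f E'(2,3)] gE AE id comp fx r] by metis
  have "rh ` W = a ` W" using a(2) primeD(2)[OF W] by (intro image_cong) auto
  thus ?thesis using r inertD[OF a(1)] decompD(2)[OF inertD(1)[OF a(1)]] a(2) primeD(2)[OF W]
   unfolding inertia_def decomp_def by auto
 qed
 obtain ta where t: "ta:decomp kk W" "!!x. x:E ==> ta x = si x" using lift_decomp[OF clb_k a f dvr_k[OF f g] W E' inertD(1)[OF s]] by metis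
 note tA = decompD(1)[OF t(1)]
 have "ta y - y:mx W" if y: "y:W" for y
 proof -
  obtain j where j: "j > 0" "y ^ (CHAR('a kbar) ^ j) - y:mx W"
   using residue_alg[OF BS galD(3)[OF g] W y] unfolding res_alg_def CHAR_kbar by blast
  obtain c where c: "c:E" "c:W" "c - y:mx W"
   using residue_of_inertia[OF cbE gE W IE CHAR_pr y j] by metis
  have "ta c - c:mx W" using inertD(2)[OF s, of c] c mx_Int(1)[OF E'(1), of W] t(2)[OF c(1)] by auto
  hence "(ta c - c) - ta (c - y) + (c - y):mx W"
   by (rule mx_add[OF BS W mx_diff[OF BS W _ decomp_max_ideal[OF t(1) c(3)]] c(3)])
  thus ?thesis by (simp add: aut_diff[OF tA])
 qed
 hence "ta:inertia kk W" using t(1) by (simp add: inertia_def)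
 hence "ta x = x" using x unfolding E fixf_def by auto
 thus "si x = x" using t(2)[OF x] by simp
qed

text \<open>The fixed field of \<open>A\<close> lies in the fixed fields of all inertia groups and
  of the decomposition groups at infinity. It is thus unramified with residues at infinity from
  \<open>k\<close>, so it equals \<open>k\<close>, and \<open>artin\<close> applies to
  \<open>A\<close>.\<close>

theorem inertia_generate:
 fixes B :: "'a::finite_field kbar set"
 assumes a: "abel kk B" and f: "fing kk B"
  and A: "A <= Aut kk" "(%x. x):A" "!!a b. a:A ==> b:A ==> a \<circ> b:A"
  and I: "!!W. prm B W ==> inertia kk W <= A"
  and D: "!!W. prm B W ==> W Int kk = Pinf ==> decomp kk W <= A"
  and s: "si:Aut kk"
 obtains b where "b:A" "!!x. x:B ==> si x = b x"
proof -
 note g = abel_gal[OF a] note BS = galD(2)[OF g]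
 define Z where "Z = fixf B A"
 have Z: "is_sf Z" "kk <= Z" "Z <= B" unfolding Z_def
  using fixf_subfield[OF BS A(1)] galD(3)[OF g] A(1) by (auto simp: fixf_def AutD(3))
 note gZ = abel_gal[OF abel_mid(2)[OF clb_k a Z]]
 note fZ = fin_gen_mid[OF clb_k f g Z]
 have sub: "EX E. is_sf E & kk <= E & E <= B & E = fixf B H" if "H <= Aut kk" for H
  using fixf_subfield[OF BS that] galD(3)[OF g] that by (auto simp: fixf_def AutD(3))
 have "Z = kk"
 proof (rule no_unramified_extension[OF gZ fZ])
  fix U assume U: "prm Z U"
  obtain W where W: "prm B W" "W Int Z = U" using above_ex[OF gZ fZ BS Z(3) U] .
  have "inertia kk W <= Aut kk" by (auto simp: inertia_def decomp_def)
  then obtain E where E: "is_sf E" "kk <= E" "E <= B" "E = fixf B (inertia kk W)" using sub by blast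
  have ZE: "Z <= E" using I[OF W(1)] unfolding Z_def E(4) fixf_def by auto
  have cbE: "clb E" by (rule clb_mono[OF clb_k E(2,1)])
  note gE = abel_gal[OF abel_mid(2)[OF clb_k a E(1-3)]]
  note fE = fin_gen_mid[OF clb_k f g E(1-3)]
  have "prm E (W Int E)" by (rule pr_rest[OF cbE BS E(3) W(1)])
  then obtain t where t: "t:kk" "unif E (W Int E) t"
   using unif_inert[OF clb_k fE gE dvr_k[OF fE gE] inertia_fixf[OF a f W(1) E(4)]] by blast
  have "W Int E Int Z = U" using W(2) ZE by auto
  thus "EX t:kk. unif Z U t" using unif_sub[OF t(2) Z(1) ZE] t(1) Z(2) by auto
 next
  fix U x assume U: "prm Z U" "U Int kk = Pinf" "x:U"
  obtain W where W: "prm B W" "W Int Z = U" using above_ex[OF gZ fZ BS Z(3) U(1)] .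
  have Wi: "W Int kk = Pinf" using W(2) U(2) Z(2) by auto
  have "decomp kk W <= Aut kk" by (auto simp: decomp_def)
  then obtain E where E: "is_sf E" "kk <= E" "E <= B" "E = fixf B (decomp kk W)" using sub by blast
  have ZE: "Z <= E" using D[OF W(1) Wi] unfolding Z_def E(4) fixf_def by auto
  have cbE: "clb E" by (rule clb_mono[OF clb_k E(2,1)])
  note gE = abel_gal[OF abel_mid(2)[OF clb_k a E(1-3)]]
  note fE = fin_gen_mid[OF clb_k f g E(1-3)]
  have pE: "prm E (W Int E)" by (rule pr_rest[OF cbE BS E(3) W(1)])
  have "x:E" using U(3) W(2) ZE by auto
  then obtain c where c: "c:kk" "c - x:mx (W Int E)"
   using residue_of_decomp_trivial[OF clb_k fE gE dvr_k[OF fE gE pE] decomp_fixf_trivial[OF a f W(1) E(4)]] by metis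
  have "c - x:Z" using c(1) Z(2) U(3) W(2) by (intro sf_cl(3)[OF Z(1)]) auto
  hence "c - x:mx (W Int Z)" using c(2) by (simp add: mx_Int(1)[OF E(1)] mx_Int(1)[OF Z(1)])
  thus "EX c:kk. c - x:mx U" using c(1) W(2) by auto
 qed
 hence "x:kk" if "x:B" "!!a. a:A ==> a x = x" for x using that unfolding Z_def fixf_def by auto
 thus thesis using artin[OF clb_k infinite_k f g A _ s] that by metis
qed

section \<open>Witt vectors\<close>

definition ring_map :: "('r::comm_ring_1 => 's::comm_ring_1) => bool" where
 "ring_map h <-> h 1 = 1 & (ALL x y. h (x - y) = h x - h y) & (ALL x y. h (x * y) = h x * h y)"

lemma ring_mapD:
 assumes "ring_map h"
 shows "h 1 = 1" "h (x - y) = h x - h y" "h (x * y) = h x * h y" "h 0 = 0" "h (x + y) = h x + h y"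
  "h (x ^ n) = h x ^ n" "h (of_nat n) = of_nat n" "h (of_int e) = of_int e" "h (sum f A) = (SUM i:A. h (f i))"
proof -
 show h: "h 1 = 1" "h (x - y) = h x - h y" "h (x * y) = h x * h y" for x y
  using assms by (auto simp: ring_map_def)
 show z: "h 0 = 0" using h(2)[of 0 0] by simp
 show p: "h (x + y) = h x + h y" for x y using h(2)[of x "0 - y"] h(2)[of 0 y] z by simp
 show "h (x ^ n) = h x ^ n" by (induction n) (simp_all add: h)
 show n: "h (of_nat n) = of_nat n" for n by (induction n) (simp_all add: h z p)
 show "h (of_int e) = of_int e" using h(2)[of 0] z by (cases e rule: int_cases2) (simp_all add: n)
 show "h (sum f A) = (SUM i:A. h (f i))" by (induction A rule: infinite_finite_induct) (simp_all add: z p)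
qed

section \<open>Evaluation of integer polynomials\<close>

definition mono_eval :: "(nat + nat => 'b::comm_ring_1) => ((nat + nat) \<Rightarrow>\<^sub>0 nat) => 'b" where
 "mono_eval rh m = (PROD i:Poly_Mapping.keys m. rh i ^ Poly_Mapping.lookup m i)"

lemma mono_eval_superset:
 "finite A ==> Poly_Mapping.keys m <= A ==> mono_eval rh m = (PROD i:A. rh i ^ Poly_Mapping.lookup m i)"
 unfolding mono_eval_def by (rule prod.mono_neutral_left) (auto simp: in_keys_iff)

lemma mono_eval_add: "mono_eval rh (m + m') = mono_eval rh m * mono_eval rh m'"
proof -
 let ?A = "Poly_Mapping.keys m Un Poly_Mapping.keys m'"
 have "mono_eval rh k = (PROD i:?A. rh i ^ Poly_Mapping.lookup k i)" if "k:{m, m', m + m'}" for k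
  using that keys_add[of m m'] by (intro mono_eval_superset) auto
 thus ?thesis by (simp add: lookup_add power_add prod.distrib)
qed

lemma mpoly_eval_superset:
 "finite A ==> Poly_Mapping.keys f <= A ==>
  mpoly_eval rh f = (SUM m:A. of_int (Poly_Mapping.lookup f m) * mono_eval rh m)"
 unfolding mpoly_eval_def mono_eval_def[symmetric] by (rule sum.mono_neutral_left) (auto simp: in_keys_iff)

lemma mpoly_single: "mpoly_eval rh (Poly_Mapping.single m 1) = mono_eval rh m"
 by (simp add: mpoly_eval_def mono_eval_def)

lemma mpoly_diff: "mpoly_eval rh (f - g) = mpoly_eval rh f - mpoly_eval rh g"
proof -
 let ?A = "Poly_Mapping.keys f Un Poly_Mapping.keys g"
 have k: "Poly_Mapping.keys (f - g) <= ?A" by (auto simp: in_keys_iff lookup_minus)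
 have "mpoly_eval rh k = (SUM m:?A. of_int (Poly_Mapping.lookup k m) * mono_eval rh m)" if "k:{f, g, f - g}" for k
  using that k by (intro mpoly_eval_superset) auto
 thus ?thesis by (simp add: lookup_minus left_diff_distrib sum_subtractf)
qed

text \<open>An integer polynomial is an element of the free abelian group on its monomials, so
  induction over differences suffices.\<close>

lemma mpoly_induct [case_names zero single diff]:
 fixes f :: int_mpoly
 assumes "Q 0" "!!m. Q (Poly_Mapping.single m 1)" "!!f g. Q f ==> Q g ==> Q (f - g)"
 shows "Q f"
 by (rule frag_induction[of f UNIV]) (use assms in auto)

lemma mpoly_eval_0: "mpoly_eval rh 0 = 0" by (simp add: mpoly_eval_def)

lemma mpoly_map: "ring_map (mpoly_eval rh)"
proof -
 have 1: "mpoly_eval rh (Poly_Mapping.single m 1 * g) = mono_eval rh m * mpoly_eval rh g" for m and g :: int_mpoly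
  by (induction g rule: mpoly_induct)
   (simp_all add: mpoly_eval_0 mult_single mpoly_single mono_eval_add mpoly_diff right_diff_distrib)
 have "mpoly_eval rh (f * g) = mpoly_eval rh f * mpoly_eval rh g" for f g
  by (induction f rule: mpoly_induct)
   (simp_all add: mpoly_eval_0 1 mpoly_single mpoly_diff left_diff_distrib)
 moreover have "mpoly_eval rh 1 = 1"
  using mpoly_single[of rh 0] by (simp add: mono_eval_def)
 ultimately show ?thesis by (simp add: ring_map_def mpoly_diff)
qed

lemmas mpoly_eval_simps = ring_mapD[OF mpoly_map]

lemma mpoly_eval_var [simp]: "mpoly_eval rh (mpoly_var i) = rh i"
 by (simp add: mpoly_var_def mpoly_single mono_eval_def)

text \<open>One induction for several uses: \<open>Q\<close> is instantiated with the graph of a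
  homomorphism, with membership in a subring, and with congruence modulo a maximal ideal.\<close>

lemma mpoly_eval_rel:
 assumes Q: "!!i. Q (rh i) (rh' i)" "Q 0 0" "Q 1 1"
  "!!x y x' y'. Q x y ==> Q x' y' ==> Q (x - x') (y - y')" "!!x y x' y'. Q x y ==> Q x' y' ==> Q (x * x') (y * y')"
 shows "Q (mpoly_eval rh f) (mpoly_eval rh' f)"
proof (induction f rule: mpoly_induct)
 case (single m)
 have p: "Q (rh i ^ n) (rh' i ^ n)" for i n by (induction n) (simp_all add: Q)
 have "Q (PROD i:A. rh i ^ Poly_Mapping.lookup m i) (PROD i:A. rh' i ^ Poly_Mapping.lookup m i)" for A
  by (induction A rule: infinite_finite_induct) (simp_all add: Q p)
 thus ?case by (simp add: mpoly_single mono_eval_def)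
qed (simp_all add: mpoly_eval_0 mpoly_diff Q)

lemma ring_map_mpoly_eval:
 assumes "ring_map h" shows "h (mpoly_eval rh f) = mpoly_eval (%i. h (rh i)) f"
 by (rule mpoly_eval_rel) (simp_all add: ring_mapD[OF assms])

lemma mono_eval_mpoly_var: "mono_eval mpoly_var m = Poly_Mapping.single m 1"
proof -
 have p: "mpoly_var i ^ n = Poly_Mapping.single (Poly_Mapping.single i n) 1" for i n
  by (induction n) (simp_all add: mpoly_var_def mult_single flip: single_add)
 have "(PROD i:A. mpoly_var i ^ c i) = Poly_Mapping.single (SUM i:A. Poly_Mapping.single i (c i)) 1" for A c
  by (induction A rule: infinite_finite_induct) (simp_all add: p mult_single)
 moreover have "(SUM i:Poly_Mapping.keys m. Poly_Mapping.single i (Poly_Mapping.lookup m i)) = m"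
  by (rule poly_mapping_eqI) (simp add: lookup_sum lookup_single when_def in_keys_iff)
 ultimately show ?thesis by (simp add: mono_eval_def)
qed

lemma mpoly_eval_mpoly_var: "mpoly_eval mpoly_var f = f"
 by (induction f rule: mpoly_induct) (simp_all add: mpoly_eval_0 mpoly_single mono_eval_mpoly_var mpoly_diff)

lemma mpoly_torsion_free:
 assumes "n > 0" "of_nat n * f = of_nat n * (g :: int_mpoly)" shows "f = g"
proof -
 have "Poly_Mapping.lookup (of_nat n * h) m = of_nat n * Poly_Mapping.lookup h m" for h :: int_mpoly and n m
  by (induction n) (simp_all add: lookup_add distrib_right)
 thus ?thesis using assms by (metis mult_cancel_left of_nat_0_eq_iff less_irrefl poly_mapping_eqI)
qed

section \<open>Ghost components and Dwork's criterion\<close>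

lemma dvd_power_prime_diff:
 fixes a b :: "'r::comm_ring_1"
 assumes "of_nat p dvd a - b" shows "of_nat p ^ Suc k dvd a ^ (p ^ k) - b ^ (p ^ k)"
proof (induction k)
 case (Suc k)
 let ?a = "a ^ (p ^ k)" and ?b = "b ^ (p ^ k)"
 have "of_nat p dvd ?a ^ i * ?b ^ (p - Suc i) - ?b ^ (p - 1)" if "i < p" for i
 proof -
  have "of_nat p dvd ?a - ?b" using Suc by (rule dvd_trans[rotated]) simp
  hence "of_nat p dvd ?a ^ i - ?b ^ i" by (rule dvd_trans) (simp add: power_diff_sumr2)
  hence "of_nat p dvd (?a ^ i - ?b ^ i) * ?b ^ (p - Suc i)" by simp
  moreover have "?b ^ i * ?b ^ (p - Suc i) = ?b ^ (p - 1)" using that by (simp flip: power_add)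
  ultimately show ?thesis by (simp add: left_diff_distrib)
 qed
 hence "of_nat p dvd (SUM i<p. ?a ^ i * ?b ^ (p - Suc i) - ?b ^ (p - 1))" by (intro dvd_sum) simp
 hence "of_nat p dvd (SUM i<p. ?a ^ i * ?b ^ (p - Suc i))"
  unfolding sum_subtractf by (subst (asm) dvd_diff_left_iff) simp_all
 hence "of_nat p ^ Suc k * of_nat p dvd (?a - ?b) * (SUM i<p. ?b ^ (p - Suc i) * ?a ^ i)"
  using Suc by (intro mult_dvd_mono) (simp_all add: mult.commute)
 thus ?case by (simp add: mult.commute[of p] mult.commute[of "of_nat p"] power_mult power_diff_sumr2)
qed (use assms in simp)

lemma freshmans_dream_dvd:
 fixes a b :: "'r::comm_ring_1"
 assumes "prime p" shows "of_nat p dvd (a + b) ^ p - a ^ p - b ^ p"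
proof -
 let ?t = "%k. of_nat (p choose k) * a ^ k * b ^ (p - k)"
 have p: "0 < p" using assms prime_gt_0_nat by blast
 have "(a + b) ^ p = (SUM k<=p. ?t k)" by (rule binomial_ring)
 also have "{..p} = insert 0 (insert p {0<..<p})" using p by auto
 finally have "(a + b) ^ p - a ^ p - b ^ p = (SUM k:{0<..<p}. ?t k)" using p by simp
 moreover have "of_nat p dvd ?t k" if "k:{0<..<p}" for k
  using that dvd_choose_prime[of k p] assms by (auto elim!: dvdE simp: mult.assoc)
 ultimately show ?thesis by (auto intro!: dvd_sum)
qed

text \<open>The Frobenius lift of the polynomial ring, raising every variable to the power
  \<open>p\<close>.\<close>

definition flift :: "nat => int_mpoly => int_mpoly" where
 "flift p = mpoly_eval (%i. mpoly_var i ^ p)"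

lemma flift: assumes "prime p" shows "of_nat p dvd flift p f - f ^ p"
proof (induction f rule: mpoly_induct)
 case zero thus ?case using prime_gt_0_nat[OF assms] by (simp add: flift_def mpoly_eval_0 power_0_left)
next
 case (single m)
 have "flift p (Poly_Mapping.single m 1) = mono_eval mpoly_var m ^ p"
  by (simp add: flift_def mpoly_single mono_eval_def prod_power_distrib flip: power_mult, simp add: mult.commute)
 thus ?case by (simp add: mono_eval_mpoly_var)
next
 case (diff f g)
 have "flift p (f - g) - (f - g) ^ p = (flift p f - f ^ p) - (flift p g - g ^ p) + ((f - g + g) ^ p - (f - g) ^ p - g ^ p)"
  by (simp add: flift_def mpoly_diff)
 also have "of_nat p dvd ..." by (intro dvd_add dvd_diff diff freshmans_dream_dvd assms)
 finally show ?case .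
qed

lemma ring_map_ghost: "ring_map h ==> h (witt_ghost p x n) = witt_ghost p (%i. h (x i)) n"
 by (simp add: witt_ghost_def ring_mapD)

lemma ghost_inj:
 fixes S S' :: "nat => int_mpoly"
 assumes "prime p" and eq: "!!k. k <= n ==> witt_ghost p S k = witt_ghost p S' k" shows "S n = S' n"
 using eq
proof (induction n rule: less_induct)
 case (less n)
 have "S i = S' i" if "i < n" for i using less.IH[OF that] less.prems that by simp
 hence "(SUM i<n. of_nat (p ^ i) * S i ^ (p ^ (n - i))) = (SUM i<n. of_nat (p ^ i) * S' i ^ (p ^ (n - i)))" by simp
 hence "of_nat (p ^ n) * S n = of_nat (p ^ n) * S' n"
  using less.prems[OF order_refl] by (simp add: witt_ghost_def lessThan_Suc_atMost[symmetric])
 thus ?case using mpoly_torsion_free[of "p ^ n"] prime_gt_0_nat[OF assms(1)] by simp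
qed

text \<open>By Dwork's lemma the divisions by \<open>p ^ n\<close> are exact for the ghost components used below.\<close>

fun ghost_preimage :: "nat => (nat => int_mpoly) => nat => int_mpoly" where
 "ghost_preimage p G n =
  (SOME x. of_nat (p ^ n) * x = G n - (SUM i:{..<n}. of_nat (p ^ i) * ghost_preimage p G i ^ (p ^ (n - i))))"
declare ghost_preimage.simps [simp del]

text \<open>Dwork's criterion. Applying \<open>flift\<close> to the previous ghost component and
  replacing \<open>flift p (S i)\<close> by \<open>S i ^ p\<close> changes the sum only by a
  multiple of \<open>p ^ n\<close>, because of the factors \<open>p ^ i\<close> and of
  \<open>dvd_power_prime_diff\<close>. So the division defining the next component is exact.\<close>

lemma ghost_surj:
 assumes p: "prime p" and G: "!!n. of_nat (p ^ Suc n) dvd G (Suc n) - flift p (G n)"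
 shows "witt_ghost p (ghost_preimage p G) n = G n"
proof (induction n rule: less_induct)
 case (less n)
 let ?S = "ghost_preimage p G" and ?r = "%n. SUM i:{..<n}. of_nat (p ^ i) * ghost_preimage p G i ^ (p ^ (n - i))"
 have "of_nat (p ^ n) dvd G n - ?r n"
 proof (cases n)
  case (Suc k)
  have f: "flift p (G k) = (SUM i<n. of_nat (p ^ i) * flift p (?S i) ^ (p ^ (k - i)))"
   unfolding less[of k, symmetric, unfolded Suc, OF lessI] flift_def ring_map_ghost[OF mpoly_map]
   by (simp add: Suc witt_ghost_def lessThan_Suc_atMost)
  have "of_nat (p ^ n) dvd of_nat (p ^ i) * flift p (?S i) ^ (p ^ (k - i)) - of_nat (p ^ i) * ?S i ^ (p ^ (n - i))"
   if i: "i < n" for i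
  proof -
   have s: "Suc (k - i) = n - i" using i Suc by simp
   have "of_nat (p ^ i) * of_nat p ^ Suc (k - i) dvd
    of_nat (p ^ i) * (flift p (?S i) ^ (p ^ (k - i)) - (?S i ^ p) ^ (p ^ (k - i)))"
    by (intro mult_dvd_mono dvd_refl dvd_power_prime_diff flift p)
   moreover have "of_nat (p ^ i) * of_nat p ^ Suc (k - i) = (of_nat (p ^ n) :: int_mpoly)"
    using i unfolding s by (simp flip: power_add)
   moreover have "(?S i ^ p) ^ (p ^ (k - i)) = ?S i ^ (p ^ (n - i))" unfolding s[symmetric] by (simp add: power_mult)
   ultimately show ?thesis by (simp add: right_diff_distrib)
  qed
  hence "of_nat (p ^ n) dvd flift p (G k) - ?r n" unfolding f sum_subtractf[symmetric] by (intro dvd_sum) simp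
  from dvd_add[OF G[of k, folded Suc] this] show ?thesis by simp
 qed simp
 hence "EX x. of_nat (p ^ n) * x = G n - ?r n" by (auto elim!: dvdE intro: sym)
 hence "of_nat (p ^ n) * ?S n = G n - ?r n" by (subst ghost_preimage.simps) (rule someI_ex)
 thus ?case by (simp add: witt_ghost_def lessThan_Suc_atMost[symmetric])
qed

section \<open>Components of Witt sums and differences\<close>

definition wcomp :: "nat => (int_mpoly => int_mpoly => int_mpoly) => (nat => 'b::comm_ring_1) => (nat => 'b) => nat => 'b" where
 "wcomp p opr x y n = mpoly_eval (case_sum x y) (witt_polys p opr n)"

context
 fixes p :: nat and opr :: "int_mpoly => int_mpoly => int_mpoly" and e :: int
 assumes p: "prime p" and opr: "!!f g. opr f g = f + of_int e * g"
begin

text \<open>The choices \<open>e = 1\<close> and \<open>e = -1\<close> treat addition and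
  subtraction together. Dwork's criterion holds since the Frobenius lift of a ghost component of the
  variables is the next one without its top term.\<close>

lemma witt_polys_ghost:
 "witt_ghost p (witt_polys p opr) n = opr (witt_ghost p (%i. mpoly_var (Inl i)) n) (witt_ghost p (%i. mpoly_var (Inr i)) n)"
proof -
 let ?G = "%n. opr (witt_ghost p (%i. mpoly_var (Inl i)) n) (witt_ghost p (%i. mpoly_var (Inr i)) n)"
 have g: "witt_ghost p (%i. mpoly_var (c i)) (Suc n) - flift p (witt_ghost p (%i. mpoly_var (c i)) n)
  = of_nat (p ^ Suc n) * mpoly_var (c (Suc n))" for c n
  unfolding flift_def ring_map_ghost[OF mpoly_map]
  by (simp add: witt_ghost_def Suc_diff_le flip: power_mult)
 have "?G (Suc n) - flift p (?G n) = of_nat (p ^ Suc n) * (mpoly_var (Inl (Suc n)) + of_int e * mpoly_var (Inr (Suc n)))" for n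
  using g[of Inl n] g[of Inr n] unfolding opr flift_def mpoly_eval_simps by (simp add: algebra_simps)
 hence "witt_ghost p (ghost_preimage p ?G) n = ?G n" for n by (intro ghost_surj p) simp
 hence ex: "EX S. ALL n. witt_ghost p S n = ?G n" by blast
 have "S = S'" if "ALL n. witt_ghost p S n = ?G n" "ALL n. witt_ghost p S' n = ?G n" for S S'
  by (rule ext, rule ghost_inj[OF p]) (simp only: that)
 hence "EX! S. ALL n. witt_ghost p S n = ?G n" using ex by (intro ex_ex1I)
 from theI'[OF this] show ?thesis unfolding witt_polys_def by (rule spec)
qed

lemma witt_comp_ghost: "witt_ghost p (wcomp p opr x y) n = witt_ghost p x n + of_int e * witt_ghost p y n"
 using arg_cong[OF witt_polys_ghost[of n], of "mpoly_eval (case_sum x y)"]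
 by (simp add: opr mpoly_eval_simps ring_map_ghost[OF mpoly_map] wcomp_def[abs_def])

lemma map_wcomp: "ring_map h ==> h (wcomp p opr x y n) = wcomp p opr (%i. h (x i)) (%i. h (y i)) n"
 unfolding wcomp_def by (subst ring_map_mpoly_eval, assumption) (rule arg_cong[where f = "%rh. mpoly_eval rh _"], auto split: sum.splits)

text \<open>Up to a correction depending on earlier components only, the operation is the ordinary
  one. This is what reduces an Artin-Schreier-Witt equation to a tower of Artin-Schreier equations.
  The identity is proved for the generic polynomials, where \<open>p ^ n\<close> can be cancelled,
  and then specialised.\<close>

lemma witt_comp_top:
 "wcomp p opr x y n = x n + of_int e * y n
  + wcomp p opr (%i. if i < n then x i else 0) (%i. if i < n then y i else 0) n"
proof -
 let ?c = "%n z i. if i < n then z i else (0 :: int_mpoly)"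
 let ?x = "%i. mpoly_var (Inl i)" and ?y = "%i. mpoly_var (Inr i)"
 \<comment> \<open>The same operation after setting the components from index \<open>n\<close> on to
   zero.\<close>
 let ?W = "%n. wcomp p opr (?c n ?x) (?c n ?y)"
 have WS: "wcomp p opr ?x ?y = witt_polys p opr"
 proof
  have "case_sum ?x ?y = mpoly_var" by (auto split: sum.split)
  thus "wcomp p opr ?x ?y n = witt_polys p opr n" for n by (simp add: wcomp_def mpoly_eval_mpoly_var)
 qed
 have main: "wcomp p opr ?x ?y n = ?x n + of_int e * ?y n + ?W n n" for n
 proof (induction n rule: less_induct)
  case (less n)
  have lo: "?W n i = wcomp p opr ?x ?y i" if "i < n" for i
  proof -
   let ?h = "mpoly_eval (case_sum (?c n ?x) (?c n ?y))"
   have "?h (wcomp p opr ?x ?y i) = ?W n i"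
    by (subst map_wcomp[OF mpoly_map]) simp
   moreover have "?h (?W i i) = ?W i i"
    using that by (subst map_wcomp[OF mpoly_map]) (auto simp: if_distrib mpoly_eval_0 intro!: arg_cong2[where f = "%a b. wcomp p opr a b i"])
   ultimately show ?thesis using less[OF that] that by (simp add: mpoly_eval_simps)
  qed
  have g: "witt_ghost p z n = (SUM i<n. of_nat (p ^ i) * z i ^ (p ^ (n - i))) + of_nat (p ^ n) * z n" for z :: "nat => int_mpoly"
   by (simp add: witt_ghost_def lessThan_Suc_atMost[symmetric])
  have "of_nat (p ^ n) * wcomp p opr ?x ?y n = of_nat (p ^ n) * (?x n + of_int e * ?y n + ?W n n)"
  proof -
   have "A * W = A * (x + e * y + V)" if "L + A * W = (Lx + A * x) + e * (Ly + A * y)" "L + A * V = Lx + e * Ly"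
    for A W V x y L Lx Ly e :: int_mpoly
   proof -
    have "L + A * (x + e * y + V) = A * x + e * (A * y) + (L + A * V)" by (simp add: algebra_simps)
    also have "... = L + A * W" unfolding that by (simp add: algebra_simps)
    finally show ?thesis by simp
   qed
   moreover have "(SUM i<n. of_nat (p ^ i) * ?W n i ^ (p ^ (n - i))) = (SUM i<n. of_nat (p ^ i) * wcomp p opr ?x ?y i ^ (p ^ (n - i)))"
    by (simp add: lo)
   ultimately show ?thesis
    using witt_comp_ghost[of ?x ?y n, unfolded g] witt_comp_ghost[of "?c n ?x" "?c n ?y" n, unfolded g] by simp
  qed
  thus ?case using mpoly_torsion_free[of "p ^ n"] prime_gt_0_nat[OF p] by simp
 qed
 from arg_cong[OF main[of n], of "mpoly_eval (case_sum x y)"] show ?thesis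
  by (simp add: mpoly_eval_simps map_wcomp[OF mpoly_map] if_distrib mpoly_eval_0 cong: if_cong)
qed

lemma wcomp_local:
 assumes "!!i. i <= n ==> x i = x' i" "!!i. i <= n ==> y i = y' i"
 shows "wcomp p opr x y n = wcomp p opr x' y' n"
proof -
 have "(%i. if i < n then x i else 0) = (%i. if i < n then x' i else 0)" "(%i. if i < n then y i else 0) = (%i. if i < n then y' i else 0)"
  using assms by auto
 thus ?thesis using assms by (subst (1 2) witt_comp_top) simp
qed

lemma witt_op_nth:
 "n < length a ==> witt_op p opr a b ! n = wcomp p opr (nth a) (nth b) n"
 by (simp add: witt_op_def wcomp_def)

lemma witt_op_ring_map:
 assumes "ring_map h" "length b = length a"
 shows "map h (witt_op p opr a b) = witt_op p opr (map h a) (map h b)"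
 using assms(2) by (intro nth_equalityI) (auto simp: witt_op_def wcomp_def[symmetric] map_wcomp[OF assms(1)] intro!: wcomp_local)

lemma witt_op_rel:
 assumes Q: "Q 0 0" "Q 1 1" "!!x y x' y'. Q x y ==> Q x' y' ==> Q (x - x') (y - y')" "!!x y x' y'. Q x y ==> Q x' y' ==> Q (x * x') (y * y')"
  and n: "n < length a" and ab: "!!i. i <= n ==> Q (a ! i) (a' ! i)" "!!i. i <= n ==> Q (b ! i) (b' ! i)"
  and l: "length a' = length a"
 shows "Q (witt_op p opr a b ! n) (witt_op p opr a' b' ! n)"
proof -
 have w: "witt_op p opr a b ! n = wcomp p opr (%i. if i <= n then a ! i else 0) (%i. if i <= n then b ! i else 0) n"
  if "n < length a" for a b using that by (simp add: witt_op_nth cong: wcomp_local)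
 show ?thesis using n l ab by (subst (1 2) w) (auto simp: wcomp_def Q split: sum.splits intro!: mpoly_eval_rel[where Q = Q])
qed

lemma witt_op_top:
 assumes R: "is_sr R" and n: "n < length a" and ab: "!!i. i < n ==> a ! i:R" "!!i. i < n ==> b ! i:R"
 shows "witt_op p opr a b ! n - (a ! n + of_int e * b ! n):R"
proof -
 have "witt_op p opr a b ! n - (a ! n + of_int e * b ! n) = wcomp p opr (%i. if i < n then a ! i else 0) (%i. if i < n then b ! i else 0) n"
  using n by (simp add: witt_op_nth, subst witt_comp_top, simp)
 also have "... : R" unfolding wcomp_def using ab sr_cl[OF R]
  by (intro mpoly_eval_rel[where Q = "%x y. x:R"]) (auto split: sum.splits)
 finally show ?thesis .
qed

end

text \<open>Identities between Witt vectors over any ring reduce to identities between integer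
  polynomials, which have no torsion. Three sequences are fitted into two families of variables by
  splitting one family into even and odd indices.\<close>

lemma witt_generic:
 fixes x y z :: "nat => 'b::comm_ring_1"
 obtains h :: "int_mpoly => 'b" and u v w where "ring_map h" "x = (%i. h (u i))" "y = (%i. h (v i))" "z = (%i. h (w i))"
proof
 let ?rh = "case_sum (%i. if even i then x (i div 2) else y (i div 2)) z"
 show "ring_map (mpoly_eval ?rh)" by (rule mpoly_map)
 show "x = (%i. mpoly_eval ?rh (mpoly_var (Inl (2 * i))))" "y = (%i. mpoly_eval ?rh (mpoly_var (Inl (2 * i + 1))))"
  "z = (%i. mpoly_eval ?rh (mpoly_var (Inr i)))" by simp_all
qed

context
 fixes p :: nat assumes p: "prime p"
begin

lemma witt_opr: "f + g = f + of_int 1 * (g :: int_mpoly)" "f - g = f + of_int (-1) * (g :: int_mpoly)" by simp_all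

lemmas witt_comp_ghosts = witt_comp_ghost[where opr = "(+)", OF p witt_opr(1)] witt_comp_ghost[where opr = "(-)", OF p witt_opr(2)]
lemmas witt_comp_maps = map_wcomp[where opr = "(+)", OF p witt_opr(1)] map_wcomp[where opr = "(-)", OF p witt_opr(2)]

text \<open>Ghost components turn each identity into one for ordinary addition, and
  \<open>ghost_inj\<close> transfers it back from the generic case.\<close>

lemma wcomp_ids:
 fixes x y z :: "nat => 'b::comm_ring_1"
 shows "wcomp p (+) x y n = wcomp p (+) y x n"
  "wcomp p (+) (wcomp p (+) x y) z n = wcomp p (+) x (wcomp p (+) y z) n"
  "wcomp p (+) (%_. 0) x n = x n"
  "wcomp p (+) (wcomp p (-) x y) y n = x n"
  "wcomp p (-) (wcomp p (+) x y) y n = x n"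
proof -
 obtain h :: "int_mpoly => 'b" and u v w where h: "ring_map h" and
  e: "x = (%i. h (u i))" "y = (%i. h (v i))" "z = (%i. h (w i))" using witt_generic .
 have z: "(%_. 0) = (%i::nat. h 0)" by (simp add: ring_mapD[OF h])
 have gz: "witt_ghost p (%_. 0) k = 0" for k using prime_gt_0_nat[OF p] by (simp add: witt_ghost_def power_0_left)
 note s = witt_comp_maps[OF h, symmetric] witt_comp_maps[OF h, symmetric, abs_def]
 show "wcomp p (+) x y n = wcomp p (+) y x n"
  "wcomp p (+) (wcomp p (+) x y) z n = wcomp p (+) x (wcomp p (+) y z) n"
  "wcomp p (+) (%_. 0) x n = x n"
  "wcomp p (+) (wcomp p (-) x y) y n = x n"
  "wcomp p (-) (wcomp p (+) x y) y n = x n"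
  unfolding e z s by (rule arg_cong[of _ _ h]; rule ghost_inj[OF p]; simp add: witt_comp_ghosts gz)+
qed

lemma length_witt [simp]: "length (wadd p a b) = length a" "length (witt_diff p a b) = length a"
 by (simp_all add: witt_add_def witt_diff_def witt_op_def)

lemma witt_nth:
 "n < length a ==> wadd p a b ! n = wcomp p (+) (nth a) (nth b) n"
 "n < length a ==> witt_diff p a b ! n = wcomp p (-) (nth a) (nth b) n"
 by (simp_all add: witt_add_def witt_diff_def witt_op_def wcomp_def)

lemmas witt_locals = wcomp_local[where opr = "(+)", OF p witt_opr(1)] wcomp_local[where opr = "(-)", OF p witt_opr(2)]

lemma witt_group:
 fixes a b c :: "'b::comm_ring_1 list"
 assumes l: "length b = length a"
 shows witt_add_commute: "wadd p a b = wadd p b a"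
  and witt_add_assoc: "length c = length a ==> wadd p (wadd p a b) c = wadd p a (wadd p b c)"
  and witt_add_0: "wadd p (replicate (length a) 0) a = a"
  and witt_diff_add: "wadd p (witt_diff p a b) b = a"
  and witt_add_diff: "witt_diff p (wadd p a b) b = a"
proof -
 show "wadd p a b = wadd p b a"
  using l by (intro nth_equalityI) (simp_all add: witt_nth wcomp_ids(1))
 show "wadd p (wadd p a b) c = wadd p a (wadd p b c)" if lc: "length c = length a"
 proof (intro nth_equalityI)
  fix i assume "i < length (wadd p (wadd p a b) c)"
  hence i: "i < length a" by simp
  hence "wadd p (wadd p a b) c ! i = wcomp p (+) (wcomp p (+) (nth a) (nth b)) (nth c) i"
   by (auto simp: witt_nth intro!: witt_locals)
  also have "... = wcomp p (+) (nth a) (wcomp p (+) (nth b) (nth c)) i" by (rule wcomp_ids)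
  also have "... = wadd p a (wadd p b c) ! i" using i l lc by (auto simp: witt_nth intro!: witt_locals)
  finally show "wadd p (wadd p a b) c ! i = wadd p a (wadd p b c) ! i" .
 qed simp
 show "wadd p (replicate (length a) 0) a = a"
 proof (intro nth_equalityI)
  fix i assume "i < length (wadd p (replicate (length a) 0) a)"
  hence i: "i < length a" by simp
  hence "wadd p (replicate (length a) 0) a ! i = wcomp p (+) (%_. 0) (nth a) i"
   by (auto simp: witt_nth intro!: witt_locals)
  thus "wadd p (replicate (length a) 0) a ! i = a ! i" by (simp add: wcomp_ids)
 qed simp
 have "wadd p (witt_diff p a b) b ! i = a ! i & witt_diff p (wadd p a b) b ! i = a ! i" if i: "i < length a" for i
 proof -
  have "wadd p (witt_diff p a b) b ! i = wcomp p (+) (wcomp p (-) (nth a) (nth b)) (nth b) i"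
   "witt_diff p (wadd p a b) b ! i = wcomp p (-) (wcomp p (+) (nth a) (nth b)) (nth b) i"
   using i by (auto simp: witt_nth intro!: witt_locals)
  thus ?thesis by (simp only: wcomp_ids(4,5) simp_thms)
 qed
 thus "wadd p (witt_diff p a b) b = a" "witt_diff p (wadd p a b) b = a" by (auto intro!: nth_equalityI)
qed

lemma witt_diff_eq_iff:
 assumes "length b = length a" "length c = length a" shows "witt_diff p a b = c <-> a = wadd p c b"
 using witt_diff_add[of b a] witt_add_diff[of b c] assms by auto

lemma witt_ring_map:
 assumes "ring_map h" "length b = length a"
 shows "map h (wadd p a b) = wadd p (map h a) (map h b)"
 unfolding witt_add_def by (rule witt_op_ring_map[OF p witt_opr(1) assms])

lemma witt_closed:
 assumes R: "is_sr R" and l: "length b = length a" and ab: "set a <= R" "set b <= R"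
 shows "set (wadd p a b) <= R" "set (witt_diff p a b) <= R"
proof -
 have "witt_op p opr a b ! n:R" if n: "n < length a" and opr: "!!f g. opr f g = f + of_int e * g" for n opr e
  using sr_cl[OF R] n l ab by (intro witt_op_rel[OF p opr, where Q = "%x y. x:R"]) (auto simp: subset_iff)
 from this[OF _ witt_opr(1)] this[OF _ witt_opr(2)] show "set (wadd p a b) <= R" "set (witt_diff p a b) <= R"
  by (auto simp: in_set_conv_nth witt_add_def witt_diff_def witt_op_def[of p _ a b])
qed

lemmas wadd_top = witt_op_top[where opr = "(+)", OF p witt_opr(1), folded witt_add_def]
lemmas witt_add_rel = witt_op_rel[where opr = "(+)", OF p witt_opr(1), folded witt_add_def]

end

section \<open>Artin--Schreier--Witt extensions\<close>

lemma frobenius_ring_map':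
 assumes "prime CHAR('r)" shows "ring_map (%x :: 'r::comm_ring_1. x ^ (CHAR('r) ^ n))"
proof (induction n)
 case (Suc n)
 have a: "(x + y) ^ CHAR('r) = x ^ CHAR('r) + y ^ CHAR('r)" for x y :: 'r using freshmans_dream[OF assms refl] .
 have "(x - y) ^ CHAR('r) = x ^ CHAR('r) - y ^ CHAR('r)" for x y :: 'r using a[of "x - y" y] by simp
 thus ?case using Suc by (simp add: ring_map_def power_mult mult.commute[of "CHAR('r)"] power_mult_distrib)
qed (simp add: ring_map_def)

lemmas frobenius_ring_map = frobenius_ring_map'[OF CHAR_pr, unfolded CHAR_kbar]

lemma GF_card: "GF CARD('a) = range (cst :: 'a::finite_field => 'a kbar)"
proof (rule sym, rule card_subset_eq)
 let ?f = "monom 1 CARD('a) - monom 1 1 :: 'a kbar poly"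
 have q: "CARD('a) > 1" by (rule card_gt)
 have G: "GF CARD('a) = {x. poly ?f x = 0}" by (auto simp: GF_def poly_monom)
 have "coeff ?f CARD('a) = 1" using q by simp
 hence f0: "?f ~= 0" by (metis coeff_0 zero_neq_one)
 have d: "degree ?f <= CARD('a)" using q by (intro degree_diff_le) (simp_all add: degree_monom_eq)
 show fin: "finite (GF CARD('a) :: 'a kbar set)" unfolding G by (rule poly_roots_finite[OF f0])
 show s: "range (cst :: 'a => 'a kbar) <= (GF CARD('a) :: 'a kbar set)" by (auto simp: GF_def cst_frob)
 have "inj (cst :: 'a => 'a kbar)" by (auto simp: inj_def cst_def of_RT_inj)
 hence "card (range (cst :: 'a => 'a kbar)) = CARD('a)" by (rule card_image)
 moreover have "card (GF CARD('a) :: 'a kbar set) <= CARD('a)"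
  unfolding G using card_poly_roots_bound[OF f0] d by linarith
 ultimately show "card (range (cst :: 'a => 'a kbar)) = card (GF CARD('a) :: 'a kbar set)" using card_mono[OF fin s] by linarith
qed

lemma const_max_ideal:
 assumes "prm L W" "c:L" "c ^ q = c" "q > 1" "c:mx W" "is_sf L" shows "c = 0"
 using const_prime[OF assms(1) sf_inv[OF assms(6,2)], of q] assms by (auto simp: max_ideal_def power_inverse)

lemma prod_mset_max_ideal:
 assumes F: "is_sf F" and W: "prm F W" and "!!c. c :# A ==> f c:W" "prod_mset (image_mset f A):mx W"
 shows "\<exists>c\<in>#A. f c:mx W"
 using assms(3,4)
proof (induction A)
 case empty thus ?case using mx_1[OF primeD(1)[OF W]] by simp
next
 case (add c A)
 have "f d:W" if "d :# A" for d using add that by simp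
 moreover have "prod_mset (image_mset f A):W" using calculation
  by (induction A) (auto intro: sr_cl[OF primeD(1)[OF W]])
 ultimately show ?case using add mx_prime[OF primeD(1)[OF W], of "f c" "prod_mset (image_mset f A)"] by auto
qed

text \<open>The equation \<open>y^e - y = d\<close> of Witt vectors, with \<open>y\<close> moved to
  the other side so that only Witt addition occurs; \<open>witt_diff_eq_iff\<close>
  translates.\<close>

definition asw :: "nat => nat => 'a::finite_field kbar list => 'a kbar list => bool" where
 "asw p e d y <-> length d = length y & set d <= kk & witt_power y e = wadd p d y"

context
 fixes u p e :: nat
 assumes p: "p = CHAR('a::finite_field)" and e: "e = p ^ u" and u: "u >= 1" "(GF e :: 'a kbar set) <= GF CARD('a)"
begin

lemma pr: "prime p" using CHAR_pr[where 'a='a] by (simp add: CHAR_kbar p)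
lemma ee: "e > 1" using one_less_power[of p u] prime_gt_1_nat[OF pr] u(1) by (simp add: e)

lemma frob_map: "ring_map (%x :: 'a kbar. x ^ e)" using frobenius_ring_map[of u] by (simp add: e p)
lemmas frob = ring_mapD[OF frob_map]

lemma gf_k: "(GF e :: 'a kbar set) <= kk" using u(2) by (auto simp: GF_card cst_k)

lemma gf_diff: "x - (y :: 'a kbar):GF e <-> x ^ e - x = y ^ e - y"
 unfolding GF_def mem_Collect_eq frob(2) by (simp add: diff_eq_eq) (simp add: algebra_simps eq_commute)

lemma gf_max_ideal: "is_sf B ==> kk <= B ==> prm B W ==> c:(GF e :: 'a kbar set) ==> c:mx W ==> c = 0"
 using const_max_ideal[of B W c e] gf_k ee by (auto simp: GF_def)

text \<open>The roots of \<open>X^e - X\<close> are the elements of \<open>GF e\<close>, so the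
  product of the differences \<open>y - c\<close> over them lies in the maximal ideal, and one
  factor must.\<close>

lemma gf_root:
 assumes B: "is_sf B" "kk <= (B :: 'a kbar set)" and W: "prm B W" and y: "y:W" "y ^ e - y:mx W"
 obtains c where "c:GF e" "y - c:mx W"
proof -
 let ?f = "monom 1 e - monom 1 1 :: 'a kbar poly"
 have "coeff ?f e = 1" using ee by simp
 hence f0: "?f ~= 0" by (metis coeff_0 zero_neq_one)
 have d: "degree ?f = e" using `coeff ?f e = 1` ee
  by (intro antisym degree_diff_le le_degree) (simp_all add: degree_monom_eq)
 obtain A where A: "?f = smult (lead_coeff ?f) (\<Prod>x\<in>#A. [:- x, 1:])" using alg_closed_imp_factorization[OF f0] by blast
 have "lead_coeff ?f = 1" unfolding d by (rule `coeff ?f e = 1`)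
 hence f: "?f = (\<Prod>x\<in>#A. [:- x, 1:])" using A by (simp only: smult_1_left)
 have ev: "x ^ e - x = prod_mset (image_mset (%c. x - c) A)" for x
 proof -
  have "x ^ e - x = poly ?f x" by (simp add: poly_monom)
  also have "... = prod_mset (image_mset (%c. x - c) A)" unfolding f by (induction A) (simp_all add: left_diff_distrib)
  finally show ?thesis .
 qed
 have g: "c:GF e" if "c :# A" for c
 proof -
  have "prod_mset (image_mset (%x. c - x) A) = 0" using that by (induction A) auto
  hence "c ^ e - c = 0" unfolding ev .
  thus ?thesis by (simp add: GF_def)
 qed
 have "c:W" if "c :# A" for c using const_prime[OF W, of c e] g[OF that] gf_k B(2) ee by (auto simp: GF_def)
 thus thesis using prod_mset_max_ideal[OF B(1) W, of A "%c. y - c"] y ev[of y] g that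
  by (auto intro: sr_diff[OF primeD(1)[OF W]])
qed

lemma witt_power_add: "length b = length a ==> witt_power (wadd p a b) e = wadd p (witt_power a e) (witt_power (b :: 'a kbar list) e)"
 unfolding witt_power_def by (rule witt_ring_map[OF pr frob_map])

lemma asw_witt_power_gf: "witt_power w e = w <-> set w <= GF e"
 unfolding witt_power_def GF_def by (induction w) auto

lemma witt_add_cancel:
 assumes "length b = length a" "length c = length a" "wadd p b a = wadd p c (a :: 'a kbar list)" shows "b = c"
 using witt_add_diff[OF pr, where a = b and b = a] witt_add_diff[OF pr, where a = c and b = a] assms by metis

lemma asw_diff:
 assumes "asw p e d y" "asw p e d (y' :: 'a kbar list)"
 obtains w where "length w = length y" "set w <= GF e" "y' = wadd p w y"
proof -
 have l: "length d = length y" "length d = length y'" and F: "witt_power y e = wadd p d y" "witt_power y' e = wadd p d y'"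
  using assms by (auto simp: asw_def)
 let ?w = "witt_diff p y' y"
 have y': "wadd p ?w y = y'" by (rule witt_diff_add[OF pr]) (use l in simp)
 have lw: "length ?w = length y" using l by (simp add: length_witt[OF pr])
 have "wadd p (witt_power ?w e) (wadd p d y) = witt_power (wadd p ?w y) e"
  unfolding F(1)[symmetric] using lw by (intro witt_power_add[symmetric]) simp
 also have "... = wadd p d (wadd p ?w y)" unfolding y' by (rule F)
 also have "... = wadd p (wadd p d ?w) y" using l lw by (intro witt_add_assoc[OF pr, symmetric]) simp_all
 also have "wadd p d ?w = wadd p ?w d" using l lw by (intro witt_add_commute[OF pr]) simp
 also have "wadd p (wadd p ?w d) y = wadd p ?w (wadd p d y)" using l lw by (intro witt_add_assoc[OF pr]) simp_all
 finally have "witt_power ?w e = ?w"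
 proof (rule witt_add_cancel[rotated 2])
  have "length (wadd p d y) = length y" using l by (simp add: length_witt[OF pr])
  thus "length (witt_power ?w e) = length (wadd p d y)" "length ?w = length (wadd p d y)"
   using lw by (simp_all only: witt_power_def length_map)
 qed
 thus thesis using that[of ?w] y' lw asw_witt_power_gf by auto
qed

lemma asw_add:
 assumes "asw p e d y" "asw p e d' (y' :: 'a kbar list)" "length y' = length y" shows "asw p e (wadd p d d') (wadd p y y')"
proof -
 have l: "length d = length y" "length d' = length y" and k: "set d <= kk" "set d' <= kk"
  and F: "witt_power y e = wadd p d y" "witt_power y' e = wadd p d' y'" using assms by (auto simp: asw_def)
 have "witt_power (wadd p y y') e = wadd p (wadd p d y) (wadd p d' y')" using witt_power_add[of y' y] F assms(3) by simp
 also have "... = wadd p d (wadd p (wadd p y d') y')" using l assms(3) by (simp add: witt_add_assoc[OF pr] length_witt[OF pr])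
 also have "wadd p y d' = wadd p d' y" using l by (intro witt_add_commute[OF pr]) simp
 also have "wadd p d (wadd p (wadd p d' y) y') = wadd p (wadd p d d') (wadd p y y')" using l assms(3) by (simp add: witt_add_assoc[OF pr] length_witt[OF pr])
 finally show ?thesis using witt_closed(1)[OF pr sf_sr[OF k_sf] _ k] l
  by (auto simp: asw_def length_witt[OF pr])
qed

context
 fixes d y :: "'a kbar list" assumes A: "asw p e d y"
begin

text \<open>Read off from the top term of Witt addition: modulo earlier components, the component
  number \<open>n\<close> satisfies an ordinary Artin-Schreier equation.\<close>

lemma asw_step:
 assumes R: "is_sr R" and n: "n < length y" and r: "set d <= R" "!!i. i < n ==> y ! i:R"
 shows "(y ! n) ^ e - y ! n:R"
proof -
 have l: "length d = length y" and F: "witt_power y e = wadd p d y" using A by (auto simp: asw_def)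
 have "(y ! n) ^ e = wadd p d y ! n" using n F[symmetric] by (simp add: witt_power_def)
 moreover have "wadd p d y ! n - (d ! n + of_int 1 * y ! n):R" using r n l by (intro wadd_top[OF pr R]) auto
 ultimately have "(y ! n) ^ e - (d ! n + y ! n) + d ! n:R" using r n l by (intro sr_add[OF R]) auto
 thus ?thesis by simp
qed

text \<open>Each component is a root of some \<open>X^e - X - c\<close> over the field of the
  earlier ones, and this polynomial has derivative \<open>-1\<close>.\<close>

lemma asw_gal_fixed: "n <= length y ==> gfix kk (adj kk (set (take n y)))"
proof (induction n)
 case 0
 have "adj kk {} = (kk :: 'a kbar set)" by (rule adjoin_self[OF k_sf]) simp
 thus ?case by (simp add: gfix_def)
next
 case (Suc n)
 let ?L = "adj kk (set (take n y))"
 have LS: "is_sf ?L" by (rule adj_sf)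
 have "set d <= ?L" using A adj_base[of kk "set (take n y)"] by (auto simp: asw_def)
 moreover have "y ! i:?L" if "i < n" for i
  using that Suc.prems adj_gen[of "set (take n y)" kk] nth_mem[of i "take n y"] by auto
 ultimately have "(y ! n) ^ e - y ! n:?L" using Suc.prems by (intro asw_step[OF sf_sr[OF LS]]) auto
 then obtain c where c: "c:?L" "(y ! n) ^ e - y ! n = c" by blast
 let ?f = "monom 1 e - monom 1 1 - [:c:]"
 have "?f:pols ?L" using c sf_cl[OF LS] by (auto simp: pols_def coeff_pCons split: nat.split)
 moreover have "poly ?f (y ! n) = 0" using c by (simp add: poly_monom)
 moreover have "(of_nat e :: 'a kbar) = 0"
  using u(1) of_nat_CHAR[where 'a = "'a kbar"] by (simp add: e p CHAR_kbar)
 hence "poly (pderiv ?f) (y ! n) = -1" by (simp add: pderiv_diff pderiv_monom pderiv_pCons poly_monom)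
 ultimately have "sep ?L (y ! n)" unfolding sep_def by (intro bexI[of _ ?f]) simp_all
 thus ?case using gal_fixed_insert[OF clb_k] Suc by (simp add: take_Suc_conv_app_nth)
qed

lemma asw_aut:
 assumes "si:Aut kk"
 obtains w where "length w = length y" "set w <= GF e" "map si y = wadd p w y"
proof (rule asw_diff[OF A])
 have h: "ring_map si" by (simp add: ring_map_def aut_one[OF assms] aut_diff[OF assms] aut_mult[OF assms])
 have l: "length d = length y" and d: "set d <= kk" and F: "witt_power y e = wadd p d y" using A by (auto simp: asw_def)
 have "witt_power (map si y) e = map si (witt_power y e)" by (simp add: witt_power_def aut_power[OF assms])
 also have "... = wadd p (map si d) (map si y)" unfolding F using witt_ring_map[OF pr h] l by simp
 also have "map si d = d" using d AutD(3)[OF assms] by (intro map_idI) auto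
 finally show "asw p e d (map si y)" using l d by (simp add: asw_def)
qed

text \<open>Automorphisms act on \<open>y\<close> by adding Witt vectors over \<open>GF e\<close>.
  These are fixed by every automorphism over \<open>k\<close>, so commutativity of Witt addition
  makes the group abelian.\<close>

lemma asw_abel: "abel kk (adj kk (set y))"
proof (rule abel_adjoinI[OF gal_adjoinI[OF clb_k]])
 show "gfix kk (adj kk (set y))" using asw_gal_fixed[of "length y"] by simp
 show "si s:adj kk (set y)" if s: "si:Aut kk" "s:set y" for si s
 proof -
  obtain w where w: "length w = length y" "set w <= GF e" "map si y = wadd p w y" using asw_aut[OF s(1)] .
  have "set (wadd p w y) <= adj kk (set y)"
   using w gf_k adj_base[of kk] adj_gen[of "set y"]
   by (intro witt_closed[OF pr sf_sr[OF adj_sf]]) auto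
  thus ?thesis using s(2) unfolding w(3)[symmetric] by auto
 qed
 show "si (ta s) = ta (si s)" if s: "si:Aut kk" "ta:Aut kk" "s:set y" for si ta s
 proof -
  have m: "map si (map ta y) = wadd p w' (wadd p w y)"
   if "si:Aut kk" and w: "length w = length y" "length w' = length y" "set w' <= GF e" "map si y = wadd p w y" "map ta y = wadd p w' y" for si ta w w'
  proof -
   have h: "ring_map si" using that(1) by (simp add: ring_map_def aut_one[OF that(1)] aut_diff[OF that(1)] aut_mult[OF that(1)])
   have "map si (map ta y) = wadd p (map si w') (map si y)" unfolding w(5) using witt_ring_map[OF pr h] w by simp
   also have "map si w' = w'" using w(3) gf_k AutD(3)[OF that(1)] by (intro map_idI) auto
   finally show ?thesis using w by simp
  qed
  obtain w where w: "length w = length y" "set w <= GF e" "map si y = wadd p w y" using asw_aut[OF s(1)] .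
  obtain w' where w': "length w' = length y" "set w' <= GF e" "map ta y = wadd p w' y" using asw_aut[OF s(2)] .
  have "wadd p w' (wadd p w y) = wadd p w (wadd p w' y)"
   using w(1) w'(1) witt_add_assoc[OF pr, where a = w and b = w' and c = y]
    witt_add_assoc[OF pr, where a = w' and b = w and c = y] witt_add_commute[OF pr, where a = w and b = w'] by metis
  hence "map si (map ta y) = map ta (map si y)"
   unfolding m[OF s(1) w(1) w'(1,2) w(3) w'(3)] m[OF s(2) w'(1) w(1,2) w'(3) w(3)] .
  thus ?thesis using s(3) by (auto simp: map_eq_conv)
 qed
qed

text \<open>Once the earlier components are fixed, \<open>si\<close> changes the next one by an
  element of \<open>GF e\<close>, so it is enough to exclude nonzero changes of this kind. The
  criteria by order, by inertia and by decomposition all go through this lemma.\<close>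

lemma asw_fixI:
 assumes s: "si:Aut kk" and h: "!!n. n < length y ==> si (y ! n) - y ! n:GF e ==> si (y ! n) = y ! n"
  and t: "t:adj kk (set y)"
 shows "si t = t"
proof -
 have R: "is_sr {x. si x = (%x. x) x}" by (rule sf_sr[OF eq_sf[OF s aut_id(2)]])
 have "si (y ! n) = y ! n" if "n < length y" for n using that
 proof (induction n rule: less_induct)
  case (less n)
  have "(y ! n) ^ e - y ! n:{x. si x = x}" using A less AutD(3)[OF s] by (intro asw_step[OF R]) (auto simp: asw_def)
  thus ?case using less.prems by (intro h) (simp_all add: gf_diff aut_diff[OF s] aut_power[OF s])
 qed
 thus ?thesis using agree_adj[OF s aut_id(2) _ t] by (auto simp: in_set_conv_nth)
qed

text \<open>An element \<open>w\<close> added by \<open>si\<close> is added \<open>j\<close> times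
  by the \<open>j\<close>-th iterate, and \<open>j\<close> is invertible in characteristic
  \<open>p\<close>.\<close>

lemma asw_coprime_order:
 assumes s: "si:Aut kk" and j: "coprime j p" "!!t. t:set y ==> (si ^^ j) t = t"
  and t: "t:adj kk (set y)"
 shows "si t = t"
proof (rule asw_fixI[OF s _ t])
 fix n assume n: "n < length y" and w: "si (y ! n) - y ! n:GF e"
 let ?w = "si (y ! n) - y ! n"
 have w': "si ?w = ?w" using AutD(3)[OF s] w gf_k by blast
 have "(si ^^ i) (y ! n) = y ! n + of_nat i * ?w" for i
 proof (induction i)
  case (Suc i)
  have "si (of_nat i * ?w) = of_nat i * ?w" unfolding aut_mult[OF s] w' using AutD(3)[OF s sf_cl(8)[OF k_sf]] by simp
  thus ?case using Suc by (simp add: aut_add[OF s] distrib_right)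
 qed simp
 hence "of_nat j * ?w = 0" using j(2)[OF nth_mem[OF n]] by simp
 moreover have "(of_nat j :: 'a kbar) ~= 0"
  using j(1) prime_gt_1_nat[OF pr] coprime_absorb_right[of "p" j] by (auto simp: of_nat_eq_0_iff_char_dvd p)
 ultimately show "si (y ! n) = y ! n" by simp
qed

context
 fixes B W :: "'a kbar set" assumes B: "is_sf B" "kk <= B" "set y <= B" and W: "prm B W"
begin

lemma asw_integral: assumes d: "set d <= W" shows "set y <= W"
proof -
 note R = primeD(1)[OF W]
 have "y ! n:W" if "n < length y" for n using that
 proof (induction n rule: less_induct)
  case (less n)
  then obtain c where c: "c:W" "(y ! n) ^ e - y ! n = c" using asw_step[OF R less.prems d] by fastforce
  let ?f = "monom 1 e - monom 1 1 - [:c:]"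
  have e1: "coeff ?f e = 1" using ee by (simp add: coeff_pCons split: nat.split)
  hence "degree ?f = e" using ee
   by (intro antisym degree_diff_le le_degree) (simp_all add: degree_monom_eq)
  thus ?case using e1 c B(3) less.prems sr_cl[OF R]
   by (intro int_closed[OF R primeD(4)[OF W], of _ ?f])
    (auto simp: pols_def coeff_pCons poly_monom split: nat.split)
 qed
 thus ?thesis by (auto simp: in_set_conv_nth)
qed

lemma asw_inertia_trivial:
 assumes d: "set d <= W" and s: "si:inertia kk W" and t: "t:adj kk (set y)"
 shows "si t = t"
proof (rule asw_fixI[OF decompD(1)[OF inertD(1)[OF s]] _ t])
 fix n assume n: "n < length y" and w: "si (y ! n) - y ! n:GF e"
 have "y ! n:W" using asw_integral[OF d] n by auto
 from gf_max_ideal[OF B(1,2) W w inertD(2)[OF s this]] show "si (y ! n) = y ! n" by simp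
qed

text \<open>With \<open>d\<close> congruent to zero, each component satisfies
  \<open>y_n^e = y_n\<close> modulo the maximal ideal and is congruent to an element of
  \<open>GF e\<close>. That element is fixed, so \<open>si\<close> moves the component only within
  its residue class.\<close>

lemma asw_decomp_trivial:
 assumes d: "set d <= mx W" and s: "si:decomp kk W" and t: "t:adj kk (set y)"
 shows "si t = t"
proof (rule asw_fixI[OF decompD(1)[OF s] _ t])
 note R = primeD(1)[OF W] and BW = B(1) W
 have dW: "set d <= W" using d mx_sub by auto
 have yW: "set y <= W" by (rule asw_integral[OF dW])
 fix n assume n: "n < length y" and w: "si (y ! n) - y ! n:GF e"
 have l: "length d = length y" and F: "witt_power y e = wadd p d y" using A by (auto simp: asw_def)
 \<comment> \<open>Integral congruence is compatible with the polynomials of Witt addition, so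
   \<open>d\<close> may be replaced by the zero vector.\<close>
 let ?Q = "%x y. x:W & y:W & x - y:mx W"
 have "?Q (wadd p d y ! n) (wadd p (replicate (length y) 0) y ! n)"
 proof (rule witt_add_rel[OF pr, where Q = ?Q])
  fix x y x' y' assume Q: "?Q x y" "?Q x' y'"
  have q: "x - x' - (y - y') = (x - y) - (x' - y')" "x * x' - y * y' = (x - y) * x' + (x' - y') * y" by (simp_all add: algebra_simps)
  have W': "x:W" "y:W" "x - y:mx W" "x':W" "y':W" "x' - y':mx W" using Q by simp_all
  show "?Q (x - x') (y - y')" "?Q (x * x') (y * y')" unfolding q
   by (intro conjI mx_diff[OF BW] mx_add[OF BW] mx_mult[OF R] sr_diff[OF R] sr_mult[OF R] W')+
 qed (use n l d dW yW mx_0[OF R] sr_0[OF R] sr_1[OF R] in auto)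
 moreover have "wadd p (replicate (length y) 0) y = y" by (rule witt_add_0[OF pr]) simp
 moreover have "wadd p d y ! n = (y ! n) ^ e" using n F[symmetric] by (simp add: witt_power_def)
 ultimately have "(y ! n) ^ e - y ! n:mx W" by simp
 moreover have "y ! n:W" using yW n by auto
 ultimately obtain c where c: "c:GF e" "y ! n - c:mx W" using gf_root[OF B(1,2) W] by metis
 have "si c = c" using AutD(3)[OF decompD(1)[OF s]] c(1) gf_k by blast
 hence "si (y ! n) - c:mx W" using decomp_max_ideal[OF s c(2)] by (simp add: aut_diff[OF decompD(1)[OF s]])
 from mx_diff[OF BW this c(2)] have "si (y ! n) - y ! n:mx W" by simp
 from gf_max_ideal[OF B(1,2) W w this] show "si (y ! n) = y ! n" by simp
qed

end

end

end

section \<open>Hilbert class fields and genus fields\<close>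

text \<open>The local conditions of the Hilbert class field for a finite Galois extension;
  \<open>good_iff\<close> compares them with the definition.\<close>

definition good :: "'a::finite_field kbar set => 'a kbar set => bool" where
 "good F L <-> (ALL W. prm L W --> (EX t:F. unif L W t) &
  (W Int kk = Pinf --> triv_on (decomp F W) L))"

text \<open>The local group that has to act trivially: inertia at finite primes, where ramification
  is forbidden, and the whole decomposition group at infinity, where full decomposition is
  required.\<close>

definition dec :: "'a::finite_field kbar set => 'a kbar set => ('a kbar => 'a kbar) set" where
 "dec F W = (if W Int kk = Pinf then decomp F W else inertia F W)"

lemma dec_sub: "inertia F W <= dec F W" "dec F W <= decomp F W" by (auto simp: dec_def inertia_def)

lemma dec_Aut: "si:dec F W ==> si:Aut F" using dec_sub(2) decompD(1) by blast

lemma decomp_Int: "gal F E ==> si:decomp F W ==> si:decomp F (W Int E)"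
 using gal_image[of F E si] image_Int[of si W E] AutD(2)[of si F] by (auto simp: decomp_def bij_def)

lemma inertia_Int: assumes g: "gal F E" and s: "si:inertia F W" shows "si:inertia F (W Int E)"
 unfolding inertia_def mx_Int(1)[OF galD(2)[OF g]]
proof (intro CollectI conjI ballI decomp_Int[OF g inertD(1)[OF s]])
 fix x assume "x:W Int E"
 thus "si x - x:mx W Int E"
  using inertD(2)[OF s] sf_cl(3)[OF galD(2)[OF g] galD(4)[OF g decompD(1)[OF inertD(1)[OF s]]]] by blast
qed

lemma dec_Int: assumes "gal F E" "si:dec F W" "kk <= E" shows "si:dec F (W Int E)"
proof -
 have "W Int E Int kk = W Int kk" using assms(3) by auto
 thus ?thesis using assms decomp_Int[OF assms(1)] inertia_Int[OF assms(1)] unfolding dec_def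
  by (cases "W Int kk = Pinf") simp_all
qed

context
 fixes F :: "'a::finite_field kbar set"
 assumes aF: "abel kk F" and fF: "fing kk F"
begin

lemma F_facts: "is_sf F" "kk <= F" "clb F" "infinite F" "F <= F" "gal kk F"
 using galD(2,3)[OF abel_gal[OF aF]] clb_mono[OF clb_k, of F] infinite_super[OF _ infinite_k] abel_gal[OF aF] by auto

lemma dvr_ext:
 assumes "gal F L" "fing F L" "prm L W" shows "dvr L W"
proof -
 have "dvr F (W Int F)" using pr_rest[OF F_facts(3) galD(2,3)[OF assms(1)] assms(3)]
  by (rule dvr_k[OF fF F_facts(6)])
 thus ?thesis unfolding dvr_def using unif_ext[OF F_facts(3) assms(2,1,3)] by blast
qed

lemma res_ext: assumes "gal F L" "prm L W" "x:W" shows "EX j>0. x ^ (CHAR('a kbar) ^ j) - x:mx W"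
 using residue_alg[OF galD(2)[OF assms(1)] _ assms(2,3)] F_facts(2) galD(3)[OF assms(1)] by (auto simp: res_alg_def CHAR_kbar)

lemma goodI:
 assumes g: "gal F L" "fing F L" and t: "!!W. prm L W ==> triv_on (dec F W) L" shows "good F L"
 unfolding good_def
proof (intro allI impI conjI)
 fix W assume W: "prm L W"
 have "triv_on (inertia F W) L" using t[OF W] dec_sub(1) by (auto simp: triv_on_def)
 thus "EX t:F. unif L W t" using unif_inert[OF F_facts(3) g(2,1) dvr_ext[OF g W]] by blast
 show "triv_on (decomp F W) L" if "W Int kk = Pinf" using t[OF W] that by (simp add: dec_def)
qed

lemma goodD:
 assumes g: "gal F L" and G: "good F L" and W: "prm L W" shows "triv_on (dec F W) L"
proof -
 obtain t where "t:F" "unif L W t" using G W unfolding good_def by blast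
 hence "triv_on (inertia F W) L" using inertia_trivial[OF _ _ CHAR_pr res_ext[OF g W]] by blast
 thus ?thesis using G W by (auto simp: dec_def good_def)
qed

lemma good_iff:
 assumes g: "gal F L" "fing F L"
 shows "(ALL V. prm F V --> unramified_at F V L) & (ALL V:primes_above kk Pinf F. decomposes_fully F V L) <-> good F L"
proof -
 note LS = galD(2,3)[OF g(1)]
 have d: "dvr F V" if "prm F V" for V by (rule dvr_k[OF fF F_facts(6) that])
 have WF: "prm F (W Int F)" "W Int F Int kk = W Int kk" if "prm L W" for W
  using pr_rest[OF F_facts(3) LS that] F_facts(2) by auto
 have u: "unramified_at F V L <-> (ALL W. prm L W --> W Int F = V --> (EX t:F. unif L W t))" if "prm F V" for V
  by (rule unramified_iff[OF F_facts(3) g(2,1) d[OF that]])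
 have f: "decomposes_fully F V L <-> (ALL W. prm L W --> W Int F = V --> triv_on (decomp F W) L)" if V: "prm F V" for V
 proof -
  obtain W where "prm L W" "W Int F = V" using above_ex[OF F_facts(6) fF LS V] .
  thus ?thesis by (rule decomposes_fully_iff[OF F_facts(3,4) g(2,1) d[OF V]])
 qed
 show ?thesis
 proof (intro iffI)
  assume h: "(ALL V. prm F V --> unramified_at F V L) & (ALL V:primes_above kk Pinf F. decomposes_fully F V L)"
  show "good F L" unfolding good_def
  proof (intro allI impI conjI)
   fix W assume W: "prm L W"
   show "EX t:F. unif L W t" using h u[OF WF(1)[OF W]] WF(1)[OF W] W by blast
   assume "W Int kk = Pinf"
   hence "W Int F:primes_above kk Pinf F" using WF[OF W] by (simp add: primes_above_def)
   thus "triv_on (decomp F W) L" using h f[OF WF(1)[OF W]] W by blast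
  qed
 next
  assume G: "good F L"
  have "decomposes_fully F V L" if V: "V:primes_above kk Pinf F" for V
  proof -
   have V: "prm F V" "V Int kk = Pinf" using V by (simp_all add: primes_above_def)
   show ?thesis unfolding f[OF V(1)]
   proof (intro allI impI)
    fix W assume W: "prm L W" "W Int F = V"
    thus "triv_on (decomp F W) L" using G V(2) WF(2)[OF W(1)] unfolding good_def W(2) by simp
   qed
  qed
  thus "(ALL V. prm F V --> unramified_at F V L) & (ALL V:primes_above kk Pinf F. decomposes_fully F V L)"
   using G u unfolding good_def by blast
 qed
qed

text \<open>Elements of decomposition groups lift from \<open>E\<close> to \<open>L\<close>, which
  settles the primes at infinity. At finite primes the uniformizer found in \<open>F\<close>
  restricts to \<open>E\<close> and makes the inertia there trivial.\<close>

lemma good_sub: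
 assumes a: "abel F L" "fing F L" "good F L" and E: "is_sf E" "F <= E" "E <= L"
 shows "good F E"
proof (rule goodI)
 note g = abel_gal[OF a(1)]
 show gE: "gal F E" "fing F E" using abel_gal[OF abel_mid(2)[OF F_facts(3) a(1) E]] fin_gen_mid[OF F_facts(3) a(2) g E] .
 fix U assume U: "prm E U"
 \<comment> \<open>\<open>above_ex\<close> starts from a field Galois over \<open>k\<close>, which
   is known for \<open>F\<close> but not for \<open>E\<close>. So a prime above
   \<open>U Int F\<close> is taken first and then moved by an element of
   \<open>Aut F\<close>.\<close>
 obtain W where W: "prm L W" "W Int F = U Int F"
  using above_ex[OF F_facts(6) fF galD(2,3)[OF g] pr_rest[OF F_facts(3) E(1,2) U]] .
 have "prm E (W Int E)" "(W Int E) Int F = U Int F"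
  using W E pr_rest[OF clb_mono[OF F_facts(3) E(2,1)] galD(2)[OF g] E(3) W(1)] by auto
 then obtain si where s: "si:Aut F" "si ` (W Int E) = U"
  using prime_trans[OF F_facts(3) gE(2,1) dvr_ext[OF gE] dvr_ext[OF gE U]] by metis
 define W' where "W' = si ` W"
 have W': "prm L W'" unfolding W'_def by (rule prime_image[OF s(1) gal_image[OF g s(1)] W(1)])
 have WE: "W' Int E = U" using s gal_image[OF gE(1) s(1)] image_Int[of si W E] AutD(2)[OF s(1)] by (auto simp: W'_def bij_def)
 show "triv_on (dec F U) E" unfolding triv_on_def
 proof (intro ballI)
  fix ta x assume t: "ta:dec F U" and x: "x:E"
  show "ta x = x"
  proof (cases "U Int kk = Pinf")
   case True
   hence "ta:decomp F (W' Int E)" using t by (simp add: dec_def WE)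
   then obtain rh where r: "rh:decomp F W'" "rh x = ta x" using lift_decomp[OF F_facts(3) a(1,2) dvr_ext[OF g a(2)] W' E] x by metis
   have "W' Int kk = Pinf" using True E(2) F_facts(2) WE by auto
   hence "triv_on (decomp F W') L" using goodD[OF g a(3) W'] by (simp add: dec_def)
   hence "rh x = x" using r(1) x E(3) unfolding triv_on_def by blast
   thus ?thesis using r(2) by simp
  next
   case False
   obtain u where "u:F" "unif L W' u" using a(3) W' unfolding good_def by blast
   hence "unif E U u" "u:F" using unif_sub[of L W' u E] E WE by auto
   hence "triv_on (inertia F U) E" using inertia_trivial[OF _ _ CHAR_pr res_ext[OF gE(1) U]] by blast
   thus ?thesis using t x False by (auto simp: dec_def triv_on_def)
  qed
 qed
qed

lemma good_composite:
 assumes L: "abel F L" "fing F L" "good F L" and L': "abel F L'" "fing F L'" "good F L'"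
 shows "good F (adj F (L Un L'))"
proof (rule goodI)
 show "gal F (adj F (L Un L'))" by (rule abel_gal[OF abel_comp2[OF F_facts(3) L(1) L'(1)]])
 show "fing F (adj F (L Un L'))" by (rule fin_gen_composite[OF L(2) L'(2)])
 fix W assume W: "prm (adj F (L Un L')) W"
 have t: "triv_on (dec F W) E" if E: "abel F E" "good F E" "E <= adj F (L Un L')" for E
 proof -
  note g = abel_gal[OF E(1)]
  have "prm E (W Int E)" by (rule pr_rest[OF clb_mono[OF F_facts(3) galD(3,2)[OF g]] adj_sf E(3) W])
  thus ?thesis using goodD[OF g E(2)] dec_Int[OF g] F_facts(2) galD(3)[OF g] by (auto simp: triv_on_def)
 qed
 show "triv_on (dec F W) (adj F (L Un L'))" unfolding triv_on_def
 proof (intro ballI)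
  fix si x assume s: "si:dec F W" and x: "x:adj F (L Un L')"
  show "si x = x" using t[OF L(1,3)] t[OF L'(1,3)] adj_gen[of "L Un L'" F] s
   by (intro agree_adj[OF dec_Aut[OF s] aut_id(2) _ x]) (auto simp: triv_on_def)
 qed
qed

definition goods :: "'a kbar set set" where "goods = {L. abel F L & fing F L & good F L}"

lemma F_goods: "F:goods"
proof -
 have "abel F F" by (rule abel_mid(1)[OF clb_k aF F_facts(1,2,5)])
 moreover have "triv_on (dec F W) F" for W using AutD(3)[OF dec_Aut] unfolding triv_on_def by blast
 ultimately show ?thesis using goodI[OF abel_gal fin_gen_base[OF F_facts(1)]] fin_gen_base[OF F_facts(1)] by (auto simp: goods_def)
qed

lemma goods_finite: "finite S ==> S <= \<Union>goods ==> EX N:goods. S <= N"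
proof (induction S rule: finite_induct)
 case (insert x S)
 then obtain N L where NL: "N:goods" "S <= N" "L:goods" "x:L" by auto
 hence "adj F (L Un N):goods" unfolding goods_def
  using abel_comp2[OF F_facts(3)] fin_gen_composite good_composite by blast
 thus ?case using NL adj_gen[of "L Un N" F] by blast
qed (use F_goods in blast)

lemma goods_field: "is_sf (\<Union>goods)" "F <= \<Union>goods" "abel F (\<Union>goods)"
proof -
 have dir: "EX N:goods. L Un M <= N" if "L:goods" "M:goods" for L M
  using that abel_comp2[OF F_facts(3)] fin_gen_composite good_composite adj_gen[of "L Un M" F]
  by (intro bexI[of _ "adj F (L Un M)"]) (auto simp: goods_def)
 have ab: "abel F L" if "L:goods" for L using that by (simp add: goods_def)
 show f: "is_sf (\<Union>goods)" using F_goods galD(2)[OF abel_gal[OF ab]] dir by (intro sf_Union) auto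
 show "F <= \<Union>goods" using F_goods by blast
 hence "adj F (\<Union>goods) = \<Union>goods" using adj_least[OF f, of F] adj_gen[of "\<Union>goods" F] by blast
 thus "abel F (\<Union>goods)" using abel_composite[OF F_facts(3), of goods] ab by simp
qed

text \<open>A finite subextension of the union has its generators in a single member and inherits
  goodness from it. Conversely, every element of a competing field generates a finite good
  extension.\<close>

theorem hilbert_class_field_eq: "hilbert_class_field F = \<Union>goods"
 unfolding hilbert_class_field_def
proof (rule Greatest_equality)
 have "good F L" if L: "finite_ext F L" "L <= \<Union>goods" for L
 proof -
  note fe = finite_ext_fing[OF L(1)]
  obtain S where S: "finite S" "L = adj F S" using fe(4) by (auto simp: fing_def)
  hence "S <= \<Union>goods" using L(2) adj_gen by blast
  then obtain N where N: "N:goods" "S <= N" using goods_finite[OF S(1)] by blast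
  hence a: "abel F N" "fing F N" "good F N" by (auto simp: goods_def)
  have "L <= N" unfolding S(2) by (rule adj_least[OF galD(2,3)[OF abel_gal[OF a(1)]] N(2)])
  thus ?thesis by (rule good_sub[OF a fe(2,3)])
 qed
 moreover have "gal F L & fing F L" if L: "finite_ext F L" "L <= \<Union>goods" for L
  using finite_ext_fing[OF L(1)] abel_gal[OF abel_mid(2)[OF F_facts(3) goods_field(3) _ _ L(2)]] by blast
 ultimately show "abelian_ext F (\<Union>goods) & (ALL L. finite_ext F L & L <= \<Union>goods -->
  (ALL V. prm F V --> unramified_at F V L) & (ALL V:primes_above kk Pinf F. decomposes_fully F V L))"
  using goods_field(3) good_iff abelian_ext_iff[OF F_facts(3)] by blast
next
 fix H assume H: "abelian_ext F H & (ALL L. finite_ext F L & L <= H -->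
  (ALL V. prm F V --> unramified_at F V L) & (ALL V:primes_above kk Pinf F. decomposes_fully F V L))"
 have aH: "abel F H" using H abelian_ext_iff[OF F_facts(3)] by blast
 note gH = galD(2,3)[OF abel_gal[OF aH]]
 show "H <= \<Union>goods"
 proof
  fix x assume x: "x:H"
  let ?L = "adj F {x}"
  have LH: "?L <= H" using x by (intro adj_least gH) simp
  have a: "abel F ?L" by (rule abel_mid(2)[OF F_facts(3) aH adj_sf adj_base LH])
  have f: "fing F ?L" by (auto simp: fing_def)
  have "good F ?L" using H LH ext_degree_gal(1)[OF F_facts(3,4) f abel_gal[OF a]] good_iff[OF abel_gal[OF a] f] by blast
  thus "x:\<Union>goods" using a f adj_gen[of "{x}" F] by (auto simp: goods_def)
 qed
qed

end

section \<open>Local groups over k and the genus field\<close>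

lemma dec_conj:
 fixes B :: "'a::finite_field kbar set"
 assumes a: "abel kk B" and r: "rh:Aut kk" and W: "prm B W" and s: "si:dec kk W"
 shows "si:dec kk (rh ` W)"
proof -
 have sA: "si:Aut kk" using dec_Aut[OF s] .
 have c: "si (rh x) = rh (si x)" if "x:W" for x using abel_commute[OF a sA r] that primeD(2)[OF W] by blast
 have "si ` rh ` W = rh ` si ` W" unfolding image_image by (rule image_cong[OF refl c])
 moreover have "si ` W = W" using s dec_sub(2) decompD(2) by blast
 ultimately have d: "si:decomp kk (rh ` W)" using sA unfolding decomp_def by simp
 have i: "rh ` S = S" if "S <= kk" for S
  using that AutD(3)[OF r] by (subst image_cong[of S S rh "%x. x"]) auto
 have k: "rh ` W Int kk = W Int kk"
  using image_Int[OF bij_is_inj[OF AutD(2)[OF r]], of W kk] i[of kk] i[of "W Int kk"] by simp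
 have "si y - y:mx (rh ` W)" if "si:inertia kk W" "y:rh ` W" for y
  using that inertD(2)[OF that(1)] image_max_ideal[OF r] by (auto simp: c aut_diff[OF r, symmetric])
 thus ?thesis using s d unfolding dec_def k inertia_def[of _ "rh ` W"] by (cases "W Int kk = Pinf") simp_all
qed

text \<open>Primes above the same prime of \<open>k\<close> are conjugate, and conjugation by
  elements commuting on \<open>B\<close> does not change the local group.\<close>

lemma dec_above_unique:
 fixes B :: "'a::finite_field kbar set"
 assumes a: "abel kk B" and f: "fing kk B" and W: "prm B W" "prm B W'" "W Int kk = W' Int kk"
  and s: "si:dec kk W"
 shows "si:dec kk W'"
proof -
 note d = dvr_k[OF f abel_gal[OF a]]
 obtain rh where r: "rh:Aut kk" "rh ` W = W'"
  using prime_trans[OF clb_k f abel_gal[OF a] d[OF W(1)] d[OF W(2)] W(3)] .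
 show ?thesis using dec_conj[OF a r(1) W(1) s] r(2) by simp
qed

lemma dec_comp:
 fixes B :: "'a::finite_field kbar set"
 assumes B: "is_sf B" and W: "prm B W" and s: "si:dec kk W" "ta:dec kk W"
 shows "si \<circ> ta:dec kk W"
proof -
 have "si (ta x) - x:mx W" if "si:inertia kk W" "ta:inertia kk W" "x:W" for x
 proof -
  have "ta x:W" using decompD(2)[OF inertD(1)[OF that(2)]] that(3) by blast
  from mx_add[OF B W inertD(2)[OF that(1) this] inertD(2)[OF that(2,3)]] show ?thesis by simp
 qed
 thus ?thesis using s decomp_comp[of si kk W ta] by (auto simp: dec_def inertia_def split: if_splits)
qed

text \<open>In the composite \<open>B\<close> of \<open>G\<close> and an extension that is good over \<open>F\<close>, every automorphism is a product
 of elements \<open>a V\<close> of the inertia (decomposition) groups of the \<open>V : Vs\<close>, and \<open>a V\<close> is determined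
 by its action on \<open>be V\<close>.\<close>

theorem genus_field_eq:
 fixes F G :: "'a::finite_field kbar set"
 assumes F: "abel kk F" "fing kk F" and Vs: "distinct Vs" "!!V. V:set Vs ==> prm kk V"
  and G: "G = adj kk (UN V:set Vs. be V)" "abel kk G" "fing kk G" "F <= G"
  and fix': "!!W V si x. prm G W ==> si:dec kk W ==> V:set Vs ==> V ~= W Int kk ==> x:be V ==> si x = x"
  and gen: "!!V. V:set Vs ==> be V <= adj F (UN V':set Vs - {V}. be V')"
 shows "genus_field F = G"
proof -
 note Ff = F_facts[OF F]
 note gG = abel_gal[OF G(2)]
 note GS = galD(2,3)[OF gG]
 have bG: "be V <= G" if "V:set Vs" for V using that adj_gen[of "UN V:set Vs. be V" kk] unfolding G(1) by blast
 have fixG: "si x = x" if "si:Aut kk" "!!V y. V:set Vs ==> y:be V ==> si y = y" "x:G" for si x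
  using that agree_adj[OF that(1) aut_id(2), of "UN V:set Vs. be V" x] unfolding G(1) by auto
 have AF: "Aut F <= Aut kk" by (rule Aut_mono[OF Ff(2)])
 have decF: "dec F W = dec kk W Int Aut F" for W using AF by (auto simp: dec_def decomp_def inertia_def)
 \<comment> \<open>A local element at \<open>W\<close> fixes the generators \<open>be V\<close> for
   all \<open>V\<close> other than the prime below \<open>W\<close>. If it fixes \<open>F\<close> as
   well, \<open>gen\<close> expresses the remaining generators through fixed elements. So
   \<open>G\<close> is good over \<open>F\<close>.\<close>
 have triv: "si x = x" if W: "prm G W" and s: "si:dec F W" and x: "x:G" for W si x
 proof (rule fixG[OF _ _ x])
  have sF: "si:Aut F" "si:dec kk W" using s decF by auto
  show "si:Aut kk" using sF AF by blast
  fix V y assume V: "V:set Vs" "y:be V"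
  show "si y = y"
  proof (cases "V = W Int kk")
   case True
   have "y:adj F (UN V':set Vs - {V}. be V')" using gen V by blast
   moreover have "si z = z" if "z:(UN V':set Vs - {V}. be V')" for z using that True fix'[OF W sF(2)] by blast
   ultimately show ?thesis using agree_adj[OF sF(1) aut_id(2)] by metis
  next
   case False
   from fix'[OF W sF(2) V(1) this V(2)] show ?thesis .
  qed
 qed
 have aG: "abel F G" by (rule abel_mid(1)[OF clb_k G(2) Ff(1,2) G(4)])
 have fG: "fing F G" by (rule fin_gen_mono[OF G(3) Ff(2) G(4)])
 have "good F G" using triv by (intro goodI[OF F abel_gal[OF aG] fG]) (unfold triv_on_def, blast)
 hence "G:goods F" using aG fG by (simp add: goods_def[OF F])
 moreover have "H <= G" if H: "F <= H" "abel kk H" "H <= \<Union>(goods F)" for H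
 proof
  fix x assume x: "x:H"
  let ?L = "adj F {x}"
  have LH: "?L <= H" using x by (intro adj_least galD(2)[OF abel_gal[OF H(2)]] H(1)) simp
  have kL: "kk <= ?L" using Ff(2) adj_base by blast
  have aL: "abel kk ?L" by (rule abel_mid(2)[OF clb_k H(2) adj_sf kL LH])
  have aFL: "abel F ?L" by (rule abel_mid(1)[OF clb_k aL Ff(1,2) adj_base])
  obtain S where S: "finite S" "F = adj kk S" using F(2) by (auto simp: fing_def)
  have "?L = adj kk (S Un {x})" unfolding S(2) adjoin_union ..
  hence fL: "fing kk ?L" using S(1) unfolding fing_def by (metis finite.emptyI finite_Un finite_insert)
  obtain N where N: "abel F N" "fing F N" "good F N" "x:N" using H(3) x by (auto simp: goods_def[OF F])
  have "?L <= N" using N(4) by (intro adj_least galD(2,3)[OF abel_gal[OF N(1)]]) simp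
  hence good: "good F ?L" by (rule good_sub[OF F N(1-3) adj_sf adj_base])
  define B where "B = adj kk (G Un ?L)"
  have B: "abel kk B" "fing kk B" unfolding B_def
   by (rule abel_comp2[OF clb_k G(2) aL], rule fin_gen_composite[OF G(3) fL])
  have sub: "G <= B" "?L <= B" unfolding B_def using adj_gen[of "G Un ?L" kk] by auto
  note gB = abel_gal[OF B(1)] note BS = galD(2,3)[OF gB]
  \<comment> \<open>A local element fixing \<open>G\<close> fixes \<open>F\<close>, so it is a local
    element over \<open>F\<close> and acts trivially on the good extension.\<close>
  have triL: "si y = y" if W: "prm B W" and s: "si:dec kk W" and G': "!!z. z:G ==> si z = z" and y: "y:B" for W si y
  proof -
   have sA: "si:Aut kk" by (rule dec_Aut[OF s])
   hence "si:Aut F" using G' G(4) by (auto simp: Aut_def)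
   hence "si:dec F W" using s decF by auto
   from dec_Int[OF abel_gal[OF aFL] this kL] have "si:dec F (W Int ?L)" .
   moreover have "prm ?L (W Int ?L)"
    by (rule pr_rest[OF clb_mono[OF clb_k kL adj_sf] BS(1) sub(2) W])
   ultimately have "si z = z" if "z:?L" for z using that goodD[OF F abel_gal[OF aFL] good] unfolding triv_on_def by blast
   hence "si z = z" if "z:G Un ?L" for z using that G' by blast
   from agree_adj[OF sA aut_id(2) this y[unfolded B_def]] show ?thesis .
  qed
  have fixB: "si y = y" if W: "prm B W" and s: "si:dec kk W" and V: "V:set Vs" "V ~= W Int kk" "y:be V" for W si V y
  proof (rule fix'[OF _ dec_Int[OF gG s GS(2)] V(1) _ V(3)])
   show "prm G (W Int G)" by (rule pr_rest[OF clb_mono[OF clb_k GS(2,1)] BS(1) sub(1) W])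
   have "W Int G Int kk = W Int kk" using GS(2) by blast
   thus "V ~= W Int G Int kk" using V(2) by simp
  qed
  have "abel kk (kk :: 'a kbar set)" by (rule abel_mid(2)[OF clb_k G(2) k_sf order_refl GS(2)])
  hence "ALL V:set Vs. EX W. prm B W & W Int kk = V"
   using above_ex[OF abel_gal fin_gen_base[OF k_sf] BS] Vs(2) by metis
  then obtain \<W> where W: "!!V. V:set Vs ==> prm B (\<W> V)" "!!V. V:set Vs ==> \<W> V Int kk = V" by metis
  define D where "D V = dec kk (\<W> V)" for V
  \<comment> \<open>A product of local elements taken in the order of a list; on the abelian field
    \<open>B\<close> the order of the factors is immaterial.\<close>
  define cmp where "cmp a Us = foldr (%V g. a V \<circ> g) Us (%x. x)" for a :: "'a kbar set => 'a kbar => 'a kbar" and Us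
  have PA: "cmp a Us:Aut kk" if "!!V. V:set Us ==> a V:Aut kk" for a Us
   using that by (induction Us) (auto simp: cmp_def aut_id aut_comp)
  have PP: "cmp a Us (cmp b Us y) = cmp (%V. a V \<circ> b V) Us y"
   if "!!V. V:set Us ==> a V:Aut kk" "!!V. V:set Us ==> b V:Aut kk" "y:B" for a b Us y
   using that(1,2)
  proof (induction Us)
   case (Cons V Us)
   have A: "cmp a Us:Aut kk" "cmp b Us:Aut kk" using Cons.prems by (auto intro: PA)
   have "cmp a Us (b V (cmp b Us y)) = b V (cmp a Us (cmp b Us y))"
    using Cons.prems(2)[of V] by (intro abel_commute[OF B(1) A(1)] galD(4)[OF gB A(2) that(3)]) simp
   thus ?case using Cons by (simp add: cmp_def)
  qed (simp add: cmp_def)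
  have DA: "a:Aut kk" if "a:D V" for a V using that dec_Aut unfolding D_def by blast
  define A where "A = {ta:Aut kk. EX a. (ALL V:set Vs. a V:D V) & (ALL y:B. ta y = cmp a Vs y)}"
  have id: "(%x. x):D V" if "V:set Vs" for V
   using mx_0[OF primeD(1)[OF W(1)[OF that]]] by (auto simp: D_def dec_def inertia_def decomp_def aut_id(2))
  have triA: "ta:A" if "ta:Aut kk" "!!y. y:B ==> ta y = y" for ta
  proof -
   have "cmp (%_ x. x) Us = (%x. x)" for Us by (induction Us) (simp_all add: cmp_def o_def)
   thus ?thesis using that id unfolding A_def by (intro CollectI conjI exI[of _ "%_ x. x"]) auto
  qed
  have single: "ta:A" if V: "V:set Vs" and t: "ta:D V" for ta V
  proof -
   have "cmp (%U. if U = V then ta else (%x. x)) Us = (if V:set Us then ta else (%x. x))" if "distinct Us" for Us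
    using that by (induction Us) (auto simp: cmp_def o_def)
   thus ?thesis using V t id DA Vs unfolding A_def
    by (intro CollectI conjI exI[of _ "%U. if U = V then ta else (%x. x)"]) auto
  qed
  have comp: "si \<circ> ta:A" if st: "si:A" "ta:A" for si ta
  proof -
   obtain a b where a: "ALL V:set Vs. a V:D V" "ALL y:B. si y = cmp a Vs y" and b: "ALL V:set Vs. b V:D V" "ALL y:B. ta y = cmp b Vs y"
    using st by (auto simp: A_def)
   have tA: "si:Aut kk" "ta:Aut kk" using st by (auto simp: A_def)
   have "(si \<circ> ta) y = cmp (%V. a V \<circ> b V) Vs y" if y: "y:B" for y
   proof -
    have "cmp a Vs (cmp b Vs y) = cmp (%V. a V \<circ> b V) Vs y" using a(1) b(1) DA y by (intro PP) blast+
    thus ?thesis using a(2) b(2) y galD(4)[OF gB tA(2) y] by simp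
   qed
   moreover have "a V \<circ> b V:D V" if "V:set Vs" for V
    using a b that dec_comp[OF BS(1) W(1)[OF that]] by (simp add: D_def)
   ultimately show ?thesis using aut_comp[OF tA] unfolding A_def by (intro CollectI conjI exI[of _ "%V. a V \<circ> b V"]) auto
  qed
  have dA: "dec kk U <= A" if U: "prm B U" for U
  proof
   fix ta assume t: "ta:dec kk U"
   show "ta:A"
   proof (cases "U Int kk:set Vs")
    case True
    have "ta:D (U Int kk)" unfolding D_def by (rule dec_above_unique[OF B U W(1)[OF True] W(2)[OF True, symmetric] t])
    thus ?thesis by (rule single[OF True])
   next
    case False
    hence "ta z = z" if "z:G" for z using fixB[OF U t] by (intro fixG[OF dec_Aut[OF t] _ that]) auto
    thus ?thesis using triL[OF U t] by (intro triA dec_Aut[OF t]) auto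
   qed
  qed
  \<comment> \<open>The goal is that automorphisms fixing \<open>G\<close> fix \<open>B\<close>, so
    that nothing outside \<open>G\<close> was added.\<close>
  have "ta y = y" if t: "ta:Aut G" and y: "y:B" for ta y
  proof -
   have tk: "ta:Aut kk" using t Aut_mono[OF GS(2)] by blast
   have AA: "A <= Aut kk" by (auto simp: A_def)
   have II: "inertia kk W <= A" "W Int kk = Pinf ==> decomp kk W <= A" if "prm B W" for W
    using dA[OF that] dec_sub(1) by (auto simp: dec_def)
   obtain b where b: "b:A" "!!y. y:B ==> ta y = b y"
    using inertia_generate[OF B AA triA[OF aut_id(2)] comp II tk] by blast
   then obtain a where a: "ALL V:set Vs. a V:D V" "ALL y:B. b y = cmp a Vs y" by (auto simp: A_def)
   have aA: "a V:Aut kk" if "V:set Vs" for V using a(1) that DA by blast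
   have fx: "a U z = z" if "U:set Vs" "V:set Vs" "V ~= U" "z:be V" for U V z
    using that a(1) W(2)[OF that(1)] fixB[OF W(1)[OF that(1)] _ that(2) _ that(4)] by (auto simp: D_def)
   \<comment> \<open>On \<open>be V\<close> every factor except the one belonging to
     \<open>V\<close> is the identity.\<close>
   have cmp: "cmp a Us z = (if V:set Us then a V z else z)"
    if "distinct Us" "set Us <= set Vs" and V: "V:set Vs" "z:be V" for Us V z
    using that(1,2)
   proof (induction Us)
    case (Cons U Us)
    have z: "z:B" using V bG sub(1) by blast
    show ?case
    proof (cases "U = V")
     case False
     hence "a U z = z" using Cons.prems V by (intro fx) auto
     moreover have "a U (a V z) = a V (a U z)" using Cons.prems V by (intro abel_commute[OF B(1) aA aA z]) auto
     ultimately show ?thesis using Cons False by (auto simp: cmp_def)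
    qed (use Cons in \<open>auto simp: cmp_def\<close>)
   qed (simp add: cmp_def)
   \<comment> \<open>As \<open>ta\<close> fixes \<open>G\<close>, the factor \<open>a V\<close>
     fixes \<open>be V\<close>; it fixes the other generators anyway. Being local and trivial on
     \<open>G\<close>, it is trivial on \<open>B\<close>.\<close>
   have aB: "a V z = z" if V: "V:set Vs" and z: "z:B" for V z
   proof (rule triL[OF W(1)[OF V] _ fixG[OF aA[OF V]] z])
    show "a V:dec kk (\<W> V)" using a(1) V by (simp add: D_def)
    fix U w assume U: "U:set Vs" "w:be U"
    hence w: "w:G" "w:B" using bG sub(1) by auto
    have "U = V ==> a V w = ta w" using cmp[OF Vs(1) order_refl V, of w] U a(2) b(2) w(2) V by simp
    thus "a V w = w" using fx[OF V U(1) _ U(2)] AutD(3)[OF t w(1)] by (cases "U = V") auto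
   qed
   have "cmp a Us y = y" if "set Us <= set Vs" for Us using that aB y by (induction Us) (auto simp: cmp_def)
   thus ?thesis using b(2) a(2) y by simp
  qed
  moreover have "x:B" using sub(2) adj_gen[of "{x}" F] by blast
  ultimately show "x:G" using galD(6)[OF abel_gal[OF abel_mid(1)[OF clb_k B(1) GS sub(1)]]] by blast
 qed
 ultimately show ?thesis unfolding genus_field_def hilbert_class_field_eq[OF F] abelian_ext_iff[OF clb_k]
  using G(2,4) by (intro Greatest_equality) auto
qed

section \<open>Cyclotomic function fields\<close>

definition tw :: "'a::finite_field kbar => 'a kbar => 'a kbar" where "tw t y = t * y + y ^ CARD('a)"

context
 fixes t :: "'a::finite_field kbar" and l :: nat
 assumes t: "t:kk" "t ~= 0" and l: "CARD('a) = CHAR('a) ^ l"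
begin

lemmas qmap = ring_mapD[OF frobenius_ring_map[where 'a='a and n = l, folded l]]

lemma tw_simps: "tw t (x + y) = tw t x + tw t y" "tw t (cst c * x) = cst c * tw t x" "tw t (x * cst c) = cst c * tw t x" "tw t 0 = 0"
 "tw t (sum f A) = (SUM i:A. tw t (f i))" "tw t (x - y) = tw t x - tw t y"
 using card_gt[where 'a='a] by (simp_all add: tw_def qmap algebra_simps power_mult_distrib cst_frob sum.distrib sum_distrib_left)

lemma carlitz_upto: "degree a <= n ==> carlitz t a x = (SUM i<=n. cst (coeff a i) * (tw t ^^ i) x)"
 unfolding carlitz_def tw_def[abs_def] cst_def by (rule sum.mono_neutral_left) (auto simp: coeff_eq_0)

lemma carlitz_0: "carlitz t 0 x = 0" by (simp add: carlitz_upto cst_hom)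

lemma carlitz_pCons: "carlitz t (pCons c a) x = cst c * x + tw t (carlitz t a x)"
proof -
 have "carlitz t (pCons c a) x = (SUM i<=Suc (degree a). cst (coeff (pCons c a) i) * (tw t ^^ i) x)"
  by (rule carlitz_upto) (rule degree_pCons_le)
 thus ?thesis unfolding sum.atMost_Suc_shift by (simp add: carlitz_upto[OF order_refl] tw_simps)
qed

lemma carlitz_add: "carlitz t (a + b) x = carlitz t a x + carlitz t b x"
 by (induction a b rule: poly_induct2) (simp_all add: carlitz_0 carlitz_pCons cst_hom tw_simps algebra_simps)

lemma carlitz_linear:
 "carlitz t (smult c a) x = cst c * carlitz t a x" "carlitz t a (x + y) = carlitz t a x + carlitz t a y"
 "carlitz t a (cst c * x) = cst c * carlitz t a x" "carlitz t a (tw t x) = tw t (carlitz t a x)" "carlitz t a 0 = 0"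
 by (induction a; simp add: carlitz_0 carlitz_pCons cst_hom tw_simps algebra_simps)+

lemmas carlitz_simps = carlitz_add carlitz_linear

lemma carlitz_diff: "carlitz t a (x - y) = carlitz t a x - carlitz t a y" "carlitz t (a - b) x = carlitz t a x - carlitz t b x"
 unfolding eq_diff_eq using carlitz_simps(3)[of a "x - y" y] carlitz_add[of "a - b" b x] by simp_all

lemma carlitz_mult: "carlitz t (a * b) x = carlitz t a (carlitz t b x)"
 by (induction a) (simp_all add: carlitz_0 carlitz_pCons carlitz_simps cst_hom)

lemma carlitz_monom: "carlitz t (monom 1 n) x = (tw t ^^ n) x"
 by (simp add: carlitz_upto[OF degree_monom_le] cst_hom if_distrib[of cst] if_distrib[of "%c. c * _"] cong: if_cong)

lemma aut_carlitz: assumes s: "si:Aut kk" shows "si (carlitz t a x) = carlitz t a (si x)"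
 by (induction a) (simp_all add: carlitz_0 carlitz_pCons aut_zero[OF s] aut_add[OF s] aut_mult[OF s] aut_power[OF s]
  tw_def AutD(3)[OF s] cst_k t)

text \<open>The action of \<open>a\<close> as a polynomial in the torsion variable. It is additive,
  with constant derivative equal to the value of \<open>a\<close> at \<open>t\<close>, so the
  torsion points are simple roots when that value is not zero.\<close>

definition carl_poly :: "'a poly => 'a kbar poly" where
 "carl_poly a = (SUM i<=degree a. smult (cst (coeff a i)) (((%P. smult t P + P ^ CARD('a)) ^^ i) [:0, 1:]))"

lemma carl_poly:
 shows "poly (carl_poly a) x = carlitz t a x" "carl_poly a:pols kk"
  "pderiv (carl_poly a) = [:SUM i<=degree a. cst (coeff a i) * t ^ i:]" "degree (carl_poly a) <= CARD('a) ^ degree a"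
proof -
 let ?P = "%i. ((%P. smult t P + P ^ CARD('a)) ^^ i) [:0, 1 :: 'a kbar:]"
 note q = card_gt[where 'a='a]
 have "poly (?P i) x = (tw t ^^ i) x" for i by (induction i) (simp_all add: tw_def)
 thus "poly (carl_poly a) x = carlitz t a x" by (simp add: carl_poly_def poly_sum carlitz_upto[OF order_refl])
 note kS = sf_sr[OF k_sf] note R = pols_sr[OF kS]
 have c: "smult c P = [:c:] * P" for c :: "'a kbar" and P by simp
 have C: "[:c:]:pols kk" if "c:kk" for c :: "'a kbar"
  using that sr_cl[OF kS] by (auto simp: pols_def coeff_pCons split: nat.split)
 have "?P i:pols kk" for i
 proof (induction i)
  case 0 thus ?case using sr_cl[OF kS] by (auto simp: pols_def coeff_pCons split: nat.split)
 next
  case (Suc i) thus ?case using C[OF t(1)] unfolding funpow.simps o_apply c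
   by (intro sr_add[OF R] sr_mult[OF R] sr_pow[OF R])
 qed
 thus "carl_poly a:pols kk" unfolding carl_poly_def c
  using C[OF cst_k] by (intro sr_sum[OF R] sr_mult[OF R])
 have "l > 0" using q l by (cases l) auto
 hence q0: "(of_nat CARD('a) :: 'a kbar) = 0" using of_nat_CHAR[where 'a = "'a kbar"] by (simp add: l CHAR_kbar)
 have "pderiv (?P i) = [:t ^ i:]" for i by (induction i) (simp_all add: pderiv_add pderiv_smult pderiv_power q0 pderiv_pCons)
 moreover have "pderiv (sum f S) = (SUM i:S. pderiv (f i))" for f :: "nat => 'a kbar poly" and S
  by (induction S rule: infinite_finite_induct) (simp_all add: pderiv_add)
 moreover have const: "(SUM i:S. [:f i:]) = [:sum f S:]" for f :: "nat => 'a kbar" and S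
  by (induction S rule: infinite_finite_induct) simp_all
 ultimately show "pderiv (carl_poly a) = [:SUM i<=degree a. cst (coeff a i) * t ^ i:]"
  using const by (simp add: carl_poly_def pderiv_smult)
 have d: "degree (?P i) <= CARD('a) ^ i" for i
 proof (induction i)
  case (Suc i)
  have "degree (?P i ^ CARD('a)) <= degree (?P i) * CARD('a)" by (rule degree_power_le)
  also have "... <= CARD('a) ^ i * CARD('a)" using Suc by (rule mult_le_mono1)
  finally have "degree (?P i ^ CARD('a)) <= CARD('a) ^ Suc i" by (simp add: mult.commute)
  moreover have "degree (smult t (?P i)) <= CARD('a) ^ Suc i"
   by (rule order_trans[OF order_trans[OF degree_smult_le Suc] power_increasing]) (use q in auto)
  ultimately show ?case by (simp add: degree_add_le)
 qed simp
 show "degree (carl_poly a) <= CARD('a) ^ degree a" unfolding carl_poly_def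
  using q by (intro degree_sum_le order_trans[OF degree_smult_le] order_trans[OF d] power_increasing) auto
qed

section \<open>Torsion points close to a pole of t\<close>

context
 fixes A :: "'a kbar set" and s :: "'a kbar" and d :: nat
 assumes A: "prm UNIV A" and tA: "t~:A" and s: "s ^ (CARD('a) - 1) = - t" and d: "d >= 1"
begin

text \<open>The element \<open>s\<close> with \<open>s^(q-1) = -t\<close> is a nonzero root of
  \<open>t X + X^q\<close>, a \<open>t\<close>-torsion point. As \<open>t\<close> is large at
  \<open>A\<close>, a torsion point of least size for a polynomial of degree \<open>d\<close> is
  expected near \<open>s / t^(d-1)\<close>; this explains the normalisation used below.\<close>

definition near :: "'a kbar => 'a kbar => bool" where "near x y <-> x - y:mx A"

lemmas mI = mx_mult[OF primeD(1)[OF A]] mx_add[OF sf_UNIV A] mx_diff[OF sf_UNIV A] mx_0[OF primeD(1)[OF A]]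

lemma cstA: "cst c:A"
 using const_prime[OF A UNIV_I cst_frob card_gt] .

lemma nearA: "near x (cst c) ==> x:A"
 using sr_add[OF primeD(1)[OF A] mx_sub cstA, of "x - cst c" c] by (simp add: near_def)

lemma near_mult: assumes "near x (cst c)" "near x' (cst c')" shows "near (x * x') (cst (c * c'))"
proof -
 have "x * x' - cst (c * c') = (x - cst c) * x' + (x' - cst c') * cst c" by (simp add: cst_hom algebra_simps)
 thus ?thesis using assms nearA[OF assms(2)] cstA mI by (simp add: near_def)
qed

lemma near_unit: assumes "near x (cst c)" "c ~= 0" shows "x:vunit A"
proof -
 have "x~:mx A"
 proof
  assume "x:mx A"
  hence "cst c:mx A" using mI(3)[of x "x - cst c"] assms(1) by (simp add: near_def)
  thus False using const_max_ideal[OF A UNIV_I cst_frob card_gt _ sf_UNIV] assms(2) by (simp add: cst_hom)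
 qed
 thus ?thesis using nearA[OF assms(1)] by (simp add: mx_iff)
qed

lemma near_inverse: assumes "near x 1" shows "near (inverse x) 1"
proof -
 have u: "x:vunit A" using near_unit[of x 1] assms by (simp add: cst_hom)
 hence "inverse x - 1 = - ((x - 1) * inverse x)" using vunit_nz[OF u] by (simp add: field_simps)
 thus ?thesis using assms u mI(1)[of "x - 1" "inverse x"] mx_um[OF primeD(1)[OF A]] by (simp add: near_def vunit_def)
qed

lemma near_power: "near x 1 ==> near (x ^ n) 1"
 using near_mult[of x 1 _ 1] mI(4) by (induction n) (simp_all add: cst_hom near_def)

lemma ti: "inverse t:mx A" using not_in_prime[OF A UNIV_I tA] .

lemma s0: "s ~= 0" using s t(2) card_gt[where 'a='a] by (auto simp: power_0_left)

lemma s_q: "s ^ CARD('a) = - t * s"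
 using s card_gt[where 'a='a] by (metis One_nat_def Suc_pred' less_trans power_Suc2 zero_less_one)

text \<open>For a point smaller than \<open>s\<close> by a factor \<open>t\<close> or more, the term
  \<open>t * y\<close> dominates \<open>y^q\<close>. So each application multiplies by
  \<open>t\<close> to leading order, until the size of \<open>s\<close> is reached.\<close>

lemma tw_iterate:
 assumes x: "near (x * t ^ (d - 1) / s) 1"
 shows "i < d ==> near ((tw t ^^ i) x * t ^ (d - 1 - i) / s) 1"
proof (induction i)
 case (Suc i)
 let ?y = "(tw t ^^ i) x" and ?n = "d - 2 - i"
 let ?k = "Suc ?n * (CARD('a) - 1) - 1"
 define r where "r = ?y * t ^ (d - 1 - i) / s"
 have r: "near r 1" using Suc by (simp add: r_def)
 have n: "d - 1 - i = Suc ?n" using Suc.prems by simp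
 have y: "?y = s * r / t ^ Suc ?n" unfolding r_def n using s0 t(2) by simp
 have "(t * y + y ^ CARD('a)) * t ^ n / s = y * t ^ Suc n / s + y ^ CARD('a) * t ^ n / s" for y n
  by (simp add: add_divide_distrib algebra_simps)
 hence "tw t ?y * t ^ ?n / s = r + ?y ^ CARD('a) * t ^ ?n / s" unfolding r_def n tw_def[of t ?y] .
 also have "?y ^ CARD('a) * t ^ ?n / s = - (t * r ^ CARD('a) * t ^ ?n / (t ^ Suc ?n) ^ CARD('a))"
  unfolding y power_divide power_mult_distrib s_q using s0 by simp
 also have "... = - (r ^ CARD('a) * (t ^ Suc ?n / (t ^ Suc ?n) ^ CARD('a)))" by (simp add: mult_ac)
 also have "t ^ Suc ?n / (t ^ Suc ?n) ^ CARD('a) = inverse (t ^ Suc ?n) ^ (CARD('a) - 1)"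
  using t(2) card_gt[where 'a='a] by (cases "CARD('a)") (simp_all add: power_inverse field_simps)
 also have "... = inverse t * inverse t ^ ?k"
 proof -
  have "Suc ?n * (CARD('a) - 1) = Suc ?k" using card_gt[where 'a='a] by simp
  moreover have "inverse (t ^ Suc ?n) ^ (CARD('a) - 1) = inverse t ^ (Suc ?n * (CARD('a) - 1))" by (simp only: power_inverse power_mult)
  ultimately show ?thesis by (metis power_Suc)
 qed
 finally have e: "tw t ?y * t ^ ?n / s - 1 = (r - 1) - inverse t * (inverse t ^ ?k * r ^ CARD('a))"
  by (simp add: mult_ac)
 have "r ^ CARD('a):A" by (rule nearA[of _ 1]) (use near_power[OF r] in \<open>simp add: cst_hom\<close>)
 from sr_mult[OF primeD(1)[OF A] sr_pow[OF primeD(1)[OF A] mx_sub[OF ti]] this]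
 have "inverse t ^ ?k * r ^ CARD('a):A" .
 hence "near (tw t ?y * t ^ ?n / s) 1" unfolding near_def e by (intro mI(3)[OF r[unfolded near_def] mI(1)[OF ti]])
 thus ?case by simp
qed (use x in simp)

text \<open>The iterates grow by a factor \<open>t\<close> each time, so below degree
  \<open>d\<close> the leading term dominates. In particular the action of a nonzero
  \<open>b\<close> does not kill \<open>x\<close>.\<close>

lemma carlitz_leading:
 assumes x: "near (x * t ^ (d - 1) / s) 1" and b: "degree b < d"
 shows "near (carlitz t b x * t ^ (d - 1 - degree b) / s) (cst (lead_coeff b))"
proof -
 let ?j = "degree b"
 let ?r = "%i. (tw t ^^ i) x * t ^ (d - 1 - i) / s"
 have r: "near (?r i) 1" if "i <= ?j" for i using tw_iterate[OF x, of i] b that by simp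
 have e: "cst (coeff b i) * (tw t ^^ i) x * t ^ (d - 1 - ?j) / s = cst (coeff b i) * ?r i * inverse t ^ (?j - i)" if "i <= ?j" for i
 proof -
  have "d - 1 - i = (d - 1 - ?j) + (?j - i)" using that b by simp
  thus ?thesis using t(2) by (simp add: power_add power_inverse field_simps)
 qed
 have "(SUM i<?j. cst (coeff b i) * (tw t ^^ i) x * t ^ (d - 1 - ?j) / s):mx A"
 proof (intro mx_sum[OF sf_UNIV A])
  fix i assume i: "i:{..<?j}"
  have "?r i:A" using nearA[of _ 1] r[of i] i by (simp add: cst_hom)
  hence "inverse t * (inverse t ^ (?j - i - 1) * (cst (coeff b i) * ?r i)):mx A"
   using mx_sub[OF ti] cstA by (intro mI(1)[OF ti] sr_mult[OF primeD(1)[OF A]] sr_pow[OF primeD(1)[OF A]])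
  moreover have "inverse t ^ (?j - i) = inverse t ^ (?j - i - 1) * inverse t" using i by (intro power_minus_mult[symmetric]) simp
  hence "cst (coeff b i) * (tw t ^^ i) x * t ^ (d - 1 - ?j) / s = inverse t * (inverse t ^ (?j - i - 1) * (cst (coeff b i) * ?r i))"
   using e[of i] i by (simp only: mult_ac lessThan_iff less_imp_le)
  ultimately show "cst (coeff b i) * (tw t ^^ i) x * t ^ (d - 1 - ?j) / s:mx A" by (simp only:)
 qed
 moreover have "near (cst (lead_coeff b) * ?r ?j) (cst (lead_coeff b * 1))"
  by (intro near_mult) (use r[of ?j] mI(4) in \<open>simp_all add: near_def cst_hom\<close>)
 moreover have "carlitz t b x * c / s = (SUM i<?j. cst (coeff b i) * (tw t ^^ i) x * c / s) + cst (lead_coeff b) * ((tw t ^^ ?j) x * c / s)" for c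
  unfolding carlitz_upto[OF order_refl] lessThan_Suc_atMost[symmetric]
  by (simp add: sum_distrib_right sum_divide_distrib distrib_right add_divide_distrib mult.assoc)
 ultimately show ?thesis by (simp only: near_def add_diff_eq[symmetric] mI(2) mult_1_right)
qed

text \<open>After \<open>d - 1\<close> steps the point is near \<open>s\<close>, where the two terms
  of the action of \<open>t\<close> cancel to leading order; the terms of lower degree are small
  compared with \<open>t * s\<close>.\<close>

lemma carlitz_near_root:
 assumes x: "near (x * t ^ (d - 1) / s) 1" and a: "degree a = d"
 shows "carlitz t a x / (t * s):mx A"
proof -
 note R = primeD(1)[OF A]
 define b where "b = a - monom (lead_coeff a) d"
 have a': "a = b + smult (lead_coeff a) (monom 1 d)" by (simp add: b_def smult_monom)
 have "coeff b k = 0" if "k >= d" for k using that a by (cases "k = d") (auto simp: b_def coeff_eq_0)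
 hence db: "degree b < d" using d by (intro degree_lessI) auto
 have b: "carlitz t b x / (t * s):mx A"
 proof -
  let ?z = "carlitz t b x * t ^ (d - 1 - degree b) / s"
  have "?z:A" by (rule nearA[OF carlitz_leading[OF x db]])
  hence "inverse t * (inverse t ^ (d - 1 - degree b) * ?z):mx A"
   using mx_sub[OF ti] by (intro mI(1)[OF ti] sr_mult[OF R] sr_pow[OF R])
  moreover have "inverse t * (inverse t ^ (d - 1 - degree b) * ?z) = carlitz t b x / (t * s)"
   using t(2) by (simp add: power_inverse field_simps)
  ultimately show ?thesis by simp
 qed
 let ?y = "(tw t ^^ (d - 1)) x" let ?r = "?y / s"
 have r: "near ?r 1" using tw_iterate[OF x, of "d - 1"] d by simp
 have "(tw t ^^ d) x = tw t ?y" using d by (cases d) simp_all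
 also have "... / (t * s) = ?r - ?r ^ CARD('a)"
  unfolding tw_def power_divide s_q using t(2) s0 by (simp add: field_simps)
 also have "... = (?r - 1) - (?r ^ CARD('a) - 1)" by simp
 also have "... : mx A" by (rule mI(3)[OF r[unfolded near_def] near_power[OF r, unfolded near_def]])
 finally have "(tw t ^^ d) x / (t * s) * cst (lead_coeff a):mx A" by (intro mI(1) cstA)
 with b have "carlitz t b x / (t * s) + (tw t ^^ d) x / (t * s) * cst (lead_coeff a):mx A" by (rule mI(2))
 thus ?thesis by (subst a') (simp add: carlitz_simps carlitz_monom add_divide_distrib mult_ac)
qed

lemma prod_mset_unit: "(!!c. c :# M ==> f c~:mx A) ==> prod_mset (image_mset f M)~:mx A & prod_mset (image_mset f M) ~= 0"
proof (induction M)
 case (add c M)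
 let ?p = "prod_mset (image_mset f M)"
 have i: "inverse x:A & x ~= 0" if "x~:mx A" for x
  using that not_in_prime[OF A UNIV_I] primeD(4)[OF A UNIV_I, of x] mI(4) by (auto simp: max_ideal_def)
 have "inverse (f c * ?p):A" "f c * ?p ~= 0"
  using add i[of "f c"] i[of ?p] sr_mult[OF primeD(1)[OF A]] by auto
 thus ?case by (auto simp: max_ideal_def)
qed (use mx_1[OF primeD(1)[OF A]] in simp)

lemma carlitz_const_term:
 assumes a: "degree a = d" shows "(SUM i<=degree a. cst (coeff a i) * t ^ i) / t ^ d:vunit A"
proof (rule near_unit)
 note R = primeD(1)[OF A]
 show "lead_coeff a ~= 0" using a d by auto
 have "(SUM i<d. cst (coeff a i) * t ^ i / t ^ d):mx A"
 proof (intro mx_sum[OF sf_UNIV A])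
  fix i assume i: "i:{..<d}"
  have "d = i + ((d - 1 - i) + 1)" using i by simp
  hence td: "t ^ d = t ^ i * (t ^ (d - 1 - i) * t)" by (metis power_add power_one_right)
  have "cst (coeff a i) * t ^ i / t ^ d = inverse t * (inverse t ^ (d - 1 - i) * cst (coeff a i))"
   unfolding td using t(2) by (simp add: power_inverse field_simps)
  moreover have "inverse t ^ (d - 1 - i) * cst (coeff a i):A"
   using mx_sub[OF ti] cstA by (intro sr_mult[OF R] sr_pow[OF R])
  ultimately show "cst (coeff a i) * t ^ i / t ^ d:mx A" using mI(1)[OF ti] by simp
 qed
 thus "near ((SUM i<=degree a. cst (coeff a i) * t ^ i) / t ^ d) (cst (lead_coeff a))" using t(2) by (simp add: a near_def lessThan_Suc_atMost[symmetric] add_divide_distrib sum_divide_distrib)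
qed

text \<open>In place of Hensel's lemma: the ratio of the values at \<open>x0\<close> and at 0 of the
  polynomial divided by \<open>X\<close> is the product of \<open>(r - x0) / r\<close> over its
  roots. This product is in the maximal ideal, so one factor is, and its root is close to
  \<open>x0\<close>.\<close>

lemma carlitz_root:
 assumes a: "degree a = d"
 obtains r where "carlitz t a r = 0" "near (r * t ^ (d - 1) / s) 1"
proof -
 note R = primeD(1)[OF A]
 let ?G = "carl_poly a"
 define a0 where "a0 = (SUM i<=degree a. cst (coeff a i) * t ^ i)"
 define x0 where "x0 = s / t ^ (d - 1)"
 have x0: "near (x0 * t ^ (d - 1) / s) 1" "x0 ~= 0" using s0 t(2) mI(4) by (simp_all add: x0_def near_def)
 have u: "a0 / t ^ d:vunit A" unfolding a0_def by (rule carlitz_const_term[OF a])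
 hence a0: "a0 ~= 0" using vunit_nz by fastforce
 obtain c G1 where G: "?G = pCons c G1" by (cases ?G)
 have c: "c = 0" using carl_poly(1)[of a 0] carlitz_simps(6)[of a] unfolding G by simp
 have G10: "poly G1 0 = a0" using arg_cong[OF carl_poly(3)[of a], of "%f. poly f 0"] unfolding G pderiv_pCons a0_def by simp
 hence "G1 ~= 0" using a0 by auto
 then obtain M where M: "G1 = smult (lead_coeff G1) (\<Prod>x\<in>#M. [:- x, 1:])" using alg_closed_imp_factorization by blast
 have ev: "poly G1 x = lead_coeff G1 * prod_mset (image_mset (%r. x - r) M)" for x
 proof -
  have "poly (\<Prod>x\<in>#M. [:- x, 1:]) x = prod_mset (image_mset (%r. x - r) M)" by (induction M) (simp_all add: left_diff_distrib)
  thus ?thesis by (subst M) simp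
 qed
 have M0: "0 ~:# M"
 proof
  assume "0 :# M"
  hence "prod_mset (image_mset (%r. 0 - r) M) = 0" by (induction M) auto
  thus False using ev[of 0] G10 a0 by simp
 qed
 have "poly G1 x0 / poly G1 0 = prod_mset (image_mset (%r. (r - x0) / r) M)"
 proof -
  have "prod_mset (image_mset (%r. x0 - r) M) = prod_mset (image_mset (%r. (r - x0) / r) M) * prod_mset (image_mset (%r. 0 - r) M)"
   using M0 by (induction M) (auto simp: field_simps)
  thus ?thesis using ev[of x0] ev[of 0] G10 a0 by simp
 qed
 moreover have "poly G1 x0 / poly G1 0 = carlitz t a x0 / (t * s) * inverse (a0 / t ^ d)"
 proof -
  have "x0 * poly G1 x0 = carlitz t a x0" using carl_poly(1)[of a x0] unfolding G c by simp
  hence e: "poly G1 x0 = carlitz t a x0 / (s / t ^ (d - 1))" using x0(2) unfolding x0_def[symmetric] by (simp add: field_simps)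
  have td: "t ^ d = t ^ (d - 1) * t" using d by (intro power_minus_mult[symmetric]) simp
  have "z / (s / u) / a0 = z / (t * s) * inverse (a0 / (u * t))" for z u using s0 t(2) a0 by (simp add: field_simps)
  thus ?thesis unfolding G10 e td .
 qed
 ultimately have e: "prod_mset (image_mset (%r. (r - x0) / r) M) = carlitz t a x0 / (t * s) * inverse (a0 / t ^ d)" by (simp only:)
 have "prod_mset (image_mset (%r. (r - x0) / r) M):mx A"
  unfolding e by (rule mI(1)[OF carlitz_near_root[OF x0(1) a]]) (use u in \<open>simp only: vunit_def mem_Collect_eq\<close>)
 then obtain r where r: "r :# M" "(r - x0) / r:mx A" using prod_mset_unit[of M "%r. (r - x0) / r"] by blast
 have r0: "r ~= 0" using r(1) M0 by auto
 have "near (x0 / r) 1" using r(2) r0 mx_um[OF R r(2)] by (simp add: near_def diff_divide_distrib)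
 from near_inverse[OF this] have "near (r * t ^ (d - 1) / s) 1" using s0 t(2) by (simp add: x0_def mult.commute)
 moreover have "poly G1 r = 0"
 proof -
  have "prod_mset (image_mset (%c. r - c) M) = 0" using r(1) by (induction M) auto
  thus ?thesis using ev[of r] by simp
 qed
 hence "carlitz t a r = 0" using carl_poly(1)[of a r] unfolding G c by simp
 ultimately show thesis using that by blast
qed

end

end

lemma val_aut:
 assumes B: "si ` B = B" and s: "si:decomp k W" and U: "unif B W po" and x: "x:B" "x ~= 0"
 shows "si x / x:vunit W"
proof -
 note sA = decompD(1)[OF s]
 obtain w where w: "w:vunit W" "x = w * po powi vl W x" using val_expand[OF U x] .
 have "si (po powi n) = si po powi n" for n by (simp add: power_int_def aut_power[OF sA] aut_inv1[OF sA])
 hence e: "si x = si w * si po powi vl W x" using arg_cong[OF w(2), of si] aut_mult[OF sA] by simp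
 have sw: "si w:vunit W" using w(1) decompD(2)[OF s] aut_inv1[OF sA] aut_eq_0[OF sA]
  unfolding vunit_def by (metis (mono_tags, lifting) image_eqI mem_Collect_eq)
 have U': "unif B W (si po)" using unif_image[OF sA B U] decompD(2)[OF s] by simp
 have v: "vl W (si x) = vl W x" unfolding e by (rule val_eqI[OF U' sw])
 have sx: "si x:B" "si x ~= 0" using B x aut_eq_0[OF sA] by auto
 thus ?thesis using val_vunit_iff[OF U sf_div[OF unif_field[OF U] sx(1) x(1)]] val_divide[OF U sx x] v x by simp
qed

definition scal :: "'a::finite_field kbar set => ('a kbar => 'a kbar) => 'a => bool" where
 "scal \<Lambda> si c <-> c ~= 0 & (ALL x:\<Lambda>. si x = cst c * x)"

context
 fixes t :: "'a::finite_field kbar" and l :: nat and V :: "'a kbar set"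
 assumes t: "t:kk" "t ~= 0" and l: "CARD('a) = CHAR('a) ^ l" and V: "prm kk V" and tV: "t~:V"
begin

abbreviation (input) "rh \<equiv> carlitz t"
lemmas csimps = carlitz_simps[OF t l]

lemma carlitz_const: "rh [:c:] x = cst c * x" using carlitz_pCons[OF t l, of c 0] by (simp add: carlitz_0[OF t l] tw_simps[OF t l])

lemma torsion_const: "a ~= 0 ==> degree a = 0 ==> Tor t a = {0}"
 by (cases a) (auto simp: carlitz_torsion_def carlitz_const cst_hom split: if_splits)

lemma tors_aut: "si:Aut kk ==> x:Tor t a ==> si x:Tor t a"
 using aut_carlitz[OF t l, of si a x] by (simp add: carlitz_torsion_def aut_zero)

text \<open>By \<open>carlitz_leading\<close> the multiples of \<open>r\<close> by the polynomials
  of degree less than \<open>d\<close> are distinct. There are \<open>q^d\<close> of them, as many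
  as the degree of \<open>carl_poly\<close> allows, so \<open>r\<close> generates the torsion
  module.\<close>

lemma tors_str:
 assumes a: "degree a = d" "d >= 1"
 obtains A s r where "prm UNIV A" "A Int kk = V" "s ^ (CARD('a) - 1) = - t"
  "r:Tor t a" "near A (r * t ^ (d - 1) / s) 1"
  "!!x. x:Tor t a ==> EX b. (b = 0 \<or> degree b < d) & x = rh b r"
  "finite (Tor t a)" "!!x. x:Tor t a ==> sep kk x"
proof -
 obtain A where A: "prm UNIV A" "A Int kk = V" using place_over_k[OF V] .
 have tA: "t~:A" using A(2) t tV by blast
 obtain s where s: "s ^ (CARD('a) - 1) = - t" using nth_root_exists[of "CARD('a) - 1" "- t"] card_gt[where 'a='a] by auto
 note H = t l A(1) tA s a(2)
 obtain r where r: "rh a r = 0" "near A (r * t ^ (d - 1) / s) 1" using carlitz_root[OF H a(1)] .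
 let ?G = "carl_poly t a" and ?L = "Tor t a"
 have "(SUM i<=degree a. cst (coeff a i) * t ^ i) ~= 0" using vunit_nz[OF carlitz_const_term[OF H a(1)]] by auto
 hence pd: "poly (pderiv ?G) x ~= 0" for x by (simp add: carl_poly(3)[OF t l])
 have L: "?L = {x. poly ?G x = 0}" by (simp add: carlitz_torsion_def carl_poly(1)[OF t l])
 have G0: "?G ~= 0" using pd[of 0] by auto
 have fin: "finite ?L" unfolding L by (rule poly_roots_finite[OF G0])
 have "card ?L <= degree ?G" unfolding L by (rule card_poly_roots_bound[OF G0])
 hence cL: "card ?L <= CARD('a) ^ d" using carl_poly(4)[OF t l, of a] unfolding a(1) by (rule le_trans)
 define be where "be f = (SUM i<d. monom (f i) i)" for f :: "nat => 'a"
 have co: "coeff (be f) i = (if i < d then f i else 0)" for f i by (simp add: be_def coeff_sum)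
 have db: "b = 0 \<or> degree b < d" if "!!i. i >= d ==> coeff b i = 0" for b :: "'a poly"
  using that a(2) by (metis degree_lessI not_le less_le_trans zero_less_one)
 have nz: "rh b r ~= 0" if b: "b ~= 0" "!!i. i >= d ==> coeff b i = 0" for b
 proof
  assume "rh b r = 0"
  hence "near A 0 (cst (lead_coeff b))" using carlitz_leading[OF H r(2), of b] db[OF b(2)] b(1) by simp
  from near_unit[OF H this] b(1) show False using vunit_nz by fastforce
 qed
 let ?F = "PiE {..<d} (%_. UNIV :: 'a set)"
 have inj: "inj_on (%f. rh (be f) r) ?F"
 proof (rule inj_onI)
  fix f g assume fg: "f:?F" "g:?F" "rh (be f) r = rh (be g) r"
  have "be f - be g = 0"
  proof (rule ccontr)
   assume "be f - be g ~= 0"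
   hence "rh (be f - be g) r ~= 0" by (rule nz) (simp add: co)
   thus False using fg(3) by (simp add: carlitz_diff[OF t l])
  qed
  hence "f i = g i" if "i < d" for i using co[of f i] co[of g i] that by simp
  thus "f = g" using fg(1,2) by (intro PiE_ext[OF fg(1,2)]) simp
 qed
 have sub: "(%f. rh (be f) r) ` ?F <= ?L"
 proof (rule image_subsetI)
  fix f show "rh (be f) r:?L" unfolding carlitz_torsion_def mem_Collect_eq carlitz_mult[OF t l, symmetric] mult.commute[of a]
   unfolding carlitz_mult[OF t l] r(1) by (rule csimps(6))
 qed
 have "card ((%f. rh (be f) r) ` ?F) = CARD('a) ^ d" unfolding card_image[OF inj] by (simp add: card_PiE)
 hence eq: "(%f. rh (be f) r) ` ?F = ?L" using card_seteq[OF fin sub] cL by simp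
 show thesis
 proof (rule that[OF A s _ r(2) _ fin])
  show "r:?L" using r(1) by (simp add: carlitz_torsion_def)
  fix x assume x: "x:?L"
  then obtain f where "x = rh (be f) r" unfolding eq[symmetric] by blast
  thus "EX b. (b = 0 \<or> degree b < d) & x = rh b r" using db[of "be f"] co by auto
  show "sep kk x" unfolding sep_def using carl_poly(2)[OF t l, of a] x pd unfolding L by blast
 qed
qed

lemma torsion_sep: assumes "a ~= 0" shows "finite (Tor t a)" "x:Tor t a ==> sep kk x"
proof -
 have "sep kk (0 :: 'a kbar)" unfolding sep_def
  using sf_cl[OF k_sf] by (intro bexI[of _ "[:0, 1:]"]) (auto simp: pols_def coeff_pCons pderiv_pCons split: nat.split)
 hence "finite (Tor t a) & (ALL x:Tor t a. sep kk x)"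
 proof (cases "degree a = 0")
  case False
  hence d: "degree a >= 1" by simp
  show ?thesis by (rule tors_str[OF refl d]) blast
 qed (use torsion_const[OF assms] in simp)
 thus "finite (Tor t a)" "x:Tor t a ==> sep kk x" by auto
qed

lemma scalar_generator:
 assumes "si:Aut kk" "!!x. x:Tor t a ==> EX b. x = rh b r" "si r = cst c * r" "c ~= 0"
 shows "scal (Tor t a) si c"
 unfolding scal_def
proof (intro conjI ballI assms(4))
 fix x assume "x:Tor t a"
 then obtain b where "x = rh b r" using assms(2) by blast
 thus "si x = cst c * x" by (simp add: aut_carlitz[OF t l assms(1)] assms(3) csimps)
qed

text \<open>Automorphisms send the generator to multiples of itself and commute with the action of
  polynomials, so they act as multiplications in a commutative ring.\<close>

lemma cyc_abel:
 assumes "a ~= 0" shows "abel kk (cyclotomic t a)" "fing kk (cyclotomic t a)"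
proof -
 let ?L = "Tor t a"
 show "fing kk (cyclotomic t a)" using torsion_sep(1)[OF assms] by (auto simp: fing_def cyclotomic_def)
 show "abel kk (cyclotomic t a)" unfolding cyclotomic_def
 proof (rule abel_adjoinI[OF gal_adjoinI[OF clb_k gfix_adj[OF clb_k torsion_sep(2)[OF assms]]]])
  show "si x:adj kk ?L" if "si:Aut kk" "x:?L" for si x
   using tors_aut[OF that] adj_gen by blast
  fix si ta :: "'a kbar => 'a kbar" and x assume s: "si:Aut kk" "ta:Aut kk" and x: "x:?L"
  show "si (ta x) = ta (si x)"
  proof (cases "degree a = 0")
   case True thus ?thesis using x torsion_const[OF assms] by (simp add: aut_zero[OF s(1)] aut_zero[OF s(2)])
  next
   case False
   hence d: "degree a >= 1" by simp
   obtain r where r: "r:?L" "!!x. x:?L ==> EX b. x = rh b r" by (rule tors_str[OF refl d]) blast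
   obtain b b' c where b: "x = rh b r" "si r = rh b' r" "ta r = rh c r" using r(2)[OF x] r(2)[OF tors_aut[OF s(1) r(1)]] r(2)[OF tors_aut[OF s(2) r(1)]] by blast
   show ?thesis unfolding b(1) by (simp add: aut_carlitz[OF t l] s b(2,3) carlitz_mult[OF t l, symmetric] mult_ac)
  qed
 qed
qed

context
 fixes B :: "'a kbar set" and a :: "'a poly"
 assumes B: "abel kk B" "fing kk B" and LB: "Tor t a <= B" and a0: "a ~= 0"
begin

text \<open>Where \<open>t\<close> has a pole, the torsion points of smallest absolute value are the multiples of one generator by constants.\<close>

lemma dec_scalar:
 assumes W: "prm B W" "W Int kk = V" and s: "si:dec kk W"
 shows "EX c. scal (Tor t a) si c"
proof (cases "degree a = 0")
 case True
 thus ?thesis using torsion_const[OF a0] aut_zero[OF dec_Aut[OF s]] by (intro exI[of _ 1]) (simp add: scal_def)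
next
 case False
 let ?L = "Tor t a" and ?d = "degree a"
 have d: "?d >= 1" using False by simp
 obtain A z r where A: "prm UNIV A" "A Int kk = V" and z: "z ^ (CARD('a) - 1) = - t" and r: "r:?L" "near A (r * t ^ (?d - 1) / z) 1"
  and gen: "!!x. x:?L ==> EX b. (b = 0 \<or> degree b < ?d) & x = rh b r" by (rule tors_str[OF refl d]) blast
 note gB = abel_gal[OF B(1)] note BS = galD(2,3)[OF gB] note sA = dec_Aut[OF s]
 have tA: "t~:A" using A(2) t tV by blast
 note H = t l A(1) tA z d
 have W0: "prm B (A Int B)" by (rule pr_rest[OF clb_mono[OF clb_k BS(2,1)] sf_UNIV _ A(1)]) simp
 have "W Int kk = A Int B Int kk" using A(2) W(2) BS(2) by blast
 hence s0: "si:decomp kk (A Int B)" using dec_above_unique[OF B W(1) W0 _ s] dec_sub(2) by blast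
 have r0: "r ~= 0" using near_unit[OF H, of "r * t ^ (?d - 1) / z" 1] r(2) vunit_nz by (fastforce simp: cst_hom)
 obtain po where U: "unif B (A Int B) po" using dvr_k[OF B(2) gB W0] by (auto simp: dvr_def)
 have q: "si r / r:A" using val_aut[OF gal_image[OF gB sA] s0 U _ r0] LB r(1) by (auto simp: vunit_def)
 obtain b where b: "b = 0 \<or> degree b < ?d" "si r = rh b r" using gen[OF tors_aut[OF sA r(1)]] by blast
 have b0: "b ~= 0" using b(2) r0 aut_eq_0[OF sA, of r] by (auto simp: carlitz_0[OF t l])
 hence db: "degree b < ?d" using b(1) by simp
 \<comment> \<open>A nonconstant \<open>b\<close> would enlarge \<open>r\<close> by a power of
   \<open>t\<close>, whereas an element of the decomposition group preserves the value.\<close>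
 have "degree b = 0"
 proof (rule ccontr)
  assume j: "degree b ~= 0"
  let ?j = "degree b" and ?y = "r * t ^ (?d - 1) / z"
  have "?d - 1 = (?d - 1 - ?j) + ?j" using db by simp
  hence td: "t ^ (?d - 1) = t ^ (?d - 1 - ?j) * t ^ ?j" by (metis power_add)
  have ij: "inverse t ^ ?j = inverse t ^ (?j - 1) * inverse t" using j by (intro power_minus_mult[symmetric]) simp
  have "si r * u / z = inverse t * (inverse t ^ (?j - 1) * (si r / r * (r * (u * t ^ ?j) / z)))" for u
  proof -
   have "si r * u / z = (inverse t ^ ?j * t ^ ?j) * (si r / r * (r * u / z))" using r0 t(2) by (simp add: power_inverse)
   thus ?thesis unfolding ij by (simp only: mult_ac times_divide_eq_right times_divide_eq_left)
  qed
  from this[of "t ^ (?d - 1 - ?j)"] have e: "si r * t ^ (?d - 1 - ?j) / z = inverse t * (inverse t ^ (?j - 1) * (si r / r * ?y))" unfolding td .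
  have "?y:A" by (rule nearA[OF H, of _ 1]) (use r(2) in \<open>simp add: cst_hom\<close>)
  from sr_mult[OF primeD(1)[OF A(1)] q this]
  have "inverse t ^ (?j - 1) * (si r / r * ?y):A"
   by (rule sr_mult[OF primeD(1)[OF A(1)] sr_pow[OF primeD(1)[OF A(1)] mx_sub[OF ti[OF H]]]])
  hence "si r * t ^ (?d - 1 - ?j) / z:mx A" unfolding e by (rule mI(1)[OF H ti[OF H]])
  thus False using near_unit[OF H carlitz_leading[OF H r(2) db]] b0 b(2) by (simp add: mx_iff)
 qed
 then obtain c where c: "b = [:c:]" using degree_eq_zeroE by blast
 have "scal ?L si c" using gen b0 by (intro scalar_generator[OF sA, of a r]) (auto simp: b(2) c carlitz_const)
 thus ?thesis by blast
qed

end

text \<open>Torsion points are integral at \<open>W\<close>, and a nonzero one is not in the maximal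
  ideal because \<open>t + y^(q-1)\<close> is a unit for \<open>y\<close> in that ideal. Inertia
  changes a torsion point by a torsion point of the ideal, which is zero.\<close>

lemma unit_torsion_fixed:
 assumes B: "is_sf B" "kk <= B" and W: "prm B W" and u: "t:vunit W" and s: "si:inertia kk W"
  and x: "x:B" "x:Tor t (monom 1 n)"
 shows "si x = x"
proof -
 note R = primeD(1)[OF W] note sA = decompD(1)[OF inertD(1)[OF s]]
 have tW: "t:W" using u by (simp add: vunit_def)
 have tw: "x:W" if "tw t x:W" "x:B" for x
 proof -
  let ?f = "monom 1 CARD('a) + [:- tw t x, t:]"
  have q: "CARD('a) > 1" by (rule card_gt)
  have e1: "coeff ?f CARD('a) = 1" using q by (auto simp: coeff_pCons split: nat.split)
  hence "degree ?f = CARD('a)" using q by (intro antisym degree_add_le le_degree) (auto simp: degree_monom_eq)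
  moreover have "poly ?f x = 0" by (simp add: poly_monom tw_def)
  ultimately show ?thesis using e1 that tW sr_cl[OF R]
   by (intro int_closed[OF R primeD(4)[OF W that(2)], of ?f])
    (auto simp: pols_def coeff_pCons split: nat.split)
 qed
 have *: "(tw t ^^ n) y = 0 ==> y:B ==> y:W & (y:mx W --> y = 0)" for y
 proof (induction n arbitrary: y)
  case 0 thus ?case by (simp add: sr_0[OF R])
 next
  case (Suc n)
  have yB: "tw t y:B" using Suc.prems(2) t B sf_cl[OF B(1)] by (auto simp: tw_def)
  have IH: "tw t y:W & (tw t y:mx W --> tw t y = 0)"
   using Suc.prems(1) by (intro Suc.IH[OF _ yB]) (simp add: funpow_swap1)
  hence yW: "y:W" using tw Suc.prems(2) by blast
  have f: "tw t y = y * (t + y ^ (CARD('a) - 1))"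
   using card_gt[where 'a='a] by (cases "CARD('a)") (simp_all add: tw_def algebra_simps)
  have "y = 0" if m: "y:mx W"
  proof -
   have "y ^ (CARD('a) - 1) = y * y ^ (CARD('a) - 1 - 1)"
    using card_gt[where 'a='a] by (subst mult.commute) (intro power_minus_mult[symmetric], simp)
   hence "y ^ (CARD('a) - 1):mx W" using mx_mult[OF R m sr_pow[OF R yW]] by simp
   from vunit_nz[OF vunit_add[OF B(1) W u this]] have nz: "t + y ^ (CARD('a) - 1) ~= 0" .
   have "tw t y:mx W" unfolding f by (intro mx_mult[OF R m] sr_add[OF R tW] sr_pow[OF R yW])
   thus ?thesis using IH nz unfolding f by simp
  qed
  thus ?case using yW by blast
 qed
 have x0: "(tw t ^^ n) x = 0" using x(2) by (simp add: carlitz_torsion_def carlitz_monom[OF t l])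
 have "si x:Tor t (monom 1 n)" by (rule tors_aut[OF sA x(2)])
 hence "(tw t ^^ n) (si x - x) = 0"
  using x(2) carlitz_diff(1)[OF t l, of "monom 1 n" "si x" x] by (simp add: carlitz_torsion_def carlitz_monom[OF t l])
 moreover have "si x - x:mx W" using inertD(2)[OF s] *[OF x0 x(1)] by blast
 moreover have "si x - x:B" using calculation(2) mx_sub primeD(2)[OF W] by blast
 ultimately show ?thesis using *[of "si x - x"] by simp
qed

text \<open>If \<open>si\<close> acts as \<open>b = c + X b1\<close>, its power acts as
  \<open>b^(q^n) = c^(q^n) + X^(q^n) b1^(q^n)\<close>. Since \<open>q^n > n\<close>, the second
  summand kills the torsion of \<open>X^(n+1)\<close>.\<close>

lemma scalar_power:
 assumes s: "si:Aut kk" shows "EX c. scal (Tor t (monom 1 (Suc n))) (si ^^ (CARD('a) ^ n)) c"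
proof -
 let ?L = "Tor t (monom 1 (Suc n))" and ?Q = "CARD('a) ^ n"
 have "degree (monom 1 (Suc n) :: 'a poly) = Suc n" by (simp add: degree_monom_eq)
 then obtain A z r where r: "prm UNIV A" "z ^ (CARD('a) - 1) = - t" "r:?L" "near A (r * t ^ n / z) 1" "A Int kk = V"
  and gen: "!!x. x:?L ==> EX b. (b = 0 \<or> degree b < Suc n) & x = rh b r"
  by (rule tors_str[of "monom 1 (Suc n)" "Suc n"]) auto
 have tA: "t~:A" using r(5) t tV by blast
 have r0: "r ~= 0" using near_unit[OF t l r(1) tA r(2) order_refl, of "r * t ^ n / z" 1] r(4) vunit_nz by (fastforce simp: cst_hom)
 obtain b where b: "si r = rh b r" using gen[OF tors_aut[OF s r(3)]] by blast
 have pow: "(si ^^ i) r = rh (b ^ i) r" for i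
 proof (induction i)
  case 0 thus ?case using carlitz_const[of 1] by (simp add: cst_hom flip: one_pCons)
 next
  case (Suc i) thus ?case by (simp add: aut_carlitz[OF t l s] b carlitz_mult[OF t l, symmetric] mult.commute)
 qed
 obtain c b1 where cb: "b = pCons c b1" by (cases b)
 have "prime CHAR('a poly)" using CHAR_pr[where 'a='a] by (simp add: CHAR_kbar)
 from ring_mapD(5)[OF frobenius_ring_map'[OF this, of "l * n"]]
 have fr: "(x + y) ^ ?Q = x ^ ?Q + y ^ ?Q" for x y :: "'a poly" by (simp add: l power_mult)
 have "b = [:c:] + monom 1 1 * b1" unfolding cb by (simp add: monom_Suc)
 hence "b ^ ?Q = [:c:] ^ ?Q + monom 1 ?Q * b1 ^ ?Q" by (simp add: fr power_mult_distrib monom_power)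
 moreover have "[:c:] ^ i = [:c ^ i:]" for i by (induction i) simp_all
 moreover have "n < ?Q" using card_gt[where 'a='a] by (intro power_gt_expt) simp
 hence "monom 1 ?Q = monom 1 (?Q - Suc n) * (monom 1 (Suc n) :: 'a poly)" by (simp add: mult_monom)
 ultimately have bQ: "b ^ ?Q = [:c ^ ?Q:] + (b1 ^ ?Q * monom 1 (?Q - Suc n)) * monom 1 (Suc n)" by (simp add: mult_ac)
 have "rh (b ^ ?Q) r = cst (c ^ ?Q) * r"
  using r(3) unfolding bQ carlitz_add[OF t l] carlitz_mult[OF t l] carlitz_const by (simp add: carlitz_torsion_def csimps)
 hence e: "(si ^^ ?Q) r = cst (c ^ ?Q) * r" unfolding pow .
 have sQ: "si ^^ ?Q:Aut kk" by (rule aut_pow[OF s])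
 have "c ^ ?Q ~= 0" using e r0 aut_eq_0[OF sQ, of r] by (auto simp: cst_hom)
 thus ?thesis using scalar_generator[OF sQ _ e] gen by blast
qed

end

text \<open>If the inertia group only acted through a group of \<open>n\<^sub>0 < q - 1\<close> scalars, the \<open>n\<^sub>0\<close>-th power of a generator
 would lie in a field unramified over \<open>k\<close> at \<open>W\<close>, although its valuation is not an integer there.\<close>

lemma inertia_scalars:
 fixes B :: "'a::finite_field kbar set"
 assumes l: "CARD('a) = CHAR('a) ^ l" and B: "abel kk B" "fing kk B" and a: "a ~= 0" "Tor TT a <= B"
 obtains W where "prm B W" "W Int kk = Pinf"
  "!!c. c ~= 0 ==> EX i:inertia kk W. scal (Tor TT a) i c"
proof -
 note gB = abel_gal[OF B(1)] note BS = galD(2,3)[OF gB]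
 note Ui = unif_inf[where 'a='a]
 have V: "prm kk (Pinf :: 'a kbar set)" by (rule unif_prime[OF Ui])
 have T: "TT:(kk :: 'a kbar set)" "(TT :: 'a kbar) ~= 0" by (simp_all add: RT_k)
 have TV: "(TT :: 'a kbar)~:Pinf" using unif_mem[OF Ui] by (auto simp: max_ideal_def)
 note ctx = T l V TV
 show thesis
 proof (cases "degree a = 0")
  case True
  obtain A where A: "prm UNIV A" "A Int kk = (Pinf :: 'a kbar set)" using place_over_k[OF V] .
  have W0: "prm B (A Int B)" by (rule pr_rest[OF clb_mono[OF clb_k BS(2,1)] sf_UNIV _ A(1)]) simp
  have "(%x. x):inertia kk (A Int B)" using aut_id(2) mx_0[OF primeD(1)[OF W0]] by (auto simp: inertia_def decomp_def)
  moreover have "A Int B Int kk = Pinf" using A(2) BS(2) by blast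
  ultimately show ?thesis using that[OF W0] torsion_const[OF ctx a(1) True] by (auto simp: scal_def)
 next
  case False
  let ?L = "Tor TT a" and ?d = "degree a" and ?q = "CARD('a)"
  have d: "?d >= 1" using False by simp
  obtain A z r where A: "prm UNIV A" "A Int kk = Pinf" and z: "z ^ (?q - 1) = - TT" and r: "r:?L" "near A (r * TT ^ (?d - 1) / z) 1"
   and gen: "!!x. x:?L ==> EX b. (b = 0 \<or> degree b < ?d) & x = carlitz TT b r" by (rule tors_str[OF ctx refl d]) blast
  have TA: "TT~:A" using A(2) T TV by blast
  note H = T l A(1) TA z d
  define W where "W = A Int B"
  have W: "prm B W" unfolding W_def by (rule pr_rest[OF clb_mono[OF clb_k BS(2,1)] sf_UNIV _ A(1)]) simp
  have Wk: "W Int kk = Pinf" using A(2) BS(2) by (auto simp: W_def)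
  let ?I = "inertia kk W"
  define S where "S = {c. EX i:?I. scal ?L i c}"
  have IA: "i:Aut kk" if "i:?I" for i using decompD(1)[OF inertD(1)[OF that]] .
  have id: "(%x. x):?I" using aut_id(2) mx_0[OF primeD(1)[OF W]] by (auto simp: inertia_def decomp_def)
  have Icomp: "i \<circ> j:?I" if ij: "i:?I" "j:?I" for i j
  proof -
   have "i (j x) - x:mx W" if "x:W" for x
   proof -
    have "j x:W" using decompD(2)[OF inertD(1)[OF ij(2)]] that by blast
    from mx_add[OF BS(1) W inertD(2)[OF ij(1) this] inertD(2)[OF ij(2) that]] show ?thesis by simp
   qed
   thus ?thesis using decomp_comp[OF inertD(1)[OF ij(1)] inertD(1)[OF ij(2)]] by (simp add: inertia_def)
  qed
  have S0: "S <= UNIV - {0}" "1:S" using id by (auto simp: S_def scal_def cst_hom intro!: bexI[of _ "%x. x"])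
  have Sm: "c * c':S" if cc: "c:S" "c':S" for c c'
  proof -
   obtain i j where ij: "i:?I" "scal ?L i c" "j:?I" "scal ?L j c'" using cc unfolding S_def by blast
   have "scal ?L (i \<circ> j) (c * c')" using ij tors_aut[OF ctx IA[OF ij(3)]]
    by (auto simp: scal_def cst_hom aut_mult[OF IA[OF ij(1)]] AutD(3)[OF IA[OF ij(1)] cst_k] mult_ac)
   thus ?thesis using Icomp[OF ij(1,3)] unfolding S_def by blast
  qed
  \<comment> \<open>The scalars realised by inertia form a finite set closed under multiplication,
    so each has order dividing its cardinality; equality of this number with \<open>q - 1\<close> is
    the goal.\<close>
  let ?n = "card S"
  have n0: "?n > 0" using S0(2) by (auto simp: card_gt_0_iff)
  have cn: "c ^ ?n = 1" if c: "c:S" for c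
  proof -
   have inj: "inj_on ((*) c) S" using c S0(1) by (auto simp: inj_on_def)
   have "(*) c ` S = S" by (intro endo_inj_surj inj) (use Sm[OF c] in auto)
   hence "\<Prod>S = (PROD x:S. c * x)" using prod.reindex[OF inj, of "%x. x"] by simp
   also have "... = c ^ ?n * \<Prod>S" by (simp add: prod.distrib)
   finally show ?thesis using S0(1) by (auto simp: prod_zero_iff)
  qed
  \<comment> \<open>The factor \<open>T^(d-1)\<close> brings \<open>r\<close> to the size of
    \<open>z\<close>, and the power \<open>?n\<close> kills all scalars from inertia, so \<omega>
    lies in the fixed field.\<close>
  define \<omega> where "\<omega> = (r * TT ^ (?d - 1)) ^ ?n"
  define E where "E = fixf B ?I"
  have IAs: "?I <= Aut kk" using IA by blast
  have "i x = x" if "i:?I" "x:kk" for i x using AutD(3)[OF IA[OF that(1)] that(2)] .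
  hence E: "is_sf E" "kk <= E" "E <= B" unfolding E_def
   using fixf_subfield[OF BS(1) IAs] BS(2) by (auto simp: fixf_def)
  have r0: "r ~= 0" using near_unit[OF H, of "r * TT ^ (?d - 1) / z" 1] r(2) vunit_nz by (fastforce simp: cst_hom)
  have "i \<omega> = \<omega>" if i: "i:?I" for i
  proof -
   have "i:dec kk W" using i dec_sub(1) by blast
   then obtain c where c: "scal ?L i c" using dec_scalar[OF ctx B a(2,1) W Wk] by blast
   hence "c ^ ?n = 1" using i by (intro cn) (auto simp: S_def)
   hence "cst c ^ ?n = 1" by (simp only: cst_power[symmetric] cst_hom)
   thus ?thesis using c r(1) unfolding \<omega>_def aut_power[OF IA[OF i]] aut_mult[OF IA[OF i]] AutD(3)[OF IA[OF i] T(1)]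
    by (simp add: scal_def power_mult_distrib)
  qed
  moreover have "\<omega>:B" using a(2) r(1) T(1) BS unfolding \<omega>_def by (blast intro: sf_cl(5,7)[OF BS(1)])
  ultimately have wE: "\<omega>:E" by (simp add: E_def fixf_def)
  have w0: "\<omega> ~= 0" using r0 by (simp add: \<omega>_def)
  have TE: "TT:E" using T(1) E(2) by blast
  note gE = abel_gal[OF abel_mid(2)[OF clb_k B(1) E]]
  note fE = fin_gen_mid[OF clb_k B(2) gB E]
  have WE: "prm E (W Int E)" by (rule pr_rest[OF clb_mono[OF clb_k E(2,1)] BS(1) E(3) W])
  obtain po where po: "po:kk" "unif E (W Int E) po"
   using unif_inert[OF clb_k fE gE dvr_k[OF fE gE WE] inertia_fixf[OF B W E_def]] .
  note U = po(2)
  have Ek: "W Int E Int kk = Pinf" using Wk E(2) by blast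
  have Uk: "unif kk Pinf po" using unif_sub[OF U k_sf E(2) po(1)] unfolding Ek .
  have "vl (W Int E) (1 / TT) = 1"
  proof -
   have i: "1 / TT:(kk :: 'a kbar set)" "(1 / TT :: 'a kbar) ~= 0" using sf_cl[OF k_sf] T by auto
   obtain w :: "'a kbar" where w: "w:vunit Pinf" "1 / TT = w * po powi vl Pinf (1 / TT :: 'a kbar)" using val_expand[OF Uk i] .
   have "w:vunit (W Int E)" using w(1) mx_Int(2)[OF k_sf, of "W Int E"] unfolding Ek by blast
   from val_eqI[OF U this, of 1] show ?thesis unfolding w(2)[unfolded val_unif[OF Ui]] .
  qed
  hence vT: "vl (W Int E) TT = -1" using val_inverse[OF U TE T(2)] by (simp add: divide_inverse)
  \<comment> \<open>Because \<open>z^(q-1) = -T\<close>, this quotient is a unit. In the unramified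
    field \<open>E\<close> the value of \<open>T\<close> is \<open>-1\<close>, so
    \<open>(q - 1) * v(\<omega>) = - ?n\<close> with an integer \<open>v(\<omega>)\<close>.\<close>
  define y where "y = \<omega> ^ (?q - 1) / TT ^ ?n"
  have yE: "y:E" unfolding y_def using sf_cl(7)[OF E(1)] wE TE by (intro sf_div[OF E(1)])
  have "y = (- ((r * TT ^ (?d - 1) / z) ^ (?q - 1))) ^ ?n"
  proof -
   have z0: "z ~= 0" by (rule s0[OF H])
   have rz: "r * TT ^ (?d - 1) = z * (r * TT ^ (?d - 1) / z)" using z0 by simp
   have "((z * v) ^ ?n) ^ (?q - 1) = (z ^ (?q - 1) * v ^ (?q - 1)) ^ ?n" for v
    by (simp only: power_mult[symmetric] power_mult_distrib mult.commute[of ?n])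
   hence "\<omega> ^ (?q - 1) = (z ^ (?q - 1) * (r * TT ^ (?d - 1) / z) ^ (?q - 1)) ^ ?n"
    unfolding \<omega>_def by (subst rz)
   also have "... = TT ^ ?n * (- ((r * TT ^ (?d - 1) / z) ^ (?q - 1))) ^ ?n" unfolding z by (simp flip: power_mult_distrib)
   finally show ?thesis unfolding y_def using T(2) by simp
  qed
  moreover have "(r * TT ^ (?d - 1) / z) ^ (?q - 1):vunit A"
   by (rule near_unit[OF H, of _ 1]) (use near_power[OF H r(2)] in \<open>simp_all add: cst_hom\<close>)
  ultimately have "y:vunit A" using vunit_power[OF primeD(1)[OF A(1)]] vunit_uminus[OF primeD(1)[OF A(1)]] by simp
  moreover have "W Int E = A Int E" using E(3) by (auto simp: W_def)
  ultimately have "y:vunit (W Int E)" using mx_Int(2)[OF E(1), of A] yE by simp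
  hence vy: "vl (W Int E) y = 0" using val_vunit_iff[OF U yE] vunit_nz by blast
  have "int (?q - 1) * vl (W Int E) \<omega> = - int ?n"
   using vy val_divide[OF U, of "\<omega> ^ (?q - 1)" "TT ^ ?n"] val_power[OF U wE w0] val_power[OF U TE T(2)] wE TE w0 T(2) sf_cl(7)[OF E(1)]
   by (simp add: y_def vT)
  hence "int (?q - 1) dvd - int ?n" by (metis dvd_triv_left)
  hence "?q - 1 dvd ?n" by (simp only: dvd_minus_iff of_nat_dvd_iff)
  hence "?q - 1 <= ?n" using n0 by (rule dvd_imp_le)
  moreover have "card (UNIV - {0 :: 'a}) = ?q - 1" by simp
  ultimately have "S = UNIV - {0}" using card_seteq[OF _ S0(1)] by simp
  thus ?thesis using that[OF W Wk] by (auto simp: S_def)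
 qed
qed

lemma fixed_subfield: "si:Aut k ==> is_sf {x. si x = x}"
 using eq_sf[OF _ aut_id(2)] .

lemma fixed_adjoin: "si:Aut k ==> (!!s. s:S ==> si s = s) ==> x:adj k S ==> si x = x"
 using agree_adj[OF _ aut_id(2)] .

lemma funpow_fixed: "f x = x ==> (f ^^ n) x = x" by (induction n) simp_all

lemma abel_Union:
 fixes k :: "'b::alg_closed_field set"
 assumes "clb k" "!!S. S:\<S> ==> abel k (adj k S)" shows "abel k (adj k (\<Union>\<S>))"
proof -
 have "adj k (\<Union>\<S>) = adj k (\<Union>(adj k ` \<S>))"
 proof (rule antisym)
  show "adj k (\<Union>\<S>) <= adj k (\<Union>(adj k ` \<S>))" using adj_gen by (intro adj_mono order_refl) blast
  show "adj k (\<Union>(adj k ` \<S>)) <= adj k (\<Union>\<S>)"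
   by (intro adj_least[OF adj_sf adj_base] UN_least adj_mono Union_upper order_refl)
 qed
 thus ?thesis using abel_composite[OF assms(1), of "adj k ` \<S>"] assms(2) by auto
qed

section \<open>The fields L_n and the constant extensions\<close>

context
 fixes l :: nat assumes l: "CARD('a::finite_field) = CHAR('a) ^ l"
begin

lemma pole_inverse_T:
 "1 / TT:(kk :: 'a kbar set)" "(1 / TT :: 'a kbar) ~= 0"
 "prm kk (Pfin [:0, 1 :: 'a:])" "(1 / TT :: 'a kbar)~:Pfin [:0, 1:]"
proof -
 have "irreducible [:0, 1 :: 'a:]" by (rule irreducible_linear_field_poly) simp
 note U = unif_fin[OF this]
 show "prm kk (Pfin [:0, 1 :: 'a:])" by (rule unif_prime[OF U])
 show "(1 / TT :: 'a kbar)~:Pfin [:0, 1:]" using unif_mem[OF U] by (auto simp: max_ideal_def divide_inverse)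
 show "1 / TT:(kk :: 'a kbar set)" "(1 / TT :: 'a kbar) ~= 0"
  by (auto intro: sf_div[OF k_sf sf_cl(1)[OF k_sf] RT_k])
qed
lemmas pole_T' = pole_inverse_T(1,2) l pole_inverse_T(3,4)

lemma pole_T:
 "TT:(kk :: 'a kbar set)" "(TT :: 'a kbar) ~= 0" "CARD('a) = CHAR('a) ^ l"
 "prm kk (Pinf :: 'a kbar set)" "(TT :: 'a kbar)~:Pinf"
 using unif_mem[OF unif_inf[where 'a='a]] unif_prime[OF unif_inf[where 'a='a]] l
 by (auto simp: max_ideal_def RT_k divide_inverse)

abbreviation (input) "tors n \<equiv> Tor (1 / TT :: 'a kbar) (monom 1 (Suc n))"

lemma tors_abel: "abel kk (cyclotomic (1 / TT :: 'a kbar) (monom 1 (Suc n)))" "fing kk (cyclotomic (1 / TT :: 'a kbar) (monom 1 (Suc n)))"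
 using cyc_abel[OF pole_T', of "monom 1 (Suc n)"] by simp_all

text \<open>Restates the field with automorphisms of the closure, the form in which inertia elements
  and their powers are available.\<close>

lemma L_field_eq:
 "L_field n = fixf (cyclotomic (1 / TT) (monom 1 (Suc n))) {si:Aut kk. EX c. scal (tors n) si c}"
proof -
 let ?C = "cyclotomic (1 / TT) (monom 1 (Suc n)) :: 'a kbar set"
 note g = abel_gal[OF tors_abel(1)[of n]] note CS = galD(2,3)[OF g]
 have LC: "tors n <= ?C" unfolding cyclotomic_def by (rule adj_gen)
 have "(ALL si:carrier (Gal kk ?C). (EX c. c ~= 0 & (ALL x:tors n. si x = cst c * x)) --> si x = x)
  <-> (ALL si:Aut kk. (EX c. scal (tors n) si c) --> si x = x)" if x: "x:?C" for x
 proof (intro iffI ballI impI)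
  fix si :: "'a kbar => 'a kbar"
  assume h: "ALL si:carrier (Gal kk ?C). (EX c. c ~= 0 & (ALL x:tors n. si x = cst c * x)) --> si x = x"
   and s: "si:Aut kk" "EX c. scal (tors n) si c"
  have "restrict si ?C:carrier (Gal kk ?C)"
   using sf_cl(1,4,5)[OF CS(1)] by (intro Aut_restrict_Gal s(1) gal_image[OF g s(1)] CS(2)) blast+
  moreover have "EX c. c ~= 0 & (ALL x:tors n. restrict si ?C x = cst c * x)" using s(2) LC unfolding scal_def by auto
  ultimately have "restrict si ?C x = x" using h by blast
  thus "si x = x" using x by simp
 next
  fix si :: "'a kbar => 'a kbar"
  assume h: "ALL si:Aut kk. (EX c. scal (tors n) si c) --> si x = x"
   and s: "si:carrier (Gal kk ?C)" "EX c. c ~= 0 & (ALL x:tors n. si x = cst c * x)"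
  obtain ta where "ta:Aut kk" "!!x. x:?C ==> ta x = si x" using carrier_Gal_extend[OF clb_k CS s(1)] by metis
  note t = this
  obtain c where c: "c ~= 0" "ALL x:tors n. si x = cst c * x" using s(2) by blast
  have "scal (tors n) ta c" unfolding scal_def
   by (intro conjI ballI c(1)) (simp only: t(2)[OF subsetD[OF LC]] c(2)[rule_format])
  hence "EX c. scal (tors n) ta c" by blast
  hence "ta x = x" using h t(1) by blast
  thus "si x = x" using t(2)[OF x] by simp
 qed
 thus ?thesis unfolding L_field_def Let_def fixf_def cst_def[symmetric] by (intro Collect_cong conj_cong refl) blast
qed

lemma L_field:
 "is_sf (L_field n :: 'a kbar set)" "kk <= (L_field n :: 'a kbar set)" "L_field n <= cyclotomic (1 / TT :: 'a kbar) (monom 1 (Suc n))"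
 "abel kk (L_field n :: 'a kbar set)"
proof -
 note CS = galD(2,3)[OF abel_gal[OF tors_abel(1)[of n]]]
 show L: "is_sf (L_field n :: 'a kbar set)" "kk <= (L_field n :: 'a kbar set)" "L_field n <= cyclotomic (1 / TT :: 'a kbar) (monom 1 (Suc n))"
  unfolding L_field_eq using fixf_subfield[OF CS(1), of "{si:Aut kk. EX c. scal (tors n) si c}" kk] CS(2)
  by (auto simp: fixf_def AutD(3))
 show "abel kk (L_field n :: 'a kbar set)" by (rule abel_mid(2)[OF clb_k tors_abel(1) L])
qed

lemma L_field_power: "si:Aut kk ==> x:L_field n ==> (si ^^ (CARD('a) ^ n)) x = (x :: 'a kbar)"
 using scalar_power[OF pole_T', of si n] aut_pow[of si kk] unfolding L_field_eq fixf_def by blast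

lemma T_in_finite: "prm kk V ==> V ~= Pinf ==> (TT :: 'a kbar):V"
 using prime_infinite by blast

text \<open>At the prime \<open>T\<close> the parameter \<open>1/T\<close> has a pole, and inertia
  acts on its torsion by scalars, which fix \<open>L_n\<close> by construction. At the other finite
  primes \<open>1/T\<close> is a unit and inertia fixes the torsion itself.\<close>

lemma L_field_inertia:
 fixes B :: "'a kbar set"
 assumes B: "abel kk B" "fing kk B" "tors n <= B" and W: "prm B W" "W Int kk ~= Pinf"
  and s: "si:inertia kk W" and x: "x:L_field n"
 shows "si x = x"
proof -
 note BS = galD(2,3)[OF abel_gal[OF B(1)]]
 have V: "prm kk (W Int kk)" by (rule pr_rest[OF clb_k BS W(1)])
 have T: "TT:W" using T_in_finite[OF V W(2)] by blast
 have "EX c. scal (tors n) si c"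
 proof (cases "TT:vunit W")
  case True
  hence "1 / TT:vunit W" using vunit_inv[OF primeD(1)[OF W(1)]] by (simp add: divide_inverse)
  hence "scal (tors n) si 1" using unit_torsion_fixed[OF pole_T' BS W(1) _ s] B(3) by (auto simp: scal_def cst_hom)
  thus ?thesis by blast
 next
  case False
  hence "TT:mx (W Int kk)" using T pole_T(1) by (simp add: mx_iff mx_Int[OF k_sf])
  moreover have "irreducible [:0, 1 :: 'a:]" by (rule irreducible_linear_field_poly) simp
  ultimately have "W Int kk = Pfin [:0, 1:]" using prime_finite[OF V] T pole_T(1) by blast
  thus ?thesis by (intro dec_scalar[OF pole_T' B _ W(1) _ subsetD[OF dec_sub(1) s]]) simp_all
 qed
 thus ?thesis using x decompD(1)[OF inertD(1)[OF s]] unfolding L_field_eq fixf_def by blast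
qed

text \<open>The product of the factors \<open>X - x^(q^j)\<close> is invariant under the
  \<open>q\<close>-th power map on coefficients, so it is a polynomial over the constants of
  \<open>k\<close> and every conjugate of \<open>x\<close> is one of its roots.\<close>

lemma GF_conjugate:
 fixes x :: "'a kbar"
 assumes m: "m >= 1" and x: "x:GF (CARD('a) ^ m)" and s: "si:Aut kk"
 obtains j where "si x = x ^ (CARD('a) ^ j)"
proof -
 let ?q = "CARD('a)"
 define f where "f = (PROD j<m. [:- (x ^ (?q ^ j)), 1:])"
 have fe: "poly f y = (PROD j<m. y - x ^ (?q ^ j))" for y unfolding f_def poly_prod by (rule prod.cong) simp_all
 note qm = ring_mapD[OF frobenius_ring_map[where 'a='a and n = l, folded l]]
 \<comment> \<open>Raising to the power \<open>q\<close> permutes the roots cyclically. Comparison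
   with the polynomial of raised coefficients, at all \<open>q\<close>-th powers and thus at all
   points, shows that the coefficients are unchanged.\<close>
 have "poly f y ^ ?q = poly f (y ^ ?q)" for y
 proof -
  have "poly f y ^ ?q = (PROD j<m. y ^ ?q - x ^ (?q ^ Suc j))"
   unfolding fe prod_power_distrib qm(2) by (simp add: mult.commute flip: power_mult)
  also have "... = (PROD j<m. y ^ ?q - x ^ (?q ^ j))"
  proof -
   obtain m' where m': "m = Suc m'" using m by (cases m) auto
   have "(PROD j<m. y ^ ?q - x ^ (?q ^ Suc j)) = (PROD j<m'. y ^ ?q - x ^ (?q ^ Suc j)) * (y ^ ?q - x ^ (?q ^ 0))"
    using x unfolding m' GF_def by simp
   also have "... = (PROD j<m. y ^ ?q - x ^ (?q ^ j))" unfolding m' prod.lessThan_Suc_shift by (simp add: mult.commute)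
   finally show ?thesis .
  qed
  finally show ?thesis by (simp add: fe)
 qed
 moreover have "poly f y ^ ?q = poly (map_poly (%c. c ^ ?q) f) (y ^ ?q)" for y
  using card_gt[where 'a='a] degree_map_poly[of "%c. c ^ ?q" f]
  by (simp add: poly_altdef qm coeff_map_poly power_mult_distrib mult.commute flip: power_mult)
 ultimately have e: "poly (map_poly (%c. c ^ ?q) f - f) (y ^ ?q) = 0" for y by simp
 have "poly (map_poly (%c. c ^ ?q) f - f) z = 0" for z
 proof -
  have "0 < ?q" using card_gt[where 'a='a] by simp
  then obtain y where "y ^ ?q = z" using nth_root_exists[of ?q z] by blast
  thus ?thesis using e[of y] by simp
 qed
 moreover have "infinite (UNIV :: 'a kbar set)" by (rule infinite_super[OF subset_UNIV infinite_k])
 ultimately have "map_poly (%c. c ^ ?q) f - f = 0" using poly_roots_finite[of "map_poly (%c. c ^ ?q) f - f"] by auto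
 hence "coeff f i ^ ?q = coeff f i" for i
  using coeff_map_poly[of "%c. c ^ ?q" f i] card_gt[where 'a='a] by (simp add: power_0_left)
 hence "coeff f i:GF ?q" for i by (simp add: GF_def)
 hence "coeff f i:kk" for i unfolding GF_card by (metis cst_k rangeE)
 hence "f:pols kk" by (simp add: pols_def)
 moreover have "poly f x = 0" using m by (auto simp: fe prod_zero_iff intro: bexI[of _ 0])
 ultimately have "poly f (si x) = 0" using aut_poly[OF s, of f x] aut_zero[OF s] by simp
 thus thesis using that by (auto simp: fe prod_zero_iff)
qed

text \<open>For the last claim: \<open>si x - x\<close> is again fixed by the \<open>q^m\<close>-th
  power map. A constant in the maximal ideal is zero.\<close>

lemma k_const:
 assumes m: "m >= 1"
 shows "abel kk (k_const m :: 'a kbar set)" "finite (GF (CARD('a) ^ m) :: 'a kbar set)"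
  "is_sf B ==> prm B W ==> si:inertia kk W ==> x:B ==> x:GF (CARD('a) ^ m) ==> si x = (x :: 'a kbar)"
proof -
 let ?Q = "CARD('a) ^ m" and ?f = "monom 1 (CARD('a) ^ m) - monom 1 1 :: 'a kbar poly"
 have l0: "l > 0" using card_gt[where 'a='a] l by (cases l) auto
 have Q: "?Q > 1" using card_gt[where 'a='a] m by (intro one_less_power) simp_all
 have stab: "si x:GF ?Q" if "si:Aut kk" "x:GF ?Q" for si and x :: "'a kbar"
  using that aut_power[OF that(1), of x ?Q] by (simp add: GF_def)
 have Q0: "(of_nat ?Q :: 'a kbar) = 0" using of_nat_CHAR[where 'a = "'a kbar"] l0 m by (simp add: l CHAR_kbar)
 have pd: "poly (pderiv ?f) x ~= 0" for x unfolding pderiv_diff pderiv_monom Q0 by simp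
 have G: "GF ?Q = {x. poly ?f x = 0}" by (auto simp: GF_def poly_monom)
 have "?f ~= 0" using pd by auto
 thus "finite (GF ?Q :: 'a kbar set)" unfolding G by (rule poly_roots_finite)
 have "sep kk x" if "x:GF ?Q" for x :: "'a kbar" unfolding sep_def
  using that pd sf_cl[OF k_sf] unfolding G by (intro bexI[of _ ?f]) (auto simp: pols_def)
 thus "abel kk (k_const m :: 'a kbar set)" unfolding k_const_def
 proof (intro abel_adjoinI[OF gal_adjoinI[OF clb_k gfix_adj[OF clb_k]]])
  show "si x:adj kk (GF ?Q)" if "si:Aut kk" "x:GF ?Q" for si and x :: "'a kbar" using stab[OF that] adj_gen by blast
  fix si ta :: "'a kbar => 'a kbar" and x :: "'a kbar" assume s: "si:Aut kk" "ta:Aut kk" and x: "x:GF ?Q"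
  obtain i where i: "si x = x ^ (CARD('a) ^ i)" using GF_conjugate[OF m x s(1)] .
  obtain j where j: "ta x = x ^ (CARD('a) ^ j)" using GF_conjugate[OF m x s(2)] .
  show "si (ta x) = ta (si x)" unfolding i j aut_power[OF s(1)] aut_power[OF s(2)]
   by (simp add: i j mult.commute flip: power_mult)
 qed simp_all
 show "si x = x" if B: "is_sf B" and W: "prm B W" and s: "si:inertia kk W" and x: "x:B" "x:GF ?Q"
 proof -
  note sA = decompD(1)[OF inertD(1)[OF s]]
  obtain i where i: "si x = x ^ (CARD('a) ^ i)" using GF_conjugate[OF m x(2) sA] .
  have "x:W" using const_prime[OF W x(1) _ Q] x(2) by (simp add: GF_def)
  hence m': "si x - x:mx W" by (rule inertD(2)[OF s])
  have l': "CARD('a) ^ m = CHAR('a) ^ (l * m)" by (simp add: l power_mult)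
  have "(si x - x) ^ ?Q = si x - x"
   using stab[OF sA x(2)] x(2) unfolding l' ring_mapD(2)[OF frobenius_ring_map] by (simp add: GF_def)
  moreover have "si x - x:B" using m' mx_sub primeD(2)[OF W] by blast
  ultimately show ?thesis using const_max_ideal[OF W _ _ Q m' B] by simp
 qed
qed

end

lemma finite_prime_inj:
 assumes "monic_irred P" "monic_irred Q" "Pfin P = (Pfin Q :: 'a::finite_field kbar set)" shows "P = Q"
proof -
 have P: "irreducible P" "irreducible Q" "lead_coeff P = 1" "lead_coeff Q = 1" using assms by (auto simp: monic_irred_def)
 have "RT P:mx (Pfin Q)" using unif_mem[OF unif_fin[OF P(1)]] assms(3) by simp
 moreover have "P ~= 0" using P(3) by auto
 ultimately have "inverse (RT P)~:(Pfin Q :: 'a kbar set)" by (auto simp: max_ideal_def)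
 moreover have "inverse (RT P) = (RT 1 / RT P :: 'a kbar)" by (simp add: of_RT_1 inverse_eq_divide)
 ultimately have "Q dvd P" unfolding finite_prime_def by blast
 then obtain c where c: "P = Q * c" by auto
 hence "c dvd 1" using Factorial_Ring.irreducibleD[OF P(1) c] P(2) by (auto simp: Factorial_Ring.irreducible_def)
 then obtain d where "c = [:d:]" by (auto simp: is_unit_poly_iff)
 moreover have "lead_coeff c = 1" using P(3,4) c by (simp add: lead_coeff_mult)
 ultimately show ?thesis using c by simp
qed

section \<open>Sums of Artin-Schreier-Witt generators\<close>

context
 fixes u p e v :: nat
 assumes p: "p = CHAR('a::finite_field)" and e: "e = p ^ u" and u: "u >= 1" "(GF e :: 'a kbar set) <= GF CARD('a)"
begin

lemmas prp = pr[OF p e u]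
lemmas wl = length_witt[OF prp]

lemma length_witt_sum: "(!!w. w:set ws ==> length w = v) ==> length (witt_sum p v (ws :: 'a kbar list list)) = v"
 by (induction ws) (simp_all add: witt_sum_def wl)

lemma asw_sum:
 fixes d y :: "nat => 'a kbar list"
 assumes "!!i. i:set is ==> asw p e (d i) (y i) & length (y i) = v"
 shows "asw p e (witt_sum p v (map d is)) (witt_sum p v (map y is))"
 using assms
proof (induction "is")
 case Nil
 have "witt_power (replicate v 0) e = replicate v (0 :: 'a kbar)" using ee[OF p e u] by (simp add: witt_power_def map_replicate)
 thus ?case using witt_add_0[OF prp, of "replicate v (0 :: 'a kbar)" "replicate v 0"] sf_cl(2)[OF k_sf]
  by (auto simp: asw_def witt_sum_def)
next
 case (Cons i "is")
 have "length (witt_sum p v (map y is)) = v" using Cons.prems by (intro length_witt_sum) auto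
 thus ?case using asw_add[OF p e u, of "d i" "y i" "witt_sum p v (map d is)" "witt_sum p v (map y is)"] Cons
  by (simp add: witt_sum_def)
qed

lemma witt_sum_closed:
 assumes R: "is_sr R" and "!!i. i:set is ==> length (y i :: 'a kbar list) = v & set (y i) <= R"
 shows "set (witt_sum p v (map y is)) <= R"
 using assms(2)
proof (induction "is")
 case (Cons i "is")
 have "length (witt_sum p v (map y is)) = v" using Cons.prems by (intro length_witt_sum) auto
 thus ?case using Cons witt_closed(1)[OF prp R, of "witt_sum p v (map y is)" "y i"] by (simp add: witt_sum_def)
qed (use sr_0[OF R] in \<open>auto simp: witt_sum_def\<close>)

lemma witt_summand:
 assumes R: "is_sr R" and l: "length b = length (a :: 'a kbar list)" and ab: "set (wadd p a b) <= R"
 shows "set b <= R ==> set a <= R" "set a <= R ==> set b <= R"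
proof -
 show "set a <= R" if "set b <= R" using witt_closed(2)[OF prp R _ ab that] witt_add_diff[OF prp l] l by (simp add: wl)
 show "set b <= R" if "set a <= R"
  using witt_closed(2)[OF prp R, of a "wadd p b a"] witt_add_diff[OF prp l[symmetric]] witt_add_commute[OF prp l] that l ab by (simp add: wl)
qed

lemma witt_sum_summand:
 fixes y :: "nat => 'a kbar list"
 assumes R: "is_sr R" and "distinct is" "i:set is" "!!j. j:set is ==> length (y j) = v" "set (witt_sum p v (map y is)) <= R"
  "!!j. j:set is ==> j ~= i ==> set (y j) <= R"
 shows "set (y i) <= R"
 using assms(2-)
proof (induction "is")
 case (Cons j "is")
 have l: "length (witt_sum p v (map y is)) = length (y j)" using Cons.prems length_witt_sum[of "map y is"] by auto
 have s: "set (wadd p (y j) (witt_sum p v (map y is))) <= R" using Cons.prems by (simp add: witt_sum_def)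
 show ?case
 proof (cases "i = j")
  case True
  hence "set (witt_sum p v (map y is)) <= R" using Cons.prems by (intro witt_sum_closed[OF R]) auto
  thus ?thesis using witt_summand(1)[OF R l s] True by simp
 next
  case False
  hence "set (witt_sum p v (map y is)) <= R" using Cons.prems by (intro witt_summand(2)[OF R l s]) auto
  thus ?thesis using Cons False by auto
 qed
qed simp

end

theorem theorem5p1:
  fixes p l q u v r n m :: nat
    and \<alpha> :: "nat \<Rightarrow> nat"
    and P :: "nat \<Rightarrow> 'a :: finite_field poly"
    and N :: "'a poly"
    and K M E :: "'a kbar set"
    and y\<^sub>0 \<xi>\<^sub>0 \<gamma> z y :: "'a kbar list"
    and \<delta> ys :: "nat \<Rightarrow> 'a kbar list"
    and e :: "nat \<Rightarrow> nat \<Rightarrow> nat"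
    and Q :: "nat \<Rightarrow> nat \<Rightarrow> 'a poly"
    and f :: "nat \<Rightarrow> 'a poly"
  assumes p: "p = CHAR('a)" and q: "q = CARD('a)" "q = p ^ l"
    and u: "u \<ge> 1" "(GF (p ^ u) :: 'a kbar set) \<subseteq> GF q"
    and K: "finite_ext k_field K" "abelian_ext k_field K"
      "Gal k_field K \<cong> product_group {1..u} (\<lambda>i. integer_mod_group (p ^ \<alpha> i))"
    and \<alpha>: "1 \<le> \<alpha> 1" "mono_on {1..u} \<alpha>" "\<alpha> u = v"
    and P: "inj_on P {1..r}"
      "P ` {1..r} = {R. monic_irred R \<and> \<not> unramified_at k_field (finite_prime R) K}"
    and y\<^sub>0: "y\<^sub>0 \<in> witt_vectors v UNIV" "K = adjoin k_field (set y\<^sub>0)"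
      "witt_diff p (witt_power y\<^sub>0 (p ^ u)) y\<^sub>0 = \<xi>\<^sub>0"
    and \<xi>\<^sub>0: "\<xi>\<^sub>0 \<in> witt_vectors v k_field"
      "\<xi>\<^sub>0 = witt_add p (witt_sum p v (map \<delta> [1..<Suc r])) \<gamma>"
    and \<delta>: "\<And>i. i \<in> {1..r} \<Longrightarrow> length (\<delta> i) = v"
      "\<And>i j. i \<in> {1..r} \<Longrightarrow> j \<in> {1..v} \<Longrightarrow>
         \<delta> i ! (j - 1) = of_RT (Q i j) / of_RT (P i ^ e i j) \<and>
         (Q i j = 0 \<or> degree (Q i j) < degree (P i ^ e i j)) \<and>
         (e i j > 0 \<longrightarrow> coprime (Q i j) (P i) \<and>
            (\<exists>lam mu. e i j = lam * p ^ mu \<and> coprime lam p \<and> mu < u))"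
    and \<gamma>: "length \<gamma> = v"
      "\<And>j. j \<in> {1..v} \<Longrightarrow> \<gamma> ! (j - 1) = of_RT (f j) \<and>
         (f j \<notin> range (\<lambda>c. [:c:]) \<longrightarrow>
            (\<exists>\<nu>\<^sub>j m\<^sub>j. degree (f j) = \<nu>\<^sub>j * p ^ m\<^sub>j \<and> coprime q \<nu>\<^sub>j \<and> m\<^sub>j < u))"
    and ys: "\<And>i. i \<in> {1..r} \<Longrightarrow> ys i \<in> witt_vectors v UNIV \<and>
         witt_diff p (witt_power (ys i) (p ^ u)) (ys i) = \<delta> i"
    and z: "z \<in> witt_vectors v UNIV" "witt_diff p (witt_power z (p ^ u)) z = \<gamma>"
    and y: "y = witt_sum p v (map ys [1..<Suc r])"
    and nNm: "m \<ge> 1" "N \<noteq> 0" "K \<subseteq> nkm_field n N m"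
    and M: "M = adjoin k_field (L_field n \<union> k_const m)"
    and E: "E = adjoin k_field (K \<union> M) \<inter> cyclotomic T_elem N"
  shows "E = adjoin k_field (set y) \<and>
         genus_field E = adjoin k_field (\<Union>i\<in>{1..r}. set (ys i)) \<and>
         genus_field K = adjoin k_field ((\<Union>i\<in>{1..r}. set (ys i)) \<union> set z)"
proof -
 define ee where "ee = p ^ u"
 have CT: "CARD('a) = CHAR('a) ^ l" using p q by simp
 have gf: "(GF ee :: 'a kbar set) <= GF CARD('a)" using u(2) q(1) by (simp add: ee_def)
 note H = p ee_def u(1) gf
 note pp = pr[OF H] and wl = length_witt[OF pr[OF H]] and kS = k_sf[where 'a='a] and kR = sf_sr[OF k_sf[where 'a='a]]
 define I where "I = {1..r}"
 define Is where "Is = [1..<Suc r]"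
 have fI: "finite I" by (simp add: I_def)
 have iss: "set Is = I" "distinct Is" by (auto simp: I_def Is_def)
 note \<delta> = \<delta>[folded I_def] and P = P[folded I_def] and ys = ys[folded I_def] and y = y[folded Is_def] and \<xi>\<^sub>0 = \<xi>\<^sub>0[folded Is_def]
 have asw1: "asw p ee d x" if "length d = v" "length x = v" "witt_diff p (witt_power x ee) x = d" "set d <= kk" for d x :: "'a kbar list"
  using that witt_diff_eq_iff[OF pp, of x "witt_power x ee" d] by (simp add: asw_def witt_power_def)
 have \<delta>e: "EX j. d = RT (Q i j) / RT (P i ^ e i j) & (Q i j = 0 \<or> degree (Q i j) < degree (P i ^ e i j))"
  if i: "i:I" "d:set (\<delta> i)" for i d
 proof -
  obtain j where j: "j < v" "d = \<delta> i ! j" using i \<delta>(1) by (auto simp: in_set_conv_nth)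
  thus ?thesis using \<delta>(2)[OF i(1), of "Suc j"] by auto
 qed
 have \<gamma>e: "EX g. d = RT g" if d: "d:set \<gamma>" for d
 proof -
  obtain j where j: "j < v" "d = \<gamma> ! j" using d \<gamma>(1) by (auto simp: in_set_conv_nth)
  thus ?thesis using \<gamma>(2)[of "Suc j"] by auto
 qed
 have yl: "length (ys i) = v" if "i:I" for i using ys[OF that] by (simp add: witt_vectors_def)
 have zl: "length z = v" and y0l: "length y\<^sub>0 = v" using z y\<^sub>0 by (simp_all add: witt_vectors_def)
 have ay: "asw p ee (\<delta> i) (ys i)" if i: "i:I" for i
 proof (rule asw1)
  show "set (\<delta> i) <= kk"
  proof
   fix d assume "d:set (\<delta> i)"
   thus "d:kk" using \<delta>e[OF i] sf_div[OF kS RT_k RT_k] by blast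
  qed
 qed (use \<delta>(1)[OF i] yl[OF i] ys[OF i] in \<open>simp_all add: ee_def\<close>)
 have az: "asw p ee \<gamma> z" using \<gamma>e RT_k \<gamma>(1) zl z(2) by (intro asw1) (auto simp: ee_def)
 have yl': "length y = v" unfolding y using yl by (intro length_witt_sum[OF H]) (auto simp: iss(1))
 have ayy: "asw p ee (witt_sum p v (map \<delta> Is)) y" unfolding y using ay yl by (intro asw_sum[OF H]) (simp add: iss(1))
 have "asw p ee \<xi>\<^sub>0 (wadd p y z)" unfolding \<xi>\<^sub>0(2) using zl yl' by (intro asw_add[OF H ayy az]) simp
 moreover have a0: "asw p ee \<xi>\<^sub>0 y\<^sub>0" using \<xi>\<^sub>0(1) y0l y\<^sub>0(3) by (intro asw1) (auto simp: witt_vectors_def ee_def)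
 \<comment> \<open>\<open>y\<^sub>0\<close> and the Witt sum of \<open>y\<close> and
   \<open>z\<close> solve the same equation, so they differ by a vector over \<open>GF ee\<close>,
   whose entries lie in \<open>k\<close>.\<close>
 ultimately obtain w where w: "length w = v" "set w <= GF ee" "y\<^sub>0 = wadd p w (wadd p y z)"
  using asw_diff[OF H, of \<xi>\<^sub>0 "wadd p y z" y\<^sub>0] yl' by (metis wl(1))
 have wk: "set w <= kk" using w(2) gf_k[OF H] by blast
 have lw: "length (wadd p y z) = length w" "length z = length y" using w(1) yl' zl by (simp_all add: wl)
 \<comment> \<open>Over a ring containing \<open>k\<close>, any two of \<open>y\<^sub>0\<close>,
   \<open>y\<close>, \<open>z\<close> determine the third; \<open>Ri\<close> does the same for
   \<open>y\<close> and its summands. These exchanges are applied both to generated fields and to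
   the fixed fields of single automorphisms.\<close>
 have R1: "set y\<^sub>0 <= R" if R: "is_sr R" "kk <= R" "set y <= R" "set z <= R" for R
  unfolding w(3) using wk R(2) lw by (intro witt_closed(1)[OF pp R(1)] R(3,4)) auto
 have R0: "set (wadd p y z) <= R" if R: "is_sr R" "kk <= R" "set y\<^sub>0 <= R" for R
  using witt_summand(2)[OF H R(1) lw(1) R(3)[unfolded w(3)]] wk R(2) by blast
 have R2: "set y <= R" if R: "is_sr R" "kk <= R" "set y\<^sub>0 <= R" "set z <= R" for R
  by (rule witt_summand(1)[OF H R(1) lw(2) R0[OF R(1-3)] R(4)])
 have R3: "set z <= R" if R: "is_sr R" "kk <= R" "set y\<^sub>0 <= R" "set y <= R" for R
  by (rule witt_summand(2)[OF H R(1) lw(2) R0[OF R(1-3)] R(4)])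
 have Ry: "set y <= R" if "is_sr R" "!!i. i:I ==> set (ys i) <= R" for R
  unfolding y using that yl by (intro witt_sum_closed[OF H]) (simp_all add: iss(1))
 have Ri: "set (ys i) <= R" if R: "is_sr R" and i: "i:I" and o: "set y <= R" "!!j. j:I ==> j ~= i ==> set (ys j) <= R" for R i
  by (rule witt_sum_summand[OF H R iss(2), of i ys v]) (use i o yl y in \<open>simp_all add: iss(1)\<close>)
 have Pi: "irreducible (P i)" "monic_irred (P i)" if "i:I" for i using P(2) that by (auto simp: monic_irred_def)
 have fpi: "Pfin (P i) ~= (Pinf :: 'a kbar set)" if "i:I" for i
 proof -
  have "~ P i dvd 1" using Pi(1)[OF that] by (simp add: Factorial_Ring.irreducible_def)
  hence "TT:(Pfin (P i) :: 'a kbar set)" unfolding finite_prime_def by (intro CollectI exI[of _ "[:0, 1:]"] exI[of _ 1]) (simp add: of_RT_1)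
  thus ?thesis using pole_T(5)[OF CT] by blast
 qed
 \<comment> \<open>At infinity the entries of \<delta> \<open>i\<close> are proper fractions, so
   they vanish and the extension splits. At finite primes other than \<open>P i\<close> their
   denominators are units, so the extension is unramified.\<close>
 have fix_ys: "si x = x" if B: "is_sf B" "kk <= B" "set (ys i) <= B" and W: "prm B W" and i: "i:I"
  and ne: "W Int kk ~= Pfin (P i)" and s: "si:dec kk W" and x: "x:adj kk (set (ys i))" for B W i si x
 proof (cases "W Int kk = Pinf")
  case True
  have "d:mx W" if d: "d:set (\<delta> i)" for d
  proof -
   obtain j where j: "d = RT (Q i j) / RT (P i ^ e i j)" "Q i j = 0 \<or> degree (Q i j) < degree (P i ^ e i j)" using \<delta>e[OF i d] by blast
   have "P i ^ e i j ~= 0" using Pi(1)[OF i] by (auto simp: Factorial_Ring.irreducible_def)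
   note ii = Pinf_iff[OF this, of "Q i j"] Pinf_iff[of "Q i j" "P i ^ e i j"]
   have "d:mx Pinf"
   proof (cases "Q i j = 0")
    case True
    thus ?thesis using mx_0[OF primeD(1)[OF pole_T(4)[OF CT]]] j(1) by (simp add: of_RT_0)
   next
    case False
    have "d:Pinf" unfolding j(1) ii(1) using j(2) by auto
    moreover have "RT (P i ^ e i j) / RT (Q i j)~:(Pinf :: 'a kbar set)"
     unfolding ii(2)[OF False] using j(2) False `P i ^ e i j ~= 0` by simp
    moreover have "inverse d = RT (P i ^ e i j) / RT (Q i j)" unfolding j(1) by (rule inverse_divide)
    ultimately show ?thesis by (simp add: max_ideal_def)
   qed
   thus ?thesis unfolding mx_Int(1)[OF kS, of W, unfolded True] by (rule IntD1)
  qed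
  moreover have "si:decomp kk W" using s dec_sub(2) by blast
  ultimately show ?thesis by (intro asw_decomp_trivial[OF H ay[OF i] B W _ _ x]) blast+
 next
  case False
  have V: "prm kk (W Int kk)" by (rule pr_rest[OF clb_k B(1,2) W])
  note VR = primeD(1)[OF V]
  have T: "TT:W Int kk" by (rule T_in_finite[OF CT V False])
  have pu: "RT (P i ^ k):vunit (W Int kk)" for k
   unfolding of_RT_power using prime_finite[OF V Pi(1)[OF i] T] ne RT_prime[OF V T] mx_iff by (intro vunit_power[OF VR]) blast
  have "d:W" if d: "d:set (\<delta> i)" for d
  proof -
   obtain j where j: "d = RT (Q i j) / RT (P i ^ e i j)" using \<delta>e[OF i d] by blast
   have "RT (Q i j) * inverse (RT (P i ^ e i j)):W Int kk"
    using pu by (intro sr_mult[OF VR RT_prime[OF V T]] vunit_sub[OF vunit_inv[OF VR]]) blast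
   thus ?thesis by (simp add: j divide_inverse)
  qed
  moreover have "si:inertia kk W" using s False by (simp add: dec_def)
  ultimately show ?thesis by (intro asw_inertia_trivial[OF H ay[OF i] B W _ _ x]) blast+
 qed
 have fix_z: "si x = x" if B: "is_sf B" "kk <= B" "set z <= B" and W: "prm B W"
  and ne: "W Int kk ~= Pinf" and s: "si:dec kk W" and x: "x:adj kk (set z)" for B W si x
 proof -
  have V: "prm kk (W Int kk)" by (rule pr_rest[OF clb_k B(1,2) W])
  have "d:W" if "d:set \<gamma>" for d using \<gamma>e[OF that] RT_prime[OF V T_in_finite[OF CT V ne]] by blast
  moreover have "si:inertia kk W" using s ne by (simp add: dec_def)
  ultimately show ?thesis by (intro asw_inertia_trivial[OF H az B W _ _ x]) blast+
 qed

 define C where "C = (cyclotomic TT N :: 'a kbar set)"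
 let ?\<Lambda> = "Tor TT N :: 'a kbar set" and ?\<Lambda>' = "Tor (1 / TT) (monom 1 (Suc n)) :: 'a kbar set"
 \<comment> \<open>One finite abelian field \<open>B\<close> contains both kinds of torsion, the
   constants and all solutions; automorphisms are compared on it.\<close>
 define \<S> where "\<S> = {?\<Lambda>, ?\<Lambda>', GF (CARD('a) ^ m), set z} Un (%i. set (ys i)) ` I"
 define B where "B = adj kk (\<Union>\<S>)"
 have CA: "abel kk C" unfolding C_def by (rule cyc_abel(1)[OF pole_T[OF CT] nNm(2)])
 have aB: "abel kk B" unfolding B_def
 proof (rule abel_Union[OF clb_k])
  fix S assume "S:\<S>"
  thus "abel kk (adj kk S)"
   using cyc_abel(1)[OF pole_T[OF CT] nNm(2)] tors_abel(1)[OF CT, of n] k_const(1)[OF CT nNm(1)] asw_abel[OF H az] asw_abel[OF H ay]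
   by (auto simp: \<S>_def cyclotomic_def k_const_def)
 qed
 have "finite (\<Union>\<S>)"
  using torsion_sep(1)[OF pole_T[OF CT] nNm(2)] torsion_sep(1)[OF pole_T'[OF CT], of "monom 1 (Suc n)"] k_const(2)[OF CT nNm(1)]
  by (auto simp: \<S>_def fI)
 hence fB: "fing kk B" by (auto simp: fing_def B_def)
 note gB = abel_gal[OF aB] note BS = galD(2,3)[OF gB]
 have SB: "S <= B" if "S:\<S>" for S using that adj_gen[of "\<Union>\<S>" kk] unfolding B_def by blast
 have sub: "?\<Lambda> <= B" "?\<Lambda>' <= B" "GF (CARD('a) ^ m) <= B" "set z <= B" "!!i. i:I ==> set (ys i) <= B"
  by (rule SB; simp add: \<S>_def)+
 have CB: "C <= B" unfolding C_def cyclotomic_def by (rule adj_least[OF BS sub(1)])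
 have LB: "L_field n <= B" using L_field(3)[OF CT, of n] adj_least[OF BS sub(2)] unfolding cyclotomic_def by blast
 have kmB: "k_const m <= B" unfolding k_const_def by (rule adj_least[OF BS sub(3)])
 have MB: "M <= B" unfolding M by (intro adj_least BS Un_least LB kmB)
 have yB: "set y <= B" by (rule Ry[OF sf_sr[OF BS(1)] sub(5)])
 have MA: "abel kk M" unfolding M by (rule abel_comp2[OF clb_k L_field(4)[OF CT] k_const(1)[OF CT nNm(1)]])
 note CS = galD(2,3)[OF abel_gal[OF CA]] and MS = galD(2,3)[OF abel_gal[OF MA]]
 have kM: "GF (CARD('a) ^ m) <= M" "L_field n <= M"
  using adj_gen[of "L_field n Un k_const m" kk] adj_gen[of "GF (CARD('a) ^ m)" kk] unfolding M k_const_def by blast+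
 have KCM: "set y\<^sub>0 <= adj kk (C Un M)"
 proof -
  have "nkm_field n N m <= adj kk (C Un M)" unfolding nkm_field_def C_def using kM by (intro adj_mono) auto
  thus ?thesis using nNm(3) y\<^sub>0(2) adj_gen[of "set y\<^sub>0" kk] by blast
 qed
 \<comment> \<open>A fixed prime at infinity. That inertia realises every scalar there is needed
   only for the inclusion of \<open>E\<close> in \<open>k(y)\<close>.\<close>
 obtain W where W: "prm B W" "W Int kk = Pinf"
  and iW: "!!c. c ~= 0 ==> EX i:inertia kk W. scal ?\<Lambda> i c" using inertia_scalars[OF CT aB fB nNm(2) sub(1)] by metis
 have WD: "dec kk W = decomp kk W" using W(2) by (simp add: dec_def)
 have dA: "d:Aut kk" if "d:decomp kk W" for d using decompD(1)[OF that] .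
 have dy: "d x = x" if d: "d:decomp kk W" and x: "x:set y" for d x
 proof -
  have "set y <= {x. d x = x}"
  proof (rule Ry[OF sf_sr[OF fixed_subfield[OF dA[OF d]]]])
   fix i assume i: "i:I"
   show "set (ys i) <= {x. d x = x}" using fix_ys[OF BS sub(5)[OF i] W(1) i _ _ subsetD[OF adj_gen]] fpi[OF i] d WD W(2) by auto
  qed
  thus ?thesis using x by blast
 qed
 \<comment> \<open>The scalars on the torsion have order dividing \<open>q - 1\<close>, prime to
   \<open>p\<close>. By \<open>asw_coprime_order\<close>, an automorphism whose power with this
   exponent fixes a solution vector fixes the vector itself.\<close>
 let ?j = "CARD('a) - 1"
 have jp: "coprime ?j p"
 proof -
  have "p dvd CARD('a)" using CT card_gt[where 'a='a] p by (cases l) auto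
  moreover have "coprime (CARD('a) - 1) (CARD('a))" by (rule coprime_diff_one_left_nat) simp
  ultimately show ?thesis by (rule coprime_divisors[OF dvd_refl])
 qed
 have scal_pow: "(d ^^ ?j) x = x" if d: "d:Aut kk" "scal ?\<Lambda> d c" and x: "x:C" for d c x
 proof (rule fixed_adjoin[OF aut_pow[OF d(1)] _ x[unfolded C_def cyclotomic_def]])
  fix x assume x: "x:?\<Lambda>"
  have c: "c ~= 0" "d x = cst c * x" using d(2) x by (auto simp: scal_def)
  have "(d ^^ i) x = cst (c ^ i) * x" for i
   by (induction i) (simp_all add: cst_hom aut_mult[OF d(1)] AutD(3)[OF d(1) cst_k] c(2) mult_ac)
  moreover have "Suc ?j = CARD('a)" using card_gt[where 'a='a] by simp
  hence "c * c ^ ?j = c * 1" using finite_field_power_card_eq_same[of c] by (metis power_Suc mult_1_right)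
  hence "c ^ ?j = 1" unfolding mult_left_cancel[OF c(1)] .
  ultimately show "(d ^^ ?j) x = x" by (simp add: cst_hom)
 qed
 have dscal: "EX c. scal ?\<Lambda> d c" if "d:decomp kk W" for d
  using dec_scalar[OF pole_T[OF CT] aB fB sub(1) nNm(2) W] that WD by blast
 have dC: "(d ^^ ?j) x = x" if "d:decomp kk W" "x:C" for d x using dscal[OF that(1)] scal_pow[OF dA[OF that(1)] _ that(2)] by blast

 \<comment> \<open>Inertia elements at finite primes belong to \<Theta>: they fix the constants,
   \<open>L_n\<close> and \<open>z\<close>. All primes at infinity share the decomposition group of
   \<open>W\<close>. Hence \<open>A\<close> contains all generators, and every automorphism acts on
   \<open>B\<close> as an element of \<Theta> after an element \<open>d\<close> of that
   group.\<close>
 define \<Theta> where "\<Theta> = {ta:Aut kk. (ALL x:M. ta x = x) & (ALL x:set z. ta x = x)}"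
 define A where "A = {ta:Aut kk. EX ta':\<Theta>. EX d:decomp kk W. ALL x:B. ta x = ta' (d x)}"
 have id: "(%x. x):\<Theta>" "(%x. x):decomp kk W" using aut_id(2) by (auto simp: \<Theta>_def decomp_def)
 have A1: "ta:A" if "ta:\<Theta>" for ta using that
  unfolding A_def by (intro CollectI conjI, simp add: \<Theta>_def) (rule bexI[OF _ that], rule bexI[OF _ id(2)], simp)
 have A2: "d:A" if "d:decomp kk W" for d using dA[OF that]
  unfolding A_def by (intro CollectI conjI, assumption) (rule bexI[OF _ id(1)], rule bexI[OF _ that], simp)
 have AA: "A <= Aut kk" by (auto simp: A_def)
 have comp: "si \<circ> ta:A" if st: "si:A" "ta:A" for si ta
 proof -
  obtain si' d where s: "si':\<Theta>" "d:decomp kk W" "ALL x:B. si x = si' (d x)" using st(1) by (auto simp: A_def)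
  obtain ta' d' where t: "ta':\<Theta>" "d':decomp kk W" "ALL x:B. ta x = ta' (d' x)" using st(2) by (auto simp: A_def)
  have Th: "si':Aut kk" "ta':Aut kk" using s(1) t(1) by (auto simp: \<Theta>_def)
  have "(si \<circ> ta) x = (si' \<circ> ta') ((d \<circ> d') x)" if x: "x:B" for x
  proof -
   have dx: "d' x:B" by (rule galD(4)[OF gB dA[OF t(2)] x])
   have "ta' (d' x):B" by (rule galD(4)[OF gB Th(2) dx])
   hence "(si \<circ> ta) x = si' (d (ta' (d' x)))" using s(3) t(3) x by simp
   thus ?thesis using abel_commute[OF aB dA[OF s(2)] Th(2) dx] by simp
  qed
  moreover have "si' \<circ> ta':\<Theta>" using s(1) t(1) aut_comp[OF Th] by (auto simp: \<Theta>_def)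
  moreover have "si \<circ> ta:Aut kk" using st AA aut_comp by blast
  ultimately show ?thesis using decomp_comp[OF s(2) t(2)] unfolding A_def by blast
 qed
 have decA: "dec kk U <= A" if U: "prm B U" for U
 proof
  fix ta assume t: "ta:dec kk U"
  show "ta:A"
  proof (cases "U Int kk = Pinf")
   case True
   thus ?thesis using A2 dec_above_unique[OF aB fB U W(1) _ t] W(2) WD by simp
  next
   case False
   note tA = dec_Aut[OF t]
   have I: "ta:inertia kk U" using t False by (simp add: dec_def)
   have "ta x = x" if "x:GF (CARD('a) ^ m)" for x using k_const(3)[OF CT nNm(1) BS(1) U I _ that] that sub(3) by blast
   hence "ta x = x" if "x:L_field n Un k_const m" for x
    using that L_field_inertia[OF CT aB fB sub(2) U False I] fixed_adjoin[OF tA, of "GF (CARD('a) ^ m)"] unfolding k_const_def by blast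
   hence "ta x = x" if "x:M" for x using fixed_adjoin[OF tA] that unfolding M by blast
   moreover have "ta x = x" if "x:set z" for x using fix_z[OF BS sub(4) U False t] adj_gen that by blast
   ultimately show ?thesis using tA by (intro A1) (simp add: \<Theta>_def)
  qed
 qed
 have split: "EX ta' d. ta':Aut kk & (ALL x:M. ta' x = x) & (ALL x:set z. ta' x = x) & d:decomp kk W & (ALL x:B. ta x = ta' (d x))"
  if t: "ta:Aut kk" for ta
 proof -
  have II: "inertia kk U <= A" "U Int kk = Pinf ==> decomp kk U <= A" if "prm B U" for U
   using decA[OF that] dec_sub(1) by (auto simp: dec_def)
  obtain b where b: "b:A" "!!x. x:B ==> ta x = b x" using inertia_generate[OF aB fB AA A1[OF id(1)] comp II t] by blast
  then obtain ta' d where "ta':\<Theta>" "d:decomp kk W" "ALL x:B. b x = ta' (d x)" by (auto simp: A_def)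
  thus ?thesis using b(2) by (auto simp: \<Theta>_def)
 qed
 have fixed_in: "x:F" if F: "is_sf F" "kk <= F" "F <= B" "x:B" "!!si. si:Aut F ==> si:Aut kk ==> si x = x" for F x
  using galD(6)[OF abel_gal[OF abel_mid(1)[OF clb_k aB F(1-3)]] F(4)] F(5) Aut_mono[OF F(2)] by blast

 \<comment> \<open>If \<open>ta\<close> fixes \<open>C\<close>, then \<open>ta'\<close> acts on the
   torsion by the scalar inverse to that of \<open>d\<close>. So its power with exponent
   \<open>q - 1\<close> fixes \<open>C\<close> and \<open>M\<close>, hence \<open>y\<^sub>0\<close>,
   and together with \<open>z\<close> also \<open>y\<close>. Therefore \<open>ta'\<close> fixes
   \<open>y\<close>, as does \<open>d\<close>.\<close>
 have yC: "set y <= C"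
 proof
  fix x assume x: "x:set y"
  show "x:C"
  proof (rule fixed_in[OF CS CB subsetD[OF yB x]])
   fix ta assume t: "ta:Aut C" "ta:Aut kk"
   obtain ta' d where h: "ta':Aut kk" "ALL x:M. ta' x = x" "ALL x:set z. ta' x = x" "d:decomp kk W" "ALL x:B. ta x = ta' (d x)"
    using split[OF t(2)] by blast
   obtain c where c: "scal ?\<Lambda> d c" using dscal[OF h(4)] by blast
   have "ta' s = cst (inverse c) * s" if s: "s:?\<Lambda>" for s
   proof -
    have "s:C" using s adj_gen unfolding C_def cyclotomic_def by blast
    hence "s = ta' (d s)" using AutD(3)[OF t(1)] h(5) CB by fastforce
    also have "... = cst c * ta' s" using c s AutD(3)[OF h(1) cst_k] by (simp add: scal_def aut_mult[OF h(1)])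
    finally have e: "s = cst c * ta' s" .
    have "cst (inverse c) * s = cst (inverse c) * (cst c * ta' s)" using arg_cong[OF e, of "(*) (cst (inverse c))"] .
    also have "... = ta' s" using c by (simp add: scal_def cst_inverse cst_hom)
    finally show ?thesis by (rule sym)
   qed
   hence "scal ?\<Lambda> ta' (inverse c)" using c by (simp add: scal_def)
   hence "(ta' ^^ ?j) s = s" if "s:C Un M" for s using that scal_pow[OF h(1)] h(2) funpow_fixed[of ta'] by blast
   from fixed_adjoin[OF aut_pow[OF h(1)] this] have "set y\<^sub>0 <= {x. (ta' ^^ ?j) x = x}" using KCM by blast
   moreover have "set z <= {x. (ta' ^^ ?j) x = x}" using h(3) funpow_fixed[of ta'] by blast
   moreover have "kk <= {x. (ta' ^^ ?j) x = x}" using AutD(3)[OF aut_pow[OF h(1)]] by blast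
   ultimately have "set y <= {x. (ta' ^^ ?j) x = x}"
    using R2[OF sf_sr[OF fixed_subfield[OF aut_pow[OF h(1)]]]] by blast
   hence "ta' x = x" using x by (intro asw_coprime_order[OF H ayy h(1) jp _ subsetD[OF adj_gen]]) auto
   thus "ta x = x" using h(5) dy[OF h(4) x] yB x by auto
  qed
 qed
 \<comment> \<open>The mirror image: if \<open>ta\<close> fixes \<open>M\<close>, so does
   \<open>d\<close>. Its power with exponent \<open>q - 1\<close> fixes \<open>C\<close> too, hence
   \<open>y\<^sub>0\<close>; since \<open>d\<close> fixes \<open>y\<close>, that power fixes
   \<open>z\<close>, and therefore \<open>d\<close> does.\<close>
 have zM: "set z <= M"
 proof
  fix x assume x: "x:set z"
  show "x:M"
  proof (rule fixed_in[OF MS MB subsetD[OF sub(4) x]])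
   fix ta assume t: "ta:Aut M" "ta:Aut kk"
   obtain ta' d where h: "ta':Aut kk" "ALL x:M. ta' x = x" "ALL x:set z. ta' x = x" "d:decomp kk W" "ALL x:B. ta x = ta' (d x)"
    using split[OF t(2)] by blast
   have "d s = s" if s: "s:M" for s
    using AutD(3)[OF t(1) s] h(5) MB s h(2) galD(4)[OF abel_gal[OF MA] dA[OF h(4)] s] by fastforce
   hence "(d ^^ ?j) s = s" if "s:C Un M" for s using that dC[OF h(4)] funpow_fixed[of d] by blast
   from fixed_adjoin[OF aut_pow[OF dA[OF h(4)]] this] have "set y\<^sub>0 <= {x. (d ^^ ?j) x = x}" using KCM by blast
   moreover have "set y <= {x. (d ^^ ?j) x = x}" using dy[OF h(4)] funpow_fixed[of d] by blast
   moreover have "kk <= {x. (d ^^ ?j) x = x}" using AutD(3)[OF aut_pow[OF dA[OF h(4)]]] by blast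
   ultimately have "set z <= {x. (d ^^ ?j) x = x}"
    using R3[OF sf_sr[OF fixed_subfield[OF aut_pow[OF dA[OF h(4)]]]]] by blast
   hence "d x = x" using x by (intro asw_coprime_order[OF H az dA[OF h(4)] jp _ subsetD[OF adj_gen]]) auto
   thus "ta x = x" using h(3,5) sub(4) x by auto
  qed
 qed

 let ?Y = "adj kk (set y)" and ?G = "adj kk (UN i:I. set (ys i))"
 have YA: "abel kk ?Y" by (rule asw_abel[OF H ayy])
 have EY: "E = ?Y"
 proof (rule antisym)
  have "set y <= adj kk (K Un M)"
  proof (rule R2[OF sf_sr[OF adj_sf] adj_base])
   show "set y\<^sub>0 <= adj kk (K Un M)" "set z <= adj kk (K Un M)"
    using adj_gen[of "K Un M" kk] adj_gen[of "set y\<^sub>0" kk] y\<^sub>0(2) zM by blast+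
  qed
  hence "?Y <= adj kk (K Un M)" by (rule adj_least[OF adj_sf adj_base])
  moreover have "?Y <= C" by (rule adj_least[OF CS yC])
  ultimately show "?Y <= E" unfolding E C_def by blast
  show "E <= ?Y"
  proof
   fix x assume "x:E"
   hence x: "x:adj kk (K Un M)" "x:C" unfolding E C_def by auto
   \<comment> \<open>As \<open>z\<close> is over \<open>M\<close>, the field \<open>M(y)\<close>
     contains \<open>K\<close>. An element of \<open>E\<close> thus lies both in \<open>M(y)\<close>
     and in the cyclotomic field.\<close>
   let ?M = "adj kk (M Un set y)"
   have g: "M <= ?M" "set y <= ?M" using adj_gen[of "M Un set y" kk] by auto
   have "set y\<^sub>0 <= ?M" using g zM by (intro R1[OF sf_sr[OF adj_sf] adj_base]) auto
   hence "K <= ?M" unfolding y\<^sub>0(2) by (rule adj_least[OF adj_sf adj_base])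
   hence xM: "x:?M" using x(1) adj_least[OF adj_sf adj_base, of "K Un M" kk "M Un set y"] g(1) by blast
   \<comment> \<open>\<open>d\<close> may move constants, so it is replaced by an inertia element
     \<open>i\<close> with the same scalar, which agrees with it on \<open>C\<close> and fixes the
     constants. The power of \<open>i\<close> with exponent \<open>q^n\<close> fixes
     \<open>M(y)\<close>, the one with exponent \<open>q - 1\<close> fixes \<open>C\<close>.\<close>
   have dx: "d x = x" if d: "d:decomp kk W" for d
   proof -
    obtain c where c: "scal ?\<Lambda> d c" using dscal[OF d] by blast
    then obtain i where i: "i:inertia kk W" "scal ?\<Lambda> i c" using iW[of c] by (auto simp: scal_def)
    note iD = inertD(1)[OF i(1)] and iA = dA[OF inertD(1)[OF i(1)]]
    have di: "d x = i x"
     by (rule agree_adj[OF dA[OF d] iA _ x(2)[unfolded C_def cyclotomic_def]]) (use c i(2) in \<open>simp add: scal_def\<close>)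
    let ?Q = "CARD('a) ^ n"
    have "i s = s" if "s:GF (CARD('a) ^ m)" for s using k_const(3)[OF CT nNm(1) BS(1) W(1) i(1) _ that] that sub(3) by blast
    hence "i s = s" if "s:k_const m" for s using fixed_adjoin[OF iA] that unfolding k_const_def by blast
    hence "(i ^^ ?Q) s = s" if "s:L_field n Un k_const m" for s
     using that L_field_power[OF CT iA] funpow_fixed[of i] by blast
    from fixed_adjoin[OF aut_pow[OF iA] this] have "(i ^^ ?Q) s = s" if "s:M" for s using that unfolding M by blast
    hence "(i ^^ ?Q) s = s" if "s:M Un set y" for s using that dy[OF iD] funpow_fixed[of i] by blast
    from fixed_adjoin[OF aut_pow[OF iA] this xM] have iQ: "(i ^^ ?Q) x = x" .
    have "EX k. Suc j ^ n = Suc (j * k)" for j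
    proof (induction n)
     case (Suc n)
     then obtain k where "Suc j ^ n = Suc (j * k)" by blast
     thus ?case by (intro exI[of _ "Suc (j * k) + k"]) (simp add: algebra_simps)
    qed simp
    moreover have "Suc ?j = CARD('a)" using card_gt[where 'a='a] by simp
    \<comment> \<open>\<open>q^n\<close> exceeds a multiple of \<open>q - 1\<close> by one, so the
      two fixed powers show that \<open>i\<close> itself fixes \<open>x\<close>.\<close>
    ultimately obtain k where k: "?Q = Suc (?j * k)" by metis
    have "(i ^^ (?j * k)) x = x"
     using funpow_fixed[of "i ^^ ?j" x k] scal_pow[OF iA i(2) x(2)] by (simp only: funpow_mult simp_thms)
    hence "i x = x" using iQ unfolding k by simp
    thus ?thesis using di by simp
   qed
   have YB: "?Y <= B" by (rule adj_least[OF BS yB])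
   show "x:?Y"
   proof (rule fixed_in[OF adj_sf adj_base YB subsetD[OF CB x(2)]])
    fix ta assume t: "ta:Aut ?Y" "ta:Aut kk"
    obtain ta' d where h: "ta':Aut kk" "ALL x:M. ta' x = x" "d:decomp kk W" "ALL x:B. ta x = ta' (d x)"
     using split[OF t(2)] by blast
    have "ta' s = s" if s: "s:set y" for s
    proof -
     have "ta s = s" using AutD(3)[OF t(1)] s adj_gen by blast
     thus ?thesis using h(4) dy[OF h(3) s] yB s by auto
    qed
    hence "ta' x = x" using h(2) by (intro fixed_adjoin[OF h(1) _ xM]) auto
    thus "ta x = x" using h(4) dx[OF h(3)] x(2) CB by auto
   qed
  qed
 qed

 \<comment> \<open>The local generators: \<open>z\<close> at infinity and \<open>ys i\<close> at
   \<open>P i\<close>. The union makes \<open>be\<close> total without choosing an index; by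
   \<open>inj\<close> it has at most one member.\<close>
 define be where "be V = (if V = Pinf then set z else (UN i:{i:I. Pfin (P i) = V}. set (ys i)))" for V
 have inj: "i = j" if "i:I" "j:I" "Pfin (P i) = (Pfin (P j) :: 'a kbar set)" for i j
  using finite_prime_inj[OF Pi(2)[OF that(1)] Pi(2)[OF that(2)] that(3)] P(1) that(1,2) by (auto dest: inj_onD)
 have be: "be (Pfin (P i)) = set (ys i)" if i: "i:I" for i
 proof -
  have "{j:I. Pfin (P j) = (Pfin (P i) :: 'a kbar set)} = {i}" using inj[OF _ i] i by blast
  thus ?thesis using fpi[OF i] by (simp add: be_def)
 qed
 define Vs :: "'a kbar set list" where "Vs = map (%i. Pfin (P i)) Is"
 have Vs: "set Vs = (%i. Pfin (P i)) ` I" "distinct Vs" "!!V. V:set Vs ==> prm kk V" "Pinf~:set Vs"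
  "!!V. V:set Vs ==> EX i:I. V = Pfin (P i)"
  using inj fpi[THEN not_sym] unif_prime[OF unif_fin[OF Pi(1)]] iss by (auto simp: Vs_def distinct_map inj_on_def)
 have Ube: "(UN V:set Vs. be V) = (UN i:I. set (ys i))" unfolding Vs(1) using be by auto
 have fx: "si x = x" if G: "is_sf G" "kk <= G" "be V <= G" and U: "prm G U" and s: "si:dec kk U"
  and V: "V:set (Pinf # Vs)" "V ~= U Int kk" and x: "x:be V" for G U V si x
 proof (cases "V = Pinf")
  case True
  thus ?thesis using fix_z[OF G(1,2) _ U _ s] G(3) V(2) x adj_gen[of "set z" kk] unfolding be_def by auto
 next
  case False
  then obtain i where i: "i:I" "V = Pfin (P i)" using V(1) Vs(5) by auto
  thus ?thesis using fix_ys[OF G(1,2) _ U i(1) _ s] G(3) V(2) x be[OF i(1)] adj_gen[of "set (ys i)" kk] by auto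
 qed
 have GA: "abel kk ?G"
  using abel_Union[OF clb_k, of "(%i. set (ys i)) ` I"] asw_abel[OF H ay] by blast
 have yG: "set y <= ?G" using adj_gen[of "UN i:I. set (ys i)" kk] by (intro Ry[OF sf_sr[OF adj_sf]]) blast
 have fG: "fing kk (adj kk S)" if "finite S" for S :: "'a kbar set" using that by (auto simp: fing_def)
 \<comment> \<open>Infinity is absent from the list because no \<open>z\<close> occurs. The
   generation hypothesis holds since \<open>ys i\<close> is recovered from \<open>y\<close> and the
   other summands.\<close>
 have gE: "genus_field E = ?G" unfolding EY
 proof (rule genus_field_eq[OF YA fG Vs(2,3) _ GA fG, where be = be])
  show "?G = adj kk (UN V:set Vs. be V)" unfolding Ube ..
  show "?Y <= ?G" by (rule adj_least[OF adj_sf adj_base yG])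
  fix V assume V: "V:set Vs"
  have "be V <= ?G" using V Ube adj_gen by blast
  thus "si x = x" if "prm ?G U" "si:dec kk U" "V ~= U Int kk" "x:be V" for U si x
   using fx[OF adj_sf adj_base _ that(1,2) _ that(3,4)] V by simp
  obtain i where i: "i:I" "V = Pfin (P i)" using V Vs(1) by auto
  let ?R = "adj ?Y (UN V':set Vs - {V}. be V')"
  have "set (ys j) <= ?R" if "j:I" "j ~= i" for j
  proof -
   have "Pfin (P j):set Vs - {V}" using that inj[OF that(1) i(1)] unfolding Vs(1) i(2) by auto
   thus ?thesis using be[OF that(1)] adj_gen[of "UN V':set Vs - {V}. be V'" ?Y] by blast
  qed
  moreover have "set y <= ?R" using adj_gen[of "set y" kk] adj_base[of ?Y] by blast
  ultimately show "be V <= ?R" unfolding i(2) be[OF i(1)] by (intro Ri[OF sf_sr[OF adj_sf] i(1)]) (auto simp: i(2))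
 qed (auto simp: fI)
 let ?H = "adj kk ((UN i:I. set (ys i)) Un set z)"
 have KA: "abel kk K" unfolding y\<^sub>0(2) by (rule asw_abel[OF H a0])
 have KF: "fing kk K" unfolding y\<^sub>0(2) by (rule fG) simp
 have HA: "abel kk ?H"
 proof -
  have "?H = adj kk (\<Union>(insert (set z) ((%i. set (ys i)) ` I)))" by (simp add: Un_commute)
  thus ?thesis using abel_Union[OF clb_k, of "insert (set z) ((%i. set (ys i)) ` I)"] asw_abel[OF H ay] asw_abel[OF H az] by auto
 qed
 have Hg: "set z <= ?H" "!!i. i:I ==> set (ys i) <= ?H"
  using adj_gen[of "(UN i:I. set (ys i)) Un set z" kk] by blast+
 \<comment> \<open>Now infinity joins the list with generator \<open>z\<close>, and each of
   \<open>z\<close> and the \<open>ys i\<close> is recovered from \<open>y\<^sub>0\<close> and the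
   remaining generators.\<close>
 have gK: "genus_field K = ?H"
 proof (rule genus_field_eq[OF KA KF, where be = be and Vs = "Pinf # Vs"])
  show "distinct (Pinf # Vs)" using Vs(2,4) by simp
  show "prm kk V" if "V:set (Pinf # Vs)" for V using that Vs(3) pole_T(4)[OF CT] by auto
  show "?H = adj kk (UN V:set (Pinf # Vs). be V)" by (simp only: list.set UN_insert Ube) (simp add: be_def Un_commute)
  show "abel kk ?H" "fing kk ?H" by (rule HA, rule fG) (simp add: fI)
  show "K <= ?H" unfolding y\<^sub>0(2)
   by (intro adj_least[OF adj_sf adj_base] R1[OF sf_sr[OF adj_sf] adj_base] Ry[OF sf_sr[OF adj_sf]] Hg)
  fix V assume V: "V:set (Pinf # Vs)"
  have "be V <= ?H"
  proof (cases "V = Pinf")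
   case False
   thus ?thesis using V Vs(5)[of V] Hg(2) be by auto
  qed (use Hg(1) in \<open>simp add: be_def\<close>)
  thus "si x = x" if "prm ?H U" "si:dec kk U" "V ~= U Int kk" "x:be V" for U si x
   by (rule fx[OF adj_sf adj_base _ that(1,2) V that(3,4)])
  let ?R = "adj K (UN V':set (Pinf # Vs) - {V}. be V')"
  note R = sf_sr[OF adj_sf, of K "UN V':set (Pinf # Vs) - {V}. be V'"]
  have kR: "kk <= ?R" "set y\<^sub>0 <= ?R" using adj_base[of K] adj_base[of kk "set y\<^sub>0"] adj_gen[of "set y\<^sub>0" kk] unfolding y\<^sub>0(2) by blast+
  have oth: "be V' <= ?R" if "V':set (Pinf # Vs)" "V' ~= V" for V'
   using that adj_gen[of "UN V':set (Pinf # Vs) - {V}. be V'" K] by blast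
  show "be V <= ?R"
  proof (cases "V = Pinf")
   case True
   have "set (ys i) <= ?R" if i: "i:I" for i
   proof -
    have "Pfin (P i):set (Pinf # Vs)" using i Vs(1) by auto
    from oth[OF this] show ?thesis using fpi[OF i] True unfolding be[OF i] by blast
   qed
   hence "set z <= ?R" by (intro R3[OF R kR] Ry[OF R])
   thus ?thesis using True by (simp add: be_def)
  next
   case False
   then obtain i where i: "i:I" "V = Pfin (P i)" using V Vs(5) by auto
   have z: "set z <= ?R" using oth[of Pinf] False by (auto simp: be_def)
   have o: "set (ys j) <= ?R" if j: "j:I" "j ~= i" for j
   proof -
    have "Pfin (P j):set (Pinf # Vs)" using j Vs(1) by auto
    from oth[OF this] show ?thesis using inj[OF j(1) i(1)] j(2) unfolding be[OF j(1)] i(2) by blast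
   qed
   have "set (ys i) <= ?R" by (rule Ri[OF R i(1) R2[OF R kR z] o])
   thus ?thesis unfolding i(2) be[OF i(1)] .
  qed
 qed
 show ?thesis using EY gE gK unfolding I_def by blast
qed

end
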